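(* Let $\mathfrak{g}$ be a finite-dimensional simple complex Lie algebra of simply-laced type and $c$ a Coxeter element of its Weyl group. Let $B_c$ be the exchange matrix of the quiver $\Gamma_c$, let $G^{(\infty)}$ be the limit $G$-matrix, let $\Lambda_e$ be the skew-symmetric $V\times V$ matrix defined in the context, and put $$\Lambda_c:=\left(G^{(\infty)}\right)^T\Lambda_e\,G^{(\infty)} .$$ Then the pair $(\Lambda_c,B_c)$ is compatible.
   Context: Quivers. Let $I=\{1,\dots,n\}$ be the vertex set of the Dynkin diagram of $\mathfrak g$, $(c_{ij})$ the Cartan matrix, $W$ the Weyl group with simple reflections $s_i$. Fix a Coxeter element $c=s_{j_1}\cdots s_{j_n}$ and let $\mathbf Q$ be the unique orientation of the Dynkin diagram such that $j_n$ is a source of $\mathbf Q$, $j_{n-1}$ is a source of the quiver obtained from $\mathbf Q$ by reversing all arrows at $j_n$, and so on. Let $l_c:I\to\mathbb Z_{\ge 0}$ be the height function: $0\in \mathrm{Im}(l_c)$ and $l_c(i)=l_c(j)+1$ for each arrow $i\to j$ of $\mathbf Q$. Put $V=\{(i,l_c(i)+2a): i\in I, a\in\mathbb Z\}$. The quiver $\Gamma_e$ has vertex set $V$ and an arrow $(i,r)\to(j,s)$ iff $c_{ij}\ne 0$ and $s=r+c_{ij}$ (so there are vertical arrows $(i,r)\to(i,r+2)$ and oblique arrows $(i,r)\to(j,r-1)$ when $c_{ij}=-1$). Let $G_c\subset\Gamma_e$ be the finite full subquiver on the vertices $(i,-l_c(i)-2k)$, $k\ge 0$, with $\tau^{-k}P_i\neq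 0$, where $P_i$ is the indecomposable projective $K\mathbf Q$-module at $i$ ($K$ a field; an arrow $i\to j$ of $\mathbf Q$ gives an irreducible map $P_j\to P_i$) and $\tau$ is the Auslander–Reiten translation of $\mathrm{mod}(K\mathbf Q)$; it is a copy of the Auslander–Reiten quiver of $\mathrm{mod}(K\mathbf Q)$. The quiver $\Gamma_c$ is obtained from $\Gamma_e$ by replacing each $x\in G_c$ by two vertices: a red one $x^R$ and, immediately below it in the same column, a green one $x^G$, with the following arrows (for $y\notin G_c$ put $y^R=y^G=y$): an arrow $x^R\to x^G$ for each $x\in G_c$; for each vertical arrow $y\to x$ of $\Gamma_e$, an arrow $y^R\to x^G$; for each oblique arrow $x\to y$ of $\Gamma_e$, an arrow $x^G\to y^R$. Then the vertices of each column $i$ are relabelled from top to bottom by consecutive elements $(i,r)$ of $V$ (labels decreasing by 2), keeping the labels of all vertices above the highest red vertex of the column, which keeps the label $(i,-l_c(i))$. Thus $\Gamma_c$ again has vertex set $V$. Exchange matrices: for a quiver with vertex set $V$, $b_{v,w}=\#\{v\to w\}-\#\{w\to v\}$. Limit $G$-matrix. Let $\Sigma_c=\Sigma_c^{(0)}$ be the seed with quiver $\Gamma_c^{(0)}=\Gamma_c$. For $k\ge 0$ the quiver $\Gamma_c^{(k+1)}$ (seed $\Sigma_c^{(k+1)}$) is obtained from $\Gamma_c^{(k)}$ (seed $\Sigma_c^{(k)}$) by mutating at all green vertices of $\Gamma_c^{(k)}$ (these mutations commute); $\Gamma_c^{(k)}$ is the translate of $\Gamma_c$ downward by $k$ steps,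 its green vertices being the $(i,r-2k)$ with $(i,r)$ green in $\Gamma_c$. $G^{(k)}$ is the $V\times V$ integer matrix whose column indexed by $v$ is the $g$-vector of the initial cluster variable of $\Sigma_c$ at $v$ with respect to the reference seed $\Sigma_c^{(k)}$. Here $g$-vectors are those of Fomin–Zelevinsky (computed with principal coefficients in any sufficiently large finite full subquiver), with the sign convention that the cluster variable obtained from the reference seed by one mutation at $k$ has $g$-vector $-e_k+\sum_{j\to k}e_j$, the sum being over arrows of the reference quiver (i.e. the Fomin–Zelevinsky $g$-vector for the matrix $-B$). By a theorem of Geiss–Hernandez–Leclerc, each column of $G^{(k)}$ is eventually constant as $k\to\infty$, all $G^{(k)}$ are block diagonal with finite blocks indexed by the sets $I(m)=\{(i,l_c(i)+2m): i\in I\}$, $m\in\mathbb Z$, and $G^{(\infty)}:=\lim_{k\to\infty}G^{(k)}$. In particular the product defining $\Lambda_c$ is well defined. The matrix $\Lambda_e$. Let $C(z)$ be the quantum Cartan matrix, $C_{ii}(z)=z+z^{-1}$ and $C_{ij}(z)=c_{ij}$ for $i\neq j$, and write its inverse as $\tilde C_{ij}(z)=\sum_{m\ge 1}\tilde C_{ij}(m)z^m\in\mathbb Z[[z]]$, with $\tilde C_{ij}(m)=0$ for $m\le 0$. Let $\mathcal F_{ij}:\mathbb Z\to\mathbb Z$ be the odd function with $\mathcal F_{ij}(m)=-\sum_{k\ge 1,\ 2k-1\le m}\tilde C_{ij}(m-2k+1)$ for $m\ge 0$. Then $(\Lambda_e)_{(i,r),(j,s)}=\mathcal F_{ij}(s-r)$.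 Compatibility. For a $J\times J$ integer matrix $B$ with finitely many nonzero entries in each row and column and a skew-symmetric $J\times J$ integer matrix $\Lambda$, the pair $(\Lambda,B)$ is compatible if $B^T\Lambda=\mathrm{diag}(d_j)_{j\in J}$ with integers $d_j$ that are all positive or all negative. *)

theory Defs
  imports
    Complex_Main
    "HOL-Computational_Algebra.Formal_Laurent_Series"
    "Jordan_Normal_Form.Matrix"
begin

section \<open>Cartan matrices, Coxeter elements, orientations\<close>

text \<open>Finite-dimensional simple complex Lie algebras of simply-laced type are encoded by their
  Cartan matrices: the indecomposable symmetric Cartan matrices of finite type, on the index set
  \<open>{1..n}\<close>.\<close>

definition simply_laced_cartan :: "nat \<Rightarrow> (nat \<Rightarrow> nat \<Rightarrow> int) \<Rightarrow> bool" where
  "simply_laced_cartan n C \<longleftrightarrow>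
     1 \<le> n \<and>
     (\<forall>i\<in>{1..n}. C i i = 2) \<and>
     (\<forall>i\<in>{1..n}. \<forall>j\<in>{1..n}. i \<noteq> j \<longrightarrow> C i j \<in> {0, -1} \<and> C i j = C j i) \<and>
     (\<forall>i\<in>{1..n}. \<forall>j\<in>{1..n}.
        (i, j) \<in> {(a, b). a \<in> {1..n} \<and> b \<in> {1..n} \<and> C a b \<noteq> 0}\<^sup>*) \<and>
     (\<forall>x :: nat \<Rightarrow> real. (\<exists>i\<in>{1..n}. x i \<noteq> 0) \<longrightarrow>
        (\<Sum>i=1..n. \<Sum>j=1..n. x i * of_int (C i j) * x j) > 0)"

text \<open>The Weyl group acts on the root lattice; \<open>x i\<close> is the coefficient of the simple root
  \<open>\<alpha>\<^sub>i\<close>, and \<open>s\<^sub>i \<alpha>\<^sub>j = \<alpha>\<^sub>j - C i j \<alpha>\<^sub>i\<close>.\<close>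

definition simple_reflection ::
    "nat \<Rightarrow> (nat \<Rightarrow> nat \<Rightarrow> int) \<Rightarrow> nat \<Rightarrow> (nat \<Rightarrow> int) \<Rightarrow> (nat \<Rightarrow> int)" where
  "simple_reflection n C i x = x(i := x i - (\<Sum>j=1..n. C i j * x j))"

definition coxeter_word ::
    "nat \<Rightarrow> (nat \<Rightarrow> nat \<Rightarrow> int) \<Rightarrow> ((nat \<Rightarrow> int) \<Rightarrow> (nat \<Rightarrow> int)) \<Rightarrow> nat list \<Rightarrow> bool" where
  "coxeter_word n C c js \<longleftrightarrow>
     distinct js \<and> set js = {1..n} \<and> c = foldr (\<lambda>j f. simple_reflection n C j \<circ> f) js id"

definition coxeter_element ::
    "nat \<Rightarrow> (nat \<Rightarrow> nat \<Rightarrow> int) \<Rightarrow> ((nat \<Rightarrow> int) \<Rightarrow> (nat \<Rightarrow> int)) \<Rightarrow> bool" where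
  "coxeter_element n C c \<longleftrightarrow> (\<exists>js. coxeter_word n C c js)"

text \<open>A quiver without multiple arrows is the set of its arrows; \<open>(i, j)\<close> is an arrow
  from \<open>i\<close> to \<open>j\<close>.\<close>

definition dynkin_orientation :: "nat \<Rightarrow> (nat \<Rightarrow> nat \<Rightarrow> int) \<Rightarrow> nat rel \<Rightarrow> bool" where
  "dynkin_orientation n C Q \<longleftrightarrow>
     Q \<subseteq> {1..n} \<times> {1..n} \<and> (\<forall>i. (i, i) \<notin> Q) \<and>
     (\<forall>i\<in>{1..n}. \<forall>j\<in>{1..n}. i \<noteq> j \<longrightarrow>
        ((i, j) \<in> Q \<or> (j, i) \<in> Q \<longleftrightarrow> C i j \<noteq> 0) \<and> \<not> ((i, j) \<in> Q \<and> (j, i) \<in> Q))"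

definition is_source :: "nat rel \<Rightarrow> nat \<Rightarrow> bool" where
  "is_source Q j \<longleftrightarrow> (\<forall>i. (i, j) \<notin> Q)"

definition reverse_at :: "nat \<Rightarrow> nat rel \<Rightarrow> nat rel" where
  "reverse_at j Q = {(a, b). if a = j \<or> b = j then (b, a) \<in> Q else (a, b) \<in> Q}"

primrec source_sequence :: "nat list \<Rightarrow> nat rel \<Rightarrow> bool" where
  "source_sequence [] Q \<longleftrightarrow> True"
| "source_sequence (j # js) Q \<longleftrightarrow> is_source Q j \<and> source_sequence js (reverse_at j Q)"

definition coxeter_quiver ::
    "nat \<Rightarrow> (nat \<Rightarrow> nat \<Rightarrow> int) \<Rightarrow> ((nat \<Rightarrow> int) \<Rightarrow> (nat \<Rightarrow> int)) \<Rightarrow> nat rel \<Rightarrow> bool" where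
  "coxeter_quiver n C c Q \<longleftrightarrow>
     dynkin_orientation n C Q \<and> (\<exists>js. coxeter_word n C c js \<and> source_sequence (rev js) Q)"

definition height_function :: "nat \<Rightarrow> nat rel \<Rightarrow> (nat \<Rightarrow> nat) \<Rightarrow> bool" where
  "height_function n Q l \<longleftrightarrow> 0 \<in> l ` {1..n} \<and> (\<forall>(i, j)\<in>Q. l i = l j + 1)"


section \<open>Representations of the orientation and the Auslander--Reiten translation\<close>

text \<open>A finite-dimensional representation with vertex set \<open>{1..n}\<close>: the space at \<open>i\<close> is
  \<open>K\<close> to the power \<open>rdim M i\<close>, and the arrow \<open>(i, j)\<close> acts by the matrix \<open>rmap M (i, j)\<close> on
  column vectors. Morphisms are families of matrices; only the indices in \<open>{1..n}\<close> matter.\<close>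

record 'k qrep =
  rdim :: "nat \<Rightarrow> nat"
  rmap :: "nat \<times> nat \<Rightarrow> 'k mat"

definition is_rep :: "nat rel \<Rightarrow> 'k::field qrep \<Rightarrow> bool" where
  "is_rep Q M \<longleftrightarrow> (\<forall>(i, j)\<in>Q. rmap M (i, j) \<in> carrier_mat (rdim M j) (rdim M i))"

definition zero_rep :: "nat \<Rightarrow> 'k::field qrep \<Rightarrow> bool" where
  "zero_rep n M \<longleftrightarrow> (\<forall>i\<in>{1..n}. rdim M i = 0)"

definition rep_hom :: "nat \<Rightarrow> nat rel \<Rightarrow> 'k::field qrep \<Rightarrow> 'k qrep \<Rightarrow> (nat \<Rightarrow> 'k mat) \<Rightarrow> bool" where
  "rep_hom n Q M N f \<longleftrightarrow>
     (\<forall>i\<in>{1..n}. f i \<in> carrier_mat (rdim N i) (rdim M i)) \<and>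
     (\<forall>(i, j)\<in>Q. f j * rmap M (i, j) = rmap N (i, j) * f i)"

definition hom_eq :: "nat \<Rightarrow> (nat \<Rightarrow> 'k mat) \<Rightarrow> (nat \<Rightarrow> 'k mat) \<Rightarrow> bool" where
  "hom_eq n f g \<longleftrightarrow> (\<forall>i\<in>{1..n}. f i = g i)"

definition hom_comp :: "(nat \<Rightarrow> 'k::field mat) \<Rightarrow> (nat \<Rightarrow> 'k mat) \<Rightarrow> nat \<Rightarrow> 'k mat" where
  "hom_comp g f = (\<lambda>i. g i * f i)"

definition hom_id :: "'k::field qrep \<Rightarrow> nat \<Rightarrow> 'k mat" where
  "hom_id M = (\<lambda>i. 1\<^sub>m (rdim M i))"

definition rep_mono :: "nat \<Rightarrow> 'k::field qrep \<Rightarrow> 'k qrep \<Rightarrow> (nat \<Rightarrow> 'k mat) \<Rightarrow> bool" where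
  "rep_mono n M N f \<longleftrightarrow>
     (\<forall>i\<in>{1..n}. inj_on (\<lambda>x. f i *\<^sub>v x) (carrier_vec (rdim M i)))"

definition rep_epi :: "nat \<Rightarrow> 'k::field qrep \<Rightarrow> 'k qrep \<Rightarrow> (nat \<Rightarrow> 'k mat) \<Rightarrow> bool" where
  "rep_epi n M N f \<longleftrightarrow>
     (\<forall>i\<in>{1..n}. (\<lambda>x. f i *\<^sub>v x) ` carrier_vec (rdim M i) = carrier_vec (rdim N i))"

definition short_exact ::
    "nat \<Rightarrow> nat rel \<Rightarrow> 'k::field qrep \<Rightarrow> (nat \<Rightarrow> 'k mat) \<Rightarrow> 'k qrep \<Rightarrow> (nat \<Rightarrow> 'k mat) \<Rightarrow> 'k qrep \<Rightarrow> bool"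
  where
  "short_exact n Q M f E g N \<longleftrightarrow>
     is_rep Q M \<and> is_rep Q E \<and> is_rep Q N \<and> rep_hom n Q M E f \<and> rep_hom n Q E N g \<and>
     rep_mono n M E f \<and> rep_epi n E N g \<and>
     (\<forall>i\<in>{1..n}. (\<lambda>x. f i *\<^sub>v x) ` carrier_vec (rdim M i) =
                  {y \<in> carrier_vec (rdim E i). g i *\<^sub>v y = 0\<^sub>v (rdim N i)})"

definition is_section :: "nat \<Rightarrow> nat rel \<Rightarrow> 'k::field qrep \<Rightarrow> 'k qrep \<Rightarrow> (nat \<Rightarrow> 'k mat) \<Rightarrow> bool" where
  "is_section n Q M N f \<longleftrightarrow> (\<exists>h. rep_hom n Q N M h \<and> hom_eq n (hom_comp h f) (hom_id M))"

definition is_retraction :: "nat \<Rightarrow> nat rel \<Rightarrow> 'k::field qrep \<Rightarrow> 'k qrep \<Rightarrow> (nat \<Rightarrow> 'k mat) \<Rightarrow> bool" where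
  "is_retraction n Q M N g \<longleftrightarrow> (\<exists>h. rep_hom n Q N M h \<and> hom_eq n (hom_comp g h) (hom_id N))"

definition left_almost_split ::
    "nat \<Rightarrow> nat rel \<Rightarrow> 'k::field qrep \<Rightarrow> 'k qrep \<Rightarrow> (nat \<Rightarrow> 'k mat) \<Rightarrow> bool" where
  "left_almost_split n Q M E f \<longleftrightarrow>
     \<not> is_section n Q M E f \<and>
     (\<forall>X h. is_rep Q X \<and> rep_hom n Q M X h \<and> \<not> is_section n Q M X h \<longrightarrow>
        (\<exists>u. rep_hom n Q E X u \<and> hom_eq n (hom_comp u f) h))"

definition right_almost_split ::
    "nat \<Rightarrow> nat rel \<Rightarrow> 'k::field qrep \<Rightarrow> 'k qrep \<Rightarrow> (nat \<Rightarrow> 'k mat) \<Rightarrow> bool" where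
  "right_almost_split n Q E N g \<longleftrightarrow>
     \<not> is_retraction n Q E N g \<and>
     (\<forall>X h. is_rep Q X \<and> rep_hom n Q X N h \<and> \<not> is_retraction n Q X N h \<longrightarrow>
        (\<exists>u. rep_hom n Q X E u \<and> hom_eq n (hom_comp g u) h))"

definition almost_split_sequence ::
    "nat \<Rightarrow> nat rel \<Rightarrow> 'k::field qrep \<Rightarrow> (nat \<Rightarrow> 'k mat) \<Rightarrow> 'k qrep \<Rightarrow> (nat \<Rightarrow> 'k mat) \<Rightarrow> 'k qrep \<Rightarrow> bool"
  where
  "almost_split_sequence n Q M f E g N \<longleftrightarrow>
     short_exact n Q M f E g N \<and> left_almost_split n Q M E f \<and> right_almost_split n Q E N g"

definition injective_rep :: "nat \<Rightarrow> nat rel \<Rightarrow> 'k::field qrep \<Rightarrow> bool" where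
  "injective_rep n Q J \<longleftrightarrow>
     is_rep Q J \<and>
     (\<forall>X Y u h. is_rep Q X \<and> is_rep Q Y \<and> rep_hom n Q X Y u \<and> rep_mono n X Y u \<and>
        rep_hom n Q X J h \<longrightarrow> (\<exists>h'. rep_hom n Q Y J h' \<and> hom_eq n (hom_comp h' u) h))"

text \<open>\<open>N\<close> is isomorphic to \<open>\<tau>\<close> inverse of \<open>M\<close>, for \<open>M\<close> indecomposable or zero. Being defined up to
  isomorphism, the inverse translation is a relation: it takes the left end of an almost split
  sequence to the right end, and the injectives to zero.\<close>

definition ar_inverse_translate :: "nat \<Rightarrow> nat rel \<Rightarrow> 'k::field qrep \<Rightarrow> 'k qrep \<Rightarrow> bool" where
  "ar_inverse_translate n Q M N \<longleftrightarrow>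
     (\<exists>f E g. almost_split_sequence n Q M f E g N) \<or>
     (injective_rep n Q M \<and> is_rep Q N \<and> zero_rep n N)"

text \<open>The space of \<open>P\<^sub>i\<close> at \<open>v\<close> has the paths from \<open>i\<close> to \<open>v\<close> as a basis; the orientation of a
  tree has at most one such path.\<close>

definition proj_rep :: "nat rel \<Rightarrow> nat \<Rightarrow> 'k::field qrep" where
  "proj_rep Q i =
     \<lparr>rdim = (\<lambda>v. if (i, v) \<in> Q\<^sup>* then 1 else 0),
      rmap = (\<lambda>(a, b). if (i, a) \<in> Q\<^sup>* then 1\<^sub>m 1 else 0\<^sub>m (if (i, b) \<in> Q\<^sup>* then 1 else 0) 0)\<rparr>"


section \<open>The quivers $\Gamma_e$ and $\Gamma_c$\<close>

type_synonym vertex = "nat \<times> int"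

definition V_set :: "nat \<Rightarrow> (nat \<Rightarrow> nat) \<Rightarrow> vertex set" where
  "V_set n l = {(i, int (l i) + 2 * a) | i a. i \<in> {1..n}}"

definition Gamma_e :: "nat \<Rightarrow> (nat \<Rightarrow> nat \<Rightarrow> int) \<Rightarrow> (nat \<Rightarrow> nat) \<Rightarrow> vertex rel" where
  "Gamma_e n C l =
     {((i, r), (j, s)). (i, r) \<in> V_set n l \<and> (j, s) \<in> V_set n l \<and> C i j \<noteq> 0 \<and> s = r + C i j}"

definition G_c :: "'k::field itself \<Rightarrow> nat \<Rightarrow> nat rel \<Rightarrow> (nat \<Rightarrow> nat) \<Rightarrow> vertex set" where
  "G_c K n Q l =
     {(i, - int (l i) - 2 * int k) | i k. i \<in> {1..n} \<and>
        (\<exists>N :: 'k qrep. (ar_inverse_translate n Q ^^ k) (proj_rep Q i) N \<and> \<not> zero_rep n N)}"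

text \<open>Labels, in $\Gamma_c$, of the vertices \<open>x\<^sup>R\<close> and \<open>x\<^sup>G\<close>, for \<open>S\<close> the vertex set of $G_c$:
  each vertex of \<open>S\<close> strictly above \<open>x\<close> in its column pushes \<open>x\<close> down by one step.\<close>

definition red_label :: "vertex set \<Rightarrow> vertex \<Rightarrow> vertex" where
  "red_label S x = (fst x, snd x - 2 * int (card {s. s > snd x \<and> (fst x, s) \<in> S}))"

definition green_label :: "vertex set \<Rightarrow> vertex \<Rightarrow> vertex" where
  "green_label S x =
     (if x \<in> S then (fst (red_label S x), snd (red_label S x) - 2) else red_label S x)"

definition Gamma_c ::
    "'k::field itself \<Rightarrow> nat \<Rightarrow> (nat \<Rightarrow> nat \<Rightarrow> int) \<Rightarrow> nat rel \<Rightarrow> (nat \<Rightarrow> nat) \<Rightarrow> vertex rel" where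
  "Gamma_c K n C Q l =
     (let S = G_c K n Q l; R = red_label S; G = green_label S in
        {(R x, G x) | x. x \<in> S} \<union>
        {(R y, G x) | y x. (y, x) \<in> Gamma_e n C l \<and> fst y = fst x} \<union>
        {(G x, R y) | x y. (x, y) \<in> Gamma_e n C l \<and> fst x \<noteq> fst y})"

definition greens ::
    "'k::field itself \<Rightarrow> nat \<Rightarrow> nat rel \<Rightarrow> (nat \<Rightarrow> nat) \<Rightarrow> nat \<Rightarrow> vertex set" where
  "greens K n Q l k = {(i, r - 2 * int k) | i r. (i, r) \<in> green_label (G_c K n Q l) ` G_c K n Q l}"

definition exchange_matrix :: "'v rel \<Rightarrow> 'v \<Rightarrow> 'v \<Rightarrow> int" where
  "exchange_matrix A v w = of_bool ((v, w) \<in> A) - of_bool ((w, v) \<in> A)"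

definition B_c ::
    "'k::field itself \<Rightarrow> nat \<Rightarrow> (nat \<Rightarrow> nat \<Rightarrow> int) \<Rightarrow> nat rel \<Rightarrow> (nat \<Rightarrow> nat) \<Rightarrow> vertex \<Rightarrow> vertex \<Rightarrow> int"
  where
  "B_c K n C Q l = exchange_matrix (Gamma_c K n C Q l)"


section \<open>Mutation and g-vectors\<close>

definition mutate_matrix :: "'w \<Rightarrow> ('w \<Rightarrow> 'w \<Rightarrow> int) \<Rightarrow> 'w \<Rightarrow> 'w \<Rightarrow> int" where
  "mutate_matrix k B = (\<lambda>i j. if i = k \<or> j = k then - B i j
     else B i j + max 0 (B i k) * max 0 (B k j) - max 0 (- B i k) * max 0 (- B k j))"

text \<open>Cluster variables are subtraction-free rational expressions in the initial ones, hence
  determined by their values at the points with positive real coordinates. A seed on the finite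
  vertex set \<open>J\<close> consists of an exchange matrix and of the values of the cluster variables at
  such a point.\<close>

definition mutate_seed ::
    "'w set \<Rightarrow> 'w \<Rightarrow> ('w \<Rightarrow> 'w \<Rightarrow> int) \<times> ('w \<Rightarrow> real) \<Rightarrow> ('w \<Rightarrow> 'w \<Rightarrow> int) \<times> ('w \<Rightarrow> real)" where
  "mutate_seed J k = (\<lambda>(B, x).
     (mutate_matrix k B,
      x(k := ((\<Prod>i\<in>J. x i ^ nat (max 0 (B i k))) + (\<Prod>i\<in>J. x i ^ nat (max 0 (- B i k)))) / x k)))"

text \<open>Principal coefficients: \<open>Inl i\<close> is the \<open>i\<close>-th mutable vertex, with variable \<open>x\<^sub>i\<close>, and
  \<open>Inr i\<close> the frozen vertex carrying the coefficient \<open>y\<^sub>i\<close>.\<close>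

fun principal_extension :: "('v \<Rightarrow> 'v \<Rightarrow> int) \<Rightarrow> 'v + 'v \<Rightarrow> 'v + 'v \<Rightarrow> int" where
  "principal_extension B (Inl i) (Inl j) = B i j"
| "principal_extension B (Inr i) (Inl j) = of_bool (i = j)"
| "principal_extension B (Inl i) (Inr j) = - of_bool (i = j)"
| "principal_extension B (Inr i) (Inr j) = 0"

text \<open>The value at \<open>p\<close> of the cluster variable at \<open>v\<close> of the seed obtained from the reference
  seed, with the full submatrix of \<open>B\<close> on \<open>F\<close> and principal coefficients, by the mutations
  \<open>ks\<close> (performed from left to right).\<close>

definition principal_cluster_variable ::
    "'v set \<Rightarrow> ('v \<Rightarrow> 'v \<Rightarrow> int) \<Rightarrow> 'v list \<Rightarrow> 'v \<Rightarrow> ('v + 'v \<Rightarrow> real) \<Rightarrow> real" where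
  "principal_cluster_variable F B ks v p =
     snd (fold (mutate_seed (Inl ` F \<union> Inr ` F)) (map Inl ks) (principal_extension B, p)) (Inl v)"

text \<open>The grading \<open>deg x\<^sub>i = e\<^sub>i\<close>, \<open>deg y\<^sub>j = - \<Sum>\<^sub>i B i j e\<^sub>i\<close> of Fomin and Zelevinsky, as an action of
  the torus of all positive \<open>t\<close>: an element is homogeneous of degree \<open>g\<close> iff the action
  multiplies it by the character \<open>\<Prod>\<^sub>i t\<^sub>i\<close> to the \<open>g\<^sub>i\<close>.\<close>

fun torus_act ::
    "'v set \<Rightarrow> ('v \<Rightarrow> 'v \<Rightarrow> int) \<Rightarrow> ('v \<Rightarrow> real) \<Rightarrow> ('v + 'v \<Rightarrow> real) \<Rightarrow> 'v + 'v \<Rightarrow> real" where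
  "torus_act F B t p (Inl i) = t i * p (Inl i)"
| "torus_act F B t p (Inr j) = (\<Prod>i\<in>F. t i powi (- B i j)) * p (Inr j)"

definition is_g_vector ::
    "'v set \<Rightarrow> ('v \<Rightarrow> 'v \<Rightarrow> int) \<Rightarrow> 'v list \<Rightarrow> 'v \<Rightarrow> ('v \<Rightarrow> int) \<Rightarrow> bool" where
  "is_g_vector F B ks v g \<longleftrightarrow>
     (\<forall>u. u \<notin> F \<longrightarrow> g u = 0) \<and>
     (\<forall>p t. (\<forall>w. p w > 0) \<and> (\<forall>u. t u > 0) \<longrightarrow>
        principal_cluster_variable F B ks v (torus_act F B t p) =
        (\<Prod>u\<in>F. t u powi g u) * principal_cluster_variable F B ks v p)"

text \<open>g-vectors for a matrix indexed by an infinite set \<open>J\<close>, computed in all sufficiently large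
  finite subsets.\<close>

definition g_vector ::
    "'v set \<Rightarrow> ('v \<Rightarrow> 'v \<Rightarrow> int) \<Rightarrow> 'v list \<Rightarrow> 'v \<Rightarrow> 'v \<Rightarrow> int" where
  "g_vector J B ks v =
     (THE g. eventually (\<lambda>F. is_g_vector F B ks v g) (finite_subsets_at_top J))"


section \<open>The limit G-matrix\<close>

text \<open>The order chosen is irrelevant, as the mutations at the green vertices commute.\<close>

definition green_list ::
    "'k::field itself \<Rightarrow> nat \<Rightarrow> nat rel \<Rightarrow> (nat \<Rightarrow> nat) \<Rightarrow> nat \<Rightarrow> vertex list" where
  "green_list K n Q l k = (SOME vs. distinct vs \<and> set vs = greens K n Q l k)"

primrec B_seq ::
    "'k::field itself \<Rightarrow> nat \<Rightarrow> (nat \<Rightarrow> nat \<Rightarrow> int) \<Rightarrow> nat rel \<Rightarrow> (nat \<Rightarrow> nat) \<Rightarrow> nat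
       \<Rightarrow> vertex \<Rightarrow> vertex \<Rightarrow> int" where
  "B_seq K n C Q l 0 = B_c K n C Q l"
| "B_seq K n C Q l (Suc k) = fold mutate_matrix (green_list K n Q l k) (B_seq K n C Q l k)"

text \<open>Mutations leading from the \<open>k\<close>-th seed back to the initial one.\<close>

primrec return_path ::
    "'k::field itself \<Rightarrow> nat \<Rightarrow> nat rel \<Rightarrow> (nat \<Rightarrow> nat) \<Rightarrow> nat \<Rightarrow> vertex list" where
  "return_path K n Q l 0 = []"
| "return_path K n Q l (Suc k) = green_list K n Q l k @ return_path K n Q l k"

text \<open>The sign of the exchange matrix implements the convention that one mutation at \<open>k\<close> yields
  the g-vector \<open>- e\<^sub>k + \<Sum> e\<^sub>j\<close>, summed over the arrows \<open>j \<rightarrow> k\<close>.\<close>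

definition G_matrix ::
    "'k::field itself \<Rightarrow> nat \<Rightarrow> (nat \<Rightarrow> nat \<Rightarrow> int) \<Rightarrow> nat rel \<Rightarrow> (nat \<Rightarrow> nat) \<Rightarrow> nat
       \<Rightarrow> vertex \<Rightarrow> vertex \<Rightarrow> int" where
  "G_matrix K n C Q l k u v =
     g_vector (V_set n l) (\<lambda>a b. - B_seq K n C Q l k a b) (return_path K n Q l k) v u"

definition G_infinity ::
    "'k::field itself \<Rightarrow> nat \<Rightarrow> (nat \<Rightarrow> nat \<Rightarrow> int) \<Rightarrow> nat rel \<Rightarrow> (nat \<Rightarrow> nat)
       \<Rightarrow> vertex \<Rightarrow> vertex \<Rightarrow> int" where
  "G_infinity K n C Q l u v = lim (\<lambda>k. G_matrix K n C Q l k u v)"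


section \<open>The matrices $\Lambda_e$ and $\Lambda_c$\<close>

definition quantum_cartan :: "(nat \<Rightarrow> nat \<Rightarrow> int) \<Rightarrow> nat \<Rightarrow> nat \<Rightarrow> int fls" where
  "quantum_cartan C i j = (if i = j then fls_X + fls_X_inv else of_int (C i j))"

definition quantum_cartan_inverse :: "nat \<Rightarrow> (nat \<Rightarrow> nat \<Rightarrow> int) \<Rightarrow> nat \<Rightarrow> nat \<Rightarrow> int fls" where
  "quantum_cartan_inverse n C =
     (THE X. (\<forall>i j. i \<notin> {1..n} \<or> j \<notin> {1..n} \<longrightarrow> X i j = 0) \<and>
        (\<forall>i\<in>{1..n}. \<forall>j\<in>{1..n}.
           (\<Sum>k=1..n. quantum_cartan C i k * X k j) = of_bool (i = j) \<and>
           (\<Sum>k=1..n. X i k * quantum_cartan C k j) = of_bool (i = j)))"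

definition F_nonneg :: "nat \<Rightarrow> (nat \<Rightarrow> nat \<Rightarrow> int) \<Rightarrow> nat \<Rightarrow> nat \<Rightarrow> int \<Rightarrow> int" where
  "F_nonneg n C i j m =
     - (\<Sum>k\<in>{k. 1 \<le> k \<and> 2 * k - 1 \<le> m}. fls_nth (quantum_cartan_inverse n C i j) (m - 2 * k + 1))"

definition F_odd :: "nat \<Rightarrow> (nat \<Rightarrow> nat \<Rightarrow> int) \<Rightarrow> nat \<Rightarrow> nat \<Rightarrow> int \<Rightarrow> int" where
  "F_odd n C i j m = (if 0 \<le> m then F_nonneg n C i j m else - F_nonneg n C i j (- m))"

definition Lambda_e :: "nat \<Rightarrow> (nat \<Rightarrow> nat \<Rightarrow> int) \<Rightarrow> vertex \<Rightarrow> vertex \<Rightarrow> int" where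
  "Lambda_e n C = (\<lambda>(i, r) (j, s). F_odd n C i j (s - r))"

text \<open>Products of matrices indexed by a possibly infinite set, for which the sums giving the
  entries have finite support.\<close>

definition mat_prod :: "'v set \<Rightarrow> ('v \<Rightarrow> 'v \<Rightarrow> int) \<Rightarrow> ('v \<Rightarrow> 'v \<Rightarrow> int) \<Rightarrow> 'v \<Rightarrow> 'v \<Rightarrow> int" where
  "mat_prod J A B u v = (\<Sum>w\<in>{w \<in> J. A u w * B w v \<noteq> 0}. A u w * B w v)"

definition mat_transp :: "('v \<Rightarrow> 'v \<Rightarrow> int) \<Rightarrow> 'v \<Rightarrow> 'v \<Rightarrow> int" where
  "mat_transp A u v = A v u"

definition Lambda_c ::
    "'k::field itself \<Rightarrow> nat \<Rightarrow> (nat \<Rightarrow> nat \<Rightarrow> int) \<Rightarrow> nat rel \<Rightarrow> (nat \<Rightarrow> nat)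
       \<Rightarrow> vertex \<Rightarrow> vertex \<Rightarrow> int" where
  "Lambda_c K n C Q l =
     (let J = V_set n l; G = G_infinity K n C Q l
      in mat_prod J (mat_transp G) (mat_prod J (Lambda_e n C) G))"

definition compatible_pair :: "'v set \<Rightarrow> ('v \<Rightarrow> 'v \<Rightarrow> int) \<Rightarrow> ('v \<Rightarrow> 'v \<Rightarrow> int) \<Rightarrow> bool" where
  "compatible_pair J \<Lambda> B \<longleftrightarrow>
     (\<forall>u\<in>J. finite {v \<in> J. B u v \<noteq> 0} \<and> finite {v \<in> J. B v u \<noteq> 0}) \<and>
     (\<forall>u\<in>J. \<forall>v\<in>J. \<Lambda> u v = - \<Lambda> v u) \<and>
     (\<exists>d. ((\<forall>j\<in>J. d j > 0) \<or> (\<forall>j\<in>J. d j < 0)) \<and>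
        (\<forall>u\<in>J. \<forall>v\<in>J. mat_prod J (mat_transp B) \<Lambda> u v = (if u = v then d u else 0)))"

end

theory Submission imports Defs begin

text \<open>The product \<open>B\<^sub>c\<^sup>T \<Lambda>\<^sub>c\<close> is \<open>-2\<close> times the identity. The reason is that the same holds for the pair
  formed by \<open>\<Lambda>\<^sub>e\<close> and the exchange matrix \<open>B\<^sub>e\<close> of \<open>\<Gamma>\<^sub>e\<close>, and that the limit G-matrix, abbreviated \<open>G\<close>,
  transports one pair to the other: \<open>G B\<^sub>c G\<^sup>T = B\<^sub>e\<close> (\<open>G_B_G_transpose\<close>). As \<open>G\<close> is invertible, this gives
  \<open>B\<^sub>c\<^sup>T G\<^sup>T \<Lambda>\<^sub>e G = G\<^sup>-\<^sup>1 B\<^sub>e\<^sup>T \<Lambda>\<^sub>e G = -2\<close>.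

  The relation \<open>B\<^sub>e\<^sup>T \<Lambda>\<^sub>e = -2\<close> (\<open>B_e_Lambda_e\<close>) is the recursion \<open>c(m+1) = A c(m) - c(m-1)\<close> for the
  coefficients of the inverse quantum Cartan matrix, where \<open>A\<close> is the adjacency matrix of the diagram: the
  difference of \<open>\<F>\<^sub>i\<^sub>j\<close> at \<open>m+2\<close> and \<open>m\<close> is \<open>-c(|m+1|)\<close>, and the arrow pattern around a vertex of \<open>\<Gamma>\<^sub>e\<close>
  evaluates the recursion (\<open>F_odd_mesh\<close>). The defect \<open>-2\<close> arises at \<open>m = 0\<close>, where \<open>c(|m+1|)\<close> and
  \<open>c(|m-1|)\<close> are both the identity.

  For the transport, let \<open>B\<^sup>(\<^sup>k\<^sup>)\<close> be the exchange matrix of the \<open>k\<close>-th seed. Mutation at a set \<open>S\<close> of vertices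
  without arrows between them is a congruence \<open>E\<^sup>T B E\<close> (\<open>mut_set_congruence\<close>), and the g-vectors of the
  variables of two consecutive seeds differ by the same factor \<open>E\<close> (\<open>G_stage_step\<close>). Hence the matrix
  \<open>G\<^sub>k B\<^sup>(\<^sup>k\<^sup>) G\<^sub>k\<^sup>T\<close>, with \<open>G\<^sub>k\<close> for the g-vectors seen from far below of the variables of the \<open>k\<close>-th seed, is
  independent of \<open>k\<close> (\<open>stage_invariance\<close>). For \<open>k = 0\<close> it is \<open>G B\<^sub>c G\<^sup>T\<close>; for large \<open>k\<close>, near any
  given vertices, \<open>G\<^sub>k\<close> is the identity and \<open>B\<^sup>(\<^sup>k\<^sup>)\<close> has become \<open>B\<^sub>e\<close>, because the red and green vertices have
  moved away downwards (\<open>B_stage_late\<close>).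

  That the g-vectors satisfy the required recursion is where representation theory enters. A cluster variable is
  homogeneous for the grading in the definition of the g-vector, and each mutation at the vertex \<open>k\<close>
  replaces its degree \<open>D\<^sub>k\<close> by \<open>-D\<^sub>k\<close> plus the degree of either exchange monomial. If the c-vector at \<open>k\<close> is
  nonnegative, one of these monomials is free of coefficients (\<open>return_path_degrees\<close>). The c-vectors of a
  block are obtained from the simple roots by products of simple reflections. If the first reflections take place
  within the walk, the c-vector at a vertex that is about to be mutated is the dimension vector of a nonzero module
  \<open>\<tau>\<^sup>-\<^sup>a P\<^sub>i\<close> (\<open>c_vec_beta\<close>). For a walk that starts in the middle it is at least a root, and a change of sign on the
  way back to the first reflection would identify the dimension vectors of two different modules
  (\<open>c_vec_nonneg\<close>). This positivity is the sign-coherence needed here.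

  It remains to determine \<open>G\<^sub>c\<close> from the definition of \<open>\<tau>\<close> by almost split sequences. The claim is that
  \<open>\<tau>\<^sup>-\<^sup>k P\<^sub>i\<close> is nonzero exactly for \<open>k < orbit_length i\<close>, the least exponent for which the inverse Coxeter
  transformation takes the dimension vector of \<open>P\<^sub>i\<close> out of the positive cone (\<open>G_c_eq\<close>). For a representation \<open>M\<close>
  with only scalar endomorphisms and \<open>q(dim M) = 1\<close>, either some indecomposable injective maps to \<open>M\<close> nontrivially, and
  then \<open>M\<close> is injective and no almost split sequence starts at it (\<open>translate_step_neg\<close>); or a representation \<open>T\<close> is
  constructed that corepresents the dual of \<open>Ext(-, M)\<close> (\<open>inverse_translate_exists\<close>), and the extensions of
  \<open>T\<close> by \<open>M\<close> whose class pairs to \<open>1\<close> with the universal element are almost split (\<open>almost_split\<close>). Comparison of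
  the lengths of adjacent orbits (\<open>orbit_length_arrow\<close>) then makes all quivers \<open>\<Gamma>\<^sub>c\<^sup>(\<^sup>k\<^sup>)\<close> explicit, and shows
  that simultaneous mutation at the green vertices is a downward shift (\<open>mut_set_green_set\<close>).\<close>

section \<open>Systems of linear equations over finite index sets\<close>

text \<open>Fredholm's alternative, by elimination of one unknown at a time, for systems with index sets of any type;
  the systems of interest are indexed by entries of families of matrices.\<close>

lemma linear_system_solvable:
  fixes A :: "'e \<Rightarrow> 'u \<Rightarrow> 'k::field"
  assumes "finite E" "finite U"
    and "\<And>y. (\<forall>u\<in>U. (\<Sum>e\<in>E. y e * A e u) = 0) \<Longrightarrow> (\<Sum>e\<in>E. y e * b e) = 0"
  shows "\<exists>x. \<forall>e\<in>E. (\<Sum>u\<in>U. A e u * x u) = b e"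
  using assms
proof (induction E arbitrary: U A b rule: finite_induct)
  case empty
  then show ?case by simp
next
  case (insert e E)
  note [simp] = insert.hyps insert.prems(1)
  show ?case
  proof (cases "\<exists>u\<in>U. A e u \<noteq> 0")
    case False
    have be: "b e = 0"
    proof -
      have "(\<Sum>e'\<in>insert e E. (if e' = e then 1 else 0) * b e') = 0"
        using False by (intro insert.prems(2)) (auto intro!: sum.neutral)
      moreover have "(\<Sum>e'\<in>insert e E. (if e' = e then 1 else 0) * b e') = b e"
        using insert.hyps by (subst sum.insert) (auto intro!: sum.neutral)
      ultimately show ?thesis by simp
    qed
    have "\<exists>x. \<forall>e\<in>E. (\<Sum>u\<in>U. A e u * x u) = b e"
    proof (rule insert.IH[OF insert.prems(1)])
      fix y assume y: "\<forall>u\<in>U. (\<Sum>e\<in>E. y e * A e u) = 0"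
      have "(\<Sum>e'\<in>insert e E. (y(e := 0)) e' * b e') = 0"
      proof (rule insert.prems(2), rule ballI)
        fix u assume "u \<in> U"
        have "(\<Sum>e'\<in>E. (y(e := 0)) e' * A e' u) = (\<Sum>e'\<in>E. y e' * A e' u)"
          using insert.hyps by (intro sum.cong) auto
        then show "(\<Sum>e'\<in>insert e E. (y(e := 0)) e' * A e' u) = 0"
          using y \<open>u \<in> U\<close> insert.hyps by simp
      qed
      moreover have "(\<Sum>e'\<in>E. (y(e := 0)) e' * b e') = (\<Sum>e'\<in>E. y e' * b e')"
        using insert.hyps by (intro sum.cong) auto
      ultimately show "(\<Sum>e\<in>E. y e * b e) = 0" using insert.hyps by simp
    qed
    then show ?thesis using be False by auto
  next
    case True
    then obtain p where p: "p \<in> U" "A e p \<noteq> 0" by auto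
    \<comment> \<open>the equations that remain after the unknown \<open>p\<close> has been eliminated by equation \<open>e\<close>\<close>
    define A' where "A' = (\<lambda>f u. A f u - A f p / A e p * A e u)"
    define b' where "b' = (\<lambda>f. b f - A f p / A e p * b e)"
    have "\<exists>x. \<forall>f\<in>E. (\<Sum>u\<in>U-{p}. A' f u * x u) = b' f"
    proof (rule insert.IH)
      show "finite (U - {p})" by simp
      fix y assume y: "\<forall>u\<in>U-{p}. (\<Sum>f\<in>E. y f * A' f u) = 0"
      define y' where "y' = y(e := - (\<Sum>f\<in>E. y f * A f p) / A e p)"
      have gen: "(\<Sum>f\<in>insert e E. y' f * g f) = (\<Sum>f\<in>E. y f * (g f - A f p / A e p * g e))" for g
      proof -
        have "(\<Sum>f\<in>E. y' f * g f) = (\<Sum>f\<in>E. y f * g f)"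
          using insert.hyps by (intro sum.cong) (auto simp: y'_def)
        moreover have "(\<Sum>f\<in>E. y f * (A f p / A e p * g e)) = (\<Sum>f\<in>E. y f * A f p) / A e p * g e"
          unfolding sum_distrib_right sum_divide_distrib by (intro sum.cong) simp_all
        ultimately show ?thesis using insert.hyps
          by (simp add: y'_def right_diff_distrib sum_subtractf)
      qed
      have "(\<Sum>f\<in>insert e E. y' f * b f) = 0"
      proof (rule insert.prems(2), rule ballI)
        fix u assume "u \<in> U"
        show "(\<Sum>f\<in>insert e E. y' f * A f u) = 0"
        proof (cases "u = p")
          case True
          then show ?thesis unfolding gen using p by (intro sum.neutral) auto
        next
          case False
          then show ?thesis unfolding gen using y \<open>u \<in> U\<close> by (auto simp: A'_def)
        qed
      qed
      then show "(\<Sum>f\<in>E. y f * b' f) = 0" unfolding gen b'_def .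
    qed
    then obtain x where x: "\<And>f. f \<in> E \<Longrightarrow> (\<Sum>u\<in>U-{p}. A' f u * x u) = b' f" by auto
    define x' where "x' = x(p := (b e - (\<Sum>u\<in>U-{p}. A e u * x u)) / A e p)"
    have split: "(\<Sum>u\<in>U. A f u * x' u) = A f p * x' p + (\<Sum>u\<in>U-{p}. A f u * x u)" for f
    proof -
      have "(\<Sum>u\<in>U-{p}. A f u * x' u) = (\<Sum>u\<in>U-{p}. A f u * x u)"
        by (intro sum.cong) (auto simp: x'_def)
      then show ?thesis using p by (simp add: sum.remove[of U p])
    qed
    have 1: "(\<Sum>u\<in>U. A e u * x' u) = b e" unfolding split using p by (simp add: x'_def)
    have 2: "(\<Sum>u\<in>U. A f u * x' u) = b f" if "f \<in> E" for f
    proof -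
      have "(\<Sum>u\<in>U-{p}. A' f u * x u) =
          (\<Sum>u\<in>U-{p}. A f u * x u) - A f p / A e p * (\<Sum>u\<in>U-{p}. A e u * x u)"
        by (simp add: A'_def left_diff_distrib sum_subtractf sum_distrib_left mult.assoc)
      then have "(\<Sum>u\<in>U-{p}. A f u * x u) = b' f + A f p / A e p * (\<Sum>u\<in>U-{p}. A e u * x u)"
        using x[OF that] by simp
      moreover have "A f p * x' p = A f p / A e p * (b e - (\<Sum>u\<in>U-{p}. A e u * x u))"
        by (simp add: x'_def)
      ultimately show ?thesis unfolding split by (simp add: b'_def right_diff_distrib)
    qed
    show ?thesis using 1 2 by blast
  qed
qed

definition kernel_basis :: "'e set \<Rightarrow> 'u set \<Rightarrow> ('e \<Rightarrow> 'u \<Rightarrow> 'k::field) \<Rightarrow> nat \<Rightarrow> (nat \<Rightarrow> 'u \<Rightarrow> 'k) \<Rightarrow> bool"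
  where "kernel_basis E U A N z \<longleftrightarrow>
    (\<forall>i<N. \<forall>e\<in>E. (\<Sum>u\<in>U. A e u * z i u) = 0) \<and>
    (\<forall>x. (\<forall>e\<in>E. (\<Sum>u\<in>U. A e u * x u) = 0) \<longrightarrow> (\<exists>c. \<forall>u\<in>U. x u = (\<Sum>i<N. c i * z i u))) \<and>
    (\<forall>c. (\<forall>u\<in>U. (\<Sum>i<N. c i * z i u) = 0) \<longrightarrow> (\<forall>i<N. c i = 0))"

text \<open>If the rows are independent, each equation lowers the dimension of the solution space by one.\<close>

lemma kernel_basis_exists:
  fixes A :: "'e \<Rightarrow> 'u \<Rightarrow> 'k::field"
  assumes "finite E" "finite U"
    and "\<And>y. (\<forall>u\<in>U. (\<Sum>e\<in>E. y e * A e u) = 0) \<Longrightarrow> (\<forall>e\<in>E. y e = 0)"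
  shows "card E \<le> card U \<and> (\<exists>z. kernel_basis E U A (card U - card E) z)"
  using assms
proof (induction E arbitrary: U A rule: finite_induct)
  case empty
  obtain h where h: "bij_betw h {..<card U} U"
    using ex_bij_betw_nat_finite[OF empty.prems(1)] by (auto simp: atLeast0LessThan)
  define z :: "nat \<Rightarrow> 'u \<Rightarrow> 'k" where "z = (\<lambda>i u. if u = h i then 1 else 0)"
  have hU: "h i \<in> U" if "i < card U" for i using h that by (auto simp: bij_betw_def)
  have inj: "h i = h j \<longleftrightarrow> i = j" if "i < card U" "j < card U" for i j
    using h that by (auto simp: bij_betw_def inj_on_def)
  have val: "(\<Sum>i<card U. c i * z i (h j)) = c j" if "j < card U" for c j
  proof -
    have "(\<Sum>i<card U. c i * z i (h j)) = (\<Sum>i<card U. if i = j then c i else 0)"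
      using inj that by (intro sum.cong) (auto simp: z_def)
    then show ?thesis using that by simp
  qed
  have ex: "\<exists>j<card U. u = h j" if "u \<in> U" for u using h that by (auto simp: bij_betw_def)
  have "kernel_basis {} U A (card U - card {}) z"
    unfolding kernel_basis_def
  proof (intro conjI allI impI)
    fix x :: "'u \<Rightarrow> 'k"
    show "\<exists>c. \<forall>u\<in>U. x u = (\<Sum>i<card U - card {}. c i * z i u)"
      using ex val by (intro exI[of _ "\<lambda>i. x (h i)"]) fastforce
  next
    fix c i assume "\<forall>u\<in>U. (\<Sum>i<card U - card {}. c i * z i u) = 0" "i < card U - card {}"
    then show "c i = 0" using hU[of i] val[of i c] by simp
  qed auto
  then show ?case by auto
next
  case (insert e E)
  note [simp] = insert.hyps insert.prems(1)
  have "\<exists>p\<in>U. A e p \<noteq> 0"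
  proof (rule ccontr)
    assume "\<not> ?thesis"
    then have "\<forall>f\<in>insert e E. (if f = e then 1 else 0) = (0::'k)"
      by (intro insert.prems(2)) (auto intro!: sum.neutral)
    then show False by simp
  qed
  then obtain p where p: "p \<in> U" "A e p \<noteq> 0" by auto
  define A' where "A' = (\<lambda>f u. A f u - A f p / A e p * A e u)"
  have cardU: "card U = Suc (card (U - {p}))" using p by (simp only: card_Suc_Diff1[OF insert.prems(1) p(1)])
  have "card E \<le> card (U-{p}) \<and> (\<exists>z. kernel_basis E (U-{p}) A' (card (U-{p}) - card E) z)"
  proof (rule insert.IH)
    show "finite (U - {p})" by simp
    fix y assume y: "\<forall>u\<in>U-{p}. (\<Sum>f\<in>E. y f * A' f u) = 0"
    define y' where "y' = y(e := - (\<Sum>f\<in>E. y f * A f p) / A e p)"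
    have gen: "(\<Sum>f\<in>insert e E. y' f * g f) = (\<Sum>f\<in>E. y f * (g f - A f p / A e p * g e))" for g
    proof -
      have "(\<Sum>f\<in>E. y' f * g f) = (\<Sum>f\<in>E. y f * g f)"
        using insert.hyps by (intro sum.cong) (auto simp: y'_def)
      moreover have "(\<Sum>f\<in>E. y f * (A f p / A e p * g e)) = (\<Sum>f\<in>E. y f * A f p) / A e p * g e"
          unfolding sum_distrib_right sum_divide_distrib by (intro sum.cong) simp_all
        ultimately show ?thesis using insert.hyps
          by (simp add: y'_def right_diff_distrib sum_subtractf)
    qed
    have "\<forall>f\<in>insert e E. y' f = 0"
    proof (rule insert.prems(2), rule ballI)
      fix u assume "u \<in> U"
      show "(\<Sum>f\<in>insert e E. y' f * A f u) = 0"
      proof (cases "u = p")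
        case True
        then show ?thesis unfolding gen using p by (intro sum.neutral) auto
      next
        case False
        then show ?thesis unfolding gen using y \<open>u \<in> U\<close> by (auto simp: A'_def)
      qed
    qed
    then show "\<forall>f\<in>E. y f = 0" using insert.hyps by (auto simp: y'_def split: if_splits)
  qed
  then obtain z where le: "card E \<le> card (U-{p})"
    and z: "kernel_basis E (U-{p}) A' (card (U-{p}) - card E) z" by auto
  define N where "N = card (U-{p}) - card E"
  have N: "card U - card (insert e E) = N" using cardU by (simp add: N_def)
  define ext where "ext = (\<lambda>x::'u\<Rightarrow>'k. x(p := - (\<Sum>u\<in>U-{p}. A e u * x u) / A e p))"
  have split: "(\<Sum>u\<in>U. A f u * x u) = A f p * x p + (\<Sum>u\<in>U-{p}. A f u * x u)" for f x
    using p by (simp add: sum.remove[of U p])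
  have cong: "(\<Sum>u\<in>U-{p}. A f u * ext x u) = (\<Sum>u\<in>U-{p}. A f u * x u)" for f x
    by (intro sum.cong) (auto simp: ext_def)
  have A'sum: "(\<Sum>u\<in>U-{p}. A' f u * x u) =
      (\<Sum>u\<in>U-{p}. A f u * x u) - A f p / A e p * (\<Sum>u\<in>U-{p}. A e u * x u)" for f x
    by (simp add: A'_def left_diff_distrib sum_subtractf sum_distrib_left mult.assoc)
  have kz: "(\<Sum>u\<in>U-{p}. A' f u * z i u) = 0" if "i < N" "f \<in> E" for i f
    using z that by (auto simp: kernel_basis_def N_def)
  have "kernel_basis (insert e E) U A N (\<lambda>i. ext (z i))"
    unfolding kernel_basis_def
  proof (intro conjI allI impI ballI)
    fix i f assume i: "i < N" and f: "f \<in> insert e E"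
    have e: "ext (z i) p = - (\<Sum>u\<in>U-{p}. A e u * z i u) / A e p" by (simp add: ext_def)
    have "(\<Sum>u\<in>U-{p}. A f u * z i u) = A f p / A e p * (\<Sum>u\<in>U-{p}. A e u * z i u)"
      using kz[OF i, of f] f A'sum[of f "z i"] p by auto
    then show "(\<Sum>u\<in>U. A f u * ext (z i) u) = 0"
      unfolding split[of f "ext (z i)"] cong e using p by (simp add: field_simps)
  next
    fix x assume x: "\<forall>f\<in>insert e E. (\<Sum>u\<in>U. A f u * x u) = 0"
    have xe: "A e p * x p + (\<Sum>u\<in>U-{p}. A e u * x u) = 0" using x split[of e x] by simp
    then have xp: "x p = - (\<Sum>u\<in>U-{p}. A e u * x u) / A e p"
      using p by (simp add: field_simps eq_neg_iff_add_eq_0)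
    have "(\<Sum>u\<in>U-{p}. A' f u * x u) = 0" if "f \<in> E" for f
    proof -
      have "A f p * x p + (\<Sum>u\<in>U-{p}. A f u * x u) = 0" using x that split[of f x] by simp
      then show ?thesis unfolding A'sum xp using p by (simp add: field_simps)
    qed
    then obtain c where "\<forall>u\<in>U-{p}. x u = (\<Sum>i<N. c i * z i u)"
      using z[unfolded kernel_basis_def N_def[symmetric], THEN conjunct2, THEN conjunct1, THEN spec[of _ x]] by auto
    then have c: "\<And>u. u \<in> U-{p} \<Longrightarrow> x u = (\<Sum>i<N. c i * z i u)" by blast
    have "x u = (\<Sum>i<N. c i * ext (z i) u)" if "u \<in> U" for u
    proof (cases "u = p")
      case False
      then show ?thesis using c that by (simp add: ext_def)
    next
      case True
      have "(\<Sum>u\<in>U-{p}. A e u * x u) = (\<Sum>u\<in>U-{p}. \<Sum>i<N. A e u * (c i * z i u))"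
        using c by (intro sum.cong) (auto simp: sum_distrib_left)
      also have "\<dots> = (\<Sum>i<N. c i * (\<Sum>u\<in>U-{p}. A e u * z i u))"
        by (subst sum.swap) (simp add: sum_distrib_left mult.left_commute)
      finally show ?thesis unfolding True xp
        by (simp add: ext_def sum_divide_distrib[symmetric] sum_negf)
    qed
    then show "\<exists>c. \<forall>u\<in>U. x u = (\<Sum>i<N. c i * ext (z i) u)" by blast
  next
    fix c i assume c: "\<forall>u\<in>U. (\<Sum>i<N. c i * ext (z i) u) = 0" and i: "i < N"
    have "(\<Sum>i<N. c i * z i u) = 0" if "u \<in> U-{p}" for u
    proof -
      have "(\<Sum>i<N. c i * z i u) = (\<Sum>i<N. c i * ext (z i) u)"
        using that by (intro sum.cong) (auto simp: ext_def)
      then show ?thesis using c that by auto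
    qed
    then show "c i = 0"
      using z[unfolded kernel_basis_def N_def[symmetric], THEN conjunct2, THEN conjunct2, THEN spec[of _ c]] i by auto
  qed
  then show ?case unfolding N using le cardU by auto
qed

section \<open>The Euler form of a Dynkin quiver\<close>

locale dynkin_quiver =
  fixes n :: nat and C :: "nat \<Rightarrow> nat \<Rightarrow> int" and Q :: "nat rel" and l :: "nat \<Rightarrow> nat"
  assumes cartan: "simply_laced_cartan n C"
    and orientation: "dynkin_orientation n C Q"
    and height: "(i, j) \<in> Q \<Longrightarrow> l i = l j + 1"
begin

definition I :: "nat set" where "I = {1..n}"

lemma finite_I [simp]: "finite I" by (simp add: I_def)
lemma Q_sub: "Q \<subseteq> I \<times> I" using orientation by (auto simp: dynkin_orientation_def I_def)
lemma Q_I: "(i, j) \<in> Q \<Longrightarrow> i \<in> I \<and> j \<in> I" using Q_sub by blast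
lemma finite_Q [simp]: "finite Q" by (rule finite_subset[OF Q_sub]) simp

lemma Q_asym: "(i, j) \<in> Q \<Longrightarrow> (j, i) \<notin> Q" using height[of i j] height[of j i] by auto
lemma Q_irrefl [simp]: "(i, i) \<notin> Q" using Q_asym by blast

lemma C_value:
  assumes "i \<in> I" "j \<in> I"
  shows "C i j = 2 * of_bool (i = j) - of_bool ((i, j) \<in> Q) - of_bool ((j, i) \<in> Q)"
proof (cases "i = j")
  case True
  then show ?thesis using assms cartan by (auto simp: simply_laced_cartan_def I_def)
next
  case False
  have "C i j \<in> {0, -1}" using assms cartan False by (auto simp: simply_laced_cartan_def I_def)
  moreover have "(i, j) \<in> Q \<or> (j, i) \<in> Q \<longleftrightarrow> C i j \<noteq> 0"
    using assms orientation False by (auto simp: dynkin_orientation_def I_def)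
  ultimately show ?thesis using False Q_asym[of i j] Q_asym[of j i] by auto
qed

lemma path_I: "(i, j) \<in> Q\<^sup>* \<Longrightarrow> i \<in> I \<longleftrightarrow> j \<in> I"
  by (induction rule: rtrancl_induct) (use Q_I in auto)

lemma path_height: "(i, j) \<in> Q\<^sup>* \<Longrightarrow> l j \<le> l i \<and> (l j = l i \<longrightarrow> i = j)"
  by (induction rule: rtrancl_induct) (use height in force)+

lemma path_antisym: "(i, j) \<in> Q\<^sup>* \<Longrightarrow> (j, i) \<in> Q\<^sup>* \<Longrightarrow> i = j"
  using path_height[of i j] path_height[of j i] by auto

lemma arrow_not_back: "(i, j) \<in> Q \<Longrightarrow> (j, i) \<notin> Q\<^sup>*"
  using height[of i j] path_height[of j i] by auto

definition euler :: "(nat \<Rightarrow> int) \<Rightarrow> (nat \<Rightarrow> int) \<Rightarrow> int" where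
  "euler x y = (\<Sum>v\<in>I. x v * y v) - (\<Sum>(u, v)\<in>Q. x u * y v)"

lemma sum_Q: "(\<Sum>(u, v)\<in>Q. f u v) = (\<Sum>u\<in>I. \<Sum>v\<in>I. if (u, v) \<in> Q then f u v else 0)"
  for f :: "nat \<Rightarrow> nat \<Rightarrow> 'a::comm_monoid_add"
proof -
  have "(\<Sum>u\<in>I. \<Sum>v\<in>I. if (u, v) \<in> Q then f u v else 0) =
      (\<Sum>p\<in>I\<times>I. if p \<in> Q then (case p of (u, v) \<Rightarrow> f u v) else 0)"
    unfolding sum.cartesian_product by (intro sum.cong) auto
  also have "\<dots> = (\<Sum>p\<in>(I\<times>I)\<inter>Q. case p of (u, v) \<Rightarrow> f u v)" by (simp add: sum.inter_restrict)
  also have "(I\<times>I)\<inter>Q = Q" using Q_sub by auto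
  finally show ?thesis by simp
qed

lemma sum_into: "(\<Sum>(u, v)\<in>Q. f u v) = (\<Sum>v\<in>I. \<Sum>u | (u, v) \<in> Q. f u v)"
  for f :: "nat \<Rightarrow> nat \<Rightarrow> 'a::comm_monoid_add"
proof -
  have "(\<Sum>u | (u, v) \<in> Q. f u v) = (\<Sum>u\<in>I. if (u, v) \<in> Q then f u v else 0)" for v
  proof -
    have "{u. (u, v) \<in> Q} = {u\<in>I. (u, v) \<in> Q}" using Q_I by auto
    then show ?thesis by (simp add: sum.inter_filter[symmetric])
  qed
  then show ?thesis unfolding sum_Q by (subst sum.swap) simp
qed

lemma sum_out: "(\<Sum>(u, v)\<in>Q. f u v) = (\<Sum>u\<in>I. \<Sum>v | (u, v) \<in> Q. f u v)"
  for f :: "nat \<Rightarrow> nat \<Rightarrow> 'a::comm_monoid_add"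
proof -
  have "(\<Sum>v | (u, v) \<in> Q. f u v) = (\<Sum>v\<in>I. if (u, v) \<in> Q then f u v else 0)" for u
  proof -
    have "{v. (u, v) \<in> Q} = {v\<in>I. (u, v) \<in> Q}" using Q_I by auto
    then show ?thesis by (simp add: sum.inter_filter[symmetric])
  qed
  then show ?thesis unfolding sum_Q by simp
qed

lemma euler_cong:
  assumes "\<And>v. v \<in> I \<Longrightarrow> x v = x' v" "\<And>v. v \<in> I \<Longrightarrow> y v = y' v"
  shows "euler x y = euler x' y'"
  unfolding euler_def using assms Q_I by (intro arg_cong2[of _ _ _ _ "(-)"] sum.cong) auto

lemma euler_add_left: "euler (\<lambda>v. x v + x' v) y = euler x y + euler x' y"
  by (simp add: euler_def distrib_right sum.distrib split_beta)
lemma euler_add_right: "euler x (\<lambda>v. y v + y' v) = euler x y + euler x y'"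
  by (simp add: euler_def distrib_left sum.distrib split_beta)
lemma euler_diff_left: "euler (\<lambda>v. x v - x' v) y = euler x y - euler x' y"
  by (simp add: euler_def left_diff_distrib sum_subtractf split_beta)
lemma euler_diff_right: "euler x (\<lambda>v. y v - y' v) = euler x y - euler x y'"
  by (simp add: euler_def right_diff_distrib sum_subtractf split_beta)
lemma euler_scale_left: "euler (\<lambda>v. c * x v) y = c * euler x y"
  by (simp add: euler_def right_diff_distrib sum_distrib_left split_beta mult_ac)
lemma euler_minus_left: "euler (\<lambda>v. - x v) y = - euler x y"
  using euler_scale_left[of "-1"] by simp
lemma euler_minus_right: "euler x (\<lambda>v. - y v) = - euler x y"
  by (simp add: euler_def sum_negf split_beta)
lemma euler_zero_left: "euler (\<lambda>v. 0) y = 0" by (simp add: euler_def)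
lemma euler_sum_left:
  assumes "finite A" shows "euler (\<lambda>v. \<Sum>a\<in>A. g a v) y = (\<Sum>a\<in>A. euler (g a) y)"
  using assms by (induction A rule: finite_induct) (simp_all add: euler_zero_left euler_add_left)

lemma cartan_form: "(\<Sum>i\<in>I. \<Sum>j\<in>I. x i * C i j * x j) = 2 * euler x x"
proof -
  have "(\<Sum>i\<in>I. \<Sum>j\<in>I. x i * C i j * x j) =
      (\<Sum>i\<in>I. \<Sum>j\<in>I. (if i = j then 2 * (x i * x j) else 0)
         - (if (i, j) \<in> Q then x i * x j else 0) - (if (j, i) \<in> Q then x j * x i else 0))"
    by (intro sum.cong refl) (auto simp: C_value)
  also have "\<dots> = (\<Sum>i\<in>I. 2 * (x i * x i)) - (\<Sum>(u, v)\<in>Q. x u * x v) - (\<Sum>(u, v)\<in>Q. x u * x v)"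
    by (simp add: sum_subtractf sum_Q, subst (2) sum.swap, simp)
  finally show ?thesis unfolding euler_def right_diff_distrib sum_distrib_left[symmetric] by simp
qed

text \<open>Positive definiteness of the Cartan matrix over the reals; integrality turns \<open>> 0\<close> into \<open>\<ge> 1\<close>.\<close>

lemma euler_positive:
  assumes "v \<in> I" "x v \<noteq> 0" shows "euler x x \<ge> 1"
proof -
  have "(\<Sum>i=1..n. \<Sum>j=1..n. real_of_int (x i) * of_int (C i j) * of_int (x j)) > 0"
  proof -
    have "\<exists>i\<in>{1..n}. real_of_int (x i) \<noteq> 0" using assms by (auto simp: I_def)
    then show ?thesis
      using cartan[unfolded simply_laced_cartan_def, THEN conjunct2, THEN conjunct2, THEN conjunct2,
          THEN conjunct2, THEN spec[of _ "\<lambda>i. real_of_int (x i)"]] by blast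
  qed
  moreover have "(\<Sum>i=1..n. \<Sum>j=1..n. real_of_int (x i) * of_int (C i j) * of_int (x j)) =
      real_of_int (\<Sum>i\<in>I. \<Sum>j\<in>I. x i * C i j * x j)" by (simp add: I_def)
  ultimately have "(\<Sum>i\<in>I. \<Sum>j\<in>I. x i * C i j * x j) > 0" by linarith
  then show ?thesis unfolding cartan_form by simp
qed

lemma euler_zero_iff: "euler x x \<le> 0 \<Longrightarrow> v \<in> I \<Longrightarrow> x v = 0"
  using euler_positive[of v x] by force

lemma euler_nonneg: "euler x x \<ge> 0"
proof (cases "\<exists>v\<in>I. x v \<noteq> 0")
  case True
  then show ?thesis using euler_positive[of _ x] by force
next
  case False
  then have "euler x x = euler (\<lambda>_. 0) (\<lambda>_. 0)" by (intro euler_cong) auto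
  then show ?thesis by (simp add: euler_zero_left)
qed

text \<open>A Dynkin diagram is a tree: otherwise the indicator vector of the convex set \<open>S\<close> of all vertices between \<open>u\<close> and
  \<open>w\<close> would have Euler form \<open>|S| - (number of arrows in S) \<le> 0\<close>.\<close>

lemma next_unique:
  assumes u1: "(u, v1) \<in> Q" "(v1, w) \<in> Q\<^sup>*" and u2: "(u, v2) \<in> Q" "(v2, w) \<in> Q\<^sup>*"
  shows "v1 = v2"
proof (rule ccontr)
  assume ne: "v1 \<noteq> v2"
  define S where "S = {x \<in> I. (u, x) \<in> Q\<^sup>* \<and> (x, w) \<in> Q\<^sup>*}"
  have fS: "finite S" by (simp add: S_def)
  have uI: "u \<in> I" using u1 Q_I by auto
  have uw: "(u, w) \<in> Q\<^sup>*" using u1 by auto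
  have u_ne_w: "u \<noteq> w" using height[OF u1(1)] path_height[OF u1(2)] by auto
  have uS: "u \<in> S" and wS: "w \<in> S" using uI uw path_I[OF uw] by (auto simp: S_def)
  have vS: "v1 \<in> S" "v2 \<in> S" using u1 u2 Q_I by (auto simp: S_def)
  have "\<exists>y. (x, y) \<in> Q \<and> y \<in> S" if "x \<in> S" "x \<noteq> w" for x
  proof -
    obtain y where "(x, y) \<in> Q" "(y, w) \<in> Q\<^sup>*"
      using \<open>x \<in> S\<close> \<open>x \<noteq> w\<close> unfolding S_def by (auto elim: converse_rtranclE)
    then show ?thesis using that Q_I unfolding S_def by (auto intro: rtrancl_into_rtrancl)
  qed
  then obtain f where f: "\<And>x. x \<in> S \<Longrightarrow> x \<noteq> w \<Longrightarrow> (x, f x) \<in> Q \<and> f x \<in> S" by metis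
  \<comment> \<open>an injection from vertices to arrows: every vertex other than \<open>w\<close> has an arrow in \<open>S\<close>, and \<open>u\<close> has two of them, one of which is left for \<open>w\<close>\<close>
  define g where "g = (\<lambda>x. if x = w then (u, v2) else if x = u then (u, v1) else (x, f x))"
  have "inj_on g S" unfolding inj_on_def g_def using ne u_ne_w by auto
  moreover have "g ` S \<subseteq> Q \<inter> S \<times> S" using f u1 u2 vS uS by (auto simp: g_def)
  ultimately have le: "card S \<le> card (Q \<inter> S \<times> S)" by (intro card_inj_on_le) auto
  define x where "x = (\<lambda>v. of_bool (v \<in> S) :: int)"
  have "euler x x = int (card S) - int (card (Q \<inter> S \<times> S))"
  proof -
    have "(\<Sum>v\<in>I. x v * x v) = (\<Sum>v\<in>I. if v \<in> S then 1 else 0)"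
      by (intro sum.cong) (auto simp: x_def)
    also have "\<dots> = int (card (I \<inter> S))" by (simp add: sum.inter_restrict[symmetric])
    also have "I \<inter> S = S" by (auto simp: S_def)
    finally have 1: "(\<Sum>v\<in>I. x v * x v) = int (card S)" .
    have "(\<Sum>(u, v)\<in>Q. x u * x v) = (\<Sum>p\<in>Q. if p \<in> S \<times> S then 1 else 0)"
      by (intro sum.cong) (auto simp: x_def)
    also have "\<dots> = int (card (Q \<inter> S \<times> S))" by (simp add: sum.inter_restrict[symmetric])
    finally show ?thesis using 1 by (simp add: euler_def)
  qed
  then show False using le euler_positive[of u x] uI uS by (auto simp: x_def)
qed

lemma prev_unique:
  assumes "(u, v1) \<in> Q\<^sup>*" "(v1, w) \<in> Q" "(u, v2) \<in> Q\<^sup>*" "(v2, w) \<in> Q"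
  shows "v1 = v2"
  using assms
proof (induction rule: converse_rtrancl_induct)
  case base
  show ?case
  proof (rule ccontr)
    assume "v1 \<noteq> v2"
    then obtain z where "(v1, z) \<in> Q" "(z, v2) \<in> Q\<^sup>*" using base by (auto elim: converse_rtranclE)
    then show False using next_unique[of v1 w w z] base arrow_not_back[of v2 w]
      by (auto intro: rtrancl_into_rtrancl)
  qed
next
  case (step u z)
  show ?case
  proof (cases "u = v2")
    case True
    then have "z = w" using next_unique[of u z w w] step
      by (auto intro: rtrancl_into_rtrancl)
    then show ?thesis using step arrow_not_back[of v1 w] by auto
  next
    case False
    then obtain z' where z': "(u, z') \<in> Q" "(z', v2) \<in> Q\<^sup>*" using step by (auto elim: converse_rtranclE)
    then have "z = z'" using next_unique[of u z w z'] step by (auto intro: rtrancl_into_rtrancl)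
    then show ?thesis using step z' by auto
  qed
qed

text \<open>The dimension vector of \<open>P\<^sub>i\<close>; \<open>\<lambda>v. pvec v w\<close> is the dimension vector of the injective at \<open>w\<close>.\<close>

definition pvec :: "nat \<Rightarrow> nat \<Rightarrow> int" where "pvec i v = of_bool ((i, v) \<in> Q\<^sup>*)"

lemma pvec_nonneg [simp]: "pvec i v \<ge> 0" by (simp add: pvec_def)
lemma pvec_self [simp]: "pvec i i = 1" by (simp add: pvec_def)

text \<open>In a tree every vertex other than \<open>i\<close> that is reached from \<open>i\<close> is reached by exactly one last arrow.\<close>

lemma pvec_rec_last:
  assumes "v \<in> I" "i \<in> I"
  shows "pvec i v = of_bool (v = i) + (\<Sum>u | (u, v) \<in> Q. pvec i u)"
proof -
  have fin: "finite {u. (u, v) \<in> Q}" by (rule finite_subset[of _ I]) (use Q_I in auto)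
  show ?thesis
  proof (cases "(i, v) \<in> Q\<^sup>* \<and> v \<noteq> i")
    case True
    then obtain p where p: "(i, p) \<in> Q\<^sup>*" "(p, v) \<in> Q" by (auto elim: rtranclE)
    have "(\<Sum>u | (u, v) \<in> Q. pvec i u) = (\<Sum>u | (u, v) \<in> Q. if u = p then 1 else 0)"
    proof (intro sum.cong refl)
      fix u assume "u \<in> {u. (u, v) \<in> Q}"
      then have "(i, u) \<in> Q\<^sup>* \<longleftrightarrow> u = p" using p prev_unique[of i u v p] by blast
      then show "pvec i u = (if u = p then 1 else 0)" by (simp add: pvec_def)
    qed
    then show ?thesis using True p fin by (simp add: pvec_def)
  next
    case False
    have "(\<Sum>u | (u, v) \<in> Q. pvec i u) = 0"
    proof (intro sum.neutral ballI)
      fix u assume u: "u \<in> {u. (u, v) \<in> Q}"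
      show "pvec i u = 0"
      proof (rule ccontr)
        assume "pvec i u \<noteq> 0"
        then have "(i, u) \<in> Q\<^sup>*" by (auto simp: pvec_def)
        then have "(i, v) \<in> Q\<^sup>*" "v \<noteq> i"
          using u arrow_not_back[of u v] by (auto intro: rtrancl_into_rtrancl)
        then show False using False by simp
      qed
    qed
    then show ?thesis using False by (auto simp: pvec_def)
  qed
qed

text \<open>The dimension count in \<open>0 \<rightarrow> \<Oplus> P\<^sub>j \<rightarrow> P\<^sub>i \<rightarrow> S\<^sub>i \<rightarrow> 0\<close>, the sum being over all arrows \<open>i \<rightarrow> j\<close>.\<close>

lemma pvec_rec_first:
  assumes "v \<in> I" "i \<in> I"
  shows "pvec i v = of_bool (v = i) + (\<Sum>j | (i, j) \<in> Q. pvec j v)"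
proof -
  have fin: "finite {u. (i, u) \<in> Q}" by (rule finite_subset[of _ I]) (use Q_I in auto)
  show ?thesis
  proof (cases "(i, v) \<in> Q\<^sup>* \<and> v \<noteq> i")
    case True
    then obtain p where p: "(i, p) \<in> Q" "(p, v) \<in> Q\<^sup>*" by (auto elim: converse_rtranclE)
    have "(\<Sum>u | (i, u) \<in> Q. pvec u v) = (\<Sum>u | (i, u) \<in> Q. if u = p then 1 else 0)"
    proof (intro sum.cong refl)
      fix u assume "u \<in> {u. (i, u) \<in> Q}"
      then have "(u, v) \<in> Q\<^sup>* \<longleftrightarrow> u = p" using p next_unique[of i u v p] by blast
      then show "pvec u v = (if u = p then 1 else 0)" by (simp add: pvec_def)
    qed
    then show ?thesis using True p fin by (simp add: pvec_def)
  next
    case False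
    have "(\<Sum>u | (i, u) \<in> Q. pvec u v) = 0"
    proof (intro sum.neutral ballI)
      fix u assume u: "u \<in> {u. (i, u) \<in> Q}"
      show "pvec u v = 0"
      proof (rule ccontr)
        assume "pvec u v \<noteq> 0"
        then have "(u, v) \<in> Q\<^sup>*" by (auto simp: pvec_def)
        then show False using False u arrow_not_back[of i u] by (auto intro: converse_rtrancl_into_rtrancl)
      qed
    qed
    then show ?thesis using False by (auto simp: pvec_def)
  qed
qed

text \<open>The numerical form of \<open>Hom(P\<^sub>i, Y) = Y\<^sub>i\<close>; the next lemma is the one of \<open>Hom(Y, I\<^sub>w) = D Y\<^sub>w\<close>.\<close>

lemma euler_pvec:
  assumes "i \<in> I" shows "euler (pvec i) y = y i"
proof -
  have "euler (pvec i) y = (\<Sum>v\<in>I. (pvec i v - (\<Sum>u | (u, v) \<in> Q. pvec i u)) * y v)"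
    by (simp add: euler_def sum_into sum_distrib_right left_diff_distrib sum_subtractf)
  also have "\<dots> = (\<Sum>v\<in>I. if v = i then y v else 0)"
    using pvec_rec_last[OF _ assms] by (intro sum.cong) auto
  finally show ?thesis using assms by simp
qed

lemma euler_ivec:
  assumes "w \<in> I" shows "euler y (\<lambda>v. pvec v w) = y w"
proof -
  have "euler y (\<lambda>v. pvec v w) = (\<Sum>u\<in>I. y u * (pvec u w - (\<Sum>v | (u, v) \<in> Q. pvec v w)))"
    by (simp add: euler_def sum_out sum_distrib_left right_diff_distrib sum_subtractf)
  also have "\<dots> = (\<Sum>u\<in>I. if u = w then y u else 0)"
    using pvec_rec_first[OF assms] by (intro sum.cong) auto
  finally show ?thesis using assms by simp
qed

text \<open>The action of the inverse Auslander--Reiten translation on dimension vectors, written out on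
  the projective presentation with terms \<open>P\<^sub>v\<close>, one for each basis vector at \<open>v\<close>, and \<open>P\<^sub>u\<close>, one for each
  arrow \<open>u \<rightarrow> v\<close> and each basis vector at \<open>v\<close>.\<close>

definition cox :: "(nat \<Rightarrow> int) \<Rightarrow> nat \<Rightarrow> int" where
  "cox m w = (\<Sum>(u, v)\<in>Q. m v * pvec u w) - (\<Sum>v\<in>I. m v * pvec v w)"

lemma cox_cong: "(\<And>v. v \<in> I \<Longrightarrow> x v = y v) \<Longrightarrow> cox x = cox y"
  unfolding cox_def using Q_I by (intro ext arg_cong2[of _ _ _ _ "(-)"] sum.cong) auto

lemma cox_outside: "w \<notin> I \<Longrightarrow> cox m w = 0"
proof -
  assume w: "w \<notin> I"
  have "pvec v w = 0" if "v \<in> I" for v using path_I[of v w] that w by (auto simp: pvec_def)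
  moreover from this have "m v * pvec u w = 0" if "(u, v) \<in> Q" for u v using Q_I[OF that] by simp
  ultimately show ?thesis unfolding cox_def by (auto intro!: sum.neutral)
qed

lemma cox_add: "cox (\<lambda>v. x v + y v) = (\<lambda>v. cox x v + cox y v)"
  by (simp add: cox_def distrib_right sum.distrib split_beta fun_eq_iff)
lemma cox_zero: "cox (\<lambda>v. 0) = (\<lambda>v. 0)" by (simp add: cox_def fun_eq_iff)
lemma cox_sum:
  assumes "finite A" shows "cox (\<lambda>v. \<Sum>a\<in>A. g a v) = (\<lambda>v. \<Sum>a\<in>A. cox (g a) v)"
  using assms by (induction A rule: finite_induct) (simp_all add: cox_zero cox_add)

text \<open>The numerical form of the Auslander--Reiten formula.\<close>

lemma euler_cox: "euler (cox m) y = - euler y m"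
proof -
  have 1: "euler (\<lambda>w. \<Sum>(u, v)\<in>Q. m v * pvec u w) y = (\<Sum>(u, v)\<in>Q. m v * y u)"
  proof -
    have "euler (\<lambda>w. \<Sum>(u, v)\<in>Q. m v * pvec u w) y = (\<Sum>p\<in>Q. euler (\<lambda>w. case p of (u, v) \<Rightarrow> m v * pvec u w) y)"
      by (subst euler_sum_left[symmetric]) auto
    also have "\<dots> = (\<Sum>(u, v)\<in>Q. m v * y u)"
      using Q_I by (intro sum.cong) (auto simp: euler_scale_left euler_pvec)
    finally show ?thesis .
  qed
  have 2: "euler (\<lambda>w. \<Sum>v\<in>I. m v * pvec v w) y = (\<Sum>v\<in>I. m v * y v)"
    by (subst euler_sum_left) (auto simp: euler_scale_left euler_pvec)
  have "euler (cox m) y = euler (\<lambda>w. \<Sum>(u, v)\<in>Q. m v * pvec u w) y - euler (\<lambda>w. \<Sum>v\<in>I. m v * pvec v w) y"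
    unfolding euler_diff_left[symmetric] cox_def[abs_def] ..
  then show ?thesis unfolding 1 2 by (simp add: euler_def mult.commute)
qed

lemma euler_cox_cox: "euler (cox x) (cox y) = euler x y"
  by (simp add: euler_cox)

lemma euler_nondegenerate:
  assumes "\<And>y. euler y x = euler y x'" "v \<in> I" shows "x v = x' v"
proof -
  have "euler (\<lambda>v. x v - x' v) (\<lambda>v. x v - x' v) = 0" by (simp add: euler_diff_right assms(1))
  then show ?thesis using euler_zero_iff[of "\<lambda>v. x v - x' v" v] assms by auto
qed

lemma cox_inj: "(\<And>v. v \<in> I \<Longrightarrow> cox x v = cox y v) \<Longrightarrow> v \<in> I \<Longrightarrow> x v = y v"
  using euler_nondegenerate[of x y v] euler_cong[of "cox x" "cox y"] euler_cox by (metis neg_equal_iff_equal)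

definition nonneg :: "(nat \<Rightarrow> int) \<Rightarrow> bool" where "nonneg x \<longleftrightarrow> (\<forall>v\<in>I. x v \<ge> 0)"

text \<open>The positive and the negative part of \<open>x\<close> have Euler form at most \<open>0\<close> with each other and at least \<open>1\<close> with
  themselves if they are nonzero.\<close>

lemma root_sign:
  assumes "euler x x = 1" shows "nonneg x \<or> nonneg (\<lambda>v. - x v)"
proof (rule ccontr)
  assume "\<not> ?thesis"
  then obtain u v where uv: "u \<in> I" "x u < 0" "v \<in> I" "x v > 0" by (force simp: nonneg_def)
  define p where "p = (\<lambda>v. max (x v) 0)"
  define m where "m = (\<lambda>v. max (- x v) 0)"
  have x: "x = (\<lambda>v. p v - m v)" by (auto simp: p_def m_def)
  have pm: "euler p m \<le> 0" "euler m p \<le> 0"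
    unfolding euler_def by (auto simp: p_def m_def max_def intro!: sum_nonneg add_nonneg_nonneg simp: sum.neutral split_beta)
  have "euler x x = euler p p + euler m m - euler p m - euler m p"
    unfolding x by (simp add: euler_diff_left euler_diff_right)
  moreover have "euler p p \<ge> 1" using euler_positive[of v p] uv by (auto simp: p_def)
  moreover have "euler m m \<ge> 1" using euler_positive[of u m] uv by (auto simp: m_def)
  ultimately show False using pm assms by linarith
qed

subsection \<open>Orbits of the indecomposable projectives\<close>

text \<open>The candidate for the dimension vector of \<open>\<tau>\<^sup>-\<^sup>k P\<^sub>i\<close>.\<close>

definition beta :: "nat \<Rightarrow> nat \<Rightarrow> nat \<Rightarrow> int" where "beta i k = (cox ^^ k) (pvec i)"

lemma beta_0 [simp]: "beta i 0 = pvec i" by (simp add: beta_def)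
lemma beta_Suc: "beta i (Suc k) = cox (beta i k)" by (simp add: beta_def)

lemma euler_beta_same: "i \<in> I \<Longrightarrow> euler (beta i k) (beta j k) = pvec j i"
  by (induction k) (simp_all add: euler_pvec beta_Suc euler_cox_cox)

lemma euler_beta_Suc: "i \<in> I \<Longrightarrow> euler (beta i k) (beta j (Suc k)) = cox (pvec j) i"
  by (induction k) (simp_all add: euler_pvec beta_Suc euler_cox_cox)

lemma beta_root: "i \<in> I \<Longrightarrow> euler (beta i k) (beta i k) = 1" by (simp add: euler_beta_same)

lemma beta_nonzero: "i \<in> I \<Longrightarrow> \<exists>v\<in>I. beta i k v \<noteq> 0"
proof (rule ccontr)
  assume i: "i \<in> I" and "\<not> (\<exists>v\<in>I. beta i k v \<noteq> 0)"
  then have "euler (beta i k) (beta i k) = euler (\<lambda>_. 0) (\<lambda>_. 0)" by (intro euler_cong) auto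
  then show False using beta_root[OF i, of k] by (simp add: euler_zero_left)
qed

lemma beta_outside: "i \<in> I \<Longrightarrow> v \<notin> I \<Longrightarrow> beta i k v = 0"
  using path_I[of i v] by (cases k) (auto simp: beta_Suc cox_outside pvec_def)

text \<open>A root pairs with every simple root to an integer of absolute value at most \<open>2\<close>, and the symmetrised form is
  nondegenerate.\<close>

lemma finite_roots: "finite {x. (\<forall>v. v \<notin> I \<longrightarrow> x v = 0) \<and> euler x x = 1}" (is "finite ?R")
proof -
  define e where "e = (\<lambda>i v :: nat. of_bool (v = i) :: int)"
  define f where "f = (\<lambda>x. restrict (\<lambda>i. euler x (e i) + euler (e i) x) I)"
  have q: "euler (e i) (e i) = 1" if "i \<in> I" for i
  proof -
    have "(\<Sum>(u, v)\<in>Q. e i u * e i v) = 0" using Q_irrefl by (intro sum.neutral) (auto simp: e_def)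
    moreover have "(\<Sum>v\<in>I. e i v * e i v) = (\<Sum>v\<in>I. if v = i then 1 else 0)"
      by (intro sum.cong) (auto simp: e_def)
    ultimately show ?thesis using that by (simp add: euler_def)
  qed
  have "f x \<in> PiE I (\<lambda>_. {-2..2})" if "x \<in> ?R" for x
  proof -
    have "euler x (e i) + euler (e i) x \<in> {-2..2}" if i: "i \<in> I" for i
      using euler_nonneg[of "\<lambda>v. x v + e i v"] euler_nonneg[of "\<lambda>v. x v - e i v"] q[OF i] \<open>x \<in> ?R\<close>
      by (simp add: euler_add_left euler_add_right euler_diff_left euler_diff_right)
    then show ?thesis by (auto simp: f_def)
  qed
  then have "f ` ?R \<subseteq> PiE I (\<lambda>_. {-2..2})" by blast
  then have "finite (f ` ?R)" by (rule finite_subset) (intro finite_PiE finite_I finite_atLeastAtMost_int)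
  moreover have "inj_on f ?R"
  proof (rule inj_onI)
    fix x y assume x: "x \<in> ?R" and y: "y \<in> ?R" and eq: "f x = f y"
    define z where "z = (\<lambda>v. x v - y v)"
    have ez: "euler z (e i) + euler (e i) z = 0" if "i \<in> I" for i
      using fun_cong[OF eq, of i] that by (simp add: f_def z_def euler_diff_left euler_diff_right)
    have zs: "euler z y' = (\<Sum>i\<in>I. z i * euler (e i) y')" for y'
    proof -
      have "euler z y' = euler (\<lambda>v. \<Sum>i\<in>I. z i * e i v) y'"
        by (intro euler_cong) (auto simp: e_def if_distrib[of "(*) _"] cong: if_cong)
      then show ?thesis by (simp add: euler_sum_left euler_scale_left)
    qed
    have zs': "euler y' z = (\<Sum>i\<in>I. z i * euler y' (e i))" for y'
    proof -
      have "z v = (\<Sum>i\<in>I. z i * e i v)" if "v \<in> I" for v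
        using that by (simp add: e_def if_distrib[of "(*) _"] cong: if_cong)
      then have "euler y' z = euler y' (\<lambda>v. \<Sum>i\<in>I. z i * e i v)" by (intro euler_cong) auto
      also have "\<dots> = (\<Sum>i\<in>I. z i * euler y' (e i))"
        by (simp add: euler_def sum_distrib_left sum_distrib_right right_diff_distrib sum_subtractf
            split_beta mult_ac) (subst sum.swap, subst (3) sum.swap, simp)
      finally show ?thesis .
    qed
    have "2 * euler z z = (\<Sum>i\<in>I. z i * (euler z (e i) + euler (e i) z))"
      unfolding distrib_left sum.distrib zs[of z, symmetric] zs'[of z, symmetric] by simp
    also have "\<dots> = 0" using ez by (intro sum.neutral) auto
    finally have "z v = 0" if "v \<in> I" for v using euler_zero_iff[of z v] that by simp
    then show "x = y" using x y by (auto simp: z_def fun_eq_iff) (metis right_minus_eq)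
  qed
  ultimately show ?thesis by (rule finite_imageD)
qed

text \<open>The orbit of \<open>P\<^sub>i\<close> under the inverse Coxeter transformation consists of roots, so it is periodic. The sum over a period
  is fixed by the transformation, hence isotropic by \<open>euler_cox\<close>, hence \<open>0\<close>.\<close>

lemma beta_not_nonneg: assumes i: "i \<in> I" shows "\<exists>k. \<not> nonneg (beta i k)"
proof (rule ccontr)
  assume "\<not> ?thesis"
  then have nn: "\<And>k v. v \<in> I \<Longrightarrow> beta i k v \<ge> 0" by (auto simp: nonneg_def)
  have "range (beta i) \<subseteq> {x. (\<forall>v. v \<notin> I \<longrightarrow> x v = 0) \<and> euler x x = 1}"
    using beta_root[OF i] beta_outside[OF i] by auto
  then have "finite (range (beta i))" using finite_roots finite_subset by blast
  then have "\<not> inj (beta i)" using finite_imageD infinite_UNIV_nat by blast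
  then obtain a b where ab: "a < b" "beta i a = beta i b"
    unfolding inj_def by (metis linorder_neqE_nat)
  define s where "s = (\<lambda>v. \<Sum>k\<in>{a..<b}. beta i k v)"
  have "cox s = (\<lambda>v. \<Sum>k\<in>{a..<b}. beta i (Suc k) v)"
    unfolding s_def by (simp add: cox_sum beta_Suc)
  also have "\<dots> = s"
  proof
    fix v
    have "(\<Sum>k\<in>{a..<b}. beta i (Suc k) v - beta i k v) = beta i b v - beta i a v"
      using ab by (intro sum_Suc_diff') auto
    then show "(\<Sum>k\<in>{a..<b}. beta i (Suc k) v) = s v" using ab by (simp add: s_def sum_subtractf)
  qed
  finally have "euler s s = - euler s s" using euler_cox[of s s] by simp
  then have "euler s s \<le> 0" by simp
  moreover obtain v where v: "v \<in> I" "beta i a v \<noteq> 0" using beta_nonzero[OF i] by blast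
  ultimately have "s v = 0" using euler_zero_iff by blast
  then have "beta i a v = 0" unfolding s_def using nn[OF v(1)] ab(1) by (subst (asm) sum_nonneg_eq_0_iff) auto
  then show False using v by simp
qed

text \<open>The length of the \<open>\<tau>\<close>-orbit of \<open>P\<^sub>i\<close>: the number of vertices of $G_c$ in column \<open>i\<close>.\<close>

definition orbit_length :: "nat \<Rightarrow> nat" where "orbit_length i = (LEAST k. \<not> nonneg (beta i k))"

lemma orbit_length_nonneg: "k < orbit_length i \<Longrightarrow> nonneg (beta i k)" unfolding orbit_length_def using not_less_Least by blast
lemma orbit_length_not: "i \<in> I \<Longrightarrow> \<not> nonneg (beta i (orbit_length i))"
  unfolding orbit_length_def using beta_not_nonneg by (rule LeastI_ex)
lemma orbit_length_pos: "i \<in> I \<Longrightarrow> orbit_length i > 0"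
  using orbit_length_not[of i] by (cases "orbit_length i") (auto simp: nonneg_def)

text \<open>For \<open>k = 0\<close> this is \<open>pvec_rec_first\<close> transformed by \<open>cox\<close>; then both sides are transported along the
  orbit.\<close>

lemma beta_mesh:
  assumes i: "i \<in> I" and v: "v \<in> I"
  shows "beta i (Suc k) v + beta i k v =
    (\<Sum>j | (j, i) \<in> Q. beta j k v) + (\<Sum>j | (i, j) \<in> Q. beta j (Suc k) v)"
proof -
  have fin: "finite {u. (i, u) \<in> Q}" "finite {u. (u, i) \<in> Q}"
    by (rule finite_subset[of _ I]; use Q_I in auto)+
  have "beta i (Suc k) v + beta i k v =
    (\<Sum>j | (j, i) \<in> Q. beta j k v) + (\<Sum>j | (i, j) \<in> Q. beta j (Suc k) v)" if "v \<in> I" for v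
    using that
  proof (induction k arbitrary: v)
    case 0
    have "cox (pvec i) = cox (\<lambda>v. of_bool (v = i) + (\<Sum>j | (i, j) \<in> Q. pvec j v))"
      by (intro cox_cong pvec_rec_first i)
    also have "\<dots> = (\<lambda>v. cox (\<lambda>v. of_bool (v = i)) v + (\<Sum>j | (i, j) \<in> Q. cox (pvec j) v))"
      by (simp add: cox_add cox_sum fin)
    finally have 1: "cox (pvec i) v = cox (\<lambda>v. of_bool (v = i)) v + (\<Sum>j | (i, j) \<in> Q. cox (pvec j) v)"
      by simp
    have "cox (\<lambda>v. of_bool (v = i)) v = (\<Sum>j | (j, i) \<in> Q. pvec j v) - pvec i v"
    proof -
      have "(\<Sum>u | (u, va) \<in> Q. of_bool (va = i) * pvec u v) = (if va = i then \<Sum>u | (u, i) \<in> Q. pvec u v else 0)" for va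
        by auto
      then have "(\<Sum>(u, va)\<in>Q. of_bool (va = i) * pvec u v) = (\<Sum>j | (j, i) \<in> Q. pvec j v)"
        unfolding sum_into using i by simp
      moreover have "(\<Sum>va\<in>I. of_bool (va = i) * pvec va v) = (\<Sum>va\<in>I. if va = i then pvec va v else 0)"
        by (intro sum.cong) auto
      ultimately show ?thesis using i by (simp add: cox_def)
    qed
    then show ?case using 1 by (simp add: beta_Suc)
  next
    case (Suc k)
    have "cox (\<lambda>v. beta i (Suc k) v + beta i k v) =
      cox (\<lambda>v. (\<Sum>j | (j, i) \<in> Q. beta j k v) + (\<Sum>j | (i, j) \<in> Q. beta j (Suc k) v))"
      using Suc.IH by (intro cox_cong) auto
    then show ?case by (simp add: cox_add cox_sum fin beta_Suc fun_eq_iff)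
  qed
  then show ?thesis using v .
qed

text \<open>Going back along the orbits, one may assume \<open>b = 0\<close>. If \<open>dim P\<^sub>j\<close> were \<open>beta i (k + 1)\<close>, then
  \<open>beta i k\<close> would be \<open>- dim I\<^sub>j\<close>.\<close>

lemma beta_distinct:
  assumes "i \<in> I" "j \<in> I" "a < orbit_length i" "b < orbit_length j" "\<And>v. v \<in> I \<Longrightarrow> beta i a v = beta j b v"
  shows "i = j \<and> a = b"
proof -
  have *: "i = j \<and> a = b"
    if "i \<in> I" "j \<in> I" "a < orbit_length i" "b < orbit_length j" "\<And>v. v \<in> I \<Longrightarrow> beta i a v = beta j b v" "b \<le> a" for i j a b
  proof -
    have red: "\<forall>v\<in>I. beta i (a - b) v = pvec j v"
      using that(5,6)
    proof (induction b arbitrary: a)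
      case 0
      then show ?case by simp
    next
      case (Suc b)
      then obtain a' where a': "a = Suc a'" "b \<le> a'" by (cases a) auto
      then show ?case using Suc.IH[of a'] cox_inj[of "beta i a'" "beta j b"] Suc.prems by (simp add: beta_Suc)
    qed
    show ?thesis
    proof (cases "a - b")
      case 0
      then have "pvec i i = pvec j i" "pvec i j = pvec j j" using red that by auto
      then have "i = j" using path_antisym[of i j] by (simp add: pvec_def)
      then show ?thesis using 0 that by auto
    next
      case (Suc k)
      have nn: "nonneg (beta i k)" using Suc that by (intro orbit_length_nonneg) auto
      have "beta i k v = - pvec v j" if v: "v \<in> I" for v
      proof -
        have "pvec v j = euler (pvec j) (pvec v)" using \<open>j \<in> I\<close> by (simp add: euler_pvec)
        also have "\<dots> = euler (beta i (Suc k)) (pvec v)" using red Suc by (intro euler_cong) auto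
        also have "\<dots> = - beta i k v" using v by (simp add: beta_Suc euler_cox euler_pvec)
        finally show ?thesis by simp
      qed
      then have "\<forall>v\<in>I. beta i k v = 0" using nn
        by (metis nonneg_def pvec_nonneg neg_le_0_iff_le order_antisym)
      then show ?thesis using beta_nonzero[OF \<open>i \<in> I\<close>] by blast
    qed
  qed
  show ?thesis
  proof (cases "b \<le> a")
    case True
    then show ?thesis using *[of i j a b] assms by auto
  next
    case False
    then show ?thesis using *[of j i b a] assms by auto
  qed
qed

end

section \<open>Extensions of representations\<close>

text \<open>The trace of \<open>A B\<close>.\<close>

definition trace_pairing :: "'k::field mat \<Rightarrow> 'k mat \<Rightarrow> 'k" where
  "trace_pairing A B = (\<Sum>i<dim_row B. \<Sum>j<dim_col B. A $$ (j, i) * B $$ (i, j))"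

lemma trace_pairing_carrier:
  "B \<in> carrier_mat p q \<Longrightarrow> trace_pairing A B = (\<Sum>i<p. \<Sum>j<q. A $$ (j, i) * B $$ (i, j))"
  by (auto simp: trace_pairing_def)

lemma mat_mult_entry:
  "A \<in> carrier_mat p q \<Longrightarrow> B \<in> carrier_mat q r \<Longrightarrow> i < p \<Longrightarrow> j < r \<Longrightarrow>
    (A * B) $$ (i, j) = (\<Sum>k<q. A $$ (i, k) * B $$ (k, j))"
  by (auto simp: scalar_prod_def atLeast0LessThan)

lemma trace_pairing_commute:
  assumes "A \<in> carrier_mat q p" "B \<in> carrier_mat p q"
  shows "trace_pairing A B = trace_pairing B A"
  unfolding trace_pairing_carrier[OF assms(1)] trace_pairing_carrier[OF assms(2)]
  by (subst sum.swap) (simp add: mult.commute)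

lemma sum_swap3: "(\<Sum>i\<in>A. \<Sum>j\<in>B. \<Sum>k\<in>C. f i j k) = (\<Sum>k\<in>C. \<Sum>j\<in>B. \<Sum>i\<in>A. f i j k)"
proof -
  have "(\<Sum>i\<in>A. \<Sum>j\<in>B. \<Sum>k\<in>C. f i j k) = (\<Sum>i\<in>A. \<Sum>k\<in>C. \<Sum>j\<in>B. f i j k)"
    by (intro sum.cong refl sum.swap)
  also have "\<dots> = (\<Sum>k\<in>C. \<Sum>i\<in>A. \<Sum>j\<in>B. f i j k)" by (rule sum.swap)
  also have "\<dots> = (\<Sum>k\<in>C. \<Sum>j\<in>B. \<Sum>i\<in>A. f i j k)"
    by (intro sum.cong refl sum.swap)
  finally show ?thesis .
qed

lemma trace_pairing_assoc:
  assumes A: "A \<in> carrier_mat p q" and B: "B \<in> carrier_mat q r" and C: "C \<in> carrier_mat r p"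
  shows "trace_pairing (A * B) C = trace_pairing A (B * C)"
proof -
  have "trace_pairing (A * B) C = (\<Sum>i<r. \<Sum>j<p. \<Sum>k<q. A $$ (j, k) * B $$ (k, i) * C $$ (i, j))"
    unfolding trace_pairing_carrier[OF C]
    by (intro sum.cong refl) (simp add: mat_mult_entry[OF A B] sum_distrib_right)
  also have "\<dots> = (\<Sum>k<q. \<Sum>j<p. \<Sum>i<r. A $$ (j, k) * B $$ (k, i) * C $$ (i, j))"
    by (rule sum_swap3)
  also have "\<dots> = trace_pairing A (B * C)"
    unfolding trace_pairing_carrier[OF mult_carrier_mat[OF B C]]
    by (intro sum.cong refl) (simp add: mat_mult_entry[OF B C] sum_distrib_left mult.assoc)
  finally show ?thesis .
qed

lemma trace_pairing_cyclic:
  assumes U: "U \<in> carrier_mat x t" and P: "P \<in> carrier_mat t m"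
    and E: "E \<in> carrier_mat m s" and H: "H \<in> carrier_mat s x"
  shows "trace_pairing (U * P) (E * H) = trace_pairing (H * U * P) E"
proof -
  have UP: "U * P \<in> carrier_mat x m" and EH: "E * H \<in> carrier_mat m x" using assms by auto
  have "trace_pairing (U * P) (E * H) = trace_pairing (E * H) (U * P)" by (rule trace_pairing_commute[OF UP EH])
  also have "\<dots> = trace_pairing E (H * (U * P))" by (rule trace_pairing_assoc[OF E H UP])
  also have "\<dots> = trace_pairing (H * (U * P)) E" using trace_pairing_commute[OF E mult_carrier_mat[OF H UP]] .
  finally show ?thesis using assoc_mult_mat[OF H U P] by simp
qed

lemma sum_Sigma_row:
  fixes g :: "nat \<Rightarrow> 'k::comm_monoid_add" and a b :: "'v \<Rightarrow> nat"
  assumes "finite S" "v \<in> S" "i0 < a v"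
  shows "(\<Sum>(w, i, j)\<in>Sigma S (\<lambda>w. {..<a w} \<times> {..<b w}). if w = v \<and> i = i0 then g j else 0) = (\<Sum>j<b v. g j)"
proof -
  have "(\<Sum>(w, i, j)\<in>Sigma S (\<lambda>w. {..<a w} \<times> {..<b w}). if w = v \<and> i = i0 then g j else 0) =
      (\<Sum>(w, i, j)\<in>(\<lambda>j. (v, i0, j)) ` {..<b v}. g j)"
    using assms by (intro sum.mono_neutral_cong_right finite_SigmaI) auto
  also have "\<dots> = (\<Sum>j<b v. g j)" by (subst sum.reindex) (auto simp: inj_on_def)
  finally show ?thesis .
qed

lemma sum_Sigma_col:
  fixes g :: "nat \<Rightarrow> 'k::comm_monoid_add" and a b :: "'v \<Rightarrow> nat"
  assumes "finite S" "v \<in> S" "j0 < b v"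
  shows "(\<Sum>(w, i, j)\<in>Sigma S (\<lambda>w. {..<a w} \<times> {..<b w}). if w = v \<and> j = j0 then g i else 0) = (\<Sum>i<a v. g i)"
proof -
  have "(\<Sum>(w, i, j)\<in>Sigma S (\<lambda>w. {..<a w} \<times> {..<b w}). if w = v \<and> j = j0 then g i else 0) =
      (\<Sum>(w, i, j)\<in>(\<lambda>i. (v, i, j0)) ` {..<a v}. g i)"
    using assms by (intro sum.mono_neutral_cong_right finite_SigmaI) auto
  also have "\<dots> = (\<Sum>i<a v. g i)" by (subst sum.reindex) (auto simp: inj_on_def)
  finally show ?thesis .
qed

context dynkin_quiver begin

abbreviation hom :: "'k::field qrep \<Rightarrow> 'k qrep \<Rightarrow> (nat \<Rightarrow> 'k mat) \<Rightarrow> bool" where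
  "hom \<equiv> rep_hom n Q"
abbreviation rep :: "'k::field qrep \<Rightarrow> bool" where "rep \<equiv> is_rep Q"

lemma rep_carrier: "rep M \<Longrightarrow> (u, v) \<in> Q \<Longrightarrow> rmap M (u, v) \<in> carrier_mat (rdim M v) (rdim M u)"
  by (auto simp: is_rep_def)
lemma hom_carrier: "hom M N f \<Longrightarrow> v \<in> I \<Longrightarrow> f v \<in> carrier_mat (rdim N v) (rdim M v)"
  by (auto simp: rep_hom_def I_def)
lemma hom_comm: "hom M N f \<Longrightarrow> (u, v) \<in> Q \<Longrightarrow> f v * rmap M (u, v) = rmap N (u, v) * f u"
  by (auto simp: rep_hom_def)
lemma homI:
  "(\<And>v. v \<in> I \<Longrightarrow> f v \<in> carrier_mat (rdim N v) (rdim M v)) \<Longrightarrow>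
   (\<And>u v. (u, v) \<in> Q \<Longrightarrow> f v * rmap M (u, v) = rmap N (u, v) * f u) \<Longrightarrow> hom M N f"
  by (auto simp: rep_hom_def I_def)

definition dimv :: "'k::field qrep \<Rightarrow> nat \<Rightarrow> int" where "dimv M v = int (rdim M v)"

text \<open>The dual of \<open>Ext(X, M)\<close>: under the trace pairing, the annihilator of the image of
  \<open>(f\<^sub>v) \<mapsto> (f\<^sub>v X\<^sub>a - M\<^sub>a f\<^sub>u)\<close>, \<open>a : u \<rightarrow> v\<close>, whose cokernel is \<open>Ext(X, M)\<close> and whose kernel is \<open>Hom(X, M)\<close>.\<close>

definition ext_dual :: "'k::field qrep \<Rightarrow> 'k qrep \<Rightarrow> (nat \<times> nat \<Rightarrow> 'k mat) \<Rightarrow> bool" where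
  "ext_dual X M \<psi> \<longleftrightarrow>
     (\<forall>(u, v)\<in>Q. \<psi> (u, v) \<in> carrier_mat (rdim X u) (rdim M v)) \<and>
     (\<forall>v\<in>I. \<forall>j<rdim X v. \<forall>i<rdim M v.
        (\<Sum>u | (u, v) \<in> Q. (rmap X (u, v) * \<psi> (u, v)) $$ (j, i)) =
        (\<Sum>w | (v, w) \<in> Q. (\<psi> (v, w) * rmap M (v, w)) $$ (j, i)))"

definition vertex_entries :: "'k::field qrep \<Rightarrow> 'k qrep \<Rightarrow> (nat \<times> nat \<times> nat) set" where
  "vertex_entries X M = Sigma I (\<lambda>v. {..<rdim M v} \<times> {..<rdim X v})"
definition arrow_entries :: "'k::field qrep \<Rightarrow> 'k qrep \<Rightarrow> ((nat \<times> nat) \<times> nat \<times> nat) set" where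
  "arrow_entries X M = Sigma Q (\<lambda>a. {..<rdim M (snd a)} \<times> {..<rdim X (fst a)})"

text \<open>The matrix of the linear map \<open>(f\<^sub>v) \<mapsto> (f\<^sub>v X\<^sub>a - M\<^sub>a f\<^sub>u)\<close> with respect to matrix entries.\<close>

definition coef :: "'k::field qrep \<Rightarrow> 'k qrep \<Rightarrow> (nat \<times> nat) \<times> nat \<times> nat \<Rightarrow> nat \<times> nat \<times> nat \<Rightarrow> 'k" where
  "coef X M t s = (case t of (a, i, j) \<Rightarrow> case s of (w, i', j') \<Rightarrow>
     (if w = snd a \<and> i' = i then rmap X a $$ (j', j) else 0) -
     (if w = fst a \<and> j' = j then rmap M a $$ (i, i') else 0))"

lemma finite_entries [simp]: "finite (vertex_entries X M)" "finite (arrow_entries X M)"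
  by (simp_all add: vertex_entries_def arrow_entries_def)

lemma card_vertex_entries: "int (card (vertex_entries X M)) = (\<Sum>v\<in>I. dimv X v * dimv M v)"
  by (simp add: vertex_entries_def dimv_def mult.commute)
lemma card_arrow_entries: "int (card (arrow_entries X M)) = (\<Sum>(u, v)\<in>Q. dimv X u * dimv M v)"
  by (simp add: arrow_entries_def dimv_def mult.commute split_beta)

lemma card_entries:
  "int (card (arrow_entries X M)) - int (card (vertex_entries X M)) = - euler (dimv X) (dimv M)"
  unfolding card_vertex_entries card_arrow_entries euler_def by simp

lemma coef_column:
  assumes X: "rep X" and M: "rep M" and f: "\<And>v. v \<in> I \<Longrightarrow> f v \<in> carrier_mat (rdim M v) (rdim X v)"
    and a: "(u, v) \<in> Q" "i < rdim M v" "j < rdim X u"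
  shows "(\<Sum>s\<in>vertex_entries X M. coef X M ((u, v), i, j) s * f (fst s) $$ snd s) =
    (f v * rmap X (u, v) - rmap M (u, v) * f u) $$ (i, j)"
proof -
  note ca = rep_carrier[OF X a(1)] rep_carrier[OF M a(1)]
  have uv: "u \<in> I" "v \<in> I" using Q_I a by auto
  have "(\<Sum>s\<in>vertex_entries X M. coef X M ((u, v), i, j) s * f (fst s) $$ snd s) =
    (\<Sum>(w, i', j')\<in>vertex_entries X M. if w = v \<and> i' = i then rmap X (u, v) $$ (j', j) * f v $$ (i, j') else 0) -
    (\<Sum>(w, i', j')\<in>vertex_entries X M. if w = u \<and> j' = j then rmap M (u, v) $$ (i, i') * f u $$ (i', j) else 0)"
    unfolding sum_subtractf[symmetric] by (intro sum.cong) (auto simp: coef_def left_diff_distrib)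
  also have "\<dots> = (\<Sum>j'<rdim X v. rmap X (u, v) $$ (j', j) * f v $$ (i, j')) -
     (\<Sum>i'<rdim M u. rmap M (u, v) $$ (i, i') * f u $$ (i', j))"
    unfolding vertex_entries_def using uv a by (subst sum_Sigma_row, simp_all) (subst sum_Sigma_col, simp_all)
  also have "\<dots> = (f v * rmap X (u, v)) $$ (i, j) - (rmap M (u, v) * f u) $$ (i, j)"
    unfolding mat_mult_entry[OF f[OF uv(2)] ca(1) a(2,3)] mat_mult_entry[OF ca(2) f[OF uv(1)] a(2,3)]
    by (simp add: mult.commute)
  finally show ?thesis using f[OF uv(1)] f[OF uv(2)] ca a by simp
qed

lemma sum_arrow_entries:
  "(\<Sum>((u, v), i, j)\<in>arrow_entries X M. g u v i j) =
    (\<Sum>(u, v)\<in>Q. \<Sum>i<rdim M v. \<Sum>j<rdim X u. g u v i j)"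
  unfolding arrow_entries_def sum.cartesian_product
  by (subst sum.Sigma[symmetric]) (auto simp: split_beta sum.cartesian_product)

lemma coef_row:
  assumes X: "rep X" and M: "rep M"
    and psi: "\<And>u v. (u, v) \<in> Q \<Longrightarrow> \<psi> (u, v) \<in> carrier_mat (rdim X u) (rdim M v)"
    and w: "w \<in> I" "i' < rdim M w" "j' < rdim X w"
  shows "(\<Sum>((u, v), i, j)\<in>arrow_entries X M. \<psi> (u, v) $$ (j, i) * coef X M ((u, v), i, j) (w, i', j')) =
    (\<Sum>u | (u, w) \<in> Q. (rmap X (u, w) * \<psi> (u, w)) $$ (j', i')) -
    (\<Sum>v | (w, v) \<in> Q. (\<psi> (w, v) * rmap M (w, v)) $$ (j', i'))"
proof -
  have "(\<Sum>((u, v), i, j)\<in>arrow_entries X M. \<psi> (u, v) $$ (j, i) * coef X M ((u, v), i, j) (w, i', j')) =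
    (\<Sum>(u, v)\<in>Q. (if v = w then (rmap X (u, w) * \<psi> (u, w)) $$ (j', i') else 0)
       - (if u = w then (\<psi> (w, v) * rmap M (w, v)) $$ (j', i') else 0))"
    unfolding sum_arrow_entries
  proof (intro sum.cong refl, clarify)
    fix u v assume a: "(u, v) \<in> Q"
    note ca = rep_carrier[OF X a] rep_carrier[OF M a] psi[OF a]
    have 1: "(\<Sum>i<rdim M v. \<Sum>j<rdim X u. if w = v \<and> i' = i then \<psi> (u, v) $$ (j, i) * rmap X (u, v) $$ (j', j) else 0)
      = (if v = w then (rmap X (u, w) * \<psi> (u, w)) $$ (j', i') else 0)"
    proof (cases "v = w")
      case True
      have "(\<Sum>i<rdim M v. \<Sum>j<rdim X u. if w = v \<and> i' = i then \<psi> (u, v) $$ (j, i) * rmap X (u, v) $$ (j', j) else 0)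
        = (\<Sum>i<rdim M v. if i = i' then \<Sum>j<rdim X u. \<psi> (u, v) $$ (j, i') * rmap X (u, v) $$ (j', j) else 0)"
        using True by (intro sum.cong) auto
      also have "\<dots> = (rmap X (u, v) * \<psi> (u, v)) $$ (j', i')"
        using True w by (subst mat_mult_entry[OF ca(1) ca(3)]) (auto simp: mult.commute)
      finally show ?thesis using True by simp
    qed auto
    have 2: "(\<Sum>i<rdim M v. \<Sum>j<rdim X u. if w = u \<and> j' = j then \<psi> (u, v) $$ (j, i) * rmap M (u, v) $$ (i, i') else 0)
      = (if u = w then (\<psi> (w, v) * rmap M (w, v)) $$ (j', i') else 0)"
    proof (cases "u = w")
      case True
      have "(\<Sum>i<rdim M v. \<Sum>j<rdim X u. if w = u \<and> j' = j then \<psi> (u, v) $$ (j, i) * rmap M (u, v) $$ (i, i') else 0)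
        = (\<Sum>i<rdim M v. \<psi> (u, v) $$ (j', i) * rmap M (u, v) $$ (i, i'))"
        using True w by (intro sum.cong) auto
      also have "\<dots> = (\<psi> (u, v) * rmap M (u, v)) $$ (j', i')"
        using True w by (subst mat_mult_entry[OF ca(3) ca(2)]) auto
      finally show ?thesis using True by simp
    qed auto
    show "(\<Sum>i<rdim M v. \<Sum>j<rdim X u. \<psi> (u, v) $$ (j, i) * coef X M ((u, v), i, j) (w, i', j')) =
       (if v = w then (rmap X (u, w) * \<psi> (u, w)) $$ (j', i') else 0)
       - (if u = w then (\<psi> (w, v) * rmap M (w, v)) $$ (j', i') else 0)"
      unfolding 1[symmetric] 2[symmetric] sum_subtractf[symmetric]
      by (intro sum.cong refl) (simp add: coef_def right_diff_distrib)
  qed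
  also have "\<dots> = (\<Sum>u | (u, w) \<in> Q. (rmap X (u, w) * \<psi> (u, w)) $$ (j', i')) -
    (\<Sum>v | (w, v) \<in> Q. (\<psi> (w, v) * rmap M (w, v)) $$ (j', i'))"
  proof -
    have "(\<Sum>(u, v)\<in>Q. if v = w then (rmap X (u, w) * \<psi> (u, w)) $$ (j', i') else 0) =
      (\<Sum>v\<in>I. if v = w then (\<Sum>u | (u, w) \<in> Q. (rmap X (u, w) * \<psi> (u, w)) $$ (j', i')) else 0)"
      unfolding sum_into by (intro sum.cong) auto
    moreover have "(\<Sum>(u, v)\<in>Q. if u = w then (\<psi> (w, v) * rmap M (w, v)) $$ (j', i') else 0) =
      (\<Sum>u\<in>I. if u = w then (\<Sum>v | (w, v) \<in> Q. (\<psi> (w, v) * rmap M (w, v)) $$ (j', i')) else 0)"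
      unfolding sum_out by (intro sum.cong) auto
    ultimately show ?thesis using w(1) by (simp add: sum_subtractf split_beta)
  qed
  finally show ?thesis .
qed

lemma ext_dual_carrier:
  "ext_dual X M \<psi> \<Longrightarrow> (u, v) \<in> Q \<Longrightarrow> \<psi> (u, v) \<in> carrier_mat (rdim X u) (rdim M v)"
  by (auto simp: ext_dual_def)

lemma ext_dual_iff_kernel:
  assumes X: "rep X" and M: "rep M"
    and psi: "\<And>u v. (u, v) \<in> Q \<Longrightarrow> \<psi> (u, v) \<in> carrier_mat (rdim X u) (rdim M v)"
  shows "ext_dual X M \<psi> \<longleftrightarrow> (\<forall>s\<in>vertex_entries X M.
    (\<Sum>((u, v), i, j)\<in>arrow_entries X M. \<psi> (u, v) $$ (j, i) * coef X M ((u, v), i, j) s) = 0)"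
  unfolding ext_dual_def vertex_entries_def using psi coef_row[OF X M psi] by fastforce

text \<open>The elements of \<open>ext_dual X M\<close> annihilate the trivial extensions.\<close>

lemma ext_dual_boundary:
  assumes X: "rep X" and M: "rep M" and psi: "ext_dual X M \<psi>"
    and f: "\<And>v. v \<in> I \<Longrightarrow> f v \<in> carrier_mat (rdim M v) (rdim X v)"
  shows "(\<Sum>(u, v)\<in>Q. trace_pairing (\<psi> (u, v)) (f v * rmap X (u, v) - rmap M (u, v) * f u)) = 0"
proof -
  have "(\<Sum>(u, v)\<in>Q. trace_pairing (\<psi> (u, v)) (f v * rmap X (u, v) - rmap M (u, v) * f u)) =
    (\<Sum>((u, v), i, j)\<in>arrow_entries X M. \<psi> (u, v) $$ (j, i) *
       (\<Sum>s\<in>vertex_entries X M. coef X M ((u, v), i, j) s * f (fst s) $$ snd s))"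
    unfolding sum_arrow_entries
  proof (intro sum.cong refl, clarify)
    fix u v assume a: "(u, v) \<in> Q"
    then have "u \<in> I" "v \<in> I" using Q_I by auto
    then have c: "f v * rmap X (u, v) - rmap M (u, v) * f u \<in> carrier_mat (rdim M v) (rdim X u)"
      using f[of u] f[of v] rep_carrier[OF X a] rep_carrier[OF M a] by (intro minus_carrier_mat mult_carrier_mat)
    show "trace_pairing (\<psi> (u, v)) (f v * rmap X (u, v) - rmap M (u, v) * f u) =
      (\<Sum>i<rdim M v. \<Sum>j<rdim X u. \<psi> (u, v) $$ (j, i) *
        (\<Sum>s\<in>vertex_entries X M. coef X M ((u, v), i, j) s * f (fst s) $$ snd s))"
      unfolding trace_pairing_carrier[OF c] by (intro sum.cong refl) (simp add: coef_column[OF X M f a])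
  qed
  also have "\<dots> = (\<Sum>s\<in>vertex_entries X M. f (fst s) $$ snd s *
      (\<Sum>((u, v), i, j)\<in>arrow_entries X M. \<psi> (u, v) $$ (j, i) * coef X M ((u, v), i, j) s))"
    by (simp add: sum_distrib_left split_beta) (subst sum.swap, simp add: mult_ac)
  also have "\<dots> = 0"
    using psi ext_dual_iff_kernel[OF X M ext_dual_carrier[OF psi]] by (intro sum.neutral) auto
  finally show ?thesis .
qed

text \<open>Conversely, by Fredholm's alternative a family annihilated by \<open>ext_dual X M\<close> is a trivial extension class.\<close>

lemma ext_vanishes:
  assumes X: "rep X" and M: "rep M"
    and eta: "\<And>u v. (u, v) \<in> Q \<Longrightarrow> \<eta> (u, v) \<in> carrier_mat (rdim M v) (rdim X u)"
    and orth: "\<And>\<psi>. ext_dual X M \<psi> \<Longrightarrow> (\<Sum>(u, v)\<in>Q. trace_pairing (\<psi> (u, v)) (\<eta> (u, v))) = 0"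
  obtains f where "\<And>v. v \<in> I \<Longrightarrow> f v \<in> carrier_mat (rdim M v) (rdim X v)"
    "\<And>u v. (u, v) \<in> Q \<Longrightarrow> f v * rmap X (u, v) - rmap M (u, v) * f u = \<eta> (u, v)"
proof -
  have "\<exists>x. \<forall>t\<in>arrow_entries X M. (\<Sum>s\<in>vertex_entries X M. coef X M t s * x s) = (case t of (a, ij) \<Rightarrow> \<eta> a $$ ij)"
  proof (rule linear_system_solvable)
    fix y assume y: "\<forall>s\<in>vertex_entries X M. (\<Sum>t\<in>arrow_entries X M. y t * coef X M t s) = 0"
    define \<psi> where "\<psi> = (\<lambda>a. mat (rdim X (fst a)) (rdim M (snd a)) (\<lambda>(j, i). y (a, i, j)))"
    have c: "\<psi> (u, v) \<in> carrier_mat (rdim X u) (rdim M v)" for u v by (simp add: \<psi>_def)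
    have "(\<Sum>((u, v), i, j)\<in>arrow_entries X M. \<psi> (u, v) $$ (j, i) * coef X M ((u, v), i, j) s) =
      (\<Sum>t\<in>arrow_entries X M. y t * coef X M t s)" for s
      by (intro sum.cong) (auto simp: \<psi>_def arrow_entries_def)
    then have "ext_dual X M \<psi>" using y by (subst ext_dual_iff_kernel[OF X M c]) auto
    then have "0 = (\<Sum>(u, v)\<in>Q. trace_pairing (\<psi> (u, v)) (\<eta> (u, v)))" using orth by simp
    also have "\<dots> = (\<Sum>(u, v)\<in>Q. \<Sum>i<rdim M v. \<Sum>j<rdim X u. \<psi> (u, v) $$ (j, i) * \<eta> (u, v) $$ (i, j))"
      using eta by (intro sum.cong) (auto simp: trace_pairing_carrier)
    also have "\<dots> = (\<Sum>((u, v), i, j)\<in>arrow_entries X M. y ((u, v), i, j) * \<eta> (u, v) $$ (i, j))"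
      unfolding sum_arrow_entries by (intro sum.cong refl) (auto simp: \<psi>_def intro!: sum.cong)
    finally show "(\<Sum>t\<in>arrow_entries X M. y t * (case t of (a, ij) \<Rightarrow> \<eta> a $$ ij)) = 0"
      by (simp add: split_beta)
  qed auto
  then obtain x where x: "\<And>t. t \<in> arrow_entries X M \<Longrightarrow>
    (\<Sum>s\<in>vertex_entries X M. coef X M t s * x s) = (case t of (a, ij) \<Rightarrow> \<eta> a $$ ij)" by blast
  define f where "f = (\<lambda>v. mat (rdim M v) (rdim X v) (\<lambda>ij. x (v, ij)))"
  have cf: "f v \<in> carrier_mat (rdim M v) (rdim X v)" for v by (simp add: f_def)
  have "f v * rmap X (u, v) - rmap M (u, v) * f u = \<eta> (u, v)" if a: "(u, v) \<in> Q" for u v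
  proof (rule eq_matI)
    show "dim_row (f v * rmap X (u, v) - rmap M (u, v) * f u) = dim_row (\<eta> (u, v))"
      "dim_col (f v * rmap X (u, v) - rmap M (u, v) * f u) = dim_col (\<eta> (u, v))"
      using eta[OF a] rep_carrier[OF X a] rep_carrier[OF M a] cf[of u] by auto
    fix i j assume "i < dim_row (\<eta> (u, v))" "j < dim_col (\<eta> (u, v))"
    then have ij: "i < rdim M v" "j < rdim X u" using eta[OF a] by auto
    have "(\<Sum>s\<in>vertex_entries X M. coef X M ((u, v), i, j) s * f (fst s) $$ snd s) =
      (\<Sum>s\<in>vertex_entries X M. coef X M ((u, v), i, j) s * x s)"
      by (intro sum.cong) (auto simp: f_def vertex_entries_def)
    then show "(f v * rmap X (u, v) - rmap M (u, v) * f u) $$ (i, j) = \<eta> (u, v) $$ (i, j)"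
      using coef_column[OF X M cf a ij] x[of "((u, v), i, j)"] a ij by (simp add: arrow_entries_def)
  qed
  then show ?thesis using that cf by blast
qed

definition ext_basis :: "'k::field qrep \<Rightarrow> 'k qrep \<Rightarrow> nat \<Rightarrow> (nat \<Rightarrow> nat \<times> nat \<Rightarrow> 'k mat) \<Rightarrow> bool" where
  "ext_basis X M N z \<longleftrightarrow> (\<forall>k<N. ext_dual X M (z k)) \<and>
    (\<forall>\<psi>. ext_dual X M \<psi> \<longrightarrow> (\<exists>c. \<forall>(u, v)\<in>Q. \<forall>j<rdim X u. \<forall>i<rdim M v.
       \<psi> (u, v) $$ (j, i) = (\<Sum>k<N. c k * z k (u, v) $$ (j, i)))) \<and>
    (\<forall>c. (\<forall>(u, v)\<in>Q. \<forall>j<rdim X u. \<forall>i<rdim M v. (\<Sum>k<N. c k * z k (u, v) $$ (j, i)) = 0) \<longrightarrow>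
       (\<forall>k<N. c k = 0))"

text \<open>The linear relations among the equations of \<open>ext_dual X M\<close> are the homomorphisms, read entry by entry.\<close>

lemma left_kernel_hom:
  assumes X: "rep X" and M: "rep M"
    and y: "\<forall>t\<in>arrow_entries X M. (\<Sum>s\<in>vertex_entries X M. y s * coef X M t s) = 0"
  shows "hom X M (\<lambda>v. mat (rdim M v) (rdim X v) (\<lambda>ij. y (v, ij)))"
proof -
  define f where "f = (\<lambda>v. mat (rdim M v) (rdim X v) (\<lambda>ij. y (v, ij)))"
  have cf: "f v \<in> carrier_mat (rdim M v) (rdim X v)" for v by (simp add: f_def)
  have "hom X M f"
  proof (rule homI)
    fix u v assume a: "(u, v) \<in> Q"
    note ca = rep_carrier[OF X a] rep_carrier[OF M a]
    show "f v * rmap X (u, v) = rmap M (u, v) * f u"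
    proof (rule eq_matI)
      show "dim_row (f v * rmap X (u, v)) = dim_row (rmap M (u, v) * f u)"
        "dim_col (f v * rmap X (u, v)) = dim_col (rmap M (u, v) * f u)"
        using ca cf[of u] cf[of v] by auto
      fix i j assume "i < dim_row (rmap M (u, v) * f u)" "j < dim_col (rmap M (u, v) * f u)"
      then have ij: "i < rdim M v" "j < rdim X u" using ca cf[of u] by auto
      have "(\<Sum>s\<in>vertex_entries X M. coef X M ((u, v), i, j) s * f (fst s) $$ snd s) =
        (\<Sum>s\<in>vertex_entries X M. y s * coef X M ((u, v), i, j) s)"
        by (intro sum.cong) (auto simp: f_def vertex_entries_def)
      then have "(f v * rmap X (u, v) - rmap M (u, v) * f u) $$ (i, j) = 0"
        using coef_column[OF X M cf a ij] y a ij by (simp add: arrow_entries_def)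
      then show "(f v * rmap X (u, v)) $$ (i, j) = (rmap M (u, v) * f u) $$ (i, j)"
        using ij ca cf[of u] cf[of v] by simp
    qed
  qed (rule cf)
  then show ?thesis by (simp add: f_def)
qed

definition no_hom :: "'k::field qrep \<Rightarrow> 'k qrep \<Rightarrow> bool" where
  "no_hom X M \<longleftrightarrow> (\<forall>f. hom X M f \<longrightarrow> (\<forall>v\<in>I. f v = 0\<^sub>m (rdim M v) (rdim X v)))"

text \<open>The Euler form is \<open>dim Hom - dim Ext\<close>.\<close>

lemma ext_basis_exists:
  assumes X: "rep X" and M: "rep M" and no_hom: "no_hom X M"
  obtains N z where "int N = - euler (dimv X) (dimv M)" "ext_basis X M N z"
proof -
  let ?V = "vertex_entries X M" and ?A = "arrow_entries X M"
  define N where "N = card ?A - card ?V"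
  have "card ?V \<le> card ?A \<and> (\<exists>z. kernel_basis ?V ?A (\<lambda>s t. coef X M t s) N z)"
    unfolding N_def
  proof (rule kernel_basis_exists, simp, simp, rule ballI)
    fix y s assume y: "\<forall>t\<in>?A. (\<Sum>s\<in>?V. y s * coef X M t s) = 0" and s: "s \<in> ?V"
    obtain v i j where s': "s = (v, i, j)" by (cases s)
    have "mat (rdim M v) (rdim X v) (\<lambda>ij. y (v, ij)) = 0\<^sub>m (rdim M v) (rdim X v)"
      using no_hom left_kernel_hom[OF X M y] s s' by (auto simp: vertex_entries_def no_hom_def)
    then have "mat (rdim M v) (rdim X v) (\<lambda>ij. y (v, ij)) $$ (i, j) = 0\<^sub>m (rdim M v) (rdim X v) $$ (i, j)"
      by simp
    then show "y s = 0" using s s' by (simp add: vertex_entries_def)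
  qed
  then obtain z where le: "card ?V \<le> card ?A" and z: "kernel_basis ?V ?A (\<lambda>s t. coef X M t s) N z" by auto
  define Z where "Z = (\<lambda>k a. mat (rdim X (fst a)) (rdim M (snd a)) (\<lambda>(j, i). z k (a, i, j)))"
  have cZ: "Z k (u, v) \<in> carrier_mat (rdim X u) (rdim M v)" for k u v by (simp add: Z_def)
  have Zz: "Z k (u, v) $$ (j, i) = z k ((u, v), i, j)" if "j < rdim X u" "i < rdim M v" for k u v i j
    using that by (simp add: Z_def)
  have kernel: "ext_dual X M \<psi> \<longleftrightarrow> (\<forall>s\<in>?V. (\<Sum>t\<in>?A. coef X M t s * y t) = 0)"
    if "\<And>u v. (u, v) \<in> Q \<Longrightarrow> \<psi> (u, v) \<in> carrier_mat (rdim X u) (rdim M v)"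
      "\<And>u v i j. (u, v) \<in> Q \<Longrightarrow> j < rdim X u \<Longrightarrow> i < rdim M v \<Longrightarrow> \<psi> (u, v) $$ (j, i) = y ((u, v), i, j)"
    for \<psi> y
  proof -
    have "(\<Sum>((u, v), i, j)\<in>?A. \<psi> (u, v) $$ (j, i) * coef X M ((u, v), i, j) s) =
      (\<Sum>t\<in>?A. coef X M t s * y t)" for s
      using that(2) by (intro sum.cong) (auto simp: arrow_entries_def)
    then show ?thesis using ext_dual_iff_kernel[OF X M that(1)] by simp
  qed
  have "ext_basis X M N Z"
    unfolding ext_basis_def
  proof (intro conjI allI impI)
    fix k assume "k < N"
    then show "ext_dual X M (Z k)"
      using z kernel[of "Z k" "z k", OF cZ Zz] by (auto simp: kernel_basis_def)
  next
    fix \<psi> assume psi: "ext_dual X M \<psi>"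
    define y where "y = (\<lambda>(a, i, j). \<psi> a $$ (j, i))"
    have "\<forall>s\<in>?V. (\<Sum>t\<in>?A. coef X M t s * y t) = 0"
      using kernel[of \<psi> y, OF ext_dual_carrier[OF psi]] psi by (auto simp: y_def)
    then obtain c where "\<forall>t\<in>?A. y t = (\<Sum>k<N. c k * z k t)"
      using z[unfolded kernel_basis_def, THEN conjunct2, THEN conjunct1, THEN spec[of _ y]] by auto
    then show "\<exists>c. \<forall>(u, v)\<in>Q. \<forall>j<rdim X u. \<forall>i<rdim M v.
       \<psi> (u, v) $$ (j, i) = (\<Sum>k<N. c k * Z k (u, v) $$ (j, i))"
      by (intro exI[of _ c]) (force simp: y_def Zz arrow_entries_def)
  next
    fix c k assume c: "\<forall>(u, v)\<in>Q. \<forall>j<rdim X u. \<forall>i<rdim M v. (\<Sum>k<N. c k * Z k (u, v) $$ (j, i)) = 0"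
      and k: "k < N"
    have "\<forall>t\<in>?A. (\<Sum>k<N. c k * z k t) = 0" using c by (force simp: Zz arrow_entries_def)
    then show "c k = 0"
      using z[unfolded kernel_basis_def, THEN conjunct2, THEN conjunct2, THEN spec[of _ c]] k by auto
  qed
  moreover have "int N = - euler (dimv X) (dimv M)"
    using card_entries[of X M] le by (simp add: N_def of_nat_diff)
  ultimately show ?thesis using that by blast
qed

definition brick :: "'k::field qrep \<Rightarrow> bool" where
  "brick M \<longleftrightarrow> rep M \<and> \<not> zero_rep n M \<and> (\<forall>f. hom M M f \<longrightarrow> (\<exists>c. \<forall>v\<in>I. f v = c \<cdot>\<^sub>m 1\<^sub>m (rdim M v)))"

lemma zero_rep_iff: "zero_rep n M \<longleftrightarrow> (\<forall>v\<in>I. rdim M v = 0)"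
  by (simp add: zero_rep_def I_def)

text \<open>\<open>dim Ext(M, M) = dim End M - q(dim M) = 0\<close>. The linear relations among the equations that define
  \<open>ext_dual M M\<close> are the endomorphisms of \<open>M\<close>, that is, the scalars. So the equations other than the one
  at \<open>s0\<close> are independent, and there are as many of them as unknowns.\<close>

lemma brick_rigid:
  assumes M: "brick M" and q: "euler (dimv M) (dimv M) = 1" and psi: "ext_dual M M \<psi>"
    and a: "(u, v) \<in> Q"
  shows "\<psi> (u, v) = 0\<^sub>m (rdim M u) (rdim M v)"
proof -
  have rM: "rep M" using M by (simp add: brick_def)
  let ?V = "vertex_entries M M" and ?A = "arrow_entries M M"
  obtain w where w: "w \<in> I" "rdim M w \<noteq> 0" using M by (auto simp: brick_def zero_rep_iff)
  define s0 where "s0 = (w, 0::nat, 0::nat)"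
  have s0: "s0 \<in> ?V" using w by (simp add: s0_def vertex_entries_def)
  have cV: "Suc (card (?V - {s0})) = card ?V" using s0 by (simp only: card_Suc_Diff1[OF finite_entries(1)])
  have "card (?V - {s0}) \<le> card ?A \<and> (\<exists>z. kernel_basis (?V - {s0}) ?A (\<lambda>s t. coef M M t s) (card ?A - card (?V - {s0})) z)"
  proof (rule kernel_basis_exists, simp, simp, rule ballI)
    fix y s assume y: "\<forall>t\<in>?A. (\<Sum>s\<in>?V - {s0}. y s * coef M M t s) = 0" and s: "s \<in> ?V - {s0}"
    define y' where "y' = y(s0 := 0)"
    have "(\<Sum>s\<in>?V. y' s * coef M M t s) = (\<Sum>s\<in>?V - {s0}. y s * coef M M t s)" for t
      by (rule sum.mono_neutral_cong_right) (auto simp: y'_def)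
    then have "hom M M (\<lambda>v. mat (rdim M v) (rdim M v) (\<lambda>ij. y' (v, ij)))"
      using y by (intro left_kernel_hom rM) auto
    then obtain c where c: "\<And>v. v \<in> I \<Longrightarrow> mat (rdim M v) (rdim M v) (\<lambda>ij. y' (v, ij)) = c \<cdot>\<^sub>m 1\<^sub>m (rdim M v)"
      using M unfolding brick_def by blast
    have e: "y' (v, i, j) = (if i = j then c else 0)" if "v \<in> I" "i < rdim M v" "j < rdim M v" for v i j
      using arg_cong[OF c[OF that(1)], of "\<lambda>m. m $$ (i, j)"] that by simp
    have "c = 0" using e[of w 0 0] w by (simp add: y'_def s0_def)
    then have "y' s = 0" using s e by (auto simp: vertex_entries_def)
    then show "y s = 0" using s by (simp add: y'_def)
  qed
  moreover have "card ?A = card (?V - {s0})"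
    using card_entries[of M M] q cV by simp
  ultimately obtain z where z: "kernel_basis (?V - {s0}) ?A (\<lambda>s t. coef M M t s) 0 z" by auto
  define y where "y = (\<lambda>(a, i, j). \<psi> a $$ (j, i))"
  have "\<forall>s\<in>?V. (\<Sum>((u, v), i, j)\<in>?A. \<psi> (u, v) $$ (j, i) * coef M M ((u, v), i, j) s) = 0"
    using psi ext_dual_iff_kernel[OF rM rM ext_dual_carrier[OF psi]] by simp
  then have "\<forall>s\<in>?V - {s0}. (\<Sum>t\<in>?A. coef M M t s * y t) = 0"
    by (auto simp: y_def split_beta mult.commute)
  then have "\<forall>t\<in>?A. y t = 0"
    using z[unfolded kernel_basis_def, THEN conjunct2, THEN conjunct1, THEN spec[of _ y]] by auto
  then show ?thesis using ext_dual_carrier[OF psi a] a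
    by (intro eq_matI) (auto simp: y_def arrow_entries_def)
qed

end

section \<open>The inverse translate as a universal object\<close>

lemma left_inverse_dim_le:
  fixes A B :: "'k::field mat"
  assumes A: "A \<in> carrier_mat p q" and B: "B \<in> carrier_mat q p" and AB: "A * B = 1\<^sub>m p"
  shows "p \<le> q"
proof -
  have "card {..<p} \<le> card {..<q} \<and> (\<exists>z. kernel_basis {..<p} {..<q} (\<lambda>i j. A $$ (i, j)) (card {..<q} - card {..<p}) z)"
  proof (rule kernel_basis_exists, simp, simp, rule ballI)
    fix y e assume y: "\<forall>u\<in>{..<q}. (\<Sum>e<p. y e * A $$ (e, u)) = 0" and e: "e \<in> {..<p}"
    have "0 = (\<Sum>u<q. (\<Sum>e<p. y e * A $$ (e, u)) * B $$ (u, e))" using y by simp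
    also have "\<dots> = (\<Sum>i<p. y i * (A * B) $$ (i, e))"
      unfolding sum_distrib_right
      by (subst sum.swap, intro sum.cong refl)
        (use e in \<open>simp add: mat_mult_entry[OF A B] sum_distrib_left mult.assoc\<close>)
    also have "\<dots> = (\<Sum>i<p. if i = e then y i else 0)"
      unfolding AB using e by (intro sum.cong) auto
    finally show "y e = 0" using e by simp
  qed
  then show ?thesis by simp
qed

context dynkin_quiver begin

text \<open>The action \<open>\<rho> w v\<close> on \<open>X\<close> of the path from \<open>v\<close> to \<open>w\<close>.\<close>

definition path_mats :: "'k::field qrep \<Rightarrow> (nat \<Rightarrow> nat \<Rightarrow> 'k mat) \<Rightarrow> bool" where
  "path_mats X \<rho> \<longleftrightarrow> (\<forall>w\<in>I. \<rho> w w = 1\<^sub>m (rdim X w)) \<and>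
     (\<forall>w\<in>I. \<forall>v. (v, w) \<in> Q\<^sup>* \<longrightarrow> \<rho> w v \<in> carrier_mat (rdim X w) (rdim X v)) \<and>
     (\<forall>w\<in>I. \<forall>u v. (u, v) \<in> Q \<longrightarrow> (v, w) \<in> Q\<^sup>* \<longrightarrow> \<rho> w u = \<rho> w v * rmap X (u, v))"

text \<open>There is at most one path between two vertices, so the matrices can be chosen by recursion on the height of the
  starting point.\<close>

lemma path_mats_exist:
  assumes X: "rep X" obtains \<rho> where "path_mats X \<rho>"
proof -
  define \<Phi> where "\<Phi> = (\<lambda>w P. P w = 1\<^sub>m (rdim X w) \<and> (\<forall>v. (v, w) \<in> Q\<^sup>* \<longrightarrow> P v \<in> carrier_mat (rdim X w) (rdim X v)) \<and>
     (\<forall>u v. (u, v) \<in> Q \<longrightarrow> (v, w) \<in> Q\<^sup>* \<longrightarrow> l u \<le> Max (l ` I) \<longrightarrow> P u = P v * rmap X (u, v)))"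
  have "\<exists>P. P w = 1\<^sub>m (rdim X w) \<and> (\<forall>v. (v, w) \<in> Q\<^sup>* \<longrightarrow> P v \<in> carrier_mat (rdim X w) (rdim X v)) \<and>
     (\<forall>u v. (u, v) \<in> Q \<longrightarrow> (v, w) \<in> Q\<^sup>* \<longrightarrow> l u \<le> h \<longrightarrow> P u = P v * rmap X (u, v))" for w h
  proof (induction h)
    case 0
    show ?case using height
      by (intro exI[of _ "\<lambda>v. if v = w then 1\<^sub>m (rdim X w) else 0\<^sub>m (rdim X w) (rdim X v)"]) auto
  next
    case (Suc h)
    then obtain P where P: "P w = 1\<^sub>m (rdim X w)"
      "\<And>v. (v, w) \<in> Q\<^sup>* \<Longrightarrow> P v \<in> carrier_mat (rdim X w) (rdim X v)"
      "\<And>u v. (u, v) \<in> Q \<Longrightarrow> (v, w) \<in> Q\<^sup>* \<Longrightarrow> l u \<le> h \<Longrightarrow> P u = P v * rmap X (u, v)" by blast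
    define nx where "nx = (\<lambda>u. SOME v. (u, v) \<in> Q \<and> (v, w) \<in> Q\<^sup>*)"
    have nx: "nx u = v" if "(u, v) \<in> Q" "(v, w) \<in> Q\<^sup>*" for u v
      unfolding nx_def using that next_unique by (intro some_equality) auto
    define P' where "P' = (\<lambda>u. if l u = Suc h \<and> (\<exists>v. (u, v) \<in> Q \<and> (v, w) \<in> Q\<^sup>*)
        then P (nx u) * rmap X (u, nx u) else P u)"
    have new: "P' u = P v * rmap X (u, v)" if "(u, v) \<in> Q" "(v, w) \<in> Q\<^sup>*" "l u = Suc h" for u v
      using nx[OF that(1,2)] that by (auto simp: P'_def)
    have old: "P' u = P u" if "l u \<le> h" for u using that by (auto simp: P'_def)
    have "P' w = 1\<^sub>m (rdim X w)"
      using P(1) arrow_not_back[of w] by (auto simp: P'_def)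
    moreover have "P' v \<in> carrier_mat (rdim X w) (rdim X v)" if v: "(v, w) \<in> Q\<^sup>*" for v
    proof (cases "l v = Suc h \<and> (\<exists>x. (v, x) \<in> Q \<and> (x, w) \<in> Q\<^sup>*)")
      case True
      then obtain x where x: "(v, x) \<in> Q" "(x, w) \<in> Q\<^sup>*" by blast
      show ?thesis using new[OF x] True P(2)[OF x(2)] rep_carrier[OF X x(1)] by auto
    next
      case False
      then show ?thesis using P(2)[OF v] unfolding P'_def by (simp only: if_False)
    qed
    moreover have "P' u = P' v * rmap X (u, v)" if uv: "(u, v) \<in> Q" "(v, w) \<in> Q\<^sup>*" "l u \<le> Suc h" for u v
    proof (cases "l u = Suc h")
      case True
      then show ?thesis using new[OF uv(1,2)] old[of v] height[OF uv(1)] by simp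
    next
      case False
      then show ?thesis using old[of u] old[of v] height[OF uv(1)] P(3)[OF uv(1,2)] uv by simp
    qed
    ultimately show ?case by blast
  qed
  then have "\<exists>P. \<Phi> w P" for w unfolding \<Phi>_def by blast
  then have "\<forall>w. \<exists>P. \<Phi> w P" by blast
  from choice[OF this] obtain P' where "\<forall>w. \<Phi> w (P' w)" by (rule exE)
  then obtain P where P: "\<And>w. P w w = 1\<^sub>m (rdim X w)"
    "\<And>w v. (v, w) \<in> Q\<^sup>* \<Longrightarrow> P w v \<in> carrier_mat (rdim X w) (rdim X v)"
    "\<And>w u v. (u, v) \<in> Q \<Longrightarrow> (v, w) \<in> Q\<^sup>* \<Longrightarrow> l u \<le> Max (l ` I) \<Longrightarrow> P w u = P w v * rmap X (u, v)"
    unfolding \<Phi>_def by blast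
  have "l u \<le> Max (l ` I)" if "(u, v) \<in> Q" for u v using Q_I[OF that] by (intro Max_ge) auto
  then have "path_mats X P" unfolding path_mats_def using P by blast
  then show ?thesis using that by blast
qed

lemma path_mats_carrier:
  "path_mats X \<rho> \<Longrightarrow> w \<in> I \<Longrightarrow> (v, w) \<in> Q\<^sup>* \<Longrightarrow> \<rho> w v \<in> carrier_mat (rdim X w) (rdim X v)"
  by (auto simp: path_mats_def)

lemma path_mats_last:
  assumes X: "rep X" and P: "path_mats X \<rho>" and w: "(w, w') \<in> Q" and u: "(u, w) \<in> Q\<^sup>*"
  shows "\<rho> w' u = rmap X (w, w') * \<rho> w u"
  using u
proof (induction rule: converse_rtrancl_induct)
  case base
  have "\<rho> w' w = \<rho> w' w' * rmap X (w, w')" using P w Q_I unfolding path_mats_def by blast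
  moreover have "\<rho> w' w' = 1\<^sub>m (rdim X w')" "\<rho> w w = 1\<^sub>m (rdim X w)"
    using P Q_I[OF w] unfolding path_mats_def by auto
  ultimately show ?case using rep_carrier[OF X w] by simp
next
  case (step u v)
  have vw': "(v, w') \<in> Q\<^sup>*" using step w by auto
  have "\<rho> w' u = \<rho> w' v * rmap X (u, v)" "\<rho> w u = \<rho> w v * rmap X (u, v)"
    using P step vw' Q_I[OF w] unfolding path_mats_def by auto
  then show ?case using step.IH rep_carrier[OF X w] rep_carrier[OF X step(1)]
      path_mats_carrier[OF P _ step(2)] Q_I[OF w] by (simp add: assoc_mult_mat[of _ "rdim X w'" "rdim X w" _ "rdim X v" _ "rdim X u"])
qed

lemma path_mats_hom:
  assumes X: "rep X" and Y: "rep Y" and P: "path_mats X \<rho>" and R: "path_mats Y \<rho>'" and h: "hom X Y h"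
    and w: "w \<in> I" and v: "(v, w) \<in> Q\<^sup>*"
  shows "h w * \<rho> w v = \<rho>' w v * h v"
  using v
proof (induction rule: converse_rtrancl_induct)
  case base
  then show ?case using P R w hom_carrier[OF h w] unfolding path_mats_def by simp
next
  case (step u v)
  have I: "u \<in> I" "v \<in> I" using Q_I[OF step(1)] by auto
  note c = hom_carrier[OF h w] hom_carrier[OF h I(1)] hom_carrier[OF h I(2)]
    path_mats_carrier[OF P w step(2)] path_mats_carrier[OF R w step(2)]
    rep_carrier[OF X step(1)] rep_carrier[OF Y step(1)]
  have "\<rho> w u = \<rho> w v * rmap X (u, v)" "\<rho>' w u = \<rho>' w v * rmap Y (u, v)"
    using P R step w unfolding path_mats_def by auto
  then have "h w * \<rho> w u = (h w * \<rho> w v) * rmap X (u, v)"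
    using c by simp
  also have "\<dots> = \<rho>' w v * (h v * rmap X (u, v))" unfolding step.IH using c by simp
  also have "\<dots> = \<rho>' w u * h u"
    unfolding hom_comm[OF h step(1)] \<open>\<rho>' w u = _\<close> using c by simp
  finally show ?case .
qed

definition inj_rep :: "nat \<Rightarrow> 'k::field qrep" where
  "inj_rep w = \<lparr>rdim = (\<lambda>v. if (v, w) \<in> Q\<^sup>* then 1 else 0),
     rmap = (\<lambda>(a, b). if (b, w) \<in> Q\<^sup>* then 1\<^sub>m 1 else 0\<^sub>m 0 (if (a, w) \<in> Q\<^sup>* then 1 else 0))\<rparr>"

lemma inj_rep_dim [simp]: "rdim (inj_rep w) v = (if (v, w) \<in> Q\<^sup>* then 1 else 0)"
  by (simp add: inj_rep_def)
lemma inj_rep_map [simp]: "rmap (inj_rep w) (a, b) =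
   (if (b, w) \<in> Q\<^sup>* then 1\<^sub>m 1 else 0\<^sub>m 0 (if (a, w) \<in> Q\<^sup>* then 1 else 0))"
  by (simp add: inj_rep_def)
lemma rep_inj_rep: "rep (inj_rep w)"
  by (auto simp: is_rep_def intro: converse_rtrancl_into_rtrancl)
lemma dimv_inj_rep: "dimv (inj_rep w) v = pvec v w" by (simp add: dimv_def pvec_def)

text \<open>A family of \<open>r\<close> elements of the dual of \<open>Ext(I\<^sub>w, M)\<close>, written as the \<open>r\<close> rows of \<open>\<Theta>\<close>; the space of
  \<open>I\<^sub>w\<close> at \<open>a\<close> has dimension \<open>1\<close> or \<open>0\<close>.\<close>

definition dual_family ::
    "'k::field qrep \<Rightarrow> nat \<Rightarrow> nat \<Rightarrow> (nat \<times> nat \<Rightarrow> 'k mat) \<Rightarrow> bool" where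
  "dual_family M w r \<Theta> \<longleftrightarrow>
    (\<forall>(a, b)\<in>Q. (a, w) \<in> Q\<^sup>* \<longrightarrow> \<Theta> (a, b) \<in> carrier_mat r (rdim M b)) \<and>
    (\<forall>v. (v, w) \<in> Q\<^sup>* \<longrightarrow> (\<forall>p<r. \<forall>k<rdim M v.
       (\<Sum>u | (u, v) \<in> Q. \<Theta> (u, v) $$ (p, k)) = (\<Sum>b | (v, b) \<in> Q. (\<Theta> (v, b) * rmap M (v, b)) $$ (p, k))))"

lemma dual_family_row:
  assumes M: "rep M" and w: "w \<in> I" and T: "dual_family M w r \<Theta>" and p: "p < r"
  shows "ext_dual (inj_rep w) M (\<lambda>(a, b). mat (if (a, w) \<in> Q\<^sup>* then 1 else 0) (rdim M b) (\<lambda>(_, k). \<Theta> (a, b) $$ (p, k)))"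
    (is "ext_dual _ _ ?\<psi>")
  unfolding ext_dual_def
proof (intro conjI ballI allI impI)
  fix a assume "a \<in> Q"
  then show "case a of (u, v) \<Rightarrow> ?\<psi> (u, v) \<in> carrier_mat (rdim (inj_rep w) u) (rdim M v)" by auto
next
  fix v j i assume v: "v \<in> I" and j: "j < rdim (inj_rep w) v" and i: "i < rdim M v"
  then have vw: "(v, w) \<in> Q\<^sup>*" and j0: "j = 0" by (auto split: if_splits)
  have "(\<Sum>u | (u, v) \<in> Q. (rmap (inj_rep w) (u, v) * ?\<psi> (u, v)) $$ (j, i)) = (\<Sum>u | (u, v) \<in> Q. \<Theta> (u, v) $$ (p, i))"
  proof (intro sum.cong refl)
    fix u assume "u \<in> {u. (u, v) \<in> Q}"
    then have "(u, w) \<in> Q\<^sup>*" using vw by (auto intro: converse_rtrancl_into_rtrancl)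
    then show "(rmap (inj_rep w) (u, v) * ?\<psi> (u, v)) $$ (j, i) = \<Theta> (u, v) $$ (p, i)"
      using vw i j0 by (simp add: left_mult_one_mat[of _ 1 "rdim M v"])
  qed
  also have "\<dots> = (\<Sum>b | (v, b) \<in> Q. (\<Theta> (v, b) * rmap M (v, b)) $$ (p, i))"
    using T vw p i unfolding dual_family_def by blast
  also have "\<dots> = (\<Sum>b | (v, b) \<in> Q. (?\<psi> (v, b) * rmap M (v, b)) $$ (j, i))"
  proof (intro sum.cong refl)
    fix b assume "b \<in> {b. (v, b) \<in> Q}"
    then have b: "(v, b) \<in> Q" by simp
    have c: "\<Theta> (v, b) \<in> carrier_mat r (rdim M b)" using T vw b unfolding dual_family_def by auto
    have c': "?\<psi> (v, b) \<in> carrier_mat 1 (rdim M b)" using vw by simp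
    show "(\<Theta> (v, b) * rmap M (v, b)) $$ (p, i) = (?\<psi> (v, b) * rmap M (v, b)) $$ (j, i)"
      using mat_mult_entry[OF c rep_carrier[OF M b] p i] mat_mult_entry[OF c' rep_carrier[OF M b], of j i] vw j0 i
      by simp
  qed
  finally show "(\<Sum>u | (u, v) \<in> Q. (rmap (inj_rep w) (u, v) * ?\<psi> (u, v)) $$ (j, i)) =
      (\<Sum>b | (v, b) \<in> Q. (?\<psi> (v, b) * rmap M (v, b)) $$ (j, i))" .
qed

text \<open>The family \<open>\<Psi>\<close> is a basis of the dual of \<open>Ext(inj_rep w, M)\<close>, written as rows; the dual of this
  space is the space at \<open>w\<close> of the inverse translate of \<open>M\<close>.\<close>

definition universal_family ::
    "'k::field qrep \<Rightarrow> nat \<Rightarrow> nat \<Rightarrow> (nat \<times> nat \<Rightarrow> 'k mat) \<Rightarrow> bool" where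
  "universal_family M w N \<Psi> \<longleftrightarrow> dual_family M w N \<Psi> \<and>
     (\<forall>r \<Theta>. dual_family M w r \<Theta> \<longrightarrow>
        (\<exists>A\<in>carrier_mat r N. \<forall>(a, b)\<in>Q. (a, w) \<in> Q\<^sup>* \<longrightarrow> \<Theta> (a, b) = A * \<Psi> (a, b))) \<and>
     (\<forall>r. \<forall>A\<in>carrier_mat r N. \<forall>B\<in>carrier_mat r N.
        (\<forall>(a, b)\<in>Q. (a, w) \<in> Q\<^sup>* \<longrightarrow> A * \<Psi> (a, b) = B * \<Psi> (a, b)) \<longrightarrow> A = B)"

text \<open>A basis exists by \<open>ext_basis_exists\<close>, and its size is
  \<open>- \<langle>dim I\<^sub>w, dim M\<rangle> = \<langle>cox(dim M), dim I\<^sub>w\<rangle> = cox(dim M)(w)\<close>.\<close>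

lemma universal_family_exists:
  fixes M :: "'k::field qrep"
  assumes M: "rep M" and w: "w \<in> I" and no_hom: "no_hom (inj_rep w) M"
  obtains N \<Psi> where "int N = cox (dimv M) w" "universal_family M w N \<Psi>"
proof -
  obtain N z where N: "int N = - euler (dimv (inj_rep w :: 'k qrep)) (dimv M)" and z: "ext_basis (inj_rep w) M N z"
    by (rule ext_basis_exists[OF rep_inj_rep M no_hom])
  have "int N = euler (cox (dimv M)) (\<lambda>v. pvec v w)"
    unfolding N euler_cox by (simp add: dimv_inj_rep cong: euler_cong)
  then have Nc: "int N = cox (dimv M) w" using euler_ivec[OF w] by simp
  define \<Psi> where "\<Psi> = (\<lambda>(a, b). mat N (rdim M b) (\<lambda>(j, k). z j (a, b) $$ (0, k)))"
  have cPsi: "\<Psi> (a, b) \<in> carrier_mat N (rdim M b)" for a b by (simp add: \<Psi>_def)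
  have Psi_entry: "\<Psi> (a, b) $$ (j, k) = z j (a, b) $$ (0, k)" if "j < N" "k < rdim M b" for a b j k
    using that by (simp add: \<Psi>_def)
  have zd: "ext_dual (inj_rep w) M (z j)" if "j < N" for j using z that by (simp add: ext_basis_def)
  have dual: "dual_family M w N \<Psi>"
    unfolding dual_family_def
  proof (intro conjI allI impI ballI)
    fix a assume "a \<in> Q"
    then show "case a of (a, b) \<Rightarrow> (a, w) \<in> Q\<^sup>* \<longrightarrow> \<Psi> (a, b) \<in> carrier_mat N (rdim M b)" using cPsi by auto
  next
    fix v p k assume vw: "(v, w) \<in> Q\<^sup>*" and p: "p < N" and k: "k < rdim M v"
    have v: "v \<in> I" using path_I[OF vw] w by simp
    have "(\<Sum>u | (u, v) \<in> Q. \<Psi> (u, v) $$ (p, k)) = (\<Sum>u | (u, v) \<in> Q. (rmap (inj_rep w) (u, v) * z p (u, v)) $$ (0, k))"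
    proof (intro sum.cong refl)
      fix u assume "u \<in> {u. (u, v) \<in> Q}"
      then have u: "(u, v) \<in> Q" by simp
      then have "(u, w) \<in> Q\<^sup>*" using vw by (auto intro: converse_rtrancl_into_rtrancl)
      then have "z p (u, v) \<in> carrier_mat 1 (rdim M v)" using ext_dual_carrier[OF zd[OF p] u] by simp
      then show "\<Psi> (u, v) $$ (p, k) = (rmap (inj_rep w) (u, v) * z p (u, v)) $$ (0, k)"
        using vw Psi_entry[OF p k] by simp
    qed
    also have "\<dots> = (\<Sum>b | (v, b) \<in> Q. (z p (v, b) * rmap M (v, b)) $$ (0, k))"
      using zd[OF p, unfolded ext_dual_def, THEN conjunct2, THEN bspec, OF v, THEN spec[of _ 0]] vw k
      by (simp del: inj_rep_map)
    also have "\<dots> = (\<Sum>b | (v, b) \<in> Q. (\<Psi> (v, b) * rmap M (v, b)) $$ (p, k))"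
    proof (intro sum.cong refl)
      fix b assume "b \<in> {b. (v, b) \<in> Q}"
      then have b: "(v, b) \<in> Q" by simp
      have c: "z p (v, b) \<in> carrier_mat 1 (rdim M b)" using ext_dual_carrier[OF zd[OF p] b] vw by simp
      show "(z p (v, b) * rmap M (v, b)) $$ (0, k) = (\<Psi> (v, b) * rmap M (v, b)) $$ (p, k)"
        using mat_mult_entry[OF c rep_carrier[OF M b], of 0 k] mat_mult_entry[OF cPsi rep_carrier[OF M b] p k] k
          Psi_entry[OF p] by simp
    qed
    finally show "(\<Sum>u | (u, v) \<in> Q. \<Psi> (u, v) $$ (p, k)) = (\<Sum>b | (v, b) \<in> Q. (\<Psi> (v, b) * rmap M (v, b)) $$ (p, k))" .
  qed
  have "\<exists>A\<in>carrier_mat r N. \<forall>(a, b)\<in>Q. (a, w) \<in> Q\<^sup>* \<longrightarrow> \<Theta> (a, b) = A * \<Psi> (a, b)"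
    if T: "dual_family M w r \<Theta>" for r \<Theta>
  proof -
    have "\<exists>c. \<forall>a b k. (a, b) \<in> Q \<longrightarrow> (a, w) \<in> Q\<^sup>* \<longrightarrow> k < rdim M b \<longrightarrow>
        \<Theta> (a, b) $$ (p, k) = (\<Sum>j<N. c j * z j (a, b) $$ (0, k))" if p: "p < r" for p
    proof -
      obtain c where c: "\<forall>(u, v)\<in>Q. \<forall>j<rdim (inj_rep w :: 'k qrep) u. \<forall>i<rdim M v.
         (case (u, v) of (a, b) \<Rightarrow> mat (if (a, w) \<in> Q\<^sup>* then 1 else 0) (rdim M b) (\<lambda>(_, k). \<Theta> (a, b) $$ (p, k))) $$ (j, i)
           = (\<Sum>k<N. c k * z k (u, v) $$ (j, i))"
        using z[unfolded ext_basis_def, THEN conjunct2, THEN conjunct1, THEN spec, THEN mp, OF dual_family_row[OF M w T p]]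
        by (rule exE)
      have "\<Theta> (a, b) $$ (p, k) = (\<Sum>j<N. c j * z j (a, b) $$ (0, k))"
        if "(a, b) \<in> Q" "(a, w) \<in> Q\<^sup>*" "k < rdim M b" for a b k
        using bspec[OF c that(1)] that(2,3) by simp
      then show ?thesis by blast
    qed
    then have "\<exists>c. \<forall>p<r. \<forall>a b k. (a, b) \<in> Q \<longrightarrow> (a, w) \<in> Q\<^sup>* \<longrightarrow> k < rdim M b \<longrightarrow>
        \<Theta> (a, b) $$ (p, k) = (\<Sum>j<N. c p j * z j (a, b) $$ (0, k))"
      by (intro choice_iff'[THEN iffD1] allI impI)
    then obtain c where c: "\<And>p a b k. p < r \<Longrightarrow> (a, b) \<in> Q \<Longrightarrow> (a, w) \<in> Q\<^sup>* \<Longrightarrow> k < rdim M b \<Longrightarrow>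
        \<Theta> (a, b) $$ (p, k) = (\<Sum>j<N. c p j * z j (a, b) $$ (0, k))" by blast
    define A where "A = mat r N (\<lambda>(p, j). c p j)"
    have cA: "A \<in> carrier_mat r N" by (simp add: A_def)
    have "\<Theta> (a, b) = A * \<Psi> (a, b)" if ab: "(a, b) \<in> Q" "(a, w) \<in> Q\<^sup>*" for a b
    proof -
      have cT: "\<Theta> (a, b) \<in> carrier_mat r (rdim M b)" using T ab unfolding dual_family_def by auto
      show ?thesis
      proof (rule eq_matI)
        fix p k assume "p < dim_row (A * \<Psi> (a, b))" "k < dim_col (A * \<Psi> (a, b))"
        then have p: "p < r" and k: "k < rdim M b" using cA cPsi[of a b] by auto
        show "\<Theta> (a, b) $$ (p, k) = (A * \<Psi> (a, b)) $$ (p, k)"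
          using mat_mult_entry[OF cA cPsi p k] c[OF p ab k] p Psi_entry[OF _ k] by (simp add: A_def)
      qed (use cT cA cPsi[of a b] in auto)
    qed
    then show ?thesis using cA by blast
  qed
  moreover have "A = B" if A: "A \<in> carrier_mat r N" and B: "B \<in> carrier_mat r N"
      and eq: "\<forall>(a, b)\<in>Q. (a, w) \<in> Q\<^sup>* \<longrightarrow> A * \<Psi> (a, b) = B * \<Psi> (a, b)" for r A B
  proof (rule eq_matI)
    fix p j assume "p < dim_row B" "j < dim_col B"
    then have p: "p < r" and j: "j < N" using B by auto
    have "\<forall>(u, v)\<in>Q. \<forall>j<rdim (inj_rep w) u. \<forall>i<rdim M v.
        (\<Sum>k<N. (A $$ (p, k) - B $$ (p, k)) * z k (u, v) $$ (j, i)) = 0"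
    proof (clarify)
      fix u v j i assume uv: "(u, v) \<in> Q" and j: "j < rdim (inj_rep w) u" and i: "i < rdim M v"
      have uw: "(u, w) \<in> Q\<^sup>*" and j0: "j = 0" using j by (auto split: if_splits)
      have "(A * \<Psi> (u, v)) $$ (p, i) = (B * \<Psi> (u, v)) $$ (p, i)" using eq uv uw by auto
      then show "(\<Sum>k<N. (A $$ (p, k) - B $$ (p, k)) * z k (u, v) $$ (j, i)) = 0"
        unfolding mat_mult_entry[OF A cPsi p i] mat_mult_entry[OF B cPsi p i]
        using j0 Psi_entry[OF _ i] by (simp add: left_diff_distrib sum_subtractf)
    qed
    then have "\<forall>k<N. A $$ (p, k) - B $$ (p, k) = 0"
      using z[unfolded ext_basis_def, THEN conjunct2, THEN conjunct2, THEN spec[of _ "\<lambda>k. A $$ (p, k) - B $$ (p, k)"]] by blast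
    then show "A $$ (p, j) = B $$ (p, j)" using j by simp
  qed (use A B in auto)
  ultimately have "universal_family M w N \<Psi>" using dual unfolding universal_family_def by blast
  then show ?thesis using that Nc by blast
qed

text \<open>\<open>T\<close> corepresents the functor taking \<open>X\<close> to the dual of \<open>Ext(X, M)\<close>, with universal element \<open>\<Psi>\<close>.\<close>

definition is_inverse_translate :: "'k::field qrep \<Rightarrow> 'k qrep \<Rightarrow> (nat \<times> nat \<Rightarrow> 'k mat) \<Rightarrow> bool" where
  "is_inverse_translate M T \<Psi> \<longleftrightarrow> rep T \<and> ext_dual T M \<Psi> \<and>
    (\<forall>X \<phi>. rep X \<longrightarrow> ext_dual X M \<phi> \<longrightarrow> (\<exists>u. hom T X u \<and> (\<forall>(a, b)\<in>Q. \<phi> (a, b) = u a * \<Psi> (a, b)))) \<and>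
    (\<forall>X u u'. rep X \<longrightarrow> hom T X u \<longrightarrow> hom T X u' \<longrightarrow> (\<forall>(a, b)\<in>Q. u a * \<Psi> (a, b) = u' a * \<Psi> (a, b)) \<longrightarrow>
       (\<forall>v\<in>I. u v = u' v))"

lemma sum_mat_mult_entry:
  assumes A: "A \<in> carrier_mat p q" and B: "\<And>x. x \<in> S \<Longrightarrow> B x \<in> carrier_mat q r" and i: "i < p" "k < r"
  shows "(\<Sum>x\<in>S. (A * B x) $$ (i, k)) = (\<Sum>j<q. A $$ (i, j) * (\<Sum>x\<in>S. B x $$ (j, k)))"
  unfolding sum_distrib_left
  by (subst sum.swap) (intro sum.cong refl, simp add: mat_mult_entry[OF A B] i)

text \<open>The images of an element of the dual of \<open>Ext(X, M)\<close> under the homomorphisms \<open>X \<rightarrow> I\<^sub>w\<close> given by the coordinates of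
  the space of \<open>X\<close> at \<open>w\<close>.\<close>

lemma path_dual_family:
  assumes X: "rep X" and M: "rep M" and P: "path_mats X \<rho>" and phi: "ext_dual X M \<phi>" and w: "w \<in> I"
  shows "dual_family M w (rdim X w) (\<lambda>(a, b). \<rho> w a * \<phi> (a, b))"
  unfolding dual_family_def
proof (intro conjI ballI allI impI)
  fix a assume "a \<in> Q"
  then show "case a of (a, b) \<Rightarrow> (a, w) \<in> Q\<^sup>* \<longrightarrow>
      (case (a, b) of (a, b) \<Rightarrow> \<rho> w a * \<phi> (a, b)) \<in> carrier_mat (rdim X w) (rdim M b)"
    using path_mats_carrier[OF P w] ext_dual_carrier[OF phi] by fastforce
next
  fix v p k assume vw: "(v, w) \<in> Q\<^sup>*" and p: "p < rdim X w" and k: "k < rdim M v"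
  have v: "v \<in> I" using path_I[OF vw] w by simp
  note cP = path_mats_carrier[OF P w vw]
  have "(\<Sum>u | (u, v) \<in> Q. (\<rho> w u * \<phi> (u, v)) $$ (p, k)) = (\<Sum>u | (u, v) \<in> Q. (\<rho> w v * (rmap X (u, v) * \<phi> (u, v))) $$ (p, k))"
  proof (intro sum.cong refl)
    fix u assume "u \<in> {u. (u, v) \<in> Q}"
    then have u: "(u, v) \<in> Q" by simp
    have "\<rho> w u = \<rho> w v * rmap X (u, v)" using P u vw w unfolding path_mats_def by auto
    then show "(\<rho> w u * \<phi> (u, v)) $$ (p, k) = (\<rho> w v * (rmap X (u, v) * \<phi> (u, v))) $$ (p, k)"
      using cP rep_carrier[OF X u] ext_dual_carrier[OF phi u] by simp
  qed
  also have "\<dots> = (\<Sum>j<rdim X v. \<rho> w v $$ (p, j) * (\<Sum>u | (u, v) \<in> Q. (rmap X (u, v) * \<phi> (u, v)) $$ (j, k)))"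
    by (rule sum_mat_mult_entry[OF cP _ p k])
      (auto intro: mult_carrier_mat[OF rep_carrier[OF X] ext_dual_carrier[OF phi]])
  also have "\<dots> = (\<Sum>j<rdim X v. \<rho> w v $$ (p, j) * (\<Sum>b | (v, b) \<in> Q. (\<phi> (v, b) * rmap M (v, b)) $$ (j, k)))"
    using phi v k unfolding ext_dual_def by (intro sum.cong) auto
  also have "\<dots> = (\<Sum>b | (v, b) \<in> Q. (\<rho> w v * (\<phi> (v, b) * rmap M (v, b))) $$ (p, k))"
    by (rule sum_mat_mult_entry[OF cP _ p k, symmetric])
      (auto intro: mult_carrier_mat[OF ext_dual_carrier[OF phi] rep_carrier[OF M]])
  also have "\<dots> = (\<Sum>b | (v, b) \<in> Q. (\<rho> w v * \<phi> (v, b) * rmap M (v, b)) $$ (p, k))"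
    by (intro sum.cong refl) (simp add: assoc_mult_mat[OF cP ext_dual_carrier[OF phi] rep_carrier[OF M]])
  finally show "(\<Sum>u | (u, v) \<in> Q. (case (u, v) of (a, b) \<Rightarrow> \<rho> w a * \<phi> (a, b)) $$ (p, k)) =
      (\<Sum>b | (v, b) \<in> Q. ((case (v, b) of (a, b) \<Rightarrow> \<rho> w a * \<phi> (a, b)) * rmap M (v, b)) $$ (p, k))"
    by simp
qed

lemma dual_family_restrict:
  assumes "dual_family M w' r \<Theta>" "(w, w') \<in> Q" shows "dual_family M w r \<Theta>"
proof -
  have "(a, w') \<in> Q\<^sup>*" if "(a, w) \<in> Q\<^sup>*" for a using that assms(2) by auto
  then show ?thesis using assms(1) unfolding dual_family_def by fastforce
qed

text \<open>The space of \<open>T\<close> at \<open>w\<close> is the dual of the space of which \<open>\<Psi> w\<close> is a basis, and the map of an arrow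
  \<open>w \<rightarrow> w'\<close> comes from the projection of the injective at \<open>w'\<close> onto the one at \<open>w\<close>. The universal element of \<open>T\<close>
  at an arrow \<open>a \<rightarrow> b\<close> is the part of the family \<open>\<Psi> a\<close> which belongs to this arrow.\<close>

lemma inverse_translate_exists:
  assumes M: "rep M" and no_hom: "\<And>w. w \<in> I \<Longrightarrow> no_hom (inj_rep w) M"
  obtains T \<Psi> where "is_inverse_translate M T \<Psi>" "\<And>w. w \<in> I \<Longrightarrow> dimv T w = cox (dimv M) w"
proof -
  have "\<exists>N \<Psi>. int N = cox (dimv M) w \<and> universal_family M w N \<Psi>" if w: "w \<in> I" for w
    using universal_family_exists[OF M w no_hom[OF w]] by blast
  then obtain N \<Psi> where N: "\<And>w. w \<in> I \<Longrightarrow> int (N w) = cox (dimv M) w"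
    and uf: "\<And>w. w \<in> I \<Longrightarrow> universal_family M w (N w) (\<Psi> w)" by metis
  have cPsi: "\<Psi> w (a, b) \<in> carrier_mat (N w) (rdim M b)" if "w \<in> I" "(a, b) \<in> Q" "(a, w) \<in> Q\<^sup>*" for w a b
    using uf[OF that(1)] that unfolding universal_family_def dual_family_def by auto
  have dualPsi: "dual_family M w (N w) (\<Psi> w)" if "w \<in> I" for w
    using uf[OF that] unfolding universal_family_def by auto
  have fac: "\<exists>A\<in>carrier_mat r (N w). \<forall>(a, b)\<in>Q. (a, w) \<in> Q\<^sup>* \<longrightarrow> \<Theta> (a, b) = A * \<Psi> w (a, b)"
    if "w \<in> I" "dual_family M w r \<Theta>" for w r \<Theta>
    using uf[OF that(1)] that(2) unfolding universal_family_def by blast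
  have can: "A = B" if "w \<in> I" "A \<in> carrier_mat r (N w)" "B \<in> carrier_mat r (N w)"
    "\<And>a b. (a, b) \<in> Q \<Longrightarrow> (a, w) \<in> Q\<^sup>* \<Longrightarrow> A * \<Psi> w (a, b) = B * \<Psi> w (a, b)" for w r A B
    by (rule uf[OF that(1), unfolded universal_family_def, THEN conjunct2, THEN conjunct2, THEN spec, THEN bspec,
          OF that(2), THEN bspec, OF that(3), THEN mp]) (use that(4) in blast)
  have "\<exists>A\<in>carrier_mat (N w') (N w). \<forall>(a, b)\<in>Q. (a, w) \<in> Q\<^sup>* \<longrightarrow> \<Psi> w' (a, b) = A * \<Psi> w (a, b)"
    if "(w, w') \<in> Q" for w w'
    using fac[of w "N w'" "\<Psi> w'"] dual_family_restrict[OF dualPsi that] Q_I[OF that] by blast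
  then have ex: "\<forall>p\<in>Q. \<exists>A. A \<in> carrier_mat (N (snd p)) (N (fst p)) \<and>
      (\<forall>(a, b)\<in>Q. (a, fst p) \<in> Q\<^sup>* \<longrightarrow> \<Psi> (snd p) (a, b) = A * \<Psi> (fst p) (a, b))"
    by (simp add: Bex_def split_beta)
  from bchoice[OF ex] obtain Tm where Tm': "\<forall>p\<in>Q. Tm p \<in> carrier_mat (N (snd p)) (N (fst p)) \<and>
      (\<forall>(a, b)\<in>Q. (a, fst p) \<in> Q\<^sup>* \<longrightarrow> \<Psi> (snd p) (a, b) = Tm p * \<Psi> (fst p) (a, b))"
    by (rule exE)
  have Tm: "Tm (w, w') \<in> carrier_mat (N w') (N w)" if "(w, w') \<in> Q" for w w'
    using bspec[OF Tm' that] by simp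
  have Tm2: "\<Psi> w' (a, b) = Tm (w, w') * \<Psi> w (a, b)"
    if "(w, w') \<in> Q" "(a, b) \<in> Q" "(a, w) \<in> Q\<^sup>*" for w w' a b
    using bspec[OF Tm' that(1)] that(2,3) by auto
  \<comment> \<open>restriction along \<open>(w, w\')\<close> is expressed in the chosen bases by \<open>Tm (w, w\')\<close>\<close>
  define T where "T = \<lparr>rdim = N, rmap = Tm\<rparr>"
  have Td [simp]: "rdim T = N" "rmap T = Tm" by (simp_all add: T_def)
  have T: "rep T" using Tm by (auto simp: is_rep_def)
  define PT where "PT = (\<lambda>(a, b). \<Psi> a (a, b))"
  have cPT: "PT (a, b) \<in> carrier_mat (N a) (rdim M b)" if "(a, b) \<in> Q" for a b
    using cPsi[of a a b] Q_I[OF that] that by (simp add: PT_def)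
  have dT: "ext_dual T M PT"
    unfolding ext_dual_def
  proof (intro conjI ballI allI impI)
    fix a assume "a \<in> Q"
    then show "case a of (u, v) \<Rightarrow> PT (u, v) \<in> carrier_mat (rdim T u) (rdim M v)" using cPT by auto
  next
    fix v j i assume v: "v \<in> I" and j: "j < rdim T v" and i: "i < rdim M v"
    have "(\<Sum>u | (u, v) \<in> Q. (rmap T (u, v) * PT (u, v)) $$ (j, i)) = (\<Sum>u | (u, v) \<in> Q. \<Psi> v (u, v) $$ (j, i))"
      using Tm2 by (intro sum.cong) (auto simp: PT_def)
    also have "\<dots> = (\<Sum>b | (v, b) \<in> Q. (\<Psi> v (v, b) * rmap M (v, b)) $$ (j, i))"
      using dualPsi[OF v] i j unfolding dual_family_def by simp
    finally show "(\<Sum>u | (u, v) \<in> Q. (rmap T (u, v) * PT (u, v)) $$ (j, i)) =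
        (\<Sum>w | (v, w) \<in> Q. (PT (v, w) * rmap M (v, w)) $$ (j, i))" by (simp add: PT_def)
  qed
  obtain \<rho>T where PiT: "path_mats T \<rho>T" using path_mats_exist[OF T] by blast
  have PiPsi: "\<rho>T w a * PT (a, b) = \<Psi> w (a, b)" if w: "w \<in> I" and ab: "(a, b) \<in> Q" and "(a, w) \<in> Q\<^sup>*" for w a b
    using \<open>(a, w) \<in> Q\<^sup>*\<close> w
  proof (induction rule: rtrancl_induct)
    case base
    then show ?case using PiT cPT[OF ab] unfolding path_mats_def by (simp add: PT_def)
  next
    case (step w w')
    have wI: "w \<in> I" using Q_I step by auto
    have "\<rho>T w' a * PT (a, b) = Tm (w, w') * (\<rho>T w a * PT (a, b))"
      unfolding path_mats_last[OF T PiT step(2,1)] using Tm[OF step(2)] path_mats_carrier[OF PiT wI step(1)] cPT[OF ab] by simp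
    then show ?case using step.IH wI Tm2[OF step(2) ab step(1)] by simp
  qed
  have univ: "\<exists>u. hom T X u \<and> (\<forall>(a, b)\<in>Q. \<phi> (a, b) = u a * PT (a, b))"
    if X: "rep X" and phi: "ext_dual X M \<phi>" for X \<phi>
  proof -
    obtain \<rho> where Pi: "path_mats X \<rho>" using path_mats_exist[OF X] by blast
    have "\<exists>A\<in>carrier_mat (rdim X w) (N w). \<forall>(a, b)\<in>Q. (a, w) \<in> Q\<^sup>* \<longrightarrow> \<rho> w a * \<phi> (a, b) = A * \<Psi> w (a, b)"
      if "w \<in> I" for w
      using fac[OF that path_dual_family[OF X M Pi phi that]] by simp
    then have ex: "\<forall>w\<in>I. \<exists>A. A \<in> carrier_mat (rdim X w) (N w) \<and>
         (\<forall>(a, b)\<in>Q. (a, w) \<in> Q\<^sup>* \<longrightarrow> \<rho> w a * \<phi> (a, b) = A * \<Psi> w (a, b))"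
      by (simp add: Bex_def)
    from bchoice[OF ex] obtain u where u': "\<forall>w\<in>I. u w \<in> carrier_mat (rdim X w) (N w) \<and>
         (\<forall>(a, b)\<in>Q. (a, w) \<in> Q\<^sup>* \<longrightarrow> \<rho> w a * \<phi> (a, b) = u w * \<Psi> w (a, b))" by (rule exE)
    have u: "\<And>w. w \<in> I \<Longrightarrow> u w \<in> carrier_mat (rdim X w) (N w)"
      "\<And>w a b. w \<in> I \<Longrightarrow> (a, b) \<in> Q \<Longrightarrow> (a, w) \<in> Q\<^sup>* \<Longrightarrow> \<rho> w a * \<phi> (a, b) = u w * \<Psi> w (a, b)"
      using u' by auto
    have "hom T X u"
    proof (rule homI)
      fix w assume "w \<in> I" then show "u w \<in> carrier_mat (rdim X w) (rdim T w)" using u by simp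
    next
      fix w w' assume a: "(w, w') \<in> Q"
      have wI: "w \<in> I" "w' \<in> I" using Q_I[OF a] by auto
      note cX = rep_carrier[OF X a] and cu = u(1)[OF wI(1)] u(1)[OF wI(2)] and cT = Tm[OF a]
      have "u w' * Tm (w, w') = rmap X (w, w') * u w"
      proof (rule can[OF wI(1)])
        fix a' b assume ab: "(a', b) \<in> Q" "(a', w) \<in> Q\<^sup>*"
        have aw': "(a', w') \<in> Q\<^sup>*" using ab a by auto
        note c = cPsi[OF wI(1) ab] path_mats_carrier[OF Pi wI(1) ab(2)] ext_dual_carrier[OF phi ab(1)]
        have "u w' * Tm (w, w') * \<Psi> w (a', b) = u w' * \<Psi> w' (a', b)"
          unfolding Tm2[OF a ab] using cu cT c by simp
        also have "\<dots> = \<rho> w' a' * \<phi> (a', b)" using u(2)[OF wI(2) ab(1) aw'] by simp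
        also have "\<dots> = rmap X (w, w') * (\<rho> w a' * \<phi> (a', b))"
          unfolding path_mats_last[OF X Pi a ab(2)] using cX c by simp
        also have "\<dots> = rmap X (w, w') * u w * \<Psi> w (a', b)"
          unfolding u(2)[OF wI(1) ab] using cX cu c by simp
        finally show "u w' * Tm (w, w') * \<Psi> w (a', b) = rmap X (w, w') * u w * \<Psi> w (a', b)" .
      qed (use cX cu cT in auto)
      then show "u w' * rmap T (w, w') = rmap X (w, w') * u w" by simp
    qed
    moreover have "\<phi> (a, b) = u a * PT (a, b)" if ab: "(a, b) \<in> Q" for a b
      using u(2)[of a a b] ab Q_I[OF ab] Pi ext_dual_carrier[OF phi ab] unfolding path_mats_def by (simp add: PT_def)
    ultimately show ?thesis by blast
  qed
  have uniq: "u w = u' w" if X: "rep X" and u: "hom T X u" and u': "hom T X u'"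
    and eq: "\<And>a b. (a, b) \<in> Q \<Longrightarrow> u a * PT (a, b) = u' a * PT (a, b)" and w: "w \<in> I" for X u u' w
  proof -
    obtain \<rho> where Pi: "path_mats X \<rho>" using path_mats_exist[OF X] by blast
    have *: "h w * \<Psi> w (a, b) = \<rho> w a * (h a * PT (a, b))" if "(a, b) \<in> Q" "(a, w) \<in> Q\<^sup>*" "hom T X h" for a b h
    proof -
      have aI: "a \<in> I" using that Q_I by auto
      note c = hom_carrier[OF that(3) w] hom_carrier[OF that(3) aI] path_mats_carrier[OF Pi w that(2)]
        path_mats_carrier[OF PiT w that(2)] cPT[OF that(1)]
      have "h w * \<Psi> w (a, b) = h w * \<rho>T w a * PT (a, b)"
        unfolding PiPsi[OF w that(1,2), symmetric] using c by simp
      also have "\<dots> = \<rho> w a * h a * PT (a, b)" unfolding path_mats_hom[OF T X PiT Pi that(3) w that(2)] ..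
      finally show ?thesis using c by simp
    qed
    show ?thesis
      using can[OF w, of "u w" "rdim X w" "u' w"] hom_carrier[OF u w] hom_carrier[OF u' w] *[OF _ _ u] *[OF _ _ u'] eq by simp
  qed
  have "is_inverse_translate M T PT"
    unfolding is_inverse_translate_def using T dT univ uniq by blast
  moreover have "dimv T w = cox (dimv M) w" if "w \<in> I" for w using N[OF that] by (simp add: dimv_def)
  ultimately show ?thesis using that by blast
qed

end

section \<open>Block matrices and injective representations\<close>

definition row_block :: "'k::field mat \<Rightarrow> 'k mat \<Rightarrow> 'k mat" where
  "row_block A B = four_block_mat A B (0\<^sub>m 0 (dim_col A)) (0\<^sub>m 0 (dim_col B))"
definition col_block :: "'k::field mat \<Rightarrow> 'k mat \<Rightarrow> 'k mat" where
  "col_block A B = four_block_mat A (0\<^sub>m (dim_row A) 0) B (0\<^sub>m (dim_row B) 0)"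

lemma row_block_carrier [intro]:
  "A \<in> carrier_mat z p \<Longrightarrow> B \<in> carrier_mat z q \<Longrightarrow> row_block A B \<in> carrier_mat z (p + q)"
  unfolding row_block_def using four_block_carrier_mat[of A z p "0\<^sub>m 0 (dim_col B)" 0 q] by simp
lemma col_block_carrier [intro]:
  "A \<in> carrier_mat p z \<Longrightarrow> B \<in> carrier_mat q z \<Longrightarrow> col_block A B \<in> carrier_mat (p + q) z"
  unfolding col_block_def using four_block_carrier_mat[of A p z "0\<^sub>m (dim_row B) 0" q 0] by simp

lemma row_block_times_four_block:
  assumes "A \<in> carrier_mat z p" "B \<in> carrier_mat z q"
    "P \<in> carrier_mat p r" "R \<in> carrier_mat p s" "S \<in> carrier_mat q r" "U \<in> carrier_mat q s"
  shows "row_block A B * four_block_mat P R S U = row_block (A * P + B * S) (A * R + B * U)"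
proof -
  have d: "dim_col A = p" "dim_col B = q" using assms by auto
  show ?thesis unfolding row_block_def
    by (subst mult_four_block_mat[of _ z p _ q _ 0])
      (use assms d in \<open>auto intro!: cong_four_block_mat eq_matI\<close>)
qed

lemma four_block_times_col_block:
  assumes "P \<in> carrier_mat r p" "R \<in> carrier_mat r q" "S \<in> carrier_mat s p" "U \<in> carrier_mat s q"
    "A \<in> carrier_mat p z" "B \<in> carrier_mat q z"
  shows "four_block_mat P R S U * col_block A B = col_block (P * A + R * B) (S * A + U * B)"
proof -
  have d: "dim_row A = p" "dim_row B = q" using assms by auto
  show ?thesis unfolding col_block_def
    by (subst mult_four_block_mat[of _ r p _ q _ s])
      (use assms d in \<open>auto intro!: cong_four_block_mat eq_matI\<close>)
qed

lemma row_block_times_col_block: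
  assumes "A \<in> carrier_mat z p" "B \<in> carrier_mat z q" "P \<in> carrier_mat p r" "R \<in> carrier_mat q r"
  shows "row_block A B * col_block P R = A * P + B * R"
proof -
  have d: "dim_col A = p" "dim_col B = q" "dim_row P = p" "dim_row R = q" using assms by auto
  show ?thesis unfolding row_block_def col_block_def
    by (subst mult_four_block_mat[of _ z p _ q _ 0])
      (use assms d in \<open>auto intro!: eq_matI\<close>)
qed

lemma col_block_times:
  assumes "A \<in> carrier_mat p z" "B \<in> carrier_mat q z" "Z \<in> carrier_mat z r"
  shows "col_block A B * Z = col_block (A * Z) (B * Z)"
proof -
  have "col_block A B * four_block_mat Z (0\<^sub>m z 0) (0\<^sub>m 0 r) (0\<^sub>m 0 0) = col_block (A * Z) (B * Z)"
    unfolding col_block_def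
    by (subst mult_four_block_mat[of _ p z _ 0 _ q])
      (use assms in \<open>auto intro!: cong_four_block_mat eq_matI\<close>)
  moreover have "four_block_mat Z (0\<^sub>m z 0) (0\<^sub>m 0 r) (0\<^sub>m 0 0) = Z" using assms by (intro eq_matI) auto
  ultimately show ?thesis by simp
qed

lemma times_row_block:
  assumes "A \<in> carrier_mat z p" "B \<in> carrier_mat z q" "Z \<in> carrier_mat r z"
  shows "Z * row_block A B = row_block (Z * A) (Z * B)"
proof -
  have "four_block_mat Z (0\<^sub>m r 0) (0\<^sub>m 0 z) (0\<^sub>m 0 0) * row_block A B = row_block (Z * A) (Z * B)"
    unfolding row_block_def
    by (subst mult_four_block_mat[of _ r z _ 0 _ 0])
      (use assms in \<open>auto intro!: cong_four_block_mat eq_matI\<close>)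
  moreover have "four_block_mat Z (0\<^sub>m r 0) (0\<^sub>m 0 z) (0\<^sub>m 0 0) = Z" using assms by (intro eq_matI) auto
  ultimately show ?thesis by simp
qed

lemma row_block_eq:
  assumes "row_block A B = row_block A' B'" "A \<in> carrier_mat z p" "B \<in> carrier_mat z q"
    "A' \<in> carrier_mat z p" "B' \<in> carrier_mat z q"
  shows "A = A'" "B = B'"
proof -
  have e: "row_block A B $$ (i, j) = row_block A' B' $$ (i, j)" for i j using assms(1) by simp
  show "A = A'"
  proof (rule eq_matI)
    fix i j assume "i < dim_row A'" "j < dim_col A'"
    then show "A $$ (i, j) = A' $$ (i, j)" using e[of i j] assms by (simp add: row_block_def)
  qed (use assms in auto)
  show "B = B'"
  proof (rule eq_matI)
    fix i j assume "i < dim_row B'" "j < dim_col B'"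
    then show "B $$ (i, j) = B' $$ (i, j)" using e[of i "p + j"] assms by (simp add: row_block_def)
  qed (use assms in auto)
qed

lemma col_block_eq:
  assumes "col_block A B = col_block A' B'" "A \<in> carrier_mat p z" "B \<in> carrier_mat q z"
    "A' \<in> carrier_mat p z" "B' \<in> carrier_mat q z"
  shows "A = A'" "B = B'"
proof -
  have e: "col_block A B $$ (i, j) = col_block A' B' $$ (i, j)" for i j using assms(1) by simp
  show "A = A'"
  proof (rule eq_matI)
    fix i j assume "i < dim_row A'" "j < dim_col A'"
    then show "A $$ (i, j) = A' $$ (i, j)" using e[of i j] assms by (simp add: col_block_def)
  qed (use assms in auto)
  show "B = B'"
  proof (rule eq_matI)
    fix i j assume "i < dim_row B'" "j < dim_col B'"
    then show "B $$ (i, j) = B' $$ (i, j)" using e[of "p + i" j] assms by (simp add: col_block_def)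
  qed (use assms in auto)
qed

lemma row_block_add_zero:
  assumes "A \<in> carrier_mat z p" "B \<in> carrier_mat z q" "D \<in> carrier_mat z q"
  shows "row_block A B + row_block (0\<^sub>m z p) D = row_block A (B + D)"
  using assms unfolding row_block_def by (intro eq_matI) auto

lemma row_block_split:
  assumes "F \<in> carrier_mat z (p + q)"
  shows "\<exists>A B. A \<in> carrier_mat z p \<and> B \<in> carrier_mat z q \<and> F = row_block A B"
proof -
  have "F = row_block (mat z p (\<lambda>(i, j). F $$ (i, j))) (mat z q (\<lambda>(i, j). F $$ (i, p + j)))"
    using assms by (intro eq_matI) (auto simp: row_block_def)
  then show ?thesis by (metis mat_carrier)
qed

lemma col_block_split:
  assumes "F \<in> carrier_mat (p + q) z"
  shows "\<exists>A B. A \<in> carrier_mat p z \<and> B \<in> carrier_mat q z \<and> F = col_block A B"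
proof -
  have "F = col_block (mat p z (\<lambda>(i, j). F $$ (i, j))) (mat q z (\<lambda>(i, j). F $$ (p + i, j)))"
    using assms by (intro eq_matI) (auto simp: col_block_def)
  then show ?thesis by (metis mat_carrier)
qed

lemma split_sum_identity:
  "col_block (1\<^sub>m p) (0\<^sub>m q p) * row_block (1\<^sub>m p) (0\<^sub>m p q) +
   col_block (0\<^sub>m p q) (1\<^sub>m q) * row_block (0\<^sub>m q p) (1\<^sub>m q) = (1\<^sub>m (p + q) :: 'k::field mat)"
proof -
  have 1: "col_block (1\<^sub>m p) (0\<^sub>m q p) * row_block (1\<^sub>m p) (0\<^sub>m p q :: 'k mat) =
      four_block_mat (1\<^sub>m p) (0\<^sub>m p q) (0\<^sub>m q p) (0\<^sub>m q q)"
    unfolding row_block_def col_block_def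
    by (subst mult_four_block_mat[of _ p p _ 0 _ q]) (auto intro!: cong_four_block_mat eq_matI)
  have 2: "col_block (0\<^sub>m p q) (1\<^sub>m q) * row_block (0\<^sub>m q p) (1\<^sub>m q :: 'k mat) =
      four_block_mat (0\<^sub>m p p) (0\<^sub>m p q) (0\<^sub>m q p) (1\<^sub>m q)"
    unfolding row_block_def col_block_def
    by (subst mult_four_block_mat[of _ p q _ 0 _ q]) (auto intro!: cong_four_block_mat eq_matI)
  show ?thesis unfolding 1 2 by (intro eq_matI) auto
qed

lemma mat_vec_zero:
  fixes A :: "'k::field mat"
  assumes A: "A \<in> carrier_mat p q" and z: "\<And>x. x \<in> carrier_vec q \<Longrightarrow> A *\<^sub>v x = 0\<^sub>v p"
  shows "A = 0\<^sub>m p q"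
proof (rule eq_matI)
  fix i j assume ij: "i < dim_row (0\<^sub>m p q :: 'k mat)" "j < dim_col (0\<^sub>m p q :: 'k mat)"
  then have "A *\<^sub>v unit_vec q j = col A j" using A by (intro eq_vecI) auto
  then have "col A j = 0\<^sub>v p" using z[of "unit_vec q j"] by simp
  then show "A $$ (i, j) = 0\<^sub>m p q $$ (i, j)" using ij A by (metis carrier_matD index_col index_zero_mat(1-3) index_zero_vec(1))
qed (use A in auto)

lemma inj_mat_cancel:
  fixes F A B :: "'k::field mat"
  assumes F: "F \<in> carrier_mat p q" and A: "A \<in> carrier_mat q r" and B: "B \<in> carrier_mat q r"
    and inj: "inj_on (\<lambda>x. F *\<^sub>v x) (carrier_vec q)" and eq: "F * A = F * B"
  shows "A = B"
proof (rule mat_col_eqI)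
  fix j assume "j < dim_col B"
  then have j: "j < r" using B by auto
  have "F *\<^sub>v col A j = F *\<^sub>v col B j"
    using arg_cong[OF eq, of "\<lambda>m. col m j"] col_mult2[OF F A j] col_mult2[OF F B j] by simp
  moreover have "col A j \<in> carrier_vec q" "col B j \<in> carrier_vec q" using A B by (auto intro: col_carrier_vec)
  ultimately show "col A j = col B j" using inj by (auto simp: inj_on_def)
qed (use A B in auto)

lemma mat_factor:
  fixes F H :: "'k::field mat"
  assumes F: "F \<in> carrier_mat p q" and H: "H \<in> carrier_mat p r"
    and img: "\<And>j. j < r \<Longrightarrow> col H j \<in> (\<lambda>x. F *\<^sub>v x) ` carrier_vec q"
  obtains K where "K \<in> carrier_mat q r" "F * K = H"
proof -
  have "\<exists>x. x \<in> carrier_vec q \<and> F *\<^sub>v x = col H j" if "j < r" for j using img[OF that] by auto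
  then obtain x where x: "\<And>j. j < r \<Longrightarrow> x j \<in> carrier_vec q" "\<And>j. j < r \<Longrightarrow> F *\<^sub>v x j = col H j" by metis
  define K where "K = mat q r (\<lambda>(i, j). x j $ i)"
  have K: "K \<in> carrier_mat q r" by (simp add: K_def)
  have cK: "col K j = x j" if "j < r" for j using x(1)[OF that] that by (intro eq_vecI) (auto simp: K_def)
  have "F * K = H"
  proof (rule mat_col_eqI)
    fix j assume "j < dim_col H"
    then have j: "j < r" using H by auto
    show "col (F * K) j = col H j" using col_mult2[OF F K j] cK[OF j] x(2)[OF j] by simp
  qed (use F H K in auto)
  then show ?thesis using that K by blast
qed

context dynkin_quiver begin

lemma hom_cong:
  assumes "hom X Y f" "\<And>v. v \<in> I \<Longrightarrow> f v = g v" shows "hom X Y g"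
proof (rule homI)
  fix v assume "v \<in> I" then show "g v \<in> carrier_mat (rdim Y v) (rdim X v)"
    using hom_carrier[OF assms(1)] assms(2) by simp
next
  fix u v assume a: "(u, v) \<in> Q"
  then have "f u = g u" "f v = g v" using assms(2) Q_I[OF a] by auto
  then show "g v * rmap X (u, v) = rmap Y (u, v) * g u" using hom_comm[OF assms(1) a] by simp
qed

lemma rep_hom_comp:
  assumes "rep X" "rep Y" "rep Z" "hom X Y f" "hom Y Z g"
  shows "hom X Z (\<lambda>v. g v * f v)"
proof (rule homI)
  fix v assume v: "v \<in> I"
  show "g v * f v \<in> carrier_mat (rdim Z v) (rdim X v)"
    using hom_carrier[OF assms(4) v] hom_carrier[OF assms(5) v] by auto
next
  fix u v assume a: "(u, v) \<in> Q"
  have I: "u \<in> I" "v \<in> I" using Q_I[OF a] by auto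
  note c = hom_carrier[OF assms(4) I(1)] hom_carrier[OF assms(4) I(2)] hom_carrier[OF assms(5) I(1)]
    hom_carrier[OF assms(5) I(2)] rep_carrier[OF assms(1) a] rep_carrier[OF assms(2) a] rep_carrier[OF assms(3) a]
  have "g v * f v * rmap X (u, v) = g v * (rmap Y (u, v) * f u)"
    unfolding hom_comm[OF assms(4) a, symmetric] using c by simp
  also have "\<dots> = (rmap Z (u, v) * g u) * f u"
    unfolding hom_comm[OF assms(5) a, symmetric] using c by simp
  finally show "g v * f v * rmap X (u, v) = rmap Z (u, v) * (g u * f u)" using c by simp
qed

lemma hom_scale:
  assumes "rep X" "rep Y" "hom X Y f" shows "hom X Y (\<lambda>v. c \<cdot>\<^sub>m f v)"
proof (rule homI)
  fix v assume "v \<in> I" then show "c \<cdot>\<^sub>m f v \<in> carrier_mat (rdim Y v) (rdim X v)"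
    using hom_carrier[OF assms(3)] by auto
next
  fix u v assume a: "(u, v) \<in> Q"
  have I: "u \<in> I" "v \<in> I" using Q_I[OF a] by auto
  note c = hom_carrier[OF assms(3) I(1)] hom_carrier[OF assms(3) I(2)] rep_carrier[OF assms(1) a] rep_carrier[OF assms(2) a]
  show "(c \<cdot>\<^sub>m f v) * rmap X (u, v) = rmap Y (u, v) * (c \<cdot>\<^sub>m f u)"
    using c hom_comm[OF assms(3) a] mult_smult_assoc_mat[OF c(2) c(3)] mult_smult_distrib[OF c(4) c(1)] by simp
qed

lemma hom_id_hom: "rep X \<Longrightarrow> hom X X (\<lambda>v. 1\<^sub>m (rdim X v))"
  by (rule homI) (use rep_carrier in force)+

lemma hom_eq_I: "hom_eq n f g \<longleftrightarrow> (\<forall>v\<in>I. f v = g v)" by (simp add: hom_eq_def I_def)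

lemma section_iff: "is_section n Q M N f \<longleftrightarrow> (\<exists>h. hom N M h \<and> (\<forall>v\<in>I. h v * f v = 1\<^sub>m (rdim M v)))"
  by (simp add: is_section_def hom_eq_I hom_comp_def hom_id_def)
lemma retraction_iff: "is_retraction n Q M N g \<longleftrightarrow> (\<exists>h. hom N M h \<and> (\<forall>v\<in>I. g v * h v = 1\<^sub>m (rdim N v)))"
  by (simp add: is_retraction_def hom_eq_I hom_comp_def hom_id_def)

subsection \<open>Homomorphisms from and to indecomposable injectives\<close>

text \<open>\<open>Hom(X, I\<^sub>w)\<close> is the dual of the space of \<open>X\<close> at \<open>w\<close>.\<close>

lemma hom_to_inj:
  assumes X: "rep X" and w: "w \<in> I" and th: "\<theta> \<in> carrier_mat 1 (rdim X w)"
  obtains g where "hom X (inj_rep w) g" "g w = \<theta>"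
proof -
  obtain \<rho> where P: "path_mats X \<rho>" using path_mats_exist[OF X] by blast
  define g where "g = (\<lambda>v. if (v, w) \<in> Q\<^sup>* then \<theta> * \<rho> w v else 0\<^sub>m 0 (rdim X v))"
  have cg: "g v \<in> carrier_mat (rdim (inj_rep w) v) (rdim X v)" for v
    using th path_mats_carrier[OF P w] by (auto simp: g_def)
  have "hom X (inj_rep w) g"
  proof (rule homI)
    fix u v assume a: "(u, v) \<in> Q"
    show "g v * rmap X (u, v) = rmap (inj_rep w) (u, v) * g u"
    proof (cases "(v, w) \<in> Q\<^sup>*")
      case True
      then have uw: "(u, w) \<in> Q\<^sup>*" using a by auto
      have "\<rho> w u = \<rho> w v * rmap X (u, v)" using P a True w unfolding path_mats_def by auto
      then have "g v * rmap X (u, v) = g u"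
        using True uw th path_mats_carrier[OF P w True] rep_carrier[OF X a] by (simp add: g_def)
      then show ?thesis using True uw cg[of u] by simp
    next
      case False
      then show ?thesis using cg[of u] cg[of v] rep_carrier[OF X a] by (intro eq_matI) auto
    qed
  qed (rule cg)
  moreover have "g w = \<theta>" using P w th by (simp add: g_def path_mats_def)
  ultimately show ?thesis using that by blast
qed

text \<open>Let \<open>v\<close> be a vertex of least height where \<open>f\<close> is nonzero. The components of \<open>f\<close> at the vertices with a path to \<open>v\<close>
  form a homomorphism from the injective at \<open>v\<close> which is nonzero on the socle.\<close>

lemma inj_socle:
  assumes M: "rep M" and w: "w \<in> I" and f: "hom (inj_rep w) M f"
    and ne: "v0 \<in> I" "f v0 \<noteq> 0\<^sub>m (rdim M v0) (rdim (inj_rep w) v0)"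
  obtains w' x where "w' \<in> I" "hom (inj_rep w') M x" "x w' \<noteq> 0\<^sub>m (rdim M w') 1"
proof -
  have cf: "f v \<in> carrier_mat (rdim M v) (if (v, w) \<in> Q\<^sup>* then 1 else 0)" if "v \<in> I" for v
    using hom_carrier[OF f that] by simp
  have zero_outside: "f v = 0\<^sub>m (rdim M v) (rdim (inj_rep w) v)" if "v \<in> I" "(v, w) \<notin> Q\<^sup>*" for v
    using cf[OF that(1)] that by (intro eq_matI) auto
  have ex: "\<exists>v. (v, w) \<in> Q\<^sup>* \<and> f v \<noteq> 0\<^sub>m (rdim M v) 1"
    using ne zero_outside[OF ne(1)] by (intro exI[of _ v0]) (auto split: if_splits)
  define v where "v = arg_min l (\<lambda>v. (v, w) \<in> Q\<^sup>* \<and> f v \<noteq> 0\<^sub>m (rdim M v) 1)"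
  have v: "(v, w) \<in> Q\<^sup>*" "f v \<noteq> 0\<^sub>m (rdim M v) 1"
    using arg_min_natI[of "\<lambda>v. (v, w) \<in> Q\<^sup>* \<and> f v \<noteq> 0\<^sub>m (rdim M v) 1" _ l] ex unfolding v_def by blast+
  have minimal: "f b = 0\<^sub>m (rdim M b) 1" if "(b, w) \<in> Q\<^sup>*" "l b < l v" for b
    using arg_min_nat_le[of "\<lambda>v. (v, w) \<in> Q\<^sup>* \<and> f v \<noteq> 0\<^sub>m (rdim M v) 1" b l] that unfolding v_def by force
  have vI: "v \<in> I" using path_I[OF v(1)] w by simp
  define x where "x = (\<lambda>u. if (u, v) \<in> Q\<^sup>* then f u else 0\<^sub>m (rdim M u) 0)"
  have toW: "(u, w) \<in> Q\<^sup>*" if "(u, v) \<in> Q\<^sup>*" for u using that v(1) by auto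
  have cx: "x u \<in> carrier_mat (rdim M u) (rdim (inj_rep v) u)" if "u \<in> I" for u
    using cf[OF that] toW by (auto simp: x_def)
  have "hom (inj_rep v) M x"
  proof (rule homI)
    fix a b assume ab: "(a, b) \<in> Q"
    have I: "a \<in> I" "b \<in> I" using Q_I[OF ab] by auto
    note cM = rep_carrier[OF M ab]
    show "x b * rmap (inj_rep v) (a, b) = rmap M (a, b) * x a"
    proof (cases "(b, v) \<in> Q\<^sup>*")
      case True
      then have av: "(a, v) \<in> Q\<^sup>*" using ab by auto
      show ?thesis using hom_comm[OF f ab] True av toW[OF True] toW[OF av] by (simp add: x_def)
    next
      case bv: False
      show ?thesis
      proof (cases "(a, v) \<in> Q\<^sup>*")
        case False
        then show ?thesis using bv cM by (simp add: x_def)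
      next
        case av: True
        have aw: "(a, w) \<in> Q\<^sup>*" by (rule toW[OF av])
        have "rmap M (a, b) * f a = 0\<^sub>m (rdim M b) 1"
        proof (cases "(b, w) \<in> Q\<^sup>*")
          case False
          then show ?thesis using hom_comm[OF f ab] cf[OF I(2)] aw by simp
        next
          case bw: True
          have "a = v"
          proof (rule ccontr)
            assume "a \<noteq> v"
            then obtain c where "(a, c) \<in> Q" "(c, v) \<in> Q\<^sup>*" using av by (auto elim: converse_rtranclE)
            then show False using next_unique[OF ab bw, of c] toW bv by auto
          qed
          then have "f b = 0\<^sub>m (rdim M b) 1" using minimal[OF bw] height[OF ab] by simp
          then show ?thesis using hom_comm[OF f ab] bw by simp
        qed
        then show ?thesis using av bv by (simp add: x_def)
      qed
    qed
  qed (rule cx)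
  moreover have "x v \<noteq> 0\<^sub>m (rdim M v) 1" using v by (simp add: x_def)
  ultimately show ?thesis using that vI by blast
qed

lemma dual_vector:
  fixes y :: "'k::field mat"
  assumes y: "y \<in> carrier_mat d 1" and ne: "y \<noteq> 0\<^sub>m d 1"
  obtains \<theta> where "\<theta> \<in> carrier_mat 1 d" "\<theta> * y = 1\<^sub>m 1"
proof -
  obtain i where i: "i < d" "y $$ (i, 0) \<noteq> 0"
  proof -
    have "\<exists>i<d. y $$ (i, 0) \<noteq> 0"
    proof (rule ccontr)
      assume "\<not> ?thesis"
      then have "y = 0\<^sub>m d 1" using y by (intro eq_matI) auto
      then show False using ne by simp
    qed
    then show ?thesis using that by blast
  qed
  define \<theta> where "\<theta> = mat 1 d (\<lambda>(_, j). if j = i then 1 / y $$ (i, 0) else 0)"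
  have c: "\<theta> \<in> carrier_mat 1 d" by (simp add: \<theta>_def)
  have "(\<theta> * y) $$ (0, 0) = (\<Sum>j<d. if j = i then 1 / y $$ (i, 0) * y $$ (j, 0) else 0)"
  proof -
    have "(\<theta> * y) $$ (0, 0) = (\<Sum>j<d. \<theta> $$ (0, j) * y $$ (j, 0))"
      using mat_mult_entry[OF c y, of 0 0] by simp
    also have "\<dots> = (\<Sum>j<d. if j = i then 1 / y $$ (i, 0) * y $$ (j, 0) else 0)"
      by (intro sum.cong) (auto simp: \<theta>_def)
    finally show ?thesis .
  qed
  then have "(\<theta> * y) $$ (0, 0) = 1" using i by simp
  then have "\<theta> * y = 1\<^sub>m 1" using c y by (intro eq_matI) auto
  then show ?thesis using that c by blast
qed

text \<open>The image of the socle of \<open>I\<^sub>w\<close> survives in \<open>Y\<close>, so a linear form on \<open>Y\<^sub>w\<close> detects it; the corresponding map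
  \<open>Y \<rightarrow> I\<^sub>w \<rightarrow> M\<close> restricts to a scalar endomorphism of \<open>M\<close>, and the scalar is read off at the socle.\<close>

lemma brick_inj_splits:
  assumes M: "brick M" and w: "w \<in> I" and x: "hom (inj_rep w) M x" "x w \<noteq> 0\<^sub>m (rdim M w) 1"
    and Y: "rep Y" and f: "hom M Y f" and mono: "rep_mono n M Y f"
  obtains \<theta> g where "hom Y (inj_rep w) g" "g w = \<theta>" "\<theta> * (f w * x w) = 1\<^sub>m 1"
    "\<And>v. v \<in> I \<Longrightarrow> (x v * g v) * f v = 1\<^sub>m (rdim M v)"
proof -
  have rM: "rep M" using M by (simp add: brick_def)
  have cx: "x w \<in> carrier_mat (rdim M w) 1" using hom_carrier[OF x(1) w] by simp
  note cf = hom_carrier[OF f w]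
  have "f w * x w \<noteq> 0\<^sub>m (rdim Y w) 1"
  proof
    assume "f w * x w = 0\<^sub>m (rdim Y w) 1"
    then have "f w * x w = f w * 0\<^sub>m (rdim M w) 1" using cf by simp
    then have "x w = 0\<^sub>m (rdim M w) 1"
      using inj_mat_cancel[OF cf cx] mono w by (simp add: rep_mono_def I_def)
    then show False using x by simp
  qed
  then obtain \<theta> where th: "\<theta> \<in> carrier_mat 1 (rdim Y w)" "\<theta> * (f w * x w) = 1\<^sub>m 1"
    using dual_vector[OF mult_carrier_mat[OF cf cx]] by blast
  obtain g where g: "hom Y (inj_rep w) g" "g w = \<theta>" using hom_to_inj[OF Y w th(1)] by blast
  have "hom M M (\<lambda>v. (x v * g v) * f v)"
    by (rule rep_hom_comp[OF rM Y rM f rep_hom_comp[OF Y rep_inj_rep rM g(1) x(1)]])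
  then obtain c where c: "\<And>v. v \<in> I \<Longrightarrow> (x v * g v) * f v = c \<cdot>\<^sub>m 1\<^sub>m (rdim M v)"
    using M unfolding brick_def by blast
  have "x w = x w * (\<theta> * (f w * x w))" using th cx by simp
  also have "\<dots> = (x w * g w) * f w * x w"
    unfolding g(2) assoc_mult_mat[OF cx th(1) cf]
    using assoc_mult_mat[OF cx mult_carrier_mat[OF th(1) cf] cx] assoc_mult_mat[OF th(1) cf cx] by simp
  also have "\<dots> = c \<cdot>\<^sub>m x w" unfolding c[OF w]
    using cx mult_smult_assoc_mat[OF one_carrier_mat cx, of c] by simp
  finally have e: "x w = c \<cdot>\<^sub>m x w" .
  obtain i where i: "i < rdim M w" "x w $$ (i, 0) \<noteq> 0"
  proof -
    have "\<exists>i<rdim M w. x w $$ (i, 0) \<noteq> 0"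
    proof (rule ccontr)
      assume "\<not> ?thesis"
      then have "x w = 0\<^sub>m (rdim M w) 1" using cx by (intro eq_matI) auto
      then show False using x by simp
    qed
    then show ?thesis using that by blast
  qed
  have "x w $$ (i, 0) = c * x w $$ (i, 0)" using arg_cong[OF e, of "\<lambda>m. m $$ (i, 0)"] i cx by simp
  then have "c = 1" using i by simp
  then have "(x v * g v) * f v = 1\<^sub>m (rdim M v)" if "v \<in> I" for v using c[OF that] by (auto intro!: eq_matI)
  then show ?thesis using that g th by blast
qed

text \<open>The case \<open>Y = M\<close> of \<open>brick_inj_splits\<close>: the compositions of \<open>x\<close> and \<open>g\<close> in both orders are identities.\<close>

lemma brick_inj_dim:
  assumes M: "brick M" and w: "w \<in> I" and x: "hom (inj_rep w) M x" "x w \<noteq> 0\<^sub>m (rdim M w) 1"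
    and v: "v \<in> I"
  shows "dimv M v = pvec v w"
proof -
  have rM: "rep M" using M by (simp add: brick_def)
  have mono: "rep_mono n M M (\<lambda>v. 1\<^sub>m (rdim M v))"
    by (auto simp: rep_mono_def inj_on_def)
  obtain \<theta> g where g: "hom M (inj_rep w) g" "g w = \<theta>" "\<theta> * (1\<^sub>m (rdim M w) * x w) = 1\<^sub>m 1"
    "\<And>v. v \<in> I \<Longrightarrow> (x v * g v) * 1\<^sub>m (rdim M v) = 1\<^sub>m (rdim M v)"
    using brick_inj_splits[OF M w x rM hom_id_hom[OF rM] mono] by blast
  note cg = hom_carrier[OF g(1)] and cx = hom_carrier[OF x(1)]
  have xg: "x v * g v = 1\<^sub>m (rdim M v)" if "v \<in> I" for v using g(4)[OF that] cg[OF that] cx[OF that] by simp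
  have gx: "hom (inj_rep w) (inj_rep w) (\<lambda>v. g v * x v)" by (rule rep_hom_comp[OF rep_inj_rep rM rep_inj_rep x(1) g(1)])
  have gxw: "g w * x w = 1\<^sub>m 1" using g(2,3) cx[OF w] by simp
  have le: "rdim M v \<le> (if (v, w) \<in> Q\<^sup>* then 1 else 0)"
    using left_inverse_dim_le[OF cx[OF v] cg[OF v] xg[OF v]] by simp
  have "1 \<le> rdim M v" if vw: "(v, w) \<in> Q\<^sup>*"
  proof -
    have "g v * x v = 1\<^sub>m 1" using vw
    proof (induction rule: converse_rtrancl_induct)
      case base
      show ?case by (rule gxw)
    next
      case (step u v')
      then have uw: "(u, w) \<in> Q\<^sup>*" by auto
      have "u \<in> I" using Q_I step by auto
      then have "g u * x u \<in> carrier_mat 1 1" using hom_carrier[OF gx, of u] uw by simp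
      then show ?case using hom_comm[OF gx step(1)] step uw left_mult_one_mat[of "g u * x u" 1 1] by simp
    qed
    moreover have "g v \<in> carrier_mat 1 (rdim M v)" "x v \<in> carrier_mat (rdim M v) 1" using cg[OF v] cx[OF v] vw by auto
    ultimately show ?thesis using left_inverse_dim_le by blast
  qed
  then show ?thesis using le by (auto simp: dimv_def pvec_def)
qed

section \<open>Extensions as block representations\<close>

text \<open>The extension of \<open>T\<close> by \<open>M\<close> with class \<open>\<xi>\<close>.\<close>

definition ext_rep :: "'k::field qrep \<Rightarrow> 'k qrep \<Rightarrow> (nat \<times> nat \<Rightarrow> 'k mat) \<Rightarrow> 'k qrep" where
  "ext_rep M T \<xi> = \<lparr>rdim = (\<lambda>v. rdim M v + rdim T v),
     rmap = (\<lambda>a. four_block_mat (rmap M a) (\<xi> a) (0\<^sub>m (rdim T (snd a)) (rdim M (fst a))) (rmap T a))\<rparr>"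

lemma ext_rep_simps [simp]: "rdim (ext_rep M T \<xi>) v = rdim M v + rdim T v"
  "rmap (ext_rep M T \<xi>) (u, v) = four_block_mat (rmap M (u, v)) (\<xi> (u, v)) (0\<^sub>m (rdim T v) (rdim M u)) (rmap T (u, v))"
  by (simp_all add: ext_rep_def)

definition cocycle :: "'k::field qrep \<Rightarrow> 'k qrep \<Rightarrow> (nat \<times> nat \<Rightarrow> 'k mat) \<Rightarrow> bool" where
  "cocycle M T \<xi> \<longleftrightarrow> (\<forall>(u, v)\<in>Q. \<xi> (u, v) \<in> carrier_mat (rdim M v) (rdim T u))"

lemma cocycle_carrier: "cocycle M T \<xi> \<Longrightarrow> (u, v) \<in> Q \<Longrightarrow> \<xi> (u, v) \<in> carrier_mat (rdim M v) (rdim T u)"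
  by (auto simp: cocycle_def)

lemma rep_ext_rep:
  assumes "rep M" "rep T" shows "rep (ext_rep M T \<xi>)"
  unfolding is_rep_def
proof (clarify)
  fix u v assume a: "(u, v) \<in> Q"
  show "rmap (ext_rep M T \<xi>) (u, v) \<in> carrier_mat (rdim (ext_rep M T \<xi>) v) (rdim (ext_rep M T \<xi>) u)"
    unfolding ext_rep_simps by (rule four_block_carrier_mat[OF rep_carrier[OF assms(1) a] rep_carrier[OF assms(2) a]])
qed

lemma hom_into_ext:
  assumes M: "rep M" and T: "rep T" and xi: "cocycle M T \<xi>" and X: "rep X"
    and b: "\<And>v. v \<in> I \<Longrightarrow> \<beta> v \<in> carrier_mat (rdim M v) (rdim X v)"
    and d: "\<And>v. v \<in> I \<Longrightarrow> \<delta> v \<in> carrier_mat (rdim T v) (rdim X v)"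
  shows "hom X (ext_rep M T \<xi>) (\<lambda>v. col_block (\<beta> v) (\<delta> v)) \<longleftrightarrow> hom X T \<delta> \<and>
    (\<forall>(u, v)\<in>Q. \<beta> v * rmap X (u, v) = rmap M (u, v) * \<beta> u + \<xi> (u, v) * \<delta> u)"
proof -
  have key: "col_block (\<beta> v) (\<delta> v) * rmap X (u, v) = rmap (ext_rep M T \<xi>) (u, v) * col_block (\<beta> u) (\<delta> u) \<longleftrightarrow>
     \<beta> v * rmap X (u, v) = rmap M (u, v) * \<beta> u + \<xi> (u, v) * \<delta> u \<and> \<delta> v * rmap X (u, v) = rmap T (u, v) * \<delta> u"
    if a: "(u, v) \<in> Q" for u v
  proof -
    have I: "u \<in> I" "v \<in> I" using Q_I[OF a] by auto
    note c = b[OF I(1)] b[OF I(2)] d[OF I(1)] d[OF I(2)] rep_carrier[OF M a] rep_carrier[OF T a] rep_carrier[OF X a]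
      cocycle_carrier[OF xi a]
    have 1: "col_block (\<beta> v) (\<delta> v) * rmap X (u, v) = col_block (\<beta> v * rmap X (u, v)) (\<delta> v * rmap X (u, v))"
      by (rule col_block_times[OF c(2) c(4) c(7)])
    have 2: "rmap (ext_rep M T \<xi>) (u, v) * col_block (\<beta> u) (\<delta> u) =
       col_block (rmap M (u, v) * \<beta> u + \<xi> (u, v) * \<delta> u) (0\<^sub>m (rdim T v) (rdim M u) * \<beta> u + rmap T (u, v) * \<delta> u)"
      unfolding ext_rep_simps by (rule four_block_times_col_block[OF c(5) c(8) _ c(6) c(1) c(3)]) simp
    have 3: "0\<^sub>m (rdim T v) (rdim M u) * \<beta> u + rmap T (u, v) * \<delta> u = rmap T (u, v) * \<delta> u"
      using c by simp
    have ca: "\<beta> v * rmap X (u, v) \<in> carrier_mat (rdim M v) (rdim X u)" "\<delta> v * rmap X (u, v) \<in> carrier_mat (rdim T v) (rdim X u)"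
      "rmap M (u, v) * \<beta> u + \<xi> (u, v) * \<delta> u \<in> carrier_mat (rdim M v) (rdim X u)"
      "rmap T (u, v) * \<delta> u \<in> carrier_mat (rdim T v) (rdim X u)"
      by (intro add_carrier_mat mult_carrier_mat; rule c)+
    show ?thesis unfolding 1 2 3 using col_block_eq[OF _ ca(1,2,3,4)] by auto
  qed
  have cc: "col_block (\<beta> v) (\<delta> v) \<in> carrier_mat (rdim (ext_rep M T \<xi>) v) (rdim X v)" if "v \<in> I" for v
    using col_block_carrier[OF b[OF that] d[OF that]] by simp
  show ?thesis
  proof
    assume h: "hom X (ext_rep M T \<xi>) (\<lambda>v. col_block (\<beta> v) (\<delta> v))"
    show "hom X T \<delta> \<and> (\<forall>(u, v)\<in>Q. \<beta> v * rmap X (u, v) = rmap M (u, v) * \<beta> u + \<xi> (u, v) * \<delta> u)"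
      using key hom_comm[OF h] d by (auto intro!: homI)
  next
    assume h: "hom X T \<delta> \<and> (\<forall>(u, v)\<in>Q. \<beta> v * rmap X (u, v) = rmap M (u, v) * \<beta> u + \<xi> (u, v) * \<delta> u)"
    show "hom X (ext_rep M T \<xi>) (\<lambda>v. col_block (\<beta> v) (\<delta> v))"
    proof (rule homI)
      fix u v assume a: "(u, v) \<in> Q"
      then show "col_block (\<beta> v) (\<delta> v) * rmap X (u, v) = rmap (ext_rep M T \<xi>) (u, v) * col_block (\<beta> u) (\<delta> u)"
        using key[OF a] h hom_comm[of X T \<delta> u v] by auto
    qed (rule cc)
  qed
qed

lemma hom_from_ext:
  assumes M: "rep M" and T: "rep T" and xi: "cocycle M T \<xi>" and X: "rep X"
    and b: "\<And>v. v \<in> I \<Longrightarrow> \<alpha> v \<in> carrier_mat (rdim X v) (rdim M v)"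
    and d: "\<And>v. v \<in> I \<Longrightarrow> \<gamma> v \<in> carrier_mat (rdim X v) (rdim T v)"
  shows "hom (ext_rep M T \<xi>) X (\<lambda>v. row_block (\<alpha> v) (\<gamma> v)) \<longleftrightarrow> hom M X \<alpha> \<and>
    (\<forall>(u, v)\<in>Q. \<alpha> v * \<xi> (u, v) + \<gamma> v * rmap T (u, v) = rmap X (u, v) * \<gamma> u)"
proof -
  have key: "row_block (\<alpha> v) (\<gamma> v) * rmap (ext_rep M T \<xi>) (u, v) = rmap X (u, v) * row_block (\<alpha> u) (\<gamma> u) \<longleftrightarrow>
     \<alpha> v * rmap M (u, v) = rmap X (u, v) * \<alpha> u \<and> \<alpha> v * \<xi> (u, v) + \<gamma> v * rmap T (u, v) = rmap X (u, v) * \<gamma> u"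
    if a: "(u, v) \<in> Q" for u v
  proof -
    have I: "u \<in> I" "v \<in> I" using Q_I[OF a] by auto
    note c = b[OF I(1)] b[OF I(2)] d[OF I(1)] d[OF I(2)] rep_carrier[OF M a] rep_carrier[OF T a] rep_carrier[OF X a]
      cocycle_carrier[OF xi a]
    have 1: "rmap X (u, v) * row_block (\<alpha> u) (\<gamma> u) = row_block (rmap X (u, v) * \<alpha> u) (rmap X (u, v) * \<gamma> u)"
      by (rule times_row_block[OF c(1) c(3) c(7)])
    have 2: "row_block (\<alpha> v) (\<gamma> v) * rmap (ext_rep M T \<xi>) (u, v) =
       row_block (\<alpha> v * rmap M (u, v) + \<gamma> v * 0\<^sub>m (rdim T v) (rdim M u)) (\<alpha> v * \<xi> (u, v) + \<gamma> v * rmap T (u, v))"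
      unfolding ext_rep_simps by (rule row_block_times_four_block[OF c(2) c(4) c(5) c(8) _ c(6)]) simp
    have 3: "\<alpha> v * rmap M (u, v) + \<gamma> v * 0\<^sub>m (rdim T v) (rdim M u) = \<alpha> v * rmap M (u, v)"
      using c by simp
    have ca: "\<alpha> v * rmap M (u, v) \<in> carrier_mat (rdim X v) (rdim M u)"
      "\<alpha> v * \<xi> (u, v) + \<gamma> v * rmap T (u, v) \<in> carrier_mat (rdim X v) (rdim T u)"
      "rmap X (u, v) * \<alpha> u \<in> carrier_mat (rdim X v) (rdim M u)" "rmap X (u, v) * \<gamma> u \<in> carrier_mat (rdim X v) (rdim T u)"
      by (intro add_carrier_mat mult_carrier_mat; rule c)+
    show ?thesis unfolding 1 2 3 using row_block_eq[OF _ ca] by auto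
  qed
  have cc: "row_block (\<alpha> v) (\<gamma> v) \<in> carrier_mat (rdim X v) (rdim (ext_rep M T \<xi>) v)" if "v \<in> I" for v
    using row_block_carrier[OF b[OF that] d[OF that]] by simp
  show ?thesis
  proof
    assume h: "hom (ext_rep M T \<xi>) X (\<lambda>v. row_block (\<alpha> v) (\<gamma> v))"
    show "hom M X \<alpha> \<and> (\<forall>(u, v)\<in>Q. \<alpha> v * \<xi> (u, v) + \<gamma> v * rmap T (u, v) = rmap X (u, v) * \<gamma> u)"
      using key hom_comm[OF h] b by (auto intro!: homI)
  next
    assume h: "hom M X \<alpha> \<and> (\<forall>(u, v)\<in>Q. \<alpha> v * \<xi> (u, v) + \<gamma> v * rmap T (u, v) = rmap X (u, v) * \<gamma> u)"
    show "hom (ext_rep M T \<xi>) X (\<lambda>v. row_block (\<alpha> v) (\<gamma> v))"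
    proof (rule homI)
      fix u v assume a: "(u, v) \<in> Q"
      then show "row_block (\<alpha> v) (\<gamma> v) * rmap (ext_rep M T \<xi>) (u, v) = rmap X (u, v) * row_block (\<alpha> u) (\<gamma> u)"
        using key[OF a] h hom_comm[of M X \<alpha> u v] by auto
    qed (rule cc)
  qed
qed

definition ext_inj :: "'k::field qrep \<Rightarrow> 'k qrep \<Rightarrow> nat \<Rightarrow> 'k mat" where
  "ext_inj M T v = col_block (1\<^sub>m (rdim M v)) (0\<^sub>m (rdim T v) (rdim M v))"
definition ext_proj :: "'k::field qrep \<Rightarrow> 'k qrep \<Rightarrow> nat \<Rightarrow> 'k mat" where
  "ext_proj M T v = row_block (0\<^sub>m (rdim T v) (rdim M v)) (1\<^sub>m (rdim T v))"

lemma hom_ext_inj: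
  assumes M: "rep M" and T: "rep T" and xi: "cocycle M T \<xi>"
  shows "hom M (ext_rep M T \<xi>) (ext_inj M T)"
proof -
  have "hom M (ext_rep M T \<xi>) (\<lambda>v. col_block (1\<^sub>m (rdim M v)) (0\<^sub>m (rdim T v) (rdim M v)))"
  proof (subst hom_into_ext[OF M T xi M], simp, simp, intro conjI ballI)
    show "hom M T (\<lambda>v. 0\<^sub>m (rdim T v) (rdim M v))"
    proof (rule homI)
      fix u v assume a: "(u, v) \<in> Q"
      show "0\<^sub>m (rdim T v) (rdim M v) * rmap M (u, v) = rmap T (u, v) * 0\<^sub>m (rdim T u) (rdim M u)"
        using rep_carrier[OF M a] rep_carrier[OF T a] by simp
    qed simp
  next
    fix a assume "a \<in> Q"
    then obtain u v where a: "a = (u, v)" "(u, v) \<in> Q" by (cases a) auto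
    show "case a of (u, v) \<Rightarrow> 1\<^sub>m (rdim M v) * rmap M (u, v) =
       rmap M (u, v) * 1\<^sub>m (rdim M u) + \<xi> (u, v) * 0\<^sub>m (rdim T u) (rdim M u)"
      using a rep_carrier[OF M a(2)] cocycle_carrier[OF xi a(2)] by simp
  qed
  then show ?thesis by (simp add: ext_inj_def[abs_def])
qed

lemma hom_ext_proj:
  assumes M: "rep M" and T: "rep T" and xi: "cocycle M T \<xi>"
  shows "hom (ext_rep M T \<xi>) T (ext_proj M T)"
proof -
  have "hom (ext_rep M T \<xi>) T (\<lambda>v. row_block (0\<^sub>m (rdim T v) (rdim M v)) (1\<^sub>m (rdim T v)))"
  proof (subst hom_from_ext[OF M T xi T], simp, simp, intro conjI ballI)
    show "hom M T (\<lambda>v. 0\<^sub>m (rdim T v) (rdim M v))"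
    proof (rule homI)
      fix u v assume a: "(u, v) \<in> Q"
      show "0\<^sub>m (rdim T v) (rdim M v) * rmap M (u, v) = rmap T (u, v) * 0\<^sub>m (rdim T u) (rdim M u)"
        using rep_carrier[OF M a] rep_carrier[OF T a] by simp
    qed simp
  next
    fix a assume "a \<in> Q"
    then obtain u v where a: "a = (u, v)" "(u, v) \<in> Q" by (cases a) auto
    show "case a of (u, v) \<Rightarrow> 0\<^sub>m (rdim T v) (rdim M v) * \<xi> (u, v) + 1\<^sub>m (rdim T v) * rmap T (u, v) =
       rmap T (u, v) * 1\<^sub>m (rdim T u)"
      using a rep_carrier[OF T a(2)] cocycle_carrier[OF xi a(2)] by simp
  qed
  then show ?thesis by (simp add: ext_proj_def[abs_def])
qed

lemma ext_proj_col:
  assumes "\<beta> \<in> carrier_mat (rdim M v) z" "\<delta> \<in> carrier_mat (rdim T v) z"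
  shows "ext_proj M T v * col_block \<beta> \<delta> = \<delta>"
  unfolding ext_proj_def
  by (subst row_block_times_col_block[of _ "rdim T v" "rdim M v" _ "rdim T v" _ z]) (use assms in auto)

lemma ext_inj_row:
  assumes "\<alpha> \<in> carrier_mat z (rdim M v)" "\<gamma> \<in> carrier_mat z (rdim T v)"
  shows "row_block \<alpha> \<gamma> * ext_inj M T v = \<alpha>"
  unfolding ext_inj_def
  by (subst row_block_times_col_block[of _ z "rdim M v" _ "rdim T v" _ "rdim M v"]) (use assms in auto)

lemma ext_inj_carrier: "ext_inj M T v \<in> carrier_mat (rdim M v + rdim T v) (rdim M v)"
  unfolding ext_inj_def by (rule col_block_carrier) auto
lemma ext_proj_carrier: "ext_proj M T v \<in> carrier_mat (rdim T v) (rdim M v + rdim T v)"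
  unfolding ext_proj_def by (rule row_block_carrier) auto

lemma ext_short_exact:
  fixes M T :: "'k::field qrep"
  assumes M: "rep M" and T: "rep T" and xi: "cocycle M T \<xi>"
  shows "short_exact n Q M (ext_inj M T) (ext_rep M T \<xi>) (ext_proj M T) T"
  unfolding short_exact_def
proof (intro conjI)
  note ci = ext_inj_carrier[of M T] and cp = ext_proj_carrier[of M T]
  define L where "L = (\<lambda>v. row_block (1\<^sub>m (rdim M v)) (0\<^sub>m (rdim M v) (rdim T v)) :: 'k mat)"
  define S where "S = (\<lambda>v. col_block (0\<^sub>m (rdim M v) (rdim T v)) (1\<^sub>m (rdim T v)) :: 'k mat)"
  have cL: "L v \<in> carrier_mat (rdim M v) (rdim M v + rdim T v)" for v unfolding L_def by (rule row_block_carrier) auto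
  have cS: "S v \<in> carrier_mat (rdim M v + rdim T v) (rdim T v)" for v unfolding S_def by (rule col_block_carrier) auto
  have Li: "L v * ext_inj M T v = 1\<^sub>m (rdim M v)" for v unfolding L_def by (rule ext_inj_row) auto
  have pS: "ext_proj M T v * S v = 1\<^sub>m (rdim T v)" for v unfolding S_def by (rule ext_proj_col) auto
  have pi: "ext_proj M T v * ext_inj M T v = 0\<^sub>m (rdim T v) (rdim M v)" for v
    unfolding ext_inj_def by (rule ext_proj_col) auto
  have sum: "ext_inj M T v * L v + S v * ext_proj M T v = 1\<^sub>m (rdim M v + rdim T v)" for v
    unfolding ext_inj_def ext_proj_def L_def S_def by (rule split_sum_identity)
  show "rep_mono n M (ext_rep M T \<xi>) (ext_inj M T)"
    unfolding rep_mono_def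
  proof (intro ballI inj_onI)
    fix v and x y :: "'k vec" assume xy: "x \<in> carrier_vec (rdim M v)" "y \<in> carrier_vec (rdim M v)"
      and eq: "ext_inj M T v *\<^sub>v x = ext_inj M T v *\<^sub>v y"
    have "L v *\<^sub>v (ext_inj M T v *\<^sub>v x) = L v *\<^sub>v (ext_inj M T v *\<^sub>v y)" using eq by simp
    then show "x = y"
      using assoc_mult_mat_vec[OF cL ci xy(1)] assoc_mult_mat_vec[OF cL ci xy(2)] xy by (simp add: Li)
  qed
  show "rep_epi n (ext_rep M T \<xi>) T (ext_proj M T)"
    unfolding rep_epi_def
  proof (intro ballI equalityI subsetI)
    fix v and y :: "'k vec" assume y: "y \<in> carrier_vec (rdim T v)"
    have "y = ext_proj M T v *\<^sub>v (S v *\<^sub>v y)"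
      using assoc_mult_mat_vec[OF cp cS y] y by (simp add: pS)
    moreover have "S v *\<^sub>v y \<in> carrier_vec (rdim (ext_rep M T \<xi>) v)"
      using mult_mat_vec_carrier[OF cS y] by simp
    ultimately show "y \<in> (\<lambda>x. ext_proj M T v *\<^sub>v x) ` carrier_vec (rdim (ext_rep M T \<xi>) v)" by blast
  next
    fix v and y :: "'k vec" assume "y \<in> (\<lambda>x. ext_proj M T v *\<^sub>v x) ` carrier_vec (rdim (ext_rep M T \<xi>) v)"
    then show "y \<in> carrier_vec (rdim T v)" using mult_mat_vec_carrier[OF cp] by auto
  qed
  show "\<forall>i\<in>{1..n}. (\<lambda>x. ext_inj M T i *\<^sub>v x) ` carrier_vec (rdim M i) =
     {y \<in> carrier_vec (rdim (ext_rep M T \<xi>) i). ext_proj M T i *\<^sub>v y = 0\<^sub>v (rdim T i)}"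
  proof (intro ballI equalityI subsetI)
    fix v and y :: "'k vec" assume "y \<in> (\<lambda>x. ext_inj M T v *\<^sub>v x) ` carrier_vec (rdim M v)"
    then obtain x where x: "x \<in> carrier_vec (rdim M v)" "y = ext_inj M T v *\<^sub>v x" by auto
    have "ext_proj M T v *\<^sub>v y = 0\<^sub>m (rdim T v) (rdim M v) *\<^sub>v x"
      unfolding x(2) assoc_mult_mat_vec[OF cp ci x(1), symmetric] pi ..
    also have "\<dots> = 0\<^sub>v (rdim T v)" using x(1) by (intro eq_vecI) auto
    finally show "y \<in> {y \<in> carrier_vec (rdim (ext_rep M T \<xi>) v). ext_proj M T v *\<^sub>v y = 0\<^sub>v (rdim T v)}"
      using mult_mat_vec_carrier[OF ci x(1)] x(2) by simp
  next
    fix v and y :: "'k vec" assume "y \<in> {y \<in> carrier_vec (rdim (ext_rep M T \<xi>) v). ext_proj M T v *\<^sub>v y = 0\<^sub>v (rdim T v)}"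
    then have y: "y \<in> carrier_vec (rdim M v + rdim T v)" "ext_proj M T v *\<^sub>v y = 0\<^sub>v (rdim T v)" by auto
    have "y = (ext_inj M T v * L v + S v * ext_proj M T v) *\<^sub>v y" using y by (simp add: sum)
    also have "\<dots> = (ext_inj M T v * L v) *\<^sub>v y + (S v * ext_proj M T v) *\<^sub>v y"
      by (rule add_mult_distrib_mat_vec[OF mult_carrier_mat[OF ci cL] mult_carrier_mat[OF cS cp] y(1)])
    also have "\<dots> = ext_inj M T v *\<^sub>v (L v *\<^sub>v y) + S v *\<^sub>v 0\<^sub>v (rdim T v)"
      using assoc_mult_mat_vec[OF ci cL y(1)] assoc_mult_mat_vec[OF cS cp y(1)] y(2) by simp
    also have "S v *\<^sub>v 0\<^sub>v (rdim T v) = 0\<^sub>v (rdim M v + rdim T v)" using cS[of v] by (intro eq_vecI) auto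
    also have "ext_inj M T v *\<^sub>v (L v *\<^sub>v y) + 0\<^sub>v (rdim M v + rdim T v) = ext_inj M T v *\<^sub>v (L v *\<^sub>v y)"
      using mult_mat_vec_carrier[OF ci mult_mat_vec_carrier[OF cL y(1)]] by simp
    finally show "y \<in> (\<lambda>x. ext_inj M T v *\<^sub>v x) ` carrier_vec (rdim M v)"
      using mult_mat_vec_carrier[OF cL y(1)] by blast
  qed
qed (use M T xi rep_ext_rep hom_ext_inj hom_ext_proj in auto)

text \<open>The component of a section of the projection in \<open>M\<close> exhibits \<open>\<xi>\<close> as trivial.\<close>

lemma ext_proj_retraction:
  assumes M: "rep M" and T: "rep T" and xi: "cocycle M T \<xi>"
    and r: "is_retraction n Q (ext_rep M T \<xi>) T (ext_proj M T)"
  obtains \<beta> where "\<And>v. v \<in> I \<Longrightarrow> \<beta> v \<in> carrier_mat (rdim M v) (rdim T v)"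
    "\<And>u v. (u, v) \<in> Q \<Longrightarrow> \<beta> v * rmap T (u, v) = rmap M (u, v) * \<beta> u + \<xi> (u, v)"
proof -
  obtain h where h: "hom T (ext_rep M T \<xi>) h" "\<And>v. v \<in> I \<Longrightarrow> ext_proj M T v * h v = 1\<^sub>m (rdim T v)"
    using r unfolding retraction_iff by blast
  have "\<exists>\<beta> \<delta>. \<beta> \<in> carrier_mat (rdim M v) (rdim T v) \<and> \<delta> \<in> carrier_mat (rdim T v) (rdim T v) \<and> h v = col_block \<beta> \<delta>"
    if "v \<in> I" for v
    using col_block_split[of "h v" "rdim M v" "rdim T v" "rdim T v"] hom_carrier[OF h(1) that] by simp
  then obtain \<beta> \<delta> where bd: "\<And>v. v \<in> I \<Longrightarrow> \<beta> v \<in> carrier_mat (rdim M v) (rdim T v)"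
    "\<And>v. v \<in> I \<Longrightarrow> \<delta> v \<in> carrier_mat (rdim T v) (rdim T v)" "\<And>v. v \<in> I \<Longrightarrow> h v = col_block (\<beta> v) (\<delta> v)" by metis
  have d1: "\<delta> v = 1\<^sub>m (rdim T v)" if "v \<in> I" for v
    using h(2)[OF that] ext_proj_col[OF bd(1,2)[OF that]] bd(3)[OF that] by simp
  have "hom T (ext_rep M T \<xi>) (\<lambda>v. col_block (\<beta> v) (\<delta> v))"
    by (rule hom_cong[OF h(1)]) (rule bd(3))
  then have e: "\<forall>(u, v)\<in>Q. \<beta> v * rmap T (u, v) = rmap M (u, v) * \<beta> u + \<xi> (u, v) * \<delta> u"
    using hom_into_ext[OF M T xi T bd(1,2)] by blast
  have "\<beta> v * rmap T (u, v) = rmap M (u, v) * \<beta> u + \<xi> (u, v)" if a: "(u, v) \<in> Q" for u v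
    using e a d1 Q_I[OF a] cocycle_carrier[OF xi a] by fastforce
  then show ?thesis using that bd(1) by blast
qed

lemma minus_mat_eq:
  fixes A B D :: "'k::field mat"
  assumes "A = B + D" "B \<in> carrier_mat p q" "D \<in> carrier_mat p q" shows "A - B = D"
  using assms by (intro eq_matI) auto

section \<open>Almost split sequences\<close>

lemma smult_one_mult:
  fixes A :: "'k::field mat" assumes "A \<in> carrier_mat p q" shows "(c \<cdot>\<^sub>m 1\<^sub>m p) * A = c \<cdot>\<^sub>m A"
  using assms mult_smult_assoc_mat[OF one_carrier_mat assms, of c] by simp

lemma mat_add_diff:
  fixes A B :: "'k::field mat" assumes "A \<in> carrier_mat p q" "B \<in> carrier_mat p q" shows "A = B + (A - B)"
  using assms by (intro eq_matI) auto

lemma mat_neg_diff: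
  fixes A D :: "'k::field mat" assumes "A \<in> carrier_mat p q" "D \<in> carrier_mat p q" shows "- A - - (D + A) = D"
  using assms by (intro eq_matI) auto

lemma mat_add_neg_sum:
  fixes A Z :: "'k::field mat" assumes "A \<in> carrier_mat p q" "Z \<in> carrier_mat p q" shows "Z + - (A + Z) = - A"
  using assms by (intro eq_matI) auto

lemma mat_solve:
  fixes A B X :: "'k::field mat"
  assumes A: "A \<in> carrier_mat p q" and B: "B \<in> carrier_mat p q" and X: "X \<in> carrier_mat p q"
    and eq: "c \<cdot>\<^sub>m X + A = B + X" and c: "c \<noteq> 1"
  shows "inverse (1 - c) \<cdot>\<^sub>m A - inverse (1 - c) \<cdot>\<^sub>m B = X"
proof (rule eq_matI)
  fix i j assume "i < dim_row X" "j < dim_col X"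
  then have ij: "i < p" "j < q" using X by auto
  have "c * X $$ (i, j) + A $$ (i, j) = B $$ (i, j) + X $$ (i, j)"
    using arg_cong[OF eq, of "\<lambda>m. m $$ (i, j)"] ij A B X by simp
  then have "A $$ (i, j) - B $$ (i, j) = (1 - c) * X $$ (i, j)" by (simp add: algebra_simps)
  then show "(inverse (1 - c) \<cdot>\<^sub>m A - inverse (1 - c) \<cdot>\<^sub>m B) $$ (i, j) = X $$ (i, j)"
    using ij A B c by (simp add: right_diff_distrib[symmetric])
qed (use A B X in auto)

lemma ext_dual_comp:
  assumes X: "rep X" and Y: "rep Y" and M: "rep M" and h: "hom X Y h" and psi: "ext_dual X M \<psi>"
  shows "ext_dual Y M (\<lambda>(u, v). h u * \<psi> (u, v))"
  unfolding ext_dual_def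
proof (intro conjI ballI allI impI)
  fix a assume "a \<in> Q"
  then show "case a of (u, v) \<Rightarrow> (case (u, v) of (u, v) \<Rightarrow> h u * \<psi> (u, v)) \<in> carrier_mat (rdim Y u) (rdim M v)"
    using hom_carrier[OF h] ext_dual_carrier[OF psi] Q_I by fastforce
next
  fix v j i assume v: "v \<in> I" and j: "j < rdim Y v" and i: "i < rdim M v"
  note chv = hom_carrier[OF h v]
  have "(\<Sum>u | (u, v) \<in> Q. (rmap Y (u, v) * (h u * \<psi> (u, v))) $$ (j, i)) =
      (\<Sum>u | (u, v) \<in> Q. (h v * (rmap X (u, v) * \<psi> (u, v))) $$ (j, i))"
  proof (intro sum.cong refl)
    fix u assume "u \<in> {u. (u, v) \<in> Q}"
    then have a: "(u, v) \<in> Q" by simp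
    have u: "u \<in> I" using Q_I[OF a] by simp
    note c = hom_carrier[OF h u] ext_dual_carrier[OF psi a] rep_carrier[OF Y a] rep_carrier[OF X a]
    have "rmap Y (u, v) * (h u * \<psi> (u, v)) = h v * (rmap X (u, v) * \<psi> (u, v))"
      using assoc_mult_mat[OF c(3) c(1) c(2)] assoc_mult_mat[OF chv c(4) c(2)] hom_comm[OF h a] by simp
    then show "(rmap Y (u, v) * (h u * \<psi> (u, v))) $$ (j, i) = (h v * (rmap X (u, v) * \<psi> (u, v))) $$ (j, i)" by simp
  qed
  also have "\<dots> = (\<Sum>k<rdim X v. h v $$ (j, k) * (\<Sum>u | (u, v) \<in> Q. (rmap X (u, v) * \<psi> (u, v)) $$ (k, i)))"
    by (rule sum_mat_mult_entry[OF chv _ j i]) (auto intro: mult_carrier_mat[OF rep_carrier[OF X] ext_dual_carrier[OF psi]])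
  also have "\<dots> = (\<Sum>k<rdim X v. h v $$ (j, k) * (\<Sum>w | (v, w) \<in> Q. (\<psi> (v, w) * rmap M (v, w)) $$ (k, i)))"
    using psi v i unfolding ext_dual_def by (intro sum.cong) auto
  also have "\<dots> = (\<Sum>w | (v, w) \<in> Q. (h v * (\<psi> (v, w) * rmap M (v, w))) $$ (j, i))"
    by (rule sum_mat_mult_entry[OF chv _ j i, symmetric]) (auto intro: mult_carrier_mat[OF ext_dual_carrier[OF psi] rep_carrier[OF M]])
  also have "\<dots> = (\<Sum>w | (v, w) \<in> Q. (h v * \<psi> (v, w) * rmap M (v, w)) $$ (j, i))"
    by (intro sum.cong refl) (simp add: assoc_mult_mat[OF chv ext_dual_carrier[OF psi] rep_carrier[OF M]])
  finally show "(\<Sum>u | (u, v) \<in> Q. (rmap Y (u, v) * (case (u, v) of (u, v) \<Rightarrow> h u * \<psi> (u, v))) $$ (j, i)) =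
      (\<Sum>w | (v, w) \<in> Q. ((case (v, w) of (u, v) \<Rightarrow> h u * \<psi> (u, v)) * rmap M (v, w)) $$ (j, i))" by simp
qed

end

text \<open>The pairing with the universal element \<open>\<Psi>\<close> identifies classes of extensions of \<open>T\<close> by \<open>M\<close> with linear
  forms on the endomorphisms of \<open>T\<close>; for a brick \<open>T\<close> only the value on the identity counts, and the
  extensions of value \<open>1\<close> are almost split.\<close>

locale ar_triple = dynkin_quiver n C Q l for n C Q l +
  fixes M T :: "'k::field qrep" and \<Psi> \<xi> :: "nat \<times> nat \<Rightarrow> 'k mat"
  assumes brick_M: "brick M" and brick_T: "brick T" and universal: "is_inverse_translate M T \<Psi>"
    and cocycle_xi: "cocycle M T \<xi>" and xi_one: "(\<Sum>(u, v)\<in>Q. trace_pairing (\<Psi> (u, v)) (\<xi> (u, v))) = 1"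
begin

lemma reps: "rep M" "rep T" using brick_M brick_T by (auto simp: brick_def)
lemma dual_Psi: "ext_dual T M \<Psi>" using universal by (simp add: is_inverse_translate_def)

lemma xi_not_boundary:
  assumes "\<And>v. v \<in> I \<Longrightarrow> f v \<in> carrier_mat (rdim M v) (rdim T v)"
    "\<And>u v. (u, v) \<in> Q \<Longrightarrow> f v * rmap T (u, v) - rmap M (u, v) * f u = \<xi> (u, v)"
  shows False
proof -
  have "(\<Sum>(u, v)\<in>Q. trace_pairing (\<Psi> (u, v)) (\<xi> (u, v))) = (\<Sum>(u, v)\<in>Q. trace_pairing (\<Psi> (u, v)) (f v * rmap T (u, v) - rmap M (u, v) * f u))"
    using assms(2) by (intro sum.cong) auto
  then show False using ext_dual_boundary[OF reps(2,1) dual_Psi assms(1)] xi_one by simp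
qed

lemma proj_not_retraction: "\<not> is_retraction n Q (ext_rep M T \<xi>) T (ext_proj M T)"
proof
  assume "is_retraction n Q (ext_rep M T \<xi>) T (ext_proj M T)"
  then obtain \<beta> where b: "\<And>v. v \<in> I \<Longrightarrow> \<beta> v \<in> carrier_mat (rdim M v) (rdim T v)"
    "\<And>u v. (u, v) \<in> Q \<Longrightarrow> \<beta> v * rmap T (u, v) = rmap M (u, v) * \<beta> u + \<xi> (u, v)"
    using ext_proj_retraction[OF reps cocycle_xi] by blast
  have "\<beta> v * rmap T (u, v) - rmap M (u, v) * \<beta> u = \<xi> (u, v)" if a: "(u, v) \<in> Q" for u v
    by (rule minus_mat_eq[OF b(2)[OF a] mult_carrier_mat[OF rep_carrier[OF reps(1) a] b(1)] cocycle_carrier[OF cocycle_xi a]])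
      (use Q_I[OF a] in simp)
  then show False using xi_not_boundary[OF b(1)] by blast
qed

text \<open>The pulled back class \<open>\<xi> h\<close> is trivial if it pairs to \<open>0\<close> with every \<open>\<psi> = p \<Psi>\<close>. The pairing is the one of \<open>h p\<close> with
  \<open>\<xi>\<close>, where \<open>h p\<close> is a scalar since \<open>T\<close> is a brick, and the scalar is \<open>0\<close> since \<open>h\<close> is not a retraction.\<close>

lemma lift_to_middle:
  assumes X: "rep X" and h: "hom X T h" and nr: "\<not> is_retraction n Q X T h"
  obtains \<beta> where "\<And>v. v \<in> I \<Longrightarrow> \<beta> v \<in> carrier_mat (rdim M v) (rdim X v)"
    "\<And>u v. (u, v) \<in> Q \<Longrightarrow> \<beta> v * rmap X (u, v) - rmap M (u, v) * \<beta> u = \<xi> (u, v) * h u"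
proof -
  have ceta: "\<xi> (u, v) * h u \<in> carrier_mat (rdim M v) (rdim X u)" if a: "(u, v) \<in> Q" for u v
    using cocycle_carrier[OF cocycle_xi a] hom_carrier[OF h, of u] Q_I[OF a] by auto
  have orth: "(\<Sum>(u, v)\<in>Q. trace_pairing (\<psi> (u, v)) (\<xi> (u, v) * h u)) = 0" if psi: "ext_dual X M \<psi>" for \<psi>
  proof -
    obtain p where p: "hom T X p" "\<And>a b. (a, b) \<in> Q \<Longrightarrow> \<psi> (a, b) = p a * \<Psi> (a, b)"
      using universal X psi unfolding is_inverse_translate_def by blast
    obtain c where c: "\<And>v. v \<in> I \<Longrightarrow> h v * p v = c \<cdot>\<^sub>m 1\<^sub>m (rdim T v)"
      using rep_hom_comp[OF reps(2) X reps(2) p(1) h] brick_T unfolding brick_def by blast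
    have "c = 0"
    proof (rule ccontr)
      assume c0: "c \<noteq> 0"
      have "h v * (inverse c \<cdot>\<^sub>m p v) = 1\<^sub>m (rdim T v)" if v: "v \<in> I" for v
        using mult_smult_distrib[OF hom_carrier[OF h v] hom_carrier[OF p(1) v], of "inverse c"] c[OF v] c0
        by (auto intro!: eq_matI)
      then have "is_retraction n Q X T h" unfolding retraction_iff
        using hom_scale[OF reps(2) X p(1), of "inverse c"] by blast
      then show False using nr by simp
    qed
    have "trace_pairing (\<psi> (u, v)) (\<xi> (u, v) * h u) = 0" if a: "(u, v) \<in> Q" for u v
    proof -
      have uI: "u \<in> I" using Q_I[OF a] by simp
      have "trace_pairing (\<psi> (u, v)) (\<xi> (u, v) * h u) = trace_pairing (h u * p u * \<Psi> (u, v)) (\<xi> (u, v))"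
        unfolding p(2)[OF a]
        by (rule trace_pairing_cyclic[OF hom_carrier[OF p(1) uI] ext_dual_carrier[OF dual_Psi a]
            cocycle_carrier[OF cocycle_xi a] hom_carrier[OF h uI]])
      also have "h u * p u * \<Psi> (u, v) = 0\<^sub>m (rdim T u) (rdim M v)"
        unfolding c[OF uI] \<open>c = 0\<close> smult_one_mult[OF ext_dual_carrier[OF dual_Psi a]]
        using ext_dual_carrier[OF dual_Psi a] by (intro eq_matI) auto
      finally show ?thesis using cocycle_carrier[OF cocycle_xi a] by (simp add: trace_pairing_carrier)
    qed
    then show ?thesis by (intro sum.neutral) auto
  qed
  have "\<exists>\<beta>. (\<forall>v\<in>I. \<beta> v \<in> carrier_mat (rdim M v) (rdim X v)) \<and>
      (\<forall>u v. (u, v) \<in> Q \<longrightarrow> \<beta> v * rmap X (u, v) - rmap M (u, v) * \<beta> u = (\<lambda>(u, v). \<xi> (u, v) * h u) (u, v))"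
    by (rule ext_vanishes[OF X reps(1), of "\<lambda>(u, v). \<xi> (u, v) * h u"]) (use ceta orth in auto)
  then show ?thesis using that by fastforce
qed

lemma right_almost_split_proj: "right_almost_split n Q (ext_rep M T \<xi>) T (ext_proj M T)"
  unfolding right_almost_split_def
proof (intro conjI allI impI)
  fix X h assume as: "is_rep Q X \<and> hom X T h \<and> \<not> is_retraction n Q X T h"
  then have X: "rep X" and h: "hom X T h" by auto
  obtain \<beta> where b: "\<And>v. v \<in> I \<Longrightarrow> \<beta> v \<in> carrier_mat (rdim M v) (rdim X v)"
    "\<And>u v. (u, v) \<in> Q \<Longrightarrow> \<beta> v * rmap X (u, v) - rmap M (u, v) * \<beta> u = \<xi> (u, v) * h u"
    using lift_to_middle[OF X h] as by blast
  have "\<beta> v * rmap X (u, v) = rmap M (u, v) * \<beta> u + \<xi> (u, v) * h u" if a: "(u, v) \<in> Q" for u v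
  proof -
    have c: "\<beta> v * rmap X (u, v) \<in> carrier_mat (rdim M v) (rdim X u)" "rmap M (u, v) * \<beta> u \<in> carrier_mat (rdim M v) (rdim X u)"
      using b(1)[of u] b(1)[of v] rep_carrier[OF X a] rep_carrier[OF reps(1) a] Q_I[OF a] by auto
    show ?thesis unfolding b(2)[OF a, symmetric] by (rule mat_add_diff[OF c])
  qed
  then have "hom X (ext_rep M T \<xi>) (\<lambda>v. col_block (\<beta> v) (h v))"
    using hom_into_ext[OF reps cocycle_xi X b(1) hom_carrier[OF h]] h by blast
  moreover have "hom_eq n (hom_comp (ext_proj M T) (\<lambda>v. col_block (\<beta> v) (h v))) h"
    unfolding hom_eq_I hom_comp_def using ext_proj_col[OF b(1) hom_carrier[OF h]] by simp
  ultimately show "\<exists>u. hom X (ext_rep M T \<xi>) u \<and> hom_eq n (hom_comp (ext_proj M T) u) h" by blast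
qed (rule proj_not_retraction)

lemma inj_not_section: "\<not> is_section n Q M (ext_rep M T \<xi>) (ext_inj M T)"
proof
  assume "is_section n Q M (ext_rep M T \<xi>) (ext_inj M T)"
  then obtain h where h: "hom (ext_rep M T \<xi>) M h" "\<And>v. v \<in> I \<Longrightarrow> h v * ext_inj M T v = 1\<^sub>m (rdim M v)"
    unfolding section_iff by blast
  have "\<exists>\<alpha> \<gamma>. \<alpha> \<in> carrier_mat (rdim M v) (rdim M v) \<and> \<gamma> \<in> carrier_mat (rdim M v) (rdim T v) \<and> h v = row_block \<alpha> \<gamma>"
    if "v \<in> I" for v
    using row_block_split[of "h v" "rdim M v" "rdim M v" "rdim T v"] hom_carrier[OF h(1) that] by simp
  then obtain \<alpha> \<gamma> where ag: "\<And>v. v \<in> I \<Longrightarrow> \<alpha> v \<in> carrier_mat (rdim M v) (rdim M v)"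
    "\<And>v. v \<in> I \<Longrightarrow> \<gamma> v \<in> carrier_mat (rdim M v) (rdim T v)" "\<And>v. v \<in> I \<Longrightarrow> h v = row_block (\<alpha> v) (\<gamma> v)" by metis
  have a1: "\<alpha> v = 1\<^sub>m (rdim M v)" if "v \<in> I" for v
    using h(2)[OF that] ext_inj_row[OF ag(1,2)[OF that]] ag(3)[OF that] by simp
  have "hom (ext_rep M T \<xi>) M (\<lambda>v. row_block (\<alpha> v) (\<gamma> v))"
    by (rule hom_cong[OF h(1)]) (rule ag(3))
  then have e: "\<And>u v. (u, v) \<in> Q \<Longrightarrow> \<alpha> v * \<xi> (u, v) + \<gamma> v * rmap T (u, v) = rmap M (u, v) * \<gamma> u"
    using hom_from_ext[OF reps cocycle_xi reps(1) ag(1,2)] by blast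
  show False
  proof (rule xi_not_boundary[of "\<lambda>v. - \<gamma> v"])
    fix v assume "v \<in> I" then show "- \<gamma> v \<in> carrier_mat (rdim M v) (rdim T v)" using ag by simp
  next
    fix u v assume a: "(u, v) \<in> Q"
    have I: "u \<in> I" "v \<in> I" using Q_I[OF a] by auto
    note c = ag(2)[OF I(1)] ag(2)[OF I(2)] rep_carrier[OF reps(1) a] rep_carrier[OF reps(2) a] cocycle_carrier[OF cocycle_xi a]
    have "\<xi> (u, v) + \<gamma> v * rmap T (u, v) = rmap M (u, v) * \<gamma> u" using e[OF a] a1[OF I(2)] c by simp
    moreover have "\<gamma> v * rmap T (u, v) \<in> carrier_mat (rdim M v) (rdim T u)" "rmap M (u, v) * \<gamma> u \<in> carrier_mat (rdim M v) (rdim T u)"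
      using c by auto
    moreover have "- \<gamma> v * rmap T (u, v) = - (\<gamma> v * rmap T (u, v))" "rmap M (u, v) * - \<gamma> u = - (rmap M (u, v) * \<gamma> u)"
      using c by auto
    ultimately show "- \<gamma> v * rmap T (u, v) - rmap M (u, v) * - \<gamma> u = \<xi> (u, v)"
    proof -
      assume eq: "\<xi> (u, v) + \<gamma> v * rmap T (u, v) = rmap M (u, v) * \<gamma> u"
        and cc: "\<gamma> v * rmap T (u, v) \<in> carrier_mat (rdim M v) (rdim T u)" "rmap M (u, v) * \<gamma> u \<in> carrier_mat (rdim M v) (rdim T u)"
        and neg: "- \<gamma> v * rmap T (u, v) = - (\<gamma> v * rmap T (u, v))" "rmap M (u, v) * - \<gamma> u = - (rmap M (u, v) * \<gamma> u)"
      show ?thesis unfolding neg eq[symmetric] by (rule mat_neg_diff[OF cc(1) c(5)])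
    qed
  qed
qed

text \<open>Consider the pushout of the extension along \<open>h : M \<rightarrow> X\<close>. If it did not split, its projection to \<open>T\<close> would lift to the
  middle term, and the lift would present \<open>\<xi>\<close> as \<open>c \<xi>\<close> up to trivial classes, with \<open>c \<noteq> 1\<close> since \<open>h\<close> is not a section. A
  splitting of the pushout extends \<open>h\<close> to the middle term.\<close>

lemma left_almost_split_inj: "left_almost_split n Q M (ext_rep M T \<xi>) (ext_inj M T)"
  unfolding left_almost_split_def
proof (intro conjI allI impI)
  fix X h assume as: "is_rep Q X \<and> hom M X h \<and> \<not> is_section n Q M X h"
  then have X: "rep X" and h: "hom M X h" and ns: "\<not> is_section n Q M X h" by auto
  \<comment> \<open>the class of the pushout\<close>
  define \<zeta> where "\<zeta> = (\<lambda>(u, v). h v * \<xi> (u, v))"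
  have cz: "cocycle X T \<zeta>" unfolding cocycle_def \<zeta>_def
  proof (clarify)
    fix u v assume a: "(u, v) \<in> Q"
    then have v: "v \<in> I" using Q_I by auto
    show "h v * \<xi> (u, v) \<in> carrier_mat (rdim X v) (rdim T u)"
      by (rule mult_carrier_mat[OF hom_carrier[OF h v] cocycle_carrier[OF cocycle_xi a]])
  qed
  have "is_retraction n Q (ext_rep X T \<zeta>) T (ext_proj X T)"
  proof (rule ccontr)
    assume nr: "\<not> is_retraction n Q (ext_rep X T \<zeta>) T (ext_proj X T)"
    note Y = rep_ext_rep[OF X reps(2), of \<zeta>]
    obtain \<kappa> where k: "\<And>v. v \<in> I \<Longrightarrow> \<kappa> v \<in> carrier_mat (rdim M v) (rdim (ext_rep X T \<zeta>) v)"
      "\<And>u v. (u, v) \<in> Q \<Longrightarrow> \<kappa> v * rmap (ext_rep X T \<zeta>) (u, v) - rmap M (u, v) * \<kappa> u = \<xi> (u, v) * ext_proj X T u"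
      using lift_to_middle[OF Y hom_ext_proj[OF X reps(2) cz] nr] by blast
    have "\<exists>\<alpha> \<gamma>. \<alpha> \<in> carrier_mat (rdim M v) (rdim X v) \<and> \<gamma> \<in> carrier_mat (rdim M v) (rdim T v) \<and> \<kappa> v = row_block \<alpha> \<gamma>"
      if "v \<in> I" for v
      using row_block_split[of "\<kappa> v" "rdim M v" "rdim X v" "rdim T v"] k(1)[OF that] by simp
    then obtain \<alpha> \<gamma> where ag: "\<And>v. v \<in> I \<Longrightarrow> \<alpha> v \<in> carrier_mat (rdim M v) (rdim X v)"
      "\<And>v. v \<in> I \<Longrightarrow> \<gamma> v \<in> carrier_mat (rdim M v) (rdim T v)" "\<And>v. v \<in> I \<Longrightarrow> \<kappa> v = row_block (\<alpha> v) (\<gamma> v)" by metis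
    have ag_eq: "\<alpha> v * rmap X (u, v) = rmap M (u, v) * \<alpha> u \<and>
        \<alpha> v * h v * \<xi> (u, v) + \<gamma> v * rmap T (u, v) = rmap M (u, v) * \<gamma> u + \<xi> (u, v)" if a: "(u, v) \<in> Q" for u v
    proof -
      have I: "u \<in> I" "v \<in> I" using Q_I[OF a] by auto
      note c = ag(1)[OF I(1)] ag(1)[OF I(2)] ag(2)[OF I(1)] ag(2)[OF I(2)] rep_carrier[OF X a] rep_carrier[OF reps(2) a]
        rep_carrier[OF reps(1) a] cocycle_carrier[OF cocycle_xi a] hom_carrier[OF h I(2)]
      have 1: "\<kappa> v * rmap (ext_rep X T \<zeta>) (u, v) = row_block (\<alpha> v * rmap X (u, v)) (\<alpha> v * (h v * \<xi> (u, v)) + \<gamma> v * rmap T (u, v))"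
        unfolding ag(3)[OF I(2)] ext_rep_simps
        by (subst row_block_times_four_block[OF c(2,4,5) cocycle_carrier[OF cz a] _ c(6)]) (use c in \<open>auto simp: \<zeta>_def\<close>)
      have 2: "rmap M (u, v) * \<kappa> u = row_block (rmap M (u, v) * \<alpha> u) (rmap M (u, v) * \<gamma> u)"
        unfolding ag(3)[OF I(1)] by (rule times_row_block[OF c(1,3,7)])
      have 3: "\<xi> (u, v) * ext_proj X T u = row_block (0\<^sub>m (rdim M v) (rdim X u)) (\<xi> (u, v))"
        unfolding ext_proj_def by (subst times_row_block[of _ "rdim T u" "rdim X u" _ "rdim T u" _ "rdim M v"]) (use c in auto)
      have ca: "\<alpha> v * rmap X (u, v) \<in> carrier_mat (rdim M v) (rdim X u)"
        "\<alpha> v * (h v * \<xi> (u, v)) + \<gamma> v * rmap T (u, v) \<in> carrier_mat (rdim M v) (rdim T u)"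
        "rmap M (u, v) * \<alpha> u \<in> carrier_mat (rdim M v) (rdim X u)" "rmap M (u, v) * \<gamma> u \<in> carrier_mat (rdim M v) (rdim T u)"
        by (intro add_carrier_mat mult_carrier_mat; rule c)+
      have s: "rmap M (u, v) * \<gamma> u + \<xi> (u, v) \<in> carrier_mat (rdim M v) (rdim T u)" using ca c by simp
      have "row_block (\<alpha> v * rmap X (u, v)) (\<alpha> v * (h v * \<xi> (u, v)) + \<gamma> v * rmap T (u, v)) =
         row_block (rmap M (u, v) * \<alpha> u) (rmap M (u, v) * \<gamma> u + \<xi> (u, v))"
      proof -
        have "row_block (\<alpha> v * rmap X (u, v)) (\<alpha> v * (h v * \<xi> (u, v)) + \<gamma> v * rmap T (u, v)) =
           row_block (rmap M (u, v) * \<alpha> u) (rmap M (u, v) * \<gamma> u) + row_block (0\<^sub>m (rdim M v) (rdim X u)) (\<xi> (u, v))"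
          unfolding 3[symmetric] k(2)[OF a, symmetric] 1 2
          using row_block_carrier[OF ca(1,2)] row_block_carrier[OF ca(3,4)] by (intro eq_matI) auto
        also have "\<dots> = row_block (rmap M (u, v) * \<alpha> u) (rmap M (u, v) * \<gamma> u + \<xi> (u, v))"
          by (rule row_block_add_zero[OF ca(3,4) c(8)])
        finally show ?thesis .
      qed
      then have "\<alpha> v * rmap X (u, v) = rmap M (u, v) * \<alpha> u"
        "\<alpha> v * (h v * \<xi> (u, v)) + \<gamma> v * rmap T (u, v) = rmap M (u, v) * \<gamma> u + \<xi> (u, v)"
        using row_block_eq[OF _ ca(1,2,3) s] by auto
      then show ?thesis using assoc_mult_mat[OF c(2) c(9) c(8)] by simp
    qed
    have "hom X M \<alpha>" using ag(1) ag_eq by (intro homI) auto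
    then obtain c where c: "\<And>v. v \<in> I \<Longrightarrow> \<alpha> v * h v = c \<cdot>\<^sub>m 1\<^sub>m (rdim M v)"
      using rep_hom_comp[OF reps(1) X reps(1) h] brick_M unfolding brick_def by blast
    have "c \<noteq> 1"
    proof
      assume "c = 1"
      then have "\<alpha> v * h v = 1\<^sub>m (rdim M v)" if "v \<in> I" for v using c[OF that] by (auto intro!: eq_matI)
      then show False using ns \<open>hom X M \<alpha>\<close> unfolding section_iff by blast
    qed
    define f where "f = (\<lambda>v. inverse (1 - c) \<cdot>\<^sub>m \<gamma> v)"
    show False
    proof (rule xi_not_boundary[of f])
      fix v assume "v \<in> I" then show "f v \<in> carrier_mat (rdim M v) (rdim T v)" using ag by (simp add: f_def)
    next
      fix u v assume a: "(u, v) \<in> Q"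
      have I: "u \<in> I" "v \<in> I" using Q_I[OF a] by auto
      note ca = ag(2)[OF I(1)] ag(2)[OF I(2)] rep_carrier[OF reps(1) a] rep_carrier[OF reps(2) a] cocycle_carrier[OF cocycle_xi a]
      have e: "c \<cdot>\<^sub>m \<xi> (u, v) + \<gamma> v * rmap T (u, v) = rmap M (u, v) * \<gamma> u + \<xi> (u, v)"
        using ag_eq[OF a] c[OF I(2)] smult_one_mult[OF ca(5)] by simp
      have cc: "\<gamma> v * rmap T (u, v) \<in> carrier_mat (rdim M v) (rdim T u)" "rmap M (u, v) * \<gamma> u \<in> carrier_mat (rdim M v) (rdim T u)"
        using ca by auto
      have f1: "f v * rmap T (u, v) = inverse (1 - c) \<cdot>\<^sub>m (\<gamma> v * rmap T (u, v))"
        unfolding f_def by (rule mult_smult_assoc_mat[OF ca(2) ca(4)])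
      have f2: "rmap M (u, v) * f u = inverse (1 - c) \<cdot>\<^sub>m (rmap M (u, v) * \<gamma> u)"
        unfolding f_def by (rule mult_smult_distrib[OF ca(3) ca(1)])
      show "f v * rmap T (u, v) - rmap M (u, v) * f u = \<xi> (u, v)"
        unfolding f1 f2 by (rule mat_solve[OF cc ca(5) e \<open>c \<noteq> 1\<close>])
    qed
  qed
  then obtain \<beta> where b: "\<And>v. v \<in> I \<Longrightarrow> \<beta> v \<in> carrier_mat (rdim X v) (rdim T v)"
    "\<And>u v. (u, v) \<in> Q \<Longrightarrow> \<beta> v * rmap T (u, v) = rmap X (u, v) * \<beta> u + \<zeta> (u, v)"
    using ext_proj_retraction[OF X reps(2) cz] by blast
  have "h v * \<xi> (u, v) + (- \<beta> v) * rmap T (u, v) = rmap X (u, v) * (- \<beta> u)" if a: "(u, v) \<in> Q" for u v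
  proof -
    have I: "u \<in> I" "v \<in> I" using Q_I[OF a] by auto
    note c = b(1)[OF I(1)] b(1)[OF I(2)] rep_carrier[OF X a] rep_carrier[OF reps(2) a] cocycle_carrier[OF cz a]
    have cc: "rmap X (u, v) * \<beta> u \<in> carrier_mat (rdim X v) (rdim T u)" using c by auto
    have "- \<beta> v * rmap T (u, v) = - (rmap X (u, v) * \<beta> u + \<zeta> (u, v))" "rmap X (u, v) * - \<beta> u = - (rmap X (u, v) * \<beta> u)"
      using c b(2)[OF a] by auto
    moreover have "h v * \<xi> (u, v) = \<zeta> (u, v)" by (simp add: \<zeta>_def)
    ultimately show ?thesis using mat_add_neg_sum[OF cc c(5)] by simp
  qed
  then have "hom (ext_rep M T \<xi>) X (\<lambda>v. row_block (h v) (- \<beta> v))"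
    using hom_from_ext[OF reps cocycle_xi X hom_carrier[OF h], of "\<lambda>v. - \<beta> v"] h b(1) by auto
  moreover have "hom_eq n (hom_comp (\<lambda>v. row_block (h v) (- \<beta> v)) (ext_inj M T)) h"
    unfolding hom_eq_I hom_comp_def using ext_inj_row[OF hom_carrier[OF h], of _ "- \<beta> _"] b(1) by simp
  ultimately show "\<exists>u. hom (ext_rep M T \<xi>) X u \<and> hom_eq n (hom_comp u (ext_inj M T)) h" by blast
qed (rule inj_not_section)

lemma almost_split: "almost_split_sequence n Q M (ext_inj M T) (ext_rep M T \<xi>) (ext_proj M T) T"
  unfolding almost_split_sequence_def
  using ext_short_exact[OF reps cocycle_xi] left_almost_split_inj right_almost_split_proj by blast

end

section \<open>Orbits of the inverse translate and the set $G_c$\<close>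

context dynkin_quiver begin

lemma ext_dual_zero_entries:
  fixes \<Psi> :: "nat \<times> nat \<Rightarrow> 'k::field mat"
  assumes "ext_dual T M \<Psi>" "\<And>u v j i. (u, v) \<in> Q \<Longrightarrow> j < rdim T u \<Longrightarrow> i < rdim M v \<Longrightarrow> \<Psi> (u, v) $$ (j, i) = 0"
    "(u, v) \<in> Q"
  shows "\<Psi> (u, v) = 0\<^sub>m (rdim T u) (rdim M v)"
  using ext_dual_carrier[OF assms(1,3)] assms(2)[OF assms(3)] by (intro eq_matI) auto

text \<open>\<open>Hom(T, M) = 0\<close> because \<open>Ext(M, M) = 0\<close>, so the dual of \<open>Ext(T, M)\<close> has dimension \<open>- \<langle>dim T, dim M\<rangle> = 1\<close>. It is also the
  endomorphism space of \<open>T\<close>, by the universal property.\<close>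

lemma inverse_translate_brick:
  fixes M T :: "'k::field qrep"
  assumes M: "brick M" and q: "euler (dimv M) (dimv M) = 1" and univ: "is_inverse_translate M T \<Psi>"
    and dT: "\<And>w. w \<in> I \<Longrightarrow> dimv T w = cox (dimv M) w"
  shows "brick T \<and> (\<exists>\<xi>. ar_triple n C Q l M T \<Psi> \<xi>)"
proof -
  have rM: "rep M" using M by (simp add: brick_def)
  have rT: "rep T" and dP: "ext_dual T M \<Psi>" using univ by (auto simp: is_inverse_translate_def)
  note cP = ext_dual_carrier[OF dP]
  have uniq: "u v = u' v" if "rep X" "hom T X u" "hom T X u'" "\<And>a b. (a, b) \<in> Q \<Longrightarrow> u a * \<Psi> (a, b) = u' a * \<Psi> (a, b)" "v \<in> I"
    for X u u' v using univ that unfolding is_inverse_translate_def by blast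
  have zero_hom: "hom T X (\<lambda>v. 0\<^sub>m (rdim X v) (rdim T v))" if X: "rep X" for X
  proof (rule homI)
    fix u v assume a: "(u, v) \<in> Q"
    show "0\<^sub>m (rdim X v) (rdim T v) * rmap T (u, v) = rmap X (u, v) * 0\<^sub>m (rdim X u) (rdim T u)"
      using rep_carrier[OF rT a] rep_carrier[OF X a] by simp
  qed simp
  have nh: "no_hom T M" unfolding no_hom_def
  proof (intro allI impI ballI)
    fix h v assume h: "hom T M h" and v: "v \<in> I"
    show "h v = 0\<^sub>m (rdim M v) (rdim T v)"
    proof (rule uniq[OF rM h zero_hom[OF rM] _ v])
      fix a b assume ab: "(a, b) \<in> Q"
      have "h a * \<Psi> (a, b) = 0\<^sub>m (rdim M a) (rdim M b)"
        using brick_rigid[OF M q ext_dual_comp[OF rT rM rM h dP] ab] by simp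
      then show "h a * \<Psi> (a, b) = 0\<^sub>m (rdim M a) (rdim T a) * \<Psi> (a, b)" using cP[OF ab] by simp
    qed
  qed
  have tt: "euler (dimv T) (dimv T) = 1"
  proof -
    have "euler (dimv T) (dimv T) = euler (cox (dimv M)) (cox (dimv M))" using dT by (intro euler_cong)
    then show ?thesis using q by (simp add: euler_cox_cox)
  qed
  have tm: "euler (dimv T) (dimv M) = - 1"
  proof -
    have "euler (dimv T) (dimv M) = euler (cox (dimv M)) (dimv M)" using dT by (intro euler_cong) auto
    then show ?thesis using q by (simp add: euler_cox)
  qed
  obtain N z where N: "int N = - euler (dimv T) (dimv M)" and z: "ext_basis T M N z"
    using ext_basis_exists[OF rT rM nh] by blast
  have N1: "N = 1" using N tm by simp
  have coord: "\<exists>c. \<forall>u v j i. (u, v) \<in> Q \<longrightarrow> j < rdim T u \<longrightarrow> i < rdim M v \<longrightarrow> \<psi> (u, v) $$ (j, i) = c * z 0 (u, v) $$ (j, i)"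
    if psi: "ext_dual T M \<psi>" for \<psi>
  proof -
    obtain c where c: "\<forall>(u, v)\<in>Q. \<forall>j<rdim T u. \<forall>i<rdim M v. \<psi> (u, v) $$ (j, i) = (\<Sum>k<N. c k * z k (u, v) $$ (j, i))"
      using z[unfolded ext_basis_def, THEN conjunct2, THEN conjunct1, THEN spec, THEN mp, OF psi] by (rule exE)
    then show ?thesis unfolding N1 by (intro exI[of _ "c 0"]) auto
  qed
  have not_zero: "\<not> zero_rep n T"
  proof
    assume "zero_rep n T"
    then have "euler (dimv T) (dimv T) = euler (\<lambda>_. 0) (\<lambda>_. 0)"
      by (intro euler_cong) (auto simp: zero_rep_iff dimv_def)
    then show False using tt by (simp add: euler_zero_left)
  qed
  \<comment> \<open>if the universal element were zero, the identity and the zero map of \<open>T\<close> would agree\<close>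
  have ex: "\<exists>u v j i. (u, v) \<in> Q \<and> j < rdim T u \<and> i < rdim M v \<and> \<Psi> (u, v) $$ (j, i) \<noteq> 0"
  proof (rule ccontr)
    assume "\<not> ?thesis"
    then have "\<Psi> (u, v) = 0\<^sub>m (rdim T u) (rdim M v)" if "(u, v) \<in> Q" for u v
      using ext_dual_zero_entries[OF dP _ that] by blast
    then have e: "1\<^sub>m (rdim T v) = (0\<^sub>m (rdim T v) (rdim T v) :: 'k mat)" if v: "v \<in> I" for v
    proof (intro uniq[OF rT hom_id_hom[OF rT] zero_hom[OF rT] _ v])
      fix a b assume "(a, b) \<in> Q" "\<And>u v. (u, v) \<in> Q \<Longrightarrow> \<Psi> (u, v) = 0\<^sub>m (rdim T u) (rdim M v)"
      then show "1\<^sub>m (rdim T a) * \<Psi> (a, b) = 0\<^sub>m (rdim T a) (rdim T a) * \<Psi> (a, b)" by simp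
    qed
    have "rdim T v = 0" if v: "v \<in> I" for v
    proof (rule ccontr)
      assume "rdim T v \<noteq> 0"
      then have "(1\<^sub>m (rdim T v) :: 'k mat) $$ (0, 0) \<noteq> 0\<^sub>m (rdim T v) (rdim T v) $$ (0, 0)" by simp
      then show False using e[OF v] by simp
    qed
    then show False using not_zero by (simp add: zero_rep_iff)
  qed
  obtain a where a: "\<And>u v j i. (u, v) \<in> Q \<Longrightarrow> j < rdim T u \<Longrightarrow> i < rdim M v \<Longrightarrow> \<Psi> (u, v) $$ (j, i) = a * z 0 (u, v) $$ (j, i)"
    using coord[OF dP] by blast
  have a0: "a \<noteq> 0" using ex a by auto
  have bT: "brick T" unfolding brick_def
  proof (intro conjI allI impI rT not_zero)
    fix e assume e: "hom T T e"
    obtain b where b: "\<And>u v j i. (u, v) \<in> Q \<Longrightarrow> j < rdim T u \<Longrightarrow> i < rdim M v \<Longrightarrow>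
        (e u * \<Psi> (u, v)) $$ (j, i) = b * z 0 (u, v) $$ (j, i)"
    proof -
      from coord[OF ext_dual_comp[OF rT rT rM e dP]] obtain b where
        "\<forall>u v j i. (u, v) \<in> Q \<longrightarrow> j < rdim T u \<longrightarrow> i < rdim M v \<longrightarrow>
          (case (u, v) of (u, v) \<Rightarrow> e u * \<Psi> (u, v)) $$ (j, i) = b * z 0 (u, v) $$ (j, i)" by (rule exE)
      then show thesis by (intro that[of b]) simp
    qed
    have "e v = (b / a) \<cdot>\<^sub>m 1\<^sub>m (rdim T v)" if v: "v \<in> I" for v
    proof (rule uniq[OF rT e hom_scale[OF rT rT hom_id_hom[OF rT]] _ v])
      fix u w assume uw: "(u, w) \<in> Q"
      have uI: "u \<in> I" using Q_I[OF uw] by simp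
      show "e u * \<Psi> (u, w) = ((b / a) \<cdot>\<^sub>m 1\<^sub>m (rdim T u)) * \<Psi> (u, w)"
        unfolding smult_one_mult[OF cP[OF uw]]
      proof (rule eq_matI)
        fix j i assume "j < dim_row ((b / a) \<cdot>\<^sub>m \<Psi> (u, w))" "i < dim_col ((b / a) \<cdot>\<^sub>m \<Psi> (u, w))"
        then have ji: "j < rdim T u" "i < rdim M w" using cP[OF uw] by auto
        show "(e u * \<Psi> (u, w)) $$ (j, i) = ((b / a) \<cdot>\<^sub>m \<Psi> (u, w)) $$ (j, i)"
          using b[OF uw ji] a[OF uw ji] a0 ji cP[OF uw] by simp
      qed (use cP[OF uw] hom_carrier[OF e uI] in auto)
    qed
    then show "\<exists>c. \<forall>v\<in>I. e v = c \<cdot>\<^sub>m 1\<^sub>m (rdim T v)" by blast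
  qed
  obtain u0 v0 j0 i0 where e: "(u0, v0) \<in> Q" "j0 < rdim T u0" "i0 < rdim M v0" "\<Psi> (u0, v0) $$ (j0, i0) \<noteq> 0"
    using ex by blast
  \<comment> \<open>any class dual to a nonzero entry of \<open>\<Psi>\<close> will do\<close>
  define \<xi> where "\<xi> = (\<lambda>(u, v). mat (rdim M v) (rdim T u)
      (\<lambda>(i, j). if u = u0 \<and> v = v0 \<and> i = i0 \<and> j = j0 then 1 / \<Psi> (u0, v0) $$ (j0, i0) else 0))"
  have "(\<Sum>(u, v)\<in>Q. trace_pairing (\<Psi> (u, v)) (\<xi> (u, v))) = (\<Sum>p\<in>Q. if p = (u0, v0) then 1 else 0)"
  proof (intro sum.cong refl, clarify)
    fix u v assume "(u, v) \<in> Q"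
    have "trace_pairing (\<Psi> (u, v)) (\<xi> (u, v)) = (\<Sum>i<rdim M v. \<Sum>j<rdim T u. if u = u0 \<and> v = v0 \<and> i = i0 \<and> j = j0 then 1 else 0)"
      using e by (subst trace_pairing_carrier[of _ "rdim M v" "rdim T u"]) (auto simp: \<xi>_def intro!: sum.cong)
    also have "\<dots> = (if (u, v) = (u0, v0) then 1 else 0)"
    proof (cases "(u, v) = (u0, v0)")
      case True
      have "(\<Sum>i<rdim M v. \<Sum>j<rdim T u. if u = u0 \<and> v = v0 \<and> i = i0 \<and> j = j0 then 1 else 0) =
        (\<Sum>i<rdim M v. if i = i0 then (\<Sum>j<rdim T u. if j = j0 then 1 else 0) else (0::'k))"
        using True by (intro sum.cong) auto
      then show ?thesis using True e by simp
    qed auto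
    finally show "trace_pairing (\<Psi> (u, v)) (\<xi> (u, v)) = (if (u, v) = (u0, v0) then 1 else 0)" .
  qed
  then have "(\<Sum>(u, v)\<in>Q. trace_pairing (\<Psi> (u, v)) (\<xi> (u, v))) = 1" using e(1) by simp
  then have "ar_triple n C Q l M T \<Psi> \<xi>"
    by unfold_locales (use M bT univ in \<open>auto simp: cocycle_def \<xi>_def\<close>)
  then show ?thesis using bT by blast
qed

lemma mat_add_zero_cancel:
  fixes A B :: "'k::field mat" assumes A: "A \<in> carrier_mat p q" and B: "B \<in> carrier_mat p q" and eq: "A + B = A"
  shows "B = 0\<^sub>m p q"
proof (rule eq_matI)
  fix i j assume ij: "i < dim_row (0\<^sub>m p q :: 'k mat)" "j < dim_col (0\<^sub>m p q :: 'k mat)"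
  then show "B $$ (i, j) = 0\<^sub>m p q $$ (i, j)"
    using arg_cong[OF eq, of "\<lambda>m. m $$ (i, j)"] A B by simp
qed (use B in auto)

lemma smult_inverse:
  fixes c :: "'k::field" assumes "c \<noteq> 0" shows "inverse c \<cdot>\<^sub>m (c \<cdot>\<^sub>m 1\<^sub>m p) = 1\<^sub>m p"
  using assms by (intro eq_matI) auto

lemma short_exact_reps: "short_exact n Q M f E g N \<Longrightarrow> rep M \<and> rep E \<and> rep N \<and> hom M E f \<and> hom E N g"
  by (auto simp: short_exact_def)

lemma short_exact_zero:
  fixes M E N :: "'k::field qrep"
  assumes s: "short_exact n Q M f E g N" and v: "v \<in> I"
  shows "g v * f v = 0\<^sub>m (rdim N v) (rdim M v)"
proof -
  have cf: "f v \<in> carrier_mat (rdim E v) (rdim M v)" and cg: "g v \<in> carrier_mat (rdim N v) (rdim E v)"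
    using short_exact_reps[OF s] hom_carrier v by auto
  have img: "(\<lambda>x. f v *\<^sub>v x) ` carrier_vec (rdim M v) = {y \<in> carrier_vec (rdim E v). g v *\<^sub>v y = 0\<^sub>v (rdim N v)}"
    using s v by (simp add: short_exact_def I_def)
  show ?thesis
  proof (rule mat_vec_zero[OF mult_carrier_mat[OF cg cf]])
    fix x :: "'k vec" assume x: "x \<in> carrier_vec (rdim M v)"
    then show "g v * f v *\<^sub>v x = 0\<^sub>v (rdim N v)" using img assoc_mult_mat_vec[OF cg cf x] by auto
  qed
qed

lemma kernel_col_factor:
  fixes M E N :: "'k::field qrep"
  assumes s: "short_exact n Q M f E g N" and v: "v \<in> I"
    and D: "D \<in> carrier_mat (rdim E v) r" and z: "g v * D = 0\<^sub>m (rdim N v) r"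
  obtains K where "K \<in> carrier_mat (rdim M v) r" "f v * K = D"
proof -
  have cf: "f v \<in> carrier_mat (rdim E v) (rdim M v)" and cg: "g v \<in> carrier_mat (rdim N v) (rdim E v)"
    using short_exact_reps[OF s] hom_carrier v by auto
  have img: "(\<lambda>x. f v *\<^sub>v x) ` carrier_vec (rdim M v) = {y \<in> carrier_vec (rdim E v). g v *\<^sub>v y = 0\<^sub>v (rdim N v)}"
    using s v by (simp add: short_exact_def I_def)
  have "col D j \<in> (\<lambda>x. f v *\<^sub>v x) ` carrier_vec (rdim M v)" if j: "j < r" for j
  proof -
    have "g v *\<^sub>v col D j = 0\<^sub>v (rdim N v)" using col_mult2[OF cg D j] j by (simp add: z)
    moreover have "col D j \<in> carrier_vec (rdim E v)" using D j by (auto intro: col_carrier_vec)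
    ultimately show ?thesis unfolding img by simp
  qed
  then show ?thesis using mat_factor[OF cf D] that by blast
qed

lemma cokernel_factor:
  fixes M E N X :: "'k::field qrep"
  assumes s: "short_exact n Q M f E g N" and X: "rep X" and h: "hom E X h"
    and z: "\<And>v. v \<in> I \<Longrightarrow> h v * f v = 0\<^sub>m (rdim X v) (rdim M v)"
  obtains k where "hom N X k" "\<And>v. v \<in> I \<Longrightarrow> k v * g v = h v"
proof -
  have r: "rep M" "rep E" "rep N" and f: "hom M E f" and g: "hom E N g" using short_exact_reps[OF s] by auto
  have "\<exists>S. S \<in> carrier_mat (rdim E v) (rdim N v) \<and> g v * S = 1\<^sub>m (rdim N v)" if v: "v \<in> I" for v
  proof -
    have "col (1\<^sub>m (rdim N v)) j \<in> (\<lambda>x. g v *\<^sub>v x) ` carrier_vec (rdim E v)" if "j < rdim N v" for j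
      using s v that by (auto simp: short_exact_def rep_epi_def I_def)
    then show ?thesis using mat_factor[OF hom_carrier[OF g v] one_carrier_mat] by blast
  qed
  then obtain S where S: "\<And>v. v \<in> I \<Longrightarrow> S v \<in> carrier_mat (rdim E v) (rdim N v)"
    "\<And>v. v \<in> I \<Longrightarrow> g v * S v = 1\<^sub>m (rdim N v)" by metis
  define k where "k = (\<lambda>v. h v * S v)"
  have kg: "k v * g v = h v" if v: "v \<in> I" for v
  proof -
    note c = hom_carrier[OF f v] hom_carrier[OF g v] hom_carrier[OF h v] S(1)[OF v]
    define D where "D = S v * g v - 1\<^sub>m (rdim E v)"
    have D: "D \<in> carrier_mat (rdim E v) (rdim E v)" using c unfolding D_def by auto
    have sg: "S v * g v = 1\<^sub>m (rdim E v) + D"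
      unfolding D_def by (rule mat_add_diff[OF mult_carrier_mat[OF c(4) c(2)] one_carrier_mat])
    have "g v * (S v * g v) = g v" using assoc_mult_mat[OF c(2) c(4) c(2)] S(2)[OF v] c by simp
    moreover have "g v * (1\<^sub>m (rdim E v) + D) = g v + g v * D" using mult_add_distrib_mat[OF c(2) one_carrier_mat D] c by simp
    ultimately have e: "g v + g v * D = g v" using sg by simp
    have gD: "g v * D \<in> carrier_mat (rdim N v) (rdim E v)" using c D by simp
    have "g v * D = 0\<^sub>m (rdim N v) (rdim E v)" by (rule mat_add_zero_cancel[OF c(2) gD e])
    then obtain K where K: "K \<in> carrier_mat (rdim M v) (rdim E v)" "f v * K = D" using kernel_col_factor[OF s v D] by blast
    have "h v * D = 0\<^sub>m (rdim X v) (rdim E v)"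
      unfolding K(2)[symmetric] using assoc_mult_mat[OF c(3) c(1) K(1)] z[OF v] K(1) by simp
    then have "h v * (S v * g v) = h v"
      unfolding sg mult_add_distrib_mat[OF c(3) one_carrier_mat D] using c by simp
    then show ?thesis using c by (simp add: k_def)
  qed
  have "hom N X k"
  proof (rule homI)
    fix v assume "v \<in> I" then show "k v \<in> carrier_mat (rdim X v) (rdim N v)"
      using hom_carrier[OF h] S unfolding k_def by (metis mult_carrier_mat)
  next
    fix u v assume a: "(u, v) \<in> Q"
    have I: "u \<in> I" "v \<in> I" using Q_I[OF a] by auto
    note c = hom_carrier[OF g I(1)] hom_carrier[OF g I(2)] hom_carrier[OF h I(1)] hom_carrier[OF h I(2)] S(1)[OF I(1)] S(1)[OF I(2)]
      rep_carrier[OF r(2) a] rep_carrier[OF r(3) a] rep_carrier[OF X a]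
    have ck: "k v \<in> carrier_mat (rdim X v) (rdim N v)" using c by (simp add: k_def)
    have "k v * rmap N (u, v) = k v * rmap N (u, v) * (g u * S u)" using S(2)[OF I(1)] c ck by simp
    also have "\<dots> = k v * (rmap N (u, v) * g u) * S u"
      using assoc_mult_mat[OF ck c(8) mult_carrier_mat[OF c(1) c(5)]] assoc_mult_mat[OF c(8) c(1) c(5)]
        assoc_mult_mat[OF ck mult_carrier_mat[OF c(8) c(1)] c(5)] by simp
    also have "\<dots> = (k v * g v) * rmap E (u, v) * S u"
      unfolding hom_comm[OF g a, symmetric] using assoc_mult_mat[OF ck c(2) c(7)] by simp
    also have "\<dots> = rmap X (u, v) * h u * S u" unfolding kg[OF I(2)] hom_comm[OF h a] ..
    also have "\<dots> = rmap X (u, v) * k u" unfolding k_def by (rule assoc_mult_mat[OF c(9) c(3) c(5)])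
    finally show "k v * rmap N (u, v) = rmap X (u, v) * k u" .
  qed
  then show ?thesis using that kg by blast
qed

lemma kernel_factor:
  fixes M E N X :: "'k::field qrep"
  assumes s: "short_exact n Q M f E g N" and X: "rep X" and h: "hom X E h"
    and z: "\<And>v. v \<in> I \<Longrightarrow> g v * h v = 0\<^sub>m (rdim N v) (rdim X v)"
  obtains k where "hom X M k" "\<And>v. v \<in> I \<Longrightarrow> f v * k v = h v"
proof -
  have r: "rep M" "rep E" "rep N" and f: "hom M E f" and g: "hom E N g" using short_exact_reps[OF s] by auto
  have "\<exists>K. K \<in> carrier_mat (rdim M v) (rdim X v) \<and> f v * K = h v" if v: "v \<in> I" for v
    using kernel_col_factor[OF s v hom_carrier[OF h v] z[OF v]] by blast
  then obtain k where k: "\<And>v. v \<in> I \<Longrightarrow> k v \<in> carrier_mat (rdim M v) (rdim X v)" "\<And>v. v \<in> I \<Longrightarrow> f v * k v = h v" by metis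
  have "hom X M k"
  proof (rule homI)
    fix u v assume a: "(u, v) \<in> Q"
    have I: "u \<in> I" "v \<in> I" using Q_I[OF a] by auto
    note c = hom_carrier[OF f I(1)] hom_carrier[OF f I(2)] k(1)[OF I(1)] k(1)[OF I(2)]
      rep_carrier[OF r(1) a] rep_carrier[OF r(2) a] rep_carrier[OF X a]
    show "k v * rmap X (u, v) = rmap M (u, v) * k u"
    proof (rule inj_mat_cancel[OF c(2)])
      show "inj_on (\<lambda>x. f v *\<^sub>v x) (carrier_vec (rdim M v))"
        using s I(2) by (simp add: short_exact_def rep_mono_def I_def)
      have "f v * (k v * rmap X (u, v)) = h v * rmap X (u, v)" using assoc_mult_mat[OF c(2) c(4) c(7)] k(2)[OF I(2)] by simp
      also have "\<dots> = rmap E (u, v) * (f u * k u)" using hom_comm[OF h a] k(2)[OF I(1)] by simp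
      also have "\<dots> = f v * (rmap M (u, v) * k u)"
        using assoc_mult_mat[OF c(6) c(1) c(3)] hom_comm[OF f a] assoc_mult_mat[OF c(2) c(5) c(3)] by simp
      finally show "f v * (k v * rmap X (u, v)) = f v * (rmap M (u, v) * k u)" .
    qed (use c in auto)
  qed (rule k(1))
  then show ?thesis using that k(2) by blast
qed

text \<open>The identity of \<open>M\<close> extends to maps between the middle terms in both directions, which induce \<open>a\<close> and \<open>b\<close> between the right
  ends. The scalar \<open>a b\<close> is nonzero, or else the first sequence would split.\<close>

lemma almost_split_unique:
  fixes M T N :: "'k::field qrep"
  assumes s: "almost_split_sequence n Q M f E g T" and s': "almost_split_sequence n Q M f' E' g' N" and T: "brick T"
  obtains a b where "hom N T a" "hom T N b" "\<And>v. v \<in> I \<Longrightarrow> a v * b v = 1\<^sub>m (rdim T v)" "\<And>v. v \<in> I \<Longrightarrow> b v * a v = 1\<^sub>m (rdim N v)"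
proof -
  have se: "short_exact n Q M f E g T" and se': "short_exact n Q M f' E' g' N"
    and la: "left_almost_split n Q M E f" and la': "left_almost_split n Q M E' f'"
    and ra: "right_almost_split n Q E T g" and ra': "right_almost_split n Q E' N g'"
    using s s' by (auto simp: almost_split_sequence_def)
  have r: "rep M" "rep E" "rep T" "rep E'" "rep N" and f: "hom M E f" and g: "hom E T g" and f': "hom M E' f'" and g': "hom E' N g'"
    using short_exact_reps[OF se] short_exact_reps[OF se'] by auto
  obtain u where u: "hom E' E u" "\<And>v. v \<in> I \<Longrightarrow> u v * f' v = f v"
    using la' la r f unfolding left_almost_split_def hom_eq_I hom_comp_def by blast
  obtain u' where u': "hom E E' u'" "\<And>v. v \<in> I \<Longrightarrow> u' v * f v = f' v"
    using la' la r f' unfolding left_almost_split_def hom_eq_I hom_comp_def by blast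
  note cr = hom_carrier[OF f] hom_carrier[OF g] hom_carrier[OF f'] hom_carrier[OF g'] hom_carrier[OF u(1)] hom_carrier[OF u'(1)]
  have z1: "g v * u v * f' v = 0\<^sub>m (rdim T v) (rdim M v)" if v: "v \<in> I" for v
    using assoc_mult_mat[OF cr(2)[OF v] cr(5)[OF v] cr(3)[OF v]] u(2)[OF v] short_exact_zero[OF se v] by simp
  obtain a where a: "hom N T a" "\<And>v. v \<in> I \<Longrightarrow> a v * g' v = g v * u v"
    using cokernel_factor[OF se' r(3) rep_hom_comp[OF r(4,2,3) u(1) g] z1] by blast
  have z2: "g' v * u' v * f v = 0\<^sub>m (rdim N v) (rdim M v)" if v: "v \<in> I" for v
    using assoc_mult_mat[OF cr(4)[OF v] cr(6)[OF v] cr(1)[OF v]] u'(2)[OF v] short_exact_zero[OF se' v] by simp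
  obtain b where b: "hom T N b" "\<And>v. v \<in> I \<Longrightarrow> b v * g v = g' v * u' v"
    using cokernel_factor[OF se r(5) rep_hom_comp[OF r(2,4,5) u'(1) g'] z2] by blast
  note ca = hom_carrier[OF a(1)] and cb = hom_carrier[OF b(1)]
  obtain c where c: "\<And>v. v \<in> I \<Longrightarrow> a v * b v = c \<cdot>\<^sub>m 1\<^sub>m (rdim T v)"
    using rep_hom_comp[OF r(3,5,3) b(1) a(1)] T unfolding brick_def by blast
  have abg: "g v * (u v * u' v) = c \<cdot>\<^sub>m g v" if v: "v \<in> I" for v
  proof -
    have "g v * (u v * u' v) = (a v * g' v) * u' v"
      unfolding a(2)[OF v] by (rule assoc_mult_mat[OF cr(2)[OF v] cr(5)[OF v] cr(6)[OF v], symmetric])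
    also have "\<dots> = a v * (b v * g v)"
      unfolding b(2)[OF v] by (rule assoc_mult_mat[OF ca[OF v] cr(4)[OF v] cr(6)[OF v]])
    also have "\<dots> = (a v * b v) * g v" by (rule assoc_mult_mat[OF ca[OF v] cb[OF v] cr(2)[OF v], symmetric])
    also have "\<dots> = c \<cdot>\<^sub>m g v" unfolding c[OF v] by (rule smult_one_mult[OF cr(2)[OF v]])
    finally show ?thesis .
  qed
  \<comment> \<open>for \<open>c = 0\<close> the map \<open>u u\'\<close> factors through the kernel \<open>M\<close> of \<open>g\<close>, which splits \<open>f\<close>\<close>
  have c0: "c \<noteq> 0"
  proof
    assume c0: "c = 0"
    have z3: "g v * (u v * u' v) = 0\<^sub>m (rdim T v) (rdim E v)" if v: "v \<in> I" for v
      unfolding abg[OF v] c0 using cr(2)[OF v] by (intro eq_matI) auto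
    obtain k where k: "hom E M k" "\<And>v. v \<in> I \<Longrightarrow> f v * k v = u v * u' v"
      using kernel_factor[OF se r(2) rep_hom_comp[OF r(2,4,2) u'(1) u(1)] z3] by blast
    have "k v * f v = 1\<^sub>m (rdim M v)" if v: "v \<in> I" for v
    proof (rule inj_mat_cancel[OF cr(1)[OF v]])
      show "inj_on (\<lambda>x. f v *\<^sub>v x) (carrier_vec (rdim M v))"
        using se v by (simp add: short_exact_def rep_mono_def I_def)
      note ck = hom_carrier[OF k(1) v]
      have "f v * (k v * f v) = u v * u' v * f v" using assoc_mult_mat[OF cr(1)[OF v] ck cr(1)[OF v]] k(2)[OF v] by simp
      also have "\<dots> = f v" using assoc_mult_mat[OF cr(5)[OF v] cr(6)[OF v] cr(1)[OF v]] u(2)[OF v] u'(2)[OF v] by simp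
      finally show "f v * (k v * f v) = f v * 1\<^sub>m (rdim M v)" using cr(1)[OF v] by simp
      show "k v * f v \<in> carrier_mat (rdim M v) (rdim M v)" using ck cr(1)[OF v] by simp
    qed simp
    then have "is_section n Q M E f" using k(1) unfolding section_iff by blast
    then show False using la by (simp add: left_almost_split_def)
  qed
  \<comment> \<open>otherwise \<open>b\<close> would lift along \<open>g\'\<close>, and \<open>g\<close> would be a retraction\<close>
  have "is_retraction n Q T N b"
  proof (rule ccontr)
    assume "\<not> ?thesis"
    then obtain t where t: "hom T E' t" "\<And>v. v \<in> I \<Longrightarrow> g' v * t v = b v"
      using ra' r b(1) unfolding right_almost_split_def hom_eq_I hom_comp_def by blast
    note ct = hom_carrier[OF t(1)]
    have "g v * (inverse c \<cdot>\<^sub>m (u v * t v)) = 1\<^sub>m (rdim T v)" if v: "v \<in> I" for v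
    proof -
      have "g v * (u v * t v) = (a v * g' v) * t v"
        unfolding a(2)[OF v] by (rule assoc_mult_mat[OF cr(2)[OF v] cr(5)[OF v] ct[OF v], symmetric])
      also have "\<dots> = a v * b v" using assoc_mult_mat[OF ca[OF v] cr(4)[OF v] ct[OF v]] t(2)[OF v] by simp
      finally have e: "g v * (u v * t v) = c \<cdot>\<^sub>m 1\<^sub>m (rdim T v)" using c[OF v] by simp
      show ?thesis
        using mult_smult_distrib[OF cr(2)[OF v] mult_carrier_mat[OF cr(5)[OF v] ct[OF v]], of "inverse c"] e smult_inverse[OF c0]
        by simp
    qed
    then have "is_retraction n Q E T g"
      unfolding retraction_iff using hom_scale[OF r(3,2) rep_hom_comp[OF r(3,4,2) t(1) u(1)]] by blast
    then show False using ra by (simp add: right_almost_split_def)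
  qed
  then obtain b' where b': "hom N T b'" "\<And>v. v \<in> I \<Longrightarrow> b v * b' v = 1\<^sub>m (rdim N v)" unfolding retraction_iff by blast
  define a' where "a' = (\<lambda>v. inverse c \<cdot>\<^sub>m a v)"
  have a'h: "hom N T a'" unfolding a'_def by (rule hom_scale[OF r(5,3) a(1)])
  have a'b: "a' v * b v = 1\<^sub>m (rdim T v)" if v: "v \<in> I" for v
    unfolding a'_def mult_smult_assoc_mat[OF ca[OF v] cb[OF v]] c[OF v] by (rule smult_inverse[OF c0])
  have "b' v = a' v" if v: "v \<in> I" for v
  proof -
    note ca' = hom_carrier[OF a'h v] and cb' = hom_carrier[OF b'(1) v]
    have "b' v = a' v * b v * b' v" using a'b[OF v] cb' by simp
    also have "\<dots> = a' v" using assoc_mult_mat[OF ca' cb[OF v] cb'] b'(2)[OF v] ca' by simp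
    finally show ?thesis .
  qed
  then have "b v * a' v = 1\<^sub>m (rdim N v)" if "v \<in> I" for v using b'(2)[OF that] that by simp
  then show ?thesis using that[OF a'h b(1) a'b] by blast
qed

lemma brick_iso:
  fixes T N :: "'k::field qrep"
  assumes T: "brick T" and N: "rep N" and ab: "hom N T a" "hom T N b"
    "\<And>v. v \<in> I \<Longrightarrow> a v * b v = 1\<^sub>m (rdim T v)" "\<And>v. v \<in> I \<Longrightarrow> b v * a v = 1\<^sub>m (rdim N v)"
  shows "brick N \<and> (\<forall>v\<in>I. rdim N v = rdim T v)"
proof -
  have rT: "rep T" using T by (simp add: brick_def)
  note ca = hom_carrier[OF ab(1)] and cb = hom_carrier[OF ab(2)]
  have d: "rdim N v = rdim T v" if v: "v \<in> I" for v
    using left_inverse_dim_le[OF ca[OF v] cb[OF v] ab(3)[OF v]] left_inverse_dim_le[OF cb[OF v] ca[OF v] ab(4)[OF v]] by simp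
  have "\<exists>c. \<forall>v\<in>I. e v = c \<cdot>\<^sub>m 1\<^sub>m (rdim N v)" if e: "hom N N e" for e
  proof -
    obtain c where c: "\<And>v. v \<in> I \<Longrightarrow> a v * (e v * b v) = c \<cdot>\<^sub>m 1\<^sub>m (rdim T v)"
      using rep_hom_comp[OF rT N rT rep_hom_comp[OF rT N N ab(2) e] ab(1)] T unfolding brick_def by blast
    have "e v = c \<cdot>\<^sub>m 1\<^sub>m (rdim N v)" if v: "v \<in> I" for v
    proof -
      note c1 = ca[OF v] and c2 = cb[OF v] and c3 = hom_carrier[OF e v]
      have "e v = (b v * a v) * e v * (b v * a v)" using ab(4)[OF v] c3 by simp
      also have "\<dots> = b v * (a v * (e v * b v)) * a v"
        using assoc_mult_mat[OF c2 c1 c3] assoc_mult_mat[OF c1 c3 c2] assoc_mult_mat[OF mult_carrier_mat[OF c2 c1] c3 mult_carrier_mat[OF c2 c1]]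
          assoc_mult_mat[OF c2 mult_carrier_mat[OF c1 c3] mult_carrier_mat[OF c2 c1]]
          assoc_mult_mat[OF mult_carrier_mat[OF c1 c3] c2 c1]
          assoc_mult_mat[OF c2 mult_carrier_mat[OF mult_carrier_mat[OF c1 c3] c2] c1] by simp
      also have "\<dots> = c \<cdot>\<^sub>m 1\<^sub>m (rdim N v)"
        unfolding c[OF v] using mult_smult_distrib[OF c2 one_carrier_mat, of c] mult_smult_assoc_mat[OF c2 c1, of c] ab(4)[OF v] c2 by simp
      finally show ?thesis .
    qed
    then show ?thesis by blast
  qed
  then show ?thesis using T N d by (auto simp: brick_def zero_rep_iff)
qed

text \<open>A nonzero map from an injective would make \<open>M\<close> have the dimension vector of some \<open>I\<^sub>w\<close>, whose image under \<open>cox\<close> is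
  \<open>- dim P\<^sub>w\<close>.\<close>

lemma translate_step_nonneg:
  fixes M :: "'k::field qrep"
  assumes M: "brick M" and q: "euler (dimv M) (dimv M) = 1" and nn: "nonneg (cox (dimv M))"
  shows "\<exists>N. ar_inverse_translate n Q M N \<and> \<not> zero_rep n N"
    and "ar_inverse_translate n Q M N \<Longrightarrow> \<not> zero_rep n N \<Longrightarrow> brick N \<and> (\<forall>v\<in>I. dimv N v = cox (dimv M) v)"
proof -
  have rM: "rep M" using M by (simp add: brick_def)
  have nh: "no_hom (inj_rep w) M" if w: "w \<in> I" for w
  proof (rule ccontr)
    assume "\<not> no_hom (inj_rep w) M"
    then obtain f v0 where f: "hom (inj_rep w) M f" "v0 \<in> I" "f v0 \<noteq> 0\<^sub>m (rdim M v0) (rdim (inj_rep w :: 'k qrep) v0)"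
      unfolding no_hom_def by blast
    have f3: "f v0 \<noteq> 0\<^sub>m (rdim M v0) (rdim (inj_rep w) v0)" using f(3) by simp
    obtain w' x where x: "w' \<in> I" "hom (inj_rep w') M x" "x w' \<noteq> 0\<^sub>m (rdim M w') 1"
      using inj_socle[OF rM w f(1,2) f3] by blast
    have "cox (dimv M) w' = euler (cox (dimv M)) (\<lambda>v. pvec v w')" using x by (simp add: euler_ivec)
    also have "\<dots> = - euler (\<lambda>v. pvec v w') (\<lambda>v. pvec v w')"
      unfolding euler_cox using brick_inj_dim[OF M x] by (simp cong: euler_cong)
    also have "\<dots> = - 1" using x(1) by (simp add: euler_ivec)
    finally show False using nn x(1) by (force simp: nonneg_def)
  qed
  obtain T \<Psi> where T: "is_inverse_translate M T \<Psi>" "\<And>w. w \<in> I \<Longrightarrow> dimv T w = cox (dimv M) w"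
    using inverse_translate_exists[OF rM nh] by blast
  obtain \<xi> where bT: "brick T" and ar: "ar_triple n C Q l M T \<Psi> \<xi>" using inverse_translate_brick[OF M q T] by blast
  have as: "almost_split_sequence n Q M (ext_inj M T) (ext_rep M T \<xi>) (ext_proj M T) T" by (rule ar_triple.almost_split[OF ar])
  then show "\<exists>N. ar_inverse_translate n Q M N \<and> \<not> zero_rep n N"
    using bT unfolding ar_inverse_translate_def brick_def by blast
  assume "ar_inverse_translate n Q M N" "\<not> zero_rep n N"
  then obtain f E g where as': "almost_split_sequence n Q M f E g N" unfolding ar_inverse_translate_def by blast
  have rN: "rep N" using as' by (auto simp: almost_split_sequence_def short_exact_def)
  obtain a b where "hom N T a" "hom T N b" "\<And>v. v \<in> I \<Longrightarrow> a v * b v = 1\<^sub>m (rdim T v)" "\<And>v. v \<in> I \<Longrightarrow> b v * a v = 1\<^sub>m (rdim N v)"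
    using almost_split_unique[OF as as' bT] by blast
  from brick_iso[OF bT rN this] have "brick N" "\<And>v. v \<in> I \<Longrightarrow> rdim N v = rdim T v" by auto
  then show "brick N \<and> (\<forall>v\<in>I. dimv N v = cox (dimv M) v)" using T(2) by (simp add: dimv_def)
qed

text \<open>If no injective mapped to \<open>M\<close>, the entries of \<open>cox (dimv M)\<close> would be dimensions. As one does, every monomorphism
  from \<open>M\<close> splits by \<open>brick_inj_splits\<close>.\<close>

lemma translate_step_neg:
  fixes M :: "'k::field qrep"
  assumes M: "brick M" and nn: "\<not> nonneg (cox (dimv M))"
  shows "\<exists>w\<in>I. \<forall>v\<in>I. dimv M v = pvec v w" and "ar_inverse_translate n Q M N \<Longrightarrow> zero_rep n N"
proof -
  have rM: "rep M" using M by (simp add: brick_def)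
  obtain w where w: "w \<in> I" "cox (dimv M) w < 0" using nn by (force simp: nonneg_def)
  have "\<not> no_hom (inj_rep w) M"
  proof
    assume "no_hom (inj_rep w) M"
    then obtain N :: nat and \<Psi> where "int N = cox (dimv M) w" using universal_family_exists[OF rM w(1)] by blast
    then show False using w(2) by simp
  qed
  then obtain f v0 where f: "hom (inj_rep w) M f" "v0 \<in> I" "f v0 \<noteq> 0\<^sub>m (rdim M v0) (rdim (inj_rep w :: 'k qrep) v0)"
    unfolding no_hom_def by blast
  have f3: "f v0 \<noteq> 0\<^sub>m (rdim M v0) (rdim (inj_rep w) v0)" using f(3) by simp
  obtain w' x where x: "w' \<in> I" "hom (inj_rep w') M x" "x w' \<noteq> 0\<^sub>m (rdim M w') 1"
    using inj_socle[OF rM w(1) f(1,2) f3] by blast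
  show "\<exists>w\<in>I. \<forall>v\<in>I. dimv M v = pvec v w" using brick_inj_dim[OF M x] x(1) by blast
  assume ar: "ar_inverse_translate n Q M N"
  show "zero_rep n N"
  proof (rule ccontr)
    assume "\<not> zero_rep n N"
    then obtain f E g where as: "almost_split_sequence n Q M f E g N" using ar unfolding ar_inverse_translate_def by blast
    then have se: "short_exact n Q M f E g N" and la: "left_almost_split n Q M E f" by (auto simp: almost_split_sequence_def)
    have rE: "rep E" and f: "hom M E f" and mono: "rep_mono n M E f" using se by (auto simp: short_exact_def)
    obtain \<theta> h where h: "hom E (inj_rep w') h" "\<And>v. v \<in> I \<Longrightarrow> (x v * h v) * f v = 1\<^sub>m (rdim M v)"
      using brick_inj_splits[OF M x rE f mono] by blast
    have "is_section n Q M E f"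
      unfolding section_iff using h(2) rep_hom_comp[OF rE rep_inj_rep rM h(1) x(2)] by blast
    then show False using la by (simp add: left_almost_split_def)
  qed
qed

text \<open>No almost split sequence starts at zero, as every map from zero is a section.\<close>

lemma zero_rep_no_translate:
  assumes z: "zero_rep n M" and ar: "ar_inverse_translate n Q M N" shows "zero_rep n N"
proof (rule ccontr)
  assume "\<not> zero_rep n N"
  then obtain f E g where as: "almost_split_sequence n Q M f E g N" using ar unfolding ar_inverse_translate_def by blast
  then have se: "short_exact n Q M f E g N" and la: "left_almost_split n Q M E f" by (auto simp: almost_split_sequence_def)
  have r: "rep M" "rep E" "hom M E f" using se by (auto simp: short_exact_def)
  have d: "rdim M v = 0" if "v \<in> I" for v using z that by (simp add: zero_rep_iff)
  have "hom E M (\<lambda>v. 0\<^sub>m 0 (rdim E v))"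
  proof (rule homI)
    fix u v assume a: "(u, v) \<in> Q"
    then show "0\<^sub>m 0 (rdim E v) * rmap E (u, v) = rmap M (u, v) * 0\<^sub>m 0 (rdim E u)"
      using d rep_carrier[OF r(1) a] rep_carrier[OF r(2) a] Q_I[OF a] by (intro eq_matI) auto
  qed (simp add: d)
  moreover have "0\<^sub>m 0 (rdim E v) * f v = 1\<^sub>m (rdim M v)" if "v \<in> I" for v
    using d[OF that] hom_carrier[OF r(3) that] by (intro eq_matI) auto
  ultimately have "is_section n Q M E f" unfolding section_iff by blast
  then show False using la by (simp add: left_almost_split_def)
qed

lemma proj_rep_simps [simp]: "rdim (proj_rep Q i) v = (if (i, v) \<in> Q\<^sup>* then 1 else 0)"
  "rmap (proj_rep Q i) (a, b) = (if (i, a) \<in> Q\<^sup>* then 1\<^sub>m 1 else 0\<^sub>m (if (i, b) \<in> Q\<^sup>* then 1 else 0) 0)"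
  by (simp_all add: proj_rep_def)

text \<open>An endomorphism of \<open>P\<^sub>i\<close> is determined by its value at the vertex \<open>i\<close>.\<close>

lemma brick_proj:
  assumes i: "i \<in> I" shows "brick (proj_rep Q i :: 'k::field qrep)"
  unfolding brick_def
proof (intro conjI allI impI)
  let ?P = "proj_rep Q i :: 'k qrep"
  show rP: "rep ?P" by (auto simp: is_rep_def intro: rtrancl_into_rtrancl)
  show "\<not> zero_rep n ?P" using i by (auto simp: zero_rep_iff)
  fix f assume f: "hom ?P ?P f"
  define c where "c = f i $$ (0, 0)"
  have "f v = c \<cdot>\<^sub>m 1\<^sub>m 1" if "(i, v) \<in> Q\<^sup>*" for v using that
  proof (induction rule: rtrancl_induct)
    case base
    have "f i \<in> carrier_mat 1 1" using hom_carrier[OF f i] by simp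
    then show ?case by (intro eq_matI) (auto simp: c_def)
  next
    case (step u v)
    have iv: "(i, v) \<in> Q\<^sup>*" using step by auto
    have "v \<in> I" using Q_I step by auto
    then have "f v \<in> carrier_mat 1 1" using hom_carrier[OF f, of v] iv by simp
    then show ?case using hom_comm[OF f step(2)] step(1,3) right_mult_one_mat[of "f v" 1 1] by simp
  qed
  moreover have "f v = c \<cdot>\<^sub>m 1\<^sub>m 0" if "(i, v) \<notin> Q\<^sup>*" "v \<in> I" for v
    using hom_carrier[OF f that(2)] that by (intro eq_matI) auto
  ultimately show "\<exists>c. \<forall>v\<in>I. f v = c \<cdot>\<^sub>m 1\<^sub>m (rdim ?P v)" by (intro exI[of _ c]) auto
qed

lemma dimv_proj: "dimv (proj_rep Q i) v = pvec i v" by (simp add: dimv_def pvec_def)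

lemma orbit_nonzero:
  fixes N :: "'k::field qrep"
  assumes i: "i \<in> I" and "(ar_inverse_translate n Q ^^ k) (proj_rep Q i) N" "\<not> zero_rep n N"
  shows "k < orbit_length i \<and> brick N \<and> (\<forall>v\<in>I. dimv N v = beta i k v)"
  using assms(2,3)
proof (induction k arbitrary: N)
  case 0
  then show ?case using brick_proj[OF i] orbit_length_pos[OF i] by (auto simp: dimv_proj)
next
  case (Suc k)
  obtain M where M: "(ar_inverse_translate n Q ^^ k) (proj_rep Q i) M" "ar_inverse_translate n Q M N"
    using Suc.prems(1) by (auto elim: relpowp_Suc_E)
  have "\<not> zero_rep n M" using zero_rep_no_translate[OF _ M(2)] Suc.prems(2) by blast
  then have IH: "k < orbit_length i" "brick M" "\<And>v. v \<in> I \<Longrightarrow> dimv M v = beta i k v" using Suc.IH[OF M(1)] by auto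
  have cox: "cox (dimv M) = beta i (Suc k)" unfolding beta_Suc by (rule cox_cong[OF IH(3)])
  have nn: "nonneg (beta i (Suc k))"
    using translate_step_neg(2)[OF IH(2) _ M(2)] Suc.prems(2) cox by auto
  have q: "euler (dimv M) (dimv M) = 1" using beta_root[OF i, of k] IH(3) by (simp cong: euler_cong)
  have "brick N \<and> (\<forall>v\<in>I. dimv N v = beta i (Suc k) v)"
    using translate_step_nonneg(2)[OF IH(2) q _ M(2) Suc.prems(2)] nn cox by simp
  moreover have "Suc k \<noteq> orbit_length i" using nn orbit_length_not[OF i] by auto
  ultimately show ?case using IH(1) by simp
qed

lemma orbit_exists:
  assumes i: "i \<in> I" and "k < orbit_length i"
  shows "\<exists>N :: 'k::field qrep. (ar_inverse_translate n Q ^^ k) (proj_rep Q i) N \<and> \<not> zero_rep n N"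
  using assms(2)
proof (induction k)
  case 0
  show ?case using brick_proj[OF i, where 'k = 'k] by (auto simp: brick_def)
next
  case (Suc k)
  then obtain M :: "'k qrep" where M: "(ar_inverse_translate n Q ^^ k) (proj_rep Q i) M" "\<not> zero_rep n M" by auto
  have b: "brick M" and d: "\<And>v. v \<in> I \<Longrightarrow> dimv M v = beta i k v" using orbit_nonzero[OF i M] by auto
  have cox: "cox (dimv M) = beta i (Suc k)" unfolding beta_Suc by (rule cox_cong[OF d])
  have q: "euler (dimv M) (dimv M) = 1" using beta_root[OF i, of k] d by (simp cong: euler_cong)
  obtain N where "ar_inverse_translate n Q M N" "\<not> zero_rep n N"
    using translate_step_nonneg(1)[OF b q] orbit_length_nonneg[OF Suc.prems] cox by auto
  then show ?case using M(1) by (blast intro: relpowp_Suc_I)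
qed

lemma G_c_eq: "G_c K n Q l = {(i, - int (l i) - 2 * int k) | i k. i \<in> I \<and> k < orbit_length i}" for K :: "'k::field itself"
  unfolding G_c_def I_def[symmetric] using orbit_nonzero orbit_exists[where 'k = 'k] by blast

text \<open>The last term of the orbit is the dimension vector of some injective \<open>I\<^sub>w\<close>, as the representations over the rationals
  show.\<close>

lemma last_injective:
  assumes i: "i \<in> I" obtains w where "w \<in> I" "\<And>y. euler (beta i (orbit_length i)) y = - y w"
proof -
  obtain k where k: "orbit_length i = Suc k" using orbit_length_pos[OF i] by (cases "orbit_length i") auto
  obtain M :: "rat qrep" where M: "(ar_inverse_translate n Q ^^ k) (proj_rep Q i) M" "\<not> zero_rep n M"
    using orbit_exists[OF i, of k] k by auto
  have b: "brick M" and d: "\<And>v. v \<in> I \<Longrightarrow> dimv M v = beta i k v" using orbit_nonzero[OF i M] by auto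
  have cox: "cox (dimv M) = beta i (orbit_length i)" unfolding k beta_Suc by (rule cox_cong[OF d])
  obtain w where w: "w \<in> I" "\<And>v. v \<in> I \<Longrightarrow> dimv M v = pvec v w"
    using translate_step_neg(1)[OF b] orbit_length_not[OF i] cox by auto
  have "euler (beta i (orbit_length i)) y = - y w" for y
    unfolding cox[symmetric] euler_cox using w by (simp add: euler_ivec cong: euler_cong)
  then show ?thesis using that w(1) by blast
qed

lemma cox_pvec_arrow:
  assumes a: "(i, j) \<in> Q" shows "cox (pvec j) i = 1"
proof -
  have I: "i \<in> I" "j \<in> I" using Q_I[OF a] by auto
  have "(\<Sum>v\<in>I. pvec j v * pvec v i) = 0"
  proof (intro sum.neutral ballI)
    fix v
    show "pvec j v * pvec v i = 0"
      using arrow_not_back[OF a] rtrancl_trans[of j v Q i] by (auto simp: pvec_def)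
  qed
  moreover have "(\<Sum>(u, v)\<in>Q. pvec j v * pvec u i) = (\<Sum>p\<in>Q. if p = (i, j) then 1 else 0)"
  proof (intro sum.cong refl, clarify)
    fix u v assume uv: "(u, v) \<in> Q"
    have "pvec j v * pvec u i = 0" if "(u, v) \<noteq> (i, j)"
    proof (rule ccontr)
      assume "\<not> ?thesis"
      then have p: "(j, v) \<in> Q\<^sup>*" "(u, i) \<in> Q\<^sup>*" by (auto simp: pvec_def split: if_splits)
      then have "u = i \<and> v = j" using path_height[OF p(1)] path_height[OF p(2)] height[OF a] height[OF uv] by auto
      then show False using that by simp
    qed
    then show "pvec j v * pvec u i = (if (u, v) = (i, j) then 1 else 0)" by auto
  qed
  ultimately show ?thesis using a by (simp add: cox_def)
qed

text \<open>An arrow \<open>i \<rightarrow> j\<close> gives irreducible maps \<open>\<tau>\<^sup>-\<^sup>k P\<^sub>j \<rightarrow> \<tau>\<^sup>-\<^sup>k P\<^sub>i \<rightarrow> \<tau>\<^sup>-\<^sup>k\<^sup>-\<^sup>1 P\<^sub>j\<close>, so the orbits end at about the same time.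
  Numerically: if one orbit were too short, its first negative vector \<open>- dim P\<^sub>w\<close> would have Euler form \<open>1\<close> with a
  nonnegative vector \<open>y\<close> of the other orbit, but the value is \<open>- y\<^sub>w\<close>.\<close>

lemma orbit_length_arrow:
  assumes a: "(i, j) \<in> Q" shows "orbit_length i \<le> orbit_length j" "orbit_length j \<le> orbit_length i + 1"
proof -
  have I: "i \<in> I" "j \<in> I" using Q_I[OF a] by auto
  show "orbit_length i \<le> orbit_length j"
  proof (rule ccontr)
    assume "\<not> ?thesis"
    then have nn: "nonneg (beta i (orbit_length j))" by (intro orbit_length_nonneg) simp
    obtain w where w: "w \<in> I" "\<And>y. euler (beta j (orbit_length j)) y = - y w" using last_injective[OF I(2)] by blast
    have "- beta i (orbit_length j) w = pvec i j" using w(2)[of "beta i (orbit_length j)"] euler_beta_same[OF I(2)] by simp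
    also have "\<dots> = 1" using a by (auto simp: pvec_def)
    finally show False using nn w(1) by (force simp: nonneg_def)
  qed
  show "orbit_length j \<le> orbit_length i + 1"
  proof (rule ccontr)
    assume "\<not> ?thesis"
    then have nn: "nonneg (beta j (Suc (orbit_length i)))" by (intro orbit_length_nonneg) simp
    obtain w where w: "w \<in> I" "\<And>y. euler (beta i (orbit_length i)) y = - y w" using last_injective[OF I(1)] by blast
    have "- beta j (Suc (orbit_length i)) w = 1"
      using w(2)[of "beta j (Suc (orbit_length i))"] euler_beta_Suc[OF I(1)] cox_pvec_arrow[OF a] by simp
    then show False using nn w(1) by (force simp: nonneg_def)
  qed
qed

end

section \<open>The arrows between two columns\<close>

text \<open>The depth below the highest red vertex of the column is used as a coordinate. In a column with \<open>d\<close> vertices in $G_c$ the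
  depths \<open>0, ..., 2 d - 1\<close> are alternately red and green.\<close>

definition is_green :: "int \<Rightarrow> int \<Rightarrow> bool" where "is_green d p \<longleftrightarrow> odd p \<and> 0 \<le> p \<and> p < 2 * d"
definition is_red :: "int \<Rightarrow> int \<Rightarrow> bool" where "is_red d p \<longleftrightarrow> even p \<and> 0 \<le> p \<and> p < 2 * d"

text \<open>Arrows from depth \<open>p\<close> to depth \<open>q\<close> within a column, from the column of \<open>i\<close> to the one of \<open>j\<close> for an arrow \<open>i \<rightarrow> j\<close> of the
  orientation, and in the other direction. Below the coloured vertices the second column is shifted by the difference
  \<open>e - d\<close> of the numbers of green vertices.\<close>

definition vertical_arr :: "int \<Rightarrow> int \<Rightarrow> int \<Rightarrow> bool" where
  "vertical_arr d p q \<longleftrightarrow> q = p - 1 \<and> \<not> is_red d q \<or> q = p + 1 \<and> is_red d p"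
definition forward_arr :: "int \<Rightarrow> int \<Rightarrow> int \<Rightarrow> int \<Rightarrow> bool" where
  "forward_arr d e p q \<longleftrightarrow> (p < 0 \<or> is_green d p) \<and> q = p + 1 \<or> 2 * d \<le> p \<and> q = p + 1 + e - d"
definition backward_arr :: "int \<Rightarrow> int \<Rightarrow> int \<Rightarrow> int \<Rightarrow> bool" where
  "backward_arr d e q p \<longleftrightarrow> q < 0 \<and> p = q \<or> is_green e q \<and> p = q - 1 \<or> 2 * e \<le> q \<and> p = q - e + d"
definition oblique_entry :: "int \<Rightarrow> int \<Rightarrow> int \<Rightarrow> int \<Rightarrow> int" where
  "oblique_entry d e p q = of_bool (forward_arr d e p q) - of_bool (backward_arr d e q p)"

lemmas colour_defs = is_green_def is_red_def forward_arr_def backward_arr_def oblique_entry_def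

lemma oblique_entry_far:
  assumes "e = d \<or> e = d + 1" "q \<noteq> p \<and> q \<noteq> p + 1 \<and> q \<noteq> p + 2" shows "oblique_entry d e p q = 0"
proof -
  have "\<not> forward_arr d e p q" "\<not> backward_arr d e q p" using assms unfolding forward_arr_def backward_arr_def by linarith+
  then show ?thesis by (simp add: oblique_entry_def)
qed

text \<open>The added terms count the paths of length two through a green vertex.\<close>

lemma oblique_entry_shift_other:
  assumes "1 \<le> d" "e = d \<or> e = d + 1" "\<not> is_green d p" "\<not> is_green e q"
  shows "oblique_entry d e p q + (of_bool (is_green d (p - 1) \<and> q = p) + of_bool (is_green d (p + 1) \<and> q = p + 2))
    - (of_bool (is_green e (q - 1) \<and> p = q - 2) + of_bool (is_green e (q + 1) \<and> p = q)) = oblique_entry d e (p - 1) (q - 1)"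
proof -
  obtain x where x: "p = 2 * x \<or> p = 2 * x + 1" by (metis evenE oddE)
  consider "q = p" | "q = p + 1" | "q = p + 2" | "q \<noteq> p \<and> q \<noteq> p + 1 \<and> q \<noteq> p + 2" by blast
  then show ?thesis
  proof cases
    case 1 then show ?thesis using assms x by (elim disjE; auto simp: colour_defs of_bool_def; presburger)
  next
    case 2 then show ?thesis using assms x by (elim disjE; auto simp: colour_defs of_bool_def; presburger)
  next
    case 3 then show ?thesis using assms x by (elim disjE; auto simp: colour_defs of_bool_def; presburger)
  next
    case 4 then show ?thesis using oblique_entry_far[of e d q p] oblique_entry_far[of e d "q - 1" "p - 1"] assms(2) by auto
  qed
qed

lemma oblique_entry_shift_green:
  assumes "1 \<le> d" "e = d \<or> e = d + 1" "is_green d p \<or> is_green e q"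
  shows "- oblique_entry d e p q = oblique_entry d e (p - 1) (q - 1)"
proof -
  obtain x where x: "p = 2 * x \<or> p = 2 * x + 1" by (metis evenE oddE)
  consider "q = p" | "q = p + 1" | "q = p + 2" | "q \<noteq> p \<and> q \<noteq> p + 1 \<and> q \<noteq> p + 2" by blast
  then show ?thesis
  proof cases
    case 1 then show ?thesis using assms x by (elim disjE; auto simp: colour_defs of_bool_def; presburger)
  next
    case 2 then show ?thesis using assms x by (elim disjE; auto simp: colour_defs of_bool_def; presburger)
  next
    case 3 then show ?thesis using assms x by (elim disjE; auto simp: colour_defs of_bool_def; presburger)
  next
    case 4 then show ?thesis using oblique_entry_far[of e d q p] oblique_entry_far[of e d "q - 1" "p - 1"] assms(2) by auto
  qed
qed

lemma ver_shift:
  assumes "is_green d p \<or> is_green d q \<Longrightarrow> s = - 1" "\<not> is_green d p \<and> \<not> is_green d q \<Longrightarrow> s = 1"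
  shows "s * (of_bool (vertical_arr d p q) - of_bool (vertical_arr d q p)) = (of_bool (vertical_arr d (p - 1) (q - 1)) - of_bool (vertical_arr d (q - 1) (p - 1)) :: int)"
proof -
  obtain x where x: "p = 2 * x \<or> p = 2 * x + 1" by (metis evenE oddE)
  consider "q = p + 1" | "q = p - 1" | "q \<noteq> p + 1 \<and> q \<noteq> p - 1" by blast
  then show ?thesis
  proof cases
    case 1 then show ?thesis using assms x by (elim disjE; auto simp: colour_defs vertical_arr_def of_bool_def; presburger)
  next
    case 2 then show ?thesis using assms x by (elim disjE; auto simp: colour_defs vertical_arr_def of_bool_def; presburger)
  next
    case 3 then show ?thesis by (auto simp: vertical_arr_def)
  qed
qed

lemma is_green_in:
  assumes "1 \<le> d" "e = d \<or> e = d + 1"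
  shows "is_green e q \<Longrightarrow> \<not> forward_arr d e p q" "is_green d p \<Longrightarrow> \<not> backward_arr d e q p"
    "is_green d p \<Longrightarrow> forward_arr d e p q \<longleftrightarrow> q = p + 1" "is_green e q \<Longrightarrow> backward_arr d e q p \<longleftrightarrow> p = q - 1"
proof -
  show "is_green e q \<Longrightarrow> \<not> forward_arr d e p q" using assms unfolding colour_defs by presburger
  show "is_green d p \<Longrightarrow> \<not> backward_arr d e q p" using assms unfolding colour_defs by presburger
  show "is_green d p \<Longrightarrow> forward_arr d e p q \<longleftrightarrow> q = p + 1" using assms unfolding colour_defs by presburger
  show "is_green e q \<Longrightarrow> backward_arr d e q p \<longleftrightarrow> p = q - 1" using assms unfolding colour_defs by presburger
qed

lemma up_grn: "is_green d e \<Longrightarrow> vertical_arr d p e \<longleftrightarrow> p = e + 1 \<or> p = e - 1" "is_green d e \<Longrightarrow> \<not> vertical_arr d e p"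
  unfolding colour_defs vertical_arr_def by presburger+

text \<open>The depths of the red and the green copy of the vertex of $\Gamma_e$ at depth \<open>a\<close>.\<close>

definition red_depth :: "int \<Rightarrow> int \<Rightarrow> int" where "red_depth d a = a + min (max a 0) d"
definition green_depth :: "int \<Rightarrow> int \<Rightarrow> int" where "green_depth d a = red_depth d a + of_bool (0 \<le> a \<and> a < d)"

lemma red_depth_cases: "1 \<le> d \<Longrightarrow> red_depth d a = (if a < 0 then a else if a < d then 2 * a else a + d)"
  by (auto simp: red_depth_def)
lemma green_depth_cases: "1 \<le> d \<Longrightarrow> green_depth d a = (if a < 0 then a else if a < d then 2 * a + 1 else a + d)"
  by (auto simp: green_depth_def red_depth_def)

lemma green_depth_surj_cases:
  fixes p d :: int
  obtains a where "p < 0" "a = p" | a where "0 \<le> p" "p < 2 * d" "p = 2 * a" | a where "0 \<le> p" "p < 2 * d" "p = 2 * a + 1"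
    | a where "2 * d \<le> p" "a = p - d"
proof (cases "p < 0 \<or> 2 * d \<le> p")
  case True
  then show thesis using that(1)[of p] that(4)[of "p - d"] by auto
next
  case False
  then show thesis using that(2)[of "p div 2"] that(3)[of "p div 2"] by (cases "even p") auto
qed

lemma vertical_arr_labels:
  assumes d: "1 \<le> d"
  shows "vertical_arr d p q \<longleftrightarrow> (\<exists>a. 0 \<le> a \<and> a < d \<and> p = red_depth d a \<and> q = red_depth d a + 1) \<or>
     (\<exists>a. p = red_depth d (a + 1) \<and> q = green_depth d a)" (is "_ \<longleftrightarrow> ?A \<or> ?B")
proof -
  have A: "?A \<longleftrightarrow> q = p + 1 \<and> is_red d p"
  proof
    assume h: "q = p + 1 \<and> is_red d p"
    then obtain a where "p = 2 * a" by (auto simp: is_red_def)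
    then show ?A using h d by (intro exI[of _ a]) (auto simp: is_red_def red_depth_cases)
  next
    assume ?A then show "q = p + 1 \<and> is_red d p" using d by (auto simp: is_red_def red_depth_cases)
  qed
  have B: "?B \<longleftrightarrow> q = p - 1 \<and> \<not> is_red d q"
  proof
    assume ?B
    then show "q = p - 1 \<and> \<not> is_red d q" using d by (auto simp: is_red_def red_depth_cases green_depth_cases split: if_splits)
  next
    assume h: "q = p - 1 \<and> \<not> is_red d q"
    consider a where "q < 0" "a = q" | a where "0 \<le> q" "q < 2 * d" "q = 2 * a" | a where "0 \<le> q" "q < 2 * d" "q = 2 * a + 1"
      | a where "2 * d \<le> q" "a = q - d" by (rule green_depth_surj_cases[where p = q and d = d])
    then show ?B
    proof cases
      case (1 a) then show ?thesis using h d by (intro exI[of _ a]) (auto simp: red_depth_cases green_depth_cases)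
    next
      case (2 a) then show ?thesis using h by (auto simp: is_red_def)
    next
      case (3 a) then show ?thesis using h d by (intro exI[of _ a]) (auto simp: red_depth_cases green_depth_cases)
    next
      case (4 a) then show ?thesis using h d by (intro exI[of _ a]) (auto simp: red_depth_cases green_depth_cases)
    qed
  qed
  show ?thesis unfolding A B vertical_arr_def by blast
qed

lemma forward_arr_labels:
  assumes d: "1 \<le> d" "e = d \<or> e = d + 1"
  shows "forward_arr d e p q \<longleftrightarrow> (\<exists>a. p = green_depth d a \<and> q = red_depth e (a + 1))"
proof
  assume h: "forward_arr d e p q"
  consider a where "p < 0" "a = p" | a where "0 \<le> p" "p < 2 * d" "p = 2 * a" | a where "0 \<le> p" "p < 2 * d" "p = 2 * a + 1"
      | a where "2 * d \<le> p" "a = p - d" by (rule green_depth_surj_cases[where p = p and d = d])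
  then show "\<exists>a. p = green_depth d a \<and> q = red_depth e (a + 1)"
  proof cases
    case (1 a) then show ?thesis using h d by (intro exI[of _ a]) (auto simp: red_depth_cases green_depth_cases colour_defs)
  next
    case (2 a) then show ?thesis using h by (auto simp: colour_defs)
  next
    case (3 a) then show ?thesis using h d by (intro exI[of _ a]) (auto simp: red_depth_cases green_depth_cases colour_defs)
  next
    case (4 a) then show ?thesis using h d by (intro exI[of _ a]) (auto simp: red_depth_cases green_depth_cases colour_defs)
  qed
next
  assume "\<exists>a. p = green_depth d a \<and> q = red_depth e (a + 1)"
  then obtain a where a: "p = green_depth d a" "q = red_depth e (a + 1)" by blast
  have e: "1 \<le> e" using d by auto
  have "p = (if a < 0 then a else if a < d then 2 * a + 1 else a + d)" unfolding a(1) by (rule green_depth_cases[OF d(1)])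
  moreover have "q = (if a + 1 < 0 then a + 1 else if a + 1 < e then 2 * (a + 1) else (a + 1) + e)"
    unfolding a(2) by (rule red_depth_cases[OF e])
  ultimately show "forward_arr d e p q" using d
    by (cases "a < 0"; cases "a < d"; cases "a + 1 < e"; auto simp: forward_arr_def is_green_def)
qed

lemma backward_arr_labels:
  assumes d: "1 \<le> d" "e = d \<or> e = d + 1"
  shows "backward_arr d e q p \<longleftrightarrow> (\<exists>a. q = green_depth e a \<and> p = red_depth d a)"
proof
  assume h: "backward_arr d e q p"
  consider a where "q < 0" "a = q" | a where "0 \<le> q" "q < 2 * e" "q = 2 * a" | a where "0 \<le> q" "q < 2 * e" "q = 2 * a + 1"
      | a where "2 * e \<le> q" "a = q - e" by (rule green_depth_surj_cases[where p = q and d = e])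
  then show "\<exists>a. q = green_depth e a \<and> p = red_depth d a"
  proof cases
    case (1 a) then show ?thesis using h d by (intro exI[of _ a]) (auto simp: red_depth_cases green_depth_cases colour_defs)
  next
    case (2 a) then show ?thesis using h by (auto simp: colour_defs)
  next
    case (3 a) then show ?thesis using h d by (intro exI[of _ a]) (auto simp: red_depth_cases green_depth_cases colour_defs)
  next
    case (4 a) then show ?thesis using h d by (intro exI[of _ a]) (auto simp: red_depth_cases green_depth_cases colour_defs)
  qed
next
  assume "\<exists>a. q = green_depth e a \<and> p = red_depth d a"
  then obtain a where a: "q = green_depth e a" "p = red_depth d a" by blast
  have e: "1 \<le> e" using d by auto
  have "q = (if a < 0 then a else if a < e then 2 * a + 1 else a + e)" unfolding a(1) by (rule green_depth_cases[OF e])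
  moreover have "p = (if a < 0 then a else if a < d then 2 * a else a + d)" unfolding a(2) by (rule red_depth_cases[OF d(1)])
  ultimately show "backward_arr d e q p" using d(2)
    by (cases "a < 0"; cases "a < d"; cases "a < e"; auto simp: backward_arr_def is_green_def)
qed

section \<open>Simultaneous mutation and graded seeds\<close>

definition unlinked :: "'w set \<Rightarrow> ('w \<Rightarrow> 'w \<Rightarrow> int) \<Rightarrow> bool" where
  "unlinked S B \<longleftrightarrow> (\<forall>i\<in>S. \<forall>j\<in>S. B i j = 0)"

definition skew :: "('w \<Rightarrow> 'w \<Rightarrow> int) \<Rightarrow> bool" where "skew B \<longleftrightarrow> (\<forall>i j. B i j = - B j i)"

lemma skewD: "skew B \<Longrightarrow> B i j = - B j i" unfolding skew_def by blast

text \<open>Simultaneous mutation at the vertices in \<open>S\<close>.\<close>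

definition mut_set :: "'w set \<Rightarrow> ('w \<Rightarrow> 'w \<Rightarrow> int) \<Rightarrow> 'w \<Rightarrow> 'w \<Rightarrow> int" where
  "mut_set S B i j = (if i \<in> S \<or> j \<in> S then - B i j
     else B i j + (\<Sum>k\<in>S. max 0 (B i k) * max 0 (B k j) - max 0 (- B i k) * max 0 (- B k j)))"

text \<open>Mutation at a vertex of \<open>S\<close> does not change the arrows at the other vertices of \<open>S\<close>.\<close>

lemma fold_mutate:
  assumes "distinct ks" "unlinked (set ks) B"
  shows "fold mutate_matrix ks B = mut_set (set ks) B"
  using assms
proof (induction ks arbitrary: B)
  case Nil
  then show ?case by (simp add: mut_set_def fun_eq_iff)
next
  case (Cons k ks)
  define B' where "B' = mutate_matrix k B"
  have un: "B i j = 0" if "i \<in> insert k (set ks)" "j \<in> insert k (set ks)" for i j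
    using Cons.prems that by (auto simp: unlinked_def)
  have kn: "k \<notin> set ks" using Cons.prems by simp
  have rowk: "B' i j = (if j = k then - B i j else B i j)" if "i \<in> set ks" for i j
    using un[of i k] that kn by (auto simp: B'_def mutate_matrix_def)
  have colk: "B' i j = (if i = k then - B i j else B i j)" if "j \<in> set ks" for i j
    using un[of k j] that kn by (auto simp: B'_def mutate_matrix_def)
  have "unlinked (set ks) B'" using rowk un by (auto simp: unlinked_def)
  then have "fold mutate_matrix (k # ks) B = mut_set (set ks) B'"
    using Cons.IH[of B'] Cons.prems by (simp add: B'_def)
  also have "\<dots> = mut_set (set (k # ks)) B"
  proof (intro ext)
    fix i j
    show "mut_set (set ks) B' i j = mut_set (set (k # ks)) B i j"
    proof (cases "i \<in> set ks \<or> j \<in> set ks")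
      case True
      then show ?thesis using rowk[of i j] colk[of j i] un[of i j] un[of j i] un[of i k] un[of k j]
        by (auto simp: mut_set_def)
    next
      case out: False
      show ?thesis
      proof (cases "i = k \<or> j = k")
        case True
        have "(\<Sum>x\<in>set ks. max 0 (B' i x) * max 0 (B' x j) - max 0 (- B' i x) * max 0 (- B' x j)) = 0"
        proof (intro sum.neutral ballI)
          fix x assume x: "x \<in> set ks"
          show "max 0 (B' i x) * max 0 (B' x j) - max 0 (- B' i x) * max 0 (- B' x j) = 0"
            using True colk[OF x, of i] rowk[OF x, of j] un[of k x] un[of x k] x by auto
        qed
        then show ?thesis using True out by (auto simp: mut_set_def B'_def mutate_matrix_def)
      next
        case False
        have "(\<Sum>x\<in>set ks. max 0 (B' i x) * max 0 (B' x j) - max 0 (- B' i x) * max 0 (- B' x j)) =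
          (\<Sum>x\<in>set ks. max 0 (B i x) * max 0 (B x j) - max 0 (- B i x) * max 0 (- B x j))"
          using colk rowk False by (intro sum.cong) auto
        then show ?thesis using False out kn by (auto simp: mut_set_def B'_def mutate_matrix_def)
      qed
    qed
  qed
  finally show ?case .
qed

lemma mut_set_involutive:
  assumes "unlinked S B" shows "mut_set S (mut_set S B) = B"
proof (intro ext)
  fix i j
  have "(\<Sum>k\<in>S. max 0 (mut_set S B i k) * max 0 (mut_set S B k j) - max 0 (- mut_set S B i k) * max 0 (- mut_set S B k j)) =
     - (\<Sum>k\<in>S. max 0 (B i k) * max 0 (B k j) - max 0 (- B i k) * max 0 (- B k j))"
    unfolding sum_negf[symmetric] by (intro sum.cong) (auto simp: mut_set_def)
  then show "mut_set S (mut_set S B) i j = B i j" by (simp add: mut_set_def[of S "mut_set S B"]) (simp add: mut_set_def)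
qed

lemma mut_set_uminus: "mut_set S (\<lambda>i j. - B i j) = (\<lambda>i j. - mut_set S B i j)"
  by (intro ext) (simp add: mut_set_def sum_negf[symmetric] sum_subtractf)

lemma skew_mutate: assumes "skew B" shows "skew (mutate_matrix k B)"
  unfolding skew_def
proof (intro allI)
  fix i j
  have e: "B j i = - B i j" "B j k = - B k j" "B k i = - B i k"
    by (rule skewD[OF assms])+
  show "mutate_matrix k B i j = - mutate_matrix k B j i" by (simp add: mutate_matrix_def e)
qed

text \<open>The degree of the new cluster variable can be read off either monomial of the exchange relation,
  since the grading \<open>D\<close> makes both of the same degree.\<close>

definition grade_step :: "'w set \<Rightarrow> 'w \<Rightarrow> ('w \<Rightarrow> 'w \<Rightarrow> int) \<Rightarrow> ('w \<Rightarrow> 'v \<Rightarrow> int) \<Rightarrow> 'w \<Rightarrow> 'v \<Rightarrow> int" where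
  "grade_step J k B D = D(k := (\<lambda>u. - D k u + (\<Sum>i\<in>J. max 0 (- B i k) * D i u)))"

primrec grade_fold :: "'w set \<Rightarrow> 'w list \<Rightarrow> ('w \<Rightarrow> 'w \<Rightarrow> int) \<Rightarrow> ('w \<Rightarrow> 'v \<Rightarrow> int) \<Rightarrow> 'w \<Rightarrow> 'v \<Rightarrow> int" where
  "grade_fold J [] B D = D"
| "grade_fold J (k # ks) B D = grade_fold J ks (mutate_matrix k B) (grade_step J k B D)"

text \<open>The two monomials of the exchange relation at each vertex in \<open>U\<close> have the same degree.\<close>

definition graded :: "'w set \<Rightarrow> 'w set \<Rightarrow> ('w \<Rightarrow> 'w \<Rightarrow> int) \<Rightarrow> ('w \<Rightarrow> 'v \<Rightarrow> int) \<Rightarrow> bool" where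
  "graded J U B D \<longleftrightarrow> (\<forall>j\<in>U. \<forall>u. (\<Sum>i\<in>J. B i j * D i u) = 0)"

lemma grade_fold_append: "grade_fold J (ks @ ls) B D = grade_fold J ls (fold mutate_matrix ks B) (grade_fold J ks B D)"
  by (induction ks arbitrary: B D) auto

lemma max_split: "max 0 (b::int) = b + max 0 (- b)" by (simp add: max_def)

lemma graded_balanced:
  assumes "graded J U B D" "k \<in> U"
  shows "(\<Sum>i\<in>J. max 0 (B i k) * D i u) = (\<Sum>i\<in>J. max 0 (- B i k) * D i u)"
proof -
  have "(\<Sum>i\<in>J. max 0 (B i k) * D i u) = (\<Sum>i\<in>J. B i k * D i u + max 0 (- B i k) * D i u)"
    by (intro sum.cong refl) (subst max_split, simp add: distrib_right)
  then show ?thesis using assms by (simp add: sum.distrib graded_def)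
qed

text \<open>The mutation formula adds to column \<open>j\<close> of \<open>B\<close> a multiple of the positive or the negative part of column
  \<open>k\<close>; against the degrees both parts give \<open>D\<^sub>k + D'\<^sub>k\<close>.\<close>

lemma graded_mutate:
  assumes J: "finite J" and UJ: "U \<subseteq> J" and sk: "skew B" and g: "graded J U B D" and k: "k \<in> U"
  shows "graded J U (mutate_matrix k B) (grade_step J k B D)"
  unfolding graded_def
proof (intro ballI allI)
  fix j u assume j: "j \<in> U"
  have kJ: "k \<in> J" using k UJ by auto
  have kk: "B k k = 0" using skewD[OF sk, of k k] by simp
  let ?D = "grade_step J k B D" and ?B = "mutate_matrix k B"
  have split: "(\<Sum>i\<in>J. f i) = f k + (\<Sum>i\<in>J-{k}. f i)" for f :: "'a \<Rightarrow> int" using J kJ by (simp add: sum.remove)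
  have Dk: "?D k u + D k u = (\<Sum>i\<in>J-{k}. max 0 (- B i k) * D i u)"
    using split[of "\<lambda>i. max 0 (- B i k) * D i u"] kk by (simp add: grade_step_def)
  then have Dk': "?D k u + D k u = (\<Sum>i\<in>J-{k}. max 0 (B i k) * D i u)"
    using graded_balanced[OF g k, of u] split[of "\<lambda>i. max 0 (- B i k) * D i u"] split[of "\<lambda>i. max 0 (B i k) * D i u"] kk by simp
  have Do: "?D i u = D i u" if "i \<noteq> k" for i using that by (simp add: grade_step_def)
  have gj: "B k j * D k u + (\<Sum>i\<in>J-{k}. B i j * D i u) = 0"
    using g j split[of "\<lambda>i. B i j * D i u"] by (simp add: graded_def)
  show "(\<Sum>i\<in>J. ?B i j * ?D i u) = 0"
  proof (cases "j = k")
    case True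
    have "(\<Sum>i\<in>J-{k}. ?B i j * ?D i u) = - (\<Sum>i\<in>J-{k}. B i j * D i u)"
      unfolding sum_negf[symmetric] using True Do by (intro sum.cong) (auto simp: mutate_matrix_def)
    then show ?thesis using split[of "\<lambda>i. ?B i j * ?D i u"] gj True kk by (simp add: mutate_matrix_def)
  next
    case False
    have "(\<Sum>i\<in>J-{k}. ?B i j * ?D i u) = (\<Sum>i\<in>J-{k}. B i j * D i u + max 0 (B k j) * (max 0 (B i k) * D i u)
        - max 0 (- B k j) * (max 0 (- B i k) * D i u))"
      using False Do by (intro sum.cong) (auto simp: mutate_matrix_def algebra_simps)
    also have "\<dots> = (\<Sum>i\<in>J-{k}. B i j * D i u) + max 0 (B k j) * (?D k u + D k u) - max 0 (- B k j) * (?D k u + D k u)"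
      unfolding sum_subtractf sum.distrib sum_distrib_left[symmetric] Dk Dk'[unfolded Dk] by (simp add: Dk[symmetric] Dk')
    also have "\<dots> = (\<Sum>i\<in>J-{k}. B i j * D i u) + B k j * (?D k u + D k u)"
      using max_split[of "B k j"] by (simp add: algebra_simps)
    finally show ?thesis using split[of "\<lambda>i. ?B i j * ?D i u"] gj by (simp add: mutate_matrix_def algebra_simps)
  qed
qed

definition tpow :: "'v set \<Rightarrow> ('v \<Rightarrow> real) \<Rightarrow> ('v \<Rightarrow> int) \<Rightarrow> real" where
  "tpow F t g = (\<Prod>u\<in>F. t u powi g u)"

lemma tpow_add: "(\<And>u. t u > 0) \<Longrightarrow> tpow F t (\<lambda>u. g u + h u) = tpow F t g * tpow F t h"
  unfolding tpow_def prod.distrib[symmetric] by (intro prod.cong refl power_int_add) (metis less_irrefl)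
lemma tpow_diff: "(\<And>u. t u > 0) \<Longrightarrow> tpow F t (\<lambda>u. g u - h u) = tpow F t g / tpow F t h"
  unfolding tpow_def prod_dividef[symmetric] by (intro prod.cong refl power_int_diff) (metis less_irrefl)
lemma tpow_zero: "tpow F t (\<lambda>u. 0) = 1" by (simp add: tpow_def)
lemma tpow_scale: "tpow F t (\<lambda>u. int m * g u) = tpow F t g ^ m"
  unfolding tpow_def prod_power_distrib
  by (intro prod.cong refl) (simp only: power_int_power' mult.commute)

lemma tpow_sum:
  assumes t: "\<And>u. t u > 0" and J: "finite J"
  shows "tpow F t (\<lambda>u. \<Sum>i\<in>J. int (e i) * g i u) = (\<Prod>i\<in>J. tpow F t (g i) ^ e i)"
  using J by (induction J rule: finite_induct) (simp_all add: tpow_zero tpow_add[OF t] tpow_scale)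

text \<open>Both exchange monomials are multiplied by the same character under the torus, hence so is their sum. Positivity allows the
  division by the old variable.\<close>

lemma seed_homogeneous:
  fixes B :: "'w \<Rightarrow> 'w \<Rightarrow> int" and t :: "'v \<Rightarrow> real"
  assumes J: "finite J" and UJ: "U \<subseteq> J" and t: "\<And>u. t u > 0"
  shows "set ks \<subseteq> U \<Longrightarrow> skew B \<Longrightarrow> graded J U B D \<Longrightarrow> (\<forall>i\<in>J. x i > 0 \<and> x' i = tpow F t (D i) * x i) \<Longrightarrow>
    (\<forall>i\<in>J. snd (fold (mutate_seed J) ks (B, x)) i > 0 \<and>
       snd (fold (mutate_seed J) ks (B, x')) i = tpow F t (grade_fold J ks B D i) * snd (fold (mutate_seed J) ks (B, x)) i)"
proof (induction ks arbitrary: B D x x')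
  case Nil
  then show ?case by simp
next
  case (Cons k ks)
  have k: "k \<in> U" "k \<in> J" using Cons.prems UJ by auto
  define y where "y = snd (mutate_seed J k (B, x))"
  define y' where "y' = snd (mutate_seed J k (B, x'))"
  have s: "mutate_seed J k (B, x) = (mutate_matrix k B, y)" "mutate_seed J k (B, x') = (mutate_matrix k B, y')"
    by (simp_all add: y_def y'_def mutate_seed_def)
  let ?m = "\<lambda>x. \<Prod>i\<in>J. x i ^ nat (max 0 (B i k))" and ?m' = "\<lambda>x. \<Prod>i\<in>J. x i ^ nat (max 0 (- B i k))"
  define g where "g = (\<lambda>u. \<Sum>i\<in>J. max 0 (- B i k) * D i u)"
  have x: "x i > 0" "x' i = tpow F t (D i) * x i" if "i \<in> J" for i using Cons.prems(4) that by auto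
  have mono: "(\<Prod>i\<in>J. x' i ^ e i) = tpow F t (\<lambda>u. \<Sum>i\<in>J. int (e i) * D i u) * (\<Prod>i\<in>J. x i ^ e i)" for e
  proof -
    have "(\<Prod>i\<in>J. x' i ^ e i) = (\<Prod>i\<in>J. tpow F t (D i) ^ e i * x i ^ e i)"
      using x by (intro prod.cong) (auto simp: power_mult_distrib)
    then show ?thesis by (simp add: prod.distrib tpow_sum[OF t J])
  qed
  have 1: "?m' x' = tpow F t g * ?m' x" using mono[of "\<lambda>i. nat (max 0 (- B i k))"] by (simp add: g_def)
  have 2: "?m x' = tpow F t g * ?m x"
    using mono[of "\<lambda>i. nat (max 0 (B i k))"] graded_balanced[OF Cons.prems(3) k(1)] by (simp add: g_def)
  have yk: "y' k = tpow F t (grade_step J k B D k) * y k"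
  proof -
    have "grade_step J k B D k = (\<lambda>u. g u - D k u)" by (simp add: grade_step_def g_def fun_eq_iff)
    then have e: "tpow F t (grade_step J k B D k) = tpow F t g / tpow F t (D k)" by (simp add: tpow_diff[OF t])
    have "y' k = (tpow F t g * (?m x + ?m' x)) / (tpow F t (D k) * x k)"
      using x(2)[OF k(2)] 1 2 by (simp add: y'_def mutate_seed_def distrib_left)
    then show ?thesis unfolding e by (simp add: y_def mutate_seed_def)
  qed
  have pos: "y k > 0"
    using x k unfolding y_def mutate_seed_def by (auto intro!: divide_pos_pos add_pos_pos prod_pos zero_less_power)
  have "\<forall>i\<in>J. y i > 0 \<and> y' i = tpow F t (grade_step J k B D i) * y i"
    using x yk pos by (auto simp: y_def y'_def mutate_seed_def grade_step_def)
  then show ?case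
    using Cons.IH[of "mutate_matrix k B" "grade_step J k B D" y y'] Cons.prems skew_mutate[OF Cons.prems(2)]
      graded_mutate[OF J UJ Cons.prems(2,3) k(1)] s by simp
qed

lemma grade_fold_unlinked:
  assumes "distinct ks" "unlinked (set ks) B"
  shows "grade_fold J ks B D i =
    (if i \<in> set ks then (\<lambda>u. - D i u + (\<Sum>w\<in>J. max 0 (- B w i) * D w u)) else D i)"
  using assms
proof (induction ks arbitrary: B D)
  case Nil
  then show ?case by simp
next
  case (Cons k ks)
  define B' where "B' = mutate_matrix k B"
  have un: "B i j = 0" if "i \<in> insert k (set ks)" "j \<in> insert k (set ks)" for i j
    using Cons.prems that by (auto simp: unlinked_def)
  have kn: "k \<notin> set ks" using Cons.prems by simp
  have colk: "B' i j = (if i = k then - B i j else B i j)" if "j \<in> set ks" for i j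
    using un[of k j] that kn by (auto simp: B'_def mutate_matrix_def)
  have "unlinked (set ks) B'" using colk un by (auto simp: unlinked_def)
  then have IH: "grade_fold J (k # ks) B D i =
     (if i \<in> set ks then (\<lambda>u. - grade_step J k B D i u + (\<Sum>w\<in>J. max 0 (- B' w i) * grade_step J k B D w u))
      else grade_step J k B D i)"
    using Cons.IH[of B' "grade_step J k B D"] Cons.prems by (simp add: B'_def)
  show ?case
  proof (cases "i \<in> set ks")
    case True
    have "(\<Sum>w\<in>J. max 0 (- B' w i) * grade_step J k B D w u) = (\<Sum>w\<in>J. max 0 (- B w i) * D w u)" for u
      using colk[OF True] un[of k i] True by (intro sum.cong) (auto simp: grade_step_def)
    then show ?thesis unfolding IH using True kn by (auto simp: grade_step_def)
  next
    case False
    then show ?thesis unfolding IH by (auto simp: grade_step_def)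
  qed
qed

text \<open>The grading by the unit vectors and the columns of \<open>-B\<close> makes the principal extension graded, so that every
  cluster variable is homogeneous. Its degree is determined by the character, as a character is trivial only if all its
  exponents vanish.\<close>

lemma g_vector_eq:
  fixes B :: "'v \<Rightarrow> 'v \<Rightarrow> int"
  assumes sk: "skew B" and J0: "finite F0" "F0 \<subseteq> J"
    and deg: "\<And>F. finite F \<Longrightarrow> F0 \<subseteq> F \<Longrightarrow> F \<subseteq> J \<Longrightarrow> set ks \<subseteq> F \<and> v \<in> F \<and> (\<forall>u. u \<notin> F \<longrightarrow> g u = 0) \<and>
       grade_fold (Inl ` F \<union> Inr ` F) (map Inl ks) (principal_extension B)
         (case_sum (\<lambda>i u. of_bool (u = i)) (\<lambda>j u. if u \<in> F then - B u j else 0)) (Inl v) = g"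
  shows "g_vector J B ks v = g"
proof -
  have sk': "skew (principal_extension B)"
    unfolding skew_def
  proof (intro allI)
    fix a b show "principal_extension B a b = - principal_extension B b a"
    proof (cases "\<exists>i j. a = Inl i \<and> b = Inl j")
      case True
      then obtain i j where "a = Inl i" "b = Inl j" by auto
      then show ?thesis using skewD[OF sk, of i j] by simp
    next
      case False
      then show ?thesis by (cases a; cases b) auto
    qed
  qed
  have char: "principal_cluster_variable F B ks v (torus_act F B t p) = tpow F t g * principal_cluster_variable F B ks v p
      \<and> principal_cluster_variable F B ks v p > 0"
    if F: "finite F" "F0 \<subseteq> F" "F \<subseteq> J" and p: "\<And>w. p w > 0" and t: "\<And>u. t u > 0" for F p t
  proof -
    let ?J = "Inl ` F \<union> Inr ` F :: ('v + 'v) set"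
    let ?D = "case_sum (\<lambda>i u. of_bool (u = i)) (\<lambda>j u. if u \<in> F then - B u j else 0) :: 'v + 'v \<Rightarrow> 'v \<Rightarrow> int"
    have sumJ: "(\<Sum>i\<in>?J. h i) = (\<Sum>i\<in>F. h (Inl i)) + (\<Sum>i\<in>F. h (Inr i))" for h :: "'v + 'v \<Rightarrow> int"
      by (subst sum.union_disjoint) (use F in \<open>auto simp: sum.reindex\<close>)
    have gr: "graded ?J (Inl ` F) (principal_extension B) ?D"
      unfolding graded_def
    proof (intro ballI allI)
      fix a :: "'v + 'v" and u :: 'v assume "a \<in> Inl ` F"
      then obtain j where a: "a = Inl j" "j \<in> F" by auto
      have "(\<Sum>i\<in>F. B i j * of_bool (u = i)) = (if u \<in> F then B u j else 0)"
      proof -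
        have "(\<Sum>i\<in>F. B i j * of_bool (u = i)) = (\<Sum>i\<in>F. if i = u then B i j else 0)" by (intro sum.cong) auto
        then show ?thesis using F by simp
      qed
      moreover have "(\<Sum>i\<in>F. of_bool (i = j) * (if u \<in> F then - B u i else 0)) = (if u \<in> F then - B u j else 0)"
      proof -
        have "(\<Sum>i\<in>F. of_bool (i = j) * (if u \<in> F then - B u i else 0)) = (\<Sum>i\<in>F. if i = j then (if u \<in> F then - B u i else 0) else 0)"
          by (intro sum.cong) auto
        then show ?thesis using F a by simp
      qed
      ultimately show "(\<Sum>i\<in>?J. principal_extension B i a * ?D i u) = 0" unfolding sumJ a by simp
    qed
    have x': "torus_act F B t p i = tpow F t (?D i) * p i" if "i \<in> ?J" for i
    proof (cases i)
      case (Inl a)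
      then have "a \<in> F" using that by auto
      have "tpow F t (?D i) = (\<Prod>u\<in>F. if u = a then t u else 1)"
        unfolding tpow_def Inl by (intro prod.cong) auto
      then show ?thesis using Inl F \<open>a \<in> F\<close> by simp
    next
      case (Inr a)
      have "tpow F t (?D i) = (\<Prod>u\<in>F. t u powi (- B u a))" unfolding tpow_def Inr by (intro prod.cong) auto
      then show ?thesis using Inr by simp
    qed
    have d: "set ks \<subseteq> F" "v \<in> F" "grade_fold ?J (map Inl ks) (principal_extension B) ?D (Inl v) = g"
      using deg[OF F] by auto
    have "snd (fold (mutate_seed ?J) (map Inl ks) (principal_extension B, p)) (Inl v) > 0 \<and>
       snd (fold (mutate_seed ?J) (map Inl ks) (principal_extension B, torus_act F B t p)) (Inl v) =
       tpow F t (grade_fold ?J (map Inl ks) (principal_extension B) ?D (Inl v)) *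
       snd (fold (mutate_seed ?J) (map Inl ks) (principal_extension B, p)) (Inl v)"
    proof -
      have sub: "set (map Inl ks) \<subseteq> Inl ` F" using d(1) by auto
      have st: "\<forall>i\<in>?J. p i > 0 \<and> torus_act F B t p i = tpow F t (?D i) * p i" using p x' by blast
      have "Inl v \<in> ?J" using d(2) by simp
      from bspec[OF seed_homogeneous[OF _ _ t sub sk' gr st] this] show ?thesis using F by blast
    qed
    then show ?thesis unfolding principal_cluster_variable_def d(3) by simp
  qed
  have isg: "is_g_vector F B ks v g" if F: "finite F" "F0 \<subseteq> F" "F \<subseteq> J" for F
    unfolding is_g_vector_def tpow_def[symmetric] using deg[OF F] char[OF F] by blast
  have ev: "eventually (\<lambda>F. finite F \<and> F0 \<subseteq> F \<and> F \<subseteq> J) (finite_subsets_at_top J)"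
    using J0 by (auto simp: eventually_finite_subsets_at_top)
  have "g' = g" if evg: "eventually (\<lambda>F. is_g_vector F B ks v g') (finite_subsets_at_top J)" for g'
  proof -
    obtain F where F: "finite F" "F0 \<subseteq> F" "F \<subseteq> J" "is_g_vector F B ks v g'"
      using eventually_happens[OF eventually_conj[OF evg ev]] by auto
    show "g' = g"
    proof
      fix u
      show "g' u = g u"
      proof (cases "u \<in> F")
        case False
        then show ?thesis using F(4) deg[OF F(1-3)] by (auto simp: is_g_vector_def)
      next
        case True
        define t where "t = (\<lambda>w. if w = u then 2 else 1 :: real)"
        define p where "p = (\<lambda>w :: 'v + 'v. 1 :: real)"
        have tp: "tpow F t h = 2 powi h u" for h
        proof -
          have "tpow F t h = (\<Prod>w\<in>F. if w = u then 2 powi h w else 1)"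
            unfolding tpow_def t_def by (intro prod.cong) auto
          then show ?thesis using F True by simp
        qed
        have ch: "principal_cluster_variable F B ks v (torus_act F B t p) = tpow F t g * principal_cluster_variable F B ks v p
            \<and> principal_cluster_variable F B ks v p > 0"
          by (rule char[OF F(1-3)]) (simp_all add: p_def t_def)
        have "\<forall>w. 0 < t w" "\<forall>i. 0 < p i" by (simp_all add: p_def t_def)
        then have "principal_cluster_variable F B ks v (torus_act F B t p) = tpow F t g' * principal_cluster_variable F B ks v p"
          using F(4) unfolding is_g_vector_def tpow_def[symmetric] by blast
        then have "tpow F t g' * principal_cluster_variable F B ks v p = tpow F t g * principal_cluster_variable F B ks v p"
          using ch by simp
        then have "(2::real) powi g' u = 2 powi g u" using ch by (simp add: tp)
        then show ?thesis
          using power_int_strict_increasing[of "g u" "g' u" "2::real"] power_int_strict_increasing[of "g' u" "g u" "2::real"]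
          by (cases "g u" "g' u" rule: linorder_cases) simp_all
      qed
    qed
  qed
  then show ?thesis unfolding g_vector_def using ev isg
    by (intro the_equality) (auto elim!: eventually_mono)
qed

section \<open>The quivers $\Gamma_c^{(k)}$ in coordinates\<close>

context dynkin_quiver begin

definition olen :: "nat \<Rightarrow> int" where "olen i = int (orbit_length i)"

lemma olen_pos: "i \<in> I \<Longrightarrow> olen i \<ge> 1" using orbit_length_pos[of i] by (simp add: olen_def)
lemma olen_arrow: "(i, j) \<in> Q \<Longrightarrow> olen i \<le> olen j \<and> olen j \<le> olen i + 1"
  using orbit_length_arrow[of i j] by (simp add: olen_def)

text \<open>The vertex at depth \<open>p\<close> below the highest red vertex of column \<open>i\<close>.\<close>

definition vtx :: "nat \<Rightarrow> int \<Rightarrow> vertex" where "vtx i p = (i, - int (l i) - 2 * p)"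

lemma vtx_inj [simp]: "vtx i p = vtx j q \<longleftrightarrow> i = j \<and> p = q" by (auto simp: vtx_def)
lemma fst_vtx [simp]: "fst (vtx i p) = i" by (simp add: vtx_def)

definition V :: "vertex set" where "V = V_set n l"

lemma V_iff: "v \<in> V \<longleftrightarrow> (\<exists>i p. i \<in> I \<and> v = vtx i p)"
proof
  assume "v \<in> V"
  then obtain i a where "i \<in> I" "v = (i, int (l i) + 2 * a)" by (auto simp: V_def V_set_def I_def)
  then have "v = vtx i (- int (l i) - a)" by (simp add: vtx_def)
  then show "\<exists>i p. i \<in> I \<and> v = vtx i p" using \<open>i \<in> I\<close> by blast
next
  assume "\<exists>i p. i \<in> I \<and> v = vtx i p"
  then obtain i p where "i \<in> I" "v = vtx i p" by blast
  then have "v = (i, int (l i) + 2 * (- int (l i) - p))" by (simp add: vtx_def)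
  then show "v \<in> V" using \<open>i \<in> I\<close> unfolding V_def V_set_def I_def by blast
qed

lemma vtx_V [simp]: "vtx i p \<in> V \<longleftrightarrow> i \<in> I" unfolding V_iff by auto

lemma olen_arrow_cases: "(i, j) \<in> Q \<Longrightarrow> olen j = olen i \<or> olen j = olen i + 1"
  using olen_arrow[of i j] by linarith

abbreviation red :: "nat \<Rightarrow> int \<Rightarrow> bool" where "red i p \<equiv> is_red (olen i) p"
abbreviation green :: "nat \<Rightarrow> int \<Rightarrow> bool" where "green i p \<equiv> is_green (olen i) p"

text \<open>The arrows of $\Gamma_c$ between the vertices at depth \<open>p\<close> in column \<open>i\<close> and at depth \<open>q\<close> in column \<open>j\<close>.\<close>

definition arr :: "nat \<Rightarrow> int \<Rightarrow> nat \<Rightarrow> int \<Rightarrow> bool" where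
  "arr i p j q \<longleftrightarrow>
    (if i = j then vertical_arr (olen i) p q else if (i, j) \<in> Q then forward_arr (olen i) (olen j) p q
     else if (j, i) \<in> Q then backward_arr (olen j) (olen i) p q else False)"

abbreviation red_pos :: "nat \<Rightarrow> int \<Rightarrow> int" where "red_pos i a \<equiv> red_depth (olen i) a"
abbreviation green_pos :: "nat \<Rightarrow> int \<Rightarrow> int" where "green_pos i a \<equiv> green_depth (olen i) a"

lemma arr_same [simp]: "arr i p i q = vertical_arr (olen i) p q" by (simp add: arr_def)
lemma arr_fw: "(i, j) \<in> Q \<Longrightarrow> arr i p j q = forward_arr (olen i) (olen j) p q" by (auto simp: arr_def)
lemma arr_bw: "(j, i) \<in> Q \<Longrightarrow> arr i p j q = backward_arr (olen j) (olen i) p q" using Q_asym[of j i] by (auto simp: arr_def)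
lemma arr_none: "i \<noteq> j \<Longrightarrow> (i, j) \<notin> Q \<Longrightarrow> (j, i) \<notin> Q \<Longrightarrow> \<not> arr i p j q" by (simp add: arr_def)

lemma arr_vertical:
  assumes "olen i \<ge> 1"
  shows "arr i p i q \<longleftrightarrow> (\<exists>a. 0 \<le> a \<and> a < olen i \<and> p = red_pos i a \<and> q = red_pos i a + 1) \<or>
     (\<exists>a. p = red_pos i (a + 1) \<and> q = green_pos i a)"
  unfolding arr_same by (rule vertical_arr_labels[OF assms])

lemma arr_forward:
  assumes a: "(i, j) \<in> Q"
  shows "arr i p j q \<longleftrightarrow> (\<exists>a. p = green_pos i a \<and> q = red_pos j (a + 1))"
  unfolding arr_fw[OF a] using forward_arr_labels[OF _ olen_arrow_cases[OF a]] olen_pos Q_I[OF a] by blast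

lemma arr_backward:
  assumes a: "(j, i) \<in> Q"
  shows "arr i p j q \<longleftrightarrow> (\<exists>a. p = green_pos i a \<and> q = red_pos j a)"
  unfolding arr_bw[OF a] using backward_arr_labels[OF _ olen_arrow_cases[OF a]] olen_pos Q_I[OF a] by blast

lemma arrow_cases [case_names same out into none]:
  obtains "i = j" | "(i, j) \<in> Q" "i \<noteq> j" | "(j, i) \<in> Q" "i \<noteq> j" | "i \<noteq> j" "(i, j) \<notin> Q" "(j, i) \<notin> Q"
  by auto

definition S :: "vertex set" where "S = {vtx i a | i a. i \<in> I \<and> 0 \<le> a \<and> a < olen i}"

lemma S_vtx [simp]: "vtx i a \<in> S \<longleftrightarrow> i \<in> I \<and> 0 \<le> a \<and> a < olen i" by (auto simp: S_def)

lemma G_c_S: "G_c K n Q l = S" for K :: "'k::field itself"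
proof -
  have "(\<exists>k. x = (i, - int (l i) - 2 * int k) \<and> k < orbit_length i) \<longleftrightarrow> (\<exists>a. x = vtx i a \<and> 0 \<le> a \<and> a < olen i)" for x i
  proof
    assume "\<exists>a. x = vtx i a \<and> 0 \<le> a \<and> a < olen i"
    then obtain a where "x = vtx i a" "0 \<le> a" "a < olen i" by blast
    then show "\<exists>k. x = (i, - int (l i) - 2 * int k) \<and> k < orbit_length i"
      by (intro exI[of _ "nat a"]) (auto simp: vtx_def olen_def)
  qed (auto simp: vtx_def olen_def)
  then show ?thesis unfolding G_c_eq S_def by blast
qed

text \<open>The vertices of $G_c$ above depth \<open>a\<close> are those of depth \<open>0, ..., min a d - 1\<close>.\<close>

lemma red_label_vtx: assumes "i \<in> I" shows "red_label S (vtx i a) = vtx i (red_pos i a)"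
proof -
  have "{s. s > - int (l i) - 2 * a \<and> (i, s) \<in> S} = (\<lambda>k. - int (l i) - 2 * int k) ` {..<nat (min (max a 0) (olen i))}"
  proof (intro equalityI subsetI)
    fix s assume "s \<in> {s. s > - int (l i) - 2 * a \<and> (i, s) \<in> S}"
    then obtain b where "s = - int (l i) - 2 * b" "0 \<le> b" "b < olen i" "b < a" by (auto simp: S_def vtx_def)
    then show "s \<in> (\<lambda>k. - int (l i) - 2 * int k) ` {..<nat (min (max a 0) (olen i))}"
      by (intro image_eqI[of _ _ "nat b"]) auto
  next
    fix s assume "s \<in> (\<lambda>k. - int (l i) - 2 * int k) ` {..<nat (min (max a 0) (olen i))}"
    then obtain k where k: "s = - int (l i) - 2 * int k" "int k < a" "int k < olen i" by auto
    then have "(i, s) = vtx i (int k)" by (simp add: vtx_def)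
    then show "s \<in> {s. s > - int (l i) - 2 * a \<and> (i, s) \<in> S}" using k assms by simp
  qed
  then have "card {s. s > - int (l i) - 2 * a \<and> (i, s) \<in> S} = nat (min (max a 0) (olen i))"
    by (simp add: card_image inj_on_def)
  then show ?thesis using olen_pos[OF assms] by (simp add: red_label_def vtx_def red_depth_def)
qed

lemma green_label_vtx: assumes "i \<in> I" shows "green_label S (vtx i a) = vtx i (green_pos i a)"
  using assms unfolding green_label_def red_label_vtx[OF assms] by (simp add: green_depth_def) (simp add: vtx_def)

lemma Gamma_e_vtx:
  "(vtx i a, vtx j b) \<in> Gamma_e n C l \<longleftrightarrow> i \<in> I \<and> j \<in> I \<and>
    (i = j \<and> b = a - 1 \<or> (i, j) \<in> Q \<and> b = a + 1 \<or> (j, i) \<in> Q \<and> b = a)"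
proof -
  have V: "vtx i a \<in> V_set n l \<longleftrightarrow> i \<in> I" for i a using vtx_V by (simp add: V_def)
  have "(vtx i a, vtx j b) \<in> Gamma_e n C l \<longleftrightarrow> i \<in> I \<and> j \<in> I \<and> C i j \<noteq> 0 \<and> - int (l j) - 2 * b = - int (l i) - 2 * a + C i j"
    unfolding Gamma_e_def using V[of i a] V[of j b] by (auto simp: vtx_def)
  moreover have "C i j \<noteq> 0 \<and> - int (l j) - 2 * b = - int (l i) - 2 * a + C i j \<longleftrightarrow>
      i = j \<and> b = a - 1 \<or> (i, j) \<in> Q \<and> b = a + 1 \<or> (j, i) \<in> Q \<and> b = a" if I: "i \<in> I" "j \<in> I"
  proof (cases i j rule: arrow_cases)
    case same
    then show ?thesis using C_value[OF I] by auto
  next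
    case out
    then have "C i j = - 1" "(j, i) \<notin> Q" using C_value[OF I] Q_asym by auto
    then show ?thesis using out height[OF out(1)] by auto
  next
    case into
    then have "C i j = - 1" "(i, j) \<notin> Q" using C_value[OF I] Q_asym by auto
    then show ?thesis using into height[OF into(1)] by auto
  next
    case none
    then show ?thesis using C_value[OF I] by auto
  qed
  ultimately show ?thesis by blast
qed

lemma Gamma_e_E:
  assumes "(x, y) \<in> Gamma_e n C l" obtains i a j b where "x = vtx i a" "y = vtx j b" "i \<in> I" "j \<in> I"
proof -
  have "x \<in> V" "y \<in> V" using assms by (auto simp: Gamma_e_def V_def)
  then show ?thesis using that by (auto simp: V_iff)
qed

lemma Gamma_c_vtx:
  fixes K :: "'k::field itself"
  assumes i: "i \<in> I" and j: "j \<in> I"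
  shows "(vtx i p, vtx j q) \<in> Gamma_c K n C Q l \<longleftrightarrow> arr i p j q"
proof -
  have "(vtx i p, vtx j q) \<in> Gamma_c K n C Q l \<longleftrightarrow>
     (\<exists>x\<in>S. vtx i p = red_label S x \<and> vtx j q = green_label S x) \<or>
     (\<exists>x y. (y, x) \<in> Gamma_e n C l \<and> fst y = fst x \<and> vtx i p = red_label S y \<and> vtx j q = green_label S x) \<or>
     (\<exists>x y. (x, y) \<in> Gamma_e n C l \<and> fst x \<noteq> fst y \<and> vtx i p = green_label S x \<and> vtx j q = red_label S y)"
    unfolding Gamma_c_def G_c_S Let_def by blast
  moreover have "(\<exists>x\<in>S. vtx i p = red_label S x \<and> vtx j q = green_label S x) \<longleftrightarrow>
     i = j \<and> (\<exists>a. 0 \<le> a \<and> a < olen i \<and> p = red_pos i a \<and> q = red_pos i a + 1)" (is "?L \<longleftrightarrow> ?R")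
  proof
    assume ?L
    then obtain i' a where x: "i' \<in> I" "0 \<le> a" "a < olen i'" "vtx i p = red_label S (vtx i' a)" "vtx j q = green_label S (vtx i' a)"
      by (auto simp: S_def)
    then show ?R by (auto simp: red_label_vtx green_label_vtx green_depth_def)
  next
    assume ?R
    then obtain a where a: "i = j" "0 \<le> a" "a < olen i" "p = red_pos i a" "q = red_pos i a + 1" by blast
    then show ?L using i by (intro bexI[of _ "vtx i a"]) (auto simp: red_label_vtx green_label_vtx green_depth_def)
  qed
  moreover have "(\<exists>x y. (y, x) \<in> Gamma_e n C l \<and> fst y = fst x \<and> vtx i p = red_label S y \<and> vtx j q = green_label S x) \<longleftrightarrow>
     i = j \<and> (\<exists>a. p = red_pos i (a + 1) \<and> q = green_pos i a)" (is "?L \<longleftrightarrow> ?R")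
  proof
    assume ?L
    then obtain x y where xy: "(y, x) \<in> Gamma_e n C l" "fst y = fst x" "vtx i p = red_label S y" "vtx j q = green_label S x" by blast
    obtain i' a j' b where e: "y = vtx i' a" "x = vtx j' b" "i' \<in> I" "j' \<in> I" using Gamma_e_E[OF xy(1)] by blast
    have "i' = j'" using xy(2) e by simp
    moreover have "b = a - 1" using xy(1) e calculation by (auto simp: Gamma_e_vtx)
    ultimately show ?R using xy(3,4) e by (auto simp: red_label_vtx green_label_vtx intro!: exI[of _ "a - 1"])
  next
    assume ?R
    then obtain a where a: "i = j" "p = red_pos i (a + 1)" "q = green_pos i a" by blast
    then show ?L using i by (intro exI[of _ "vtx i a"] exI[of _ "vtx i (a + 1)"]) (auto simp: red_label_vtx green_label_vtx Gamma_e_vtx)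
  qed
  moreover have "(\<exists>x y. (x, y) \<in> Gamma_e n C l \<and> fst x \<noteq> fst y \<and> vtx i p = green_label S x \<and> vtx j q = red_label S y) \<longleftrightarrow>
     (i, j) \<in> Q \<and> (\<exists>a. p = green_pos i a \<and> q = red_pos j (a + 1)) \<or>
     (j, i) \<in> Q \<and> (\<exists>a. p = green_pos i a \<and> q = red_pos j a)" (is "?L \<longleftrightarrow> ?R")
  proof
    assume ?L
    then obtain x y where xy: "(x, y) \<in> Gamma_e n C l" "fst x \<noteq> fst y" "vtx i p = green_label S x" "vtx j q = red_label S y" by blast
    obtain i' a j' b where e: "x = vtx i' a" "y = vtx j' b" "i' \<in> I" "j' \<in> I" using Gamma_e_E[OF xy(1)] by blast
    have "i' = i" "j' = j" "p = green_pos i a" "q = red_pos j b" using xy(3,4) e by (auto simp: red_label_vtx green_label_vtx)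
    then show ?R using xy(1,2) e by (auto simp: Gamma_e_vtx)
  next
    assume ?R
    then show ?L
    proof
      assume "(i, j) \<in> Q \<and> (\<exists>a. p = green_pos i a \<and> q = red_pos j (a + 1))"
      then obtain a where a: "(i, j) \<in> Q" "p = green_pos i a" "q = red_pos j (a + 1)" by blast
      then show ?L using i j by (intro exI[of _ "vtx i a"] exI[of _ "vtx j (a + 1)"]) (auto simp: red_label_vtx green_label_vtx Gamma_e_vtx)
    next
      assume "(j, i) \<in> Q \<and> (\<exists>a. p = green_pos i a \<and> q = red_pos j a)"
      then obtain a where a: "(j, i) \<in> Q" "p = green_pos i a" "q = red_pos j a" by blast
      then show ?L using i j by (intro exI[of _ "vtx i a"] exI[of _ "vtx j a"]) (auto simp: red_label_vtx green_label_vtx Gamma_e_vtx)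
    qed
  qed
  ultimately have *: "(vtx i p, vtx j q) \<in> Gamma_c K n C Q l \<longleftrightarrow>
     i = j \<and> ((\<exists>a. 0 \<le> a \<and> a < olen i \<and> p = red_pos i a \<and> q = red_pos i a + 1) \<or> (\<exists>a. p = red_pos i (a + 1) \<and> q = green_pos i a)) \<or>
     (i, j) \<in> Q \<and> (\<exists>a. p = green_pos i a \<and> q = red_pos j (a + 1)) \<or> (j, i) \<in> Q \<and> (\<exists>a. p = green_pos i a \<and> q = red_pos j a)"
    by blast
  show ?thesis
  proof (cases "i = j")
    case True
    then show ?thesis unfolding * using arr_vertical[OF olen_pos[OF i], of p q] by auto
  next
    case ne: False
    show ?thesis
    proof (cases "(i, j) \<in> Q")
      case True
      then show ?thesis unfolding * arr_forward[OF True] using ne Q_asym[OF True] by blast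
    next
      case False
      show ?thesis
      proof (cases "(j, i) \<in> Q")
        case True
        then show ?thesis unfolding * arr_backward[OF True] using ne False by blast
      next
        case F: False
        then show ?thesis unfolding * using ne False by (simp add: arr_def)
      qed
    qed
  qed
qed

lemma Gamma_c_V: "(v, w) \<in> Gamma_c K n C Q l \<Longrightarrow> v \<in> V \<and> w \<in> V" for K :: "'k::field itself"
proof -
  assume "(v, w) \<in> Gamma_c K n C Q l"
  then have "(\<exists>x\<in>S. v = red_label S x \<and> w = green_label S x) \<or>
     (\<exists>x y. (y, x) \<in> Gamma_e n C l \<and> v = red_label S y \<and> w = green_label S x) \<or>
     (\<exists>x y. (x, y) \<in> Gamma_e n C l \<and> v = green_label S x \<and> w = red_label S y)"
    unfolding Gamma_c_def G_c_S Let_def by blast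
  moreover have "red_label S x \<in> V \<and> green_label S x \<in> V" if "x \<in> V" for x
    using that by (auto simp: V_iff red_label_vtx green_label_vtx)
  moreover have "x \<in> V" if "x \<in> S" for x using that by (auto simp: S_def)
  moreover have "x \<in> V \<and> y \<in> V" if "(x, y) \<in> Gamma_e n C l" for x y using that by (auto simp: Gamma_e_def V_def)
  ultimately show ?thesis by blast
qed

definition b_coord :: "nat \<Rightarrow> int \<Rightarrow> nat \<Rightarrow> int \<Rightarrow> int" where
  "b_coord i p j q = of_bool (arr i p j q) - of_bool (arr j q i p)"

definition depth :: "vertex \<Rightarrow> int" where "depth v = (- int (l (fst v)) - snd v) div 2"

lemma depth_vtx [simp]: "depth (vtx i p) = p" by (simp add: depth_def vtx_def)

text \<open>The matrix of $\Gamma_c$ translated downwards by \<open>k\<close> steps.\<close>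

definition B_stage :: "nat \<Rightarrow> vertex \<Rightarrow> vertex \<Rightarrow> int" where
  "B_stage k v w = (if v \<in> V \<and> w \<in> V then b_coord (fst v) (depth v - int k) (fst w) (depth w - int k) else 0)"

lemma B_stage_vtx: "i \<in> I \<Longrightarrow> j \<in> I \<Longrightarrow> B_stage k (vtx i p) (vtx j q) = b_coord i (p - int k) j (q - int k)"
  by (simp add: B_stage_def)
lemma B_stage_outside: "v \<notin> V \<or> w \<notin> V \<Longrightarrow> B_stage k v w = 0" by (auto simp: B_stage_def)
lemma b_coord_skew: "b_coord i p j q = - b_coord j q i p" by (simp add: b_coord_def)
lemma skew_B_stage: "skew (B_stage k)"
proof (unfold skew_def, intro allI)
  fix v w
  show "B_stage k v w = - B_stage k w v"
    using b_coord_skew[of "fst v" "depth v - int k" "fst w" "depth w - int k"] unfolding B_stage_def by auto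
qed

lemma B_c_B_stage: "B_c K n C Q l = B_stage 0" for K :: "'k::field itself"
proof (intro ext)
  fix v w
  show "B_c K n C Q l v w = B_stage 0 v w"
  proof (cases "v \<in> V \<and> w \<in> V")
    case True
    then obtain i p j q where e: "v = vtx i p" "i \<in> I" "w = vtx j q" "j \<in> I" unfolding V_iff by blast
    have "B_c K n C Q l v w = b_coord i p j q"
      unfolding e(1,3) B_c_def exchange_matrix_def Gamma_c_vtx[OF e(2,4)] Gamma_c_vtx[OF e(4,2)] b_coord_def ..
    then show ?thesis using e by (simp add: B_stage_vtx)
  next
    case False
    then have "(v, w) \<notin> Gamma_c K n C Q l" "(w, v) \<notin> Gamma_c K n C Q l" using Gamma_c_V by blast+
    then show ?thesis using False by (auto simp: B_c_def exchange_matrix_def B_stage_def)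
  qed
qed

definition green_set :: "nat \<Rightarrow> vertex set" where "green_set k = {vtx i (p + int k) | i p. i \<in> I \<and> green i p}"

lemma greens_eq: "greens K n Q l k = green_set k" for K :: "'k::field itself"
proof -
  have "green_label S ` S = {vtx i p | i p. i \<in> I \<and> green i p}"
  proof (intro equalityI subsetI)
    fix x assume "x \<in> green_label S ` S"
    then obtain i a where "i \<in> I" "0 \<le> a" "a < olen i" "x = green_label S (vtx i a)" by (auto simp: S_def)
    then have "x = vtx i (2 * a + 1)" "green i (2 * a + 1)" "i \<in> I"
      by (auto simp: green_label_vtx green_depth_def red_depth_def is_green_def)
    then show "x \<in> {vtx i p | i p. i \<in> I \<and> green i p}" by blast
  next
    fix x assume "x \<in> {vtx i p | i p. i \<in> I \<and> green i p}"
    then obtain i p where p: "i \<in> I" "green i p" "x = vtx i p" by blast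
    then obtain a where a: "p = 2 * a + 1" by (auto simp: is_green_def elim: oddE)
    then have "x = green_label S (vtx i a)" "vtx i a \<in> S"
      using p by (auto simp: green_label_vtx green_depth_def red_depth_def is_green_def)
    then show "x \<in> green_label S ` S" by blast
  qed
  then show ?thesis unfolding greens_def green_set_def G_c_S by (fastforce simp: vtx_def)
qed

lemma green_set_vtx [simp]: "vtx i p \<in> green_set k \<longleftrightarrow> i \<in> I \<and> green i (p - int k)" unfolding green_set_def by force
lemma green_set_E: "v \<in> green_set k \<Longrightarrow> (\<And>i p. v = vtx i p \<Longrightarrow> i \<in> I \<Longrightarrow> green i (p - int k) \<Longrightarrow> thesis) \<Longrightarrow> thesis"
  by (auto simp: green_set_def)
lemma finite_green_set [simp]: "finite (green_set k)"
proof -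
  have "green_set k \<subseteq> (\<Union>i\<in>I. (\<lambda>p. vtx i (p + int k)) ` {0..<2 * olen i})" by (auto simp: green_set_def is_green_def)
  then show ?thesis by (rule finite_subset) auto
qed

lemma arr_green_in:
  assumes "green i' e" shows "arr i p i' e \<longleftrightarrow> i = i' \<and> (p = e + 1 \<or> p = e - 1)"
proof (cases i i' rule: arrow_cases)
  case same
  then show ?thesis using up_grn(1) assms by auto
next
  case out
  then show ?thesis using is_green_in(1)[OF _ olen_arrow_cases[OF out(1)] assms] olen_pos[of i] Q_I[OF out(1)] arr_fw[OF out(1)] by auto
next
  case into
  then show ?thesis using is_green_in(2)[OF _ olen_arrow_cases[OF into(1)] assms] olen_pos[of i'] Q_I[OF into(1)] arr_bw[OF into(1)] by auto
qed (simp add: arr_none)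

text \<open>At stage \<open>k\<close> this relates a green vertex to the ends of its outgoing arrows, which lie in the same block.\<close>

definition oblique :: "nat \<Rightarrow> int \<Rightarrow> nat \<Rightarrow> int \<Rightarrow> bool" where
  "oblique i p j q \<longleftrightarrow> (i, j) \<in> Q \<and> q = p + 1 \<or> (j, i) \<in> Q \<and> q = p - 1"

lemma arr_green_out:
  assumes "green i e" shows "arr i e j q \<longleftrightarrow> oblique i e j q"
proof (cases i j rule: arrow_cases)
  case same
  then show ?thesis using up_grn(2) assms by (auto simp: oblique_def)
next
  case out
  then show ?thesis using is_green_in(3)[OF _ olen_arrow_cases[OF out(1)] assms] olen_pos[of i] Q_I[OF out(1)] arr_fw[OF out(1)] Q_asym
    by (auto simp: oblique_def)
next
  case into
  then show ?thesis using is_green_in(4)[OF _ olen_arrow_cases[OF into(1)] assms] olen_pos[of j] Q_I[OF into(1)] arr_bw[OF into(1)] Q_asym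
    by (auto simp: oblique_def)
qed (simp add: arr_none oblique_def)

lemma oblique_ne: "oblique i p j q \<Longrightarrow> i \<noteq> j" by (auto simp: oblique_def)

lemma b_coord_green_in:
  assumes "green i' e" shows "max 0 (b_coord i p i' e) = of_bool (i = i' \<and> (p = e + 1 \<or> p = e - 1))"
  unfolding b_coord_def arr_green_in[OF assms] arr_green_out[OF assms] using oblique_ne[of i' e i p] by auto

lemma b_coord_green_out:
  assumes "green i e" shows "max 0 (b_coord i e j q) = of_bool (oblique i e j q)"
  unfolding b_coord_def arr_green_in[OF assms] arr_green_out[OF assms] using oblique_ne[of i e j q] by auto

lemma b_coord_Q: "(i, j) \<in> Q \<Longrightarrow> b_coord i p j q = oblique_entry (olen i) (olen j) p q"
  by (simp add: b_coord_def oblique_entry_def arr_fw arr_bw)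
lemma b_coord_same: "b_coord i p i q = of_bool (vertical_arr (olen i) p q) - of_bool (vertical_arr (olen i) q p)"
  by (simp add: b_coord_def)
lemma b_coord_none: "i \<noteq> j \<Longrightarrow> (i, j) \<notin> Q \<Longrightarrow> (j, i) \<notin> Q \<Longrightarrow> b_coord i p j q = 0"
  by (simp add: b_coord_def arr_none)

lemma unlinked_green_set: "unlinked (green_set k) (B_stage k)"
  unfolding unlinked_def
proof (intro ballI)
  fix v w assume "v \<in> green_set k" "w \<in> green_set k"
  then obtain i p j q where v: "v = vtx i p" "i \<in> I" "green i (p - int k)" and w: "w = vtx j q" "j \<in> I" "green j (q - int k)"
    by (auto elim!: green_set_E)
  have "max 0 (b_coord i (p - int k) j (q - int k)) = 0" "max 0 (b_coord j (q - int k) i (p - int k)) = 0"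
    using v(3) w(3) unfolding b_coord_green_in[OF w(3)] b_coord_green_in[OF v(3)] by (auto simp: is_green_def)
  then show "B_stage k v w = 0" using b_coord_skew[of i "p - int k" j "q - int k"] v w by (simp add: B_stage_vtx max_def split: if_splits)
qed

text \<open>The number of paths of length two through a green vertex: up or down to a green neighbour in the same column, then along
  an oblique arrow.\<close>

definition via :: "nat \<Rightarrow> int \<Rightarrow> nat \<Rightarrow> int \<Rightarrow> int" where
  "via i p j q = of_bool (green i (p - 1) \<and> oblique i (p - 1) j q) + of_bool (green i (p + 1) \<and> oblique i (p + 1) j q)"

lemma sum_via:
  assumes i: "i \<in> I" and j: "j \<in> I"
  shows "(\<Sum>g\<in>green_set k. max 0 (B_stage k (vtx i p) g) * max 0 (B_stage k g (vtx j q))) = via i (p - int k) j (q - int k)"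
proof -
  let ?p = "p - int k" and ?q = "q - int k"
  define X where "X = {e \<in> {?p - 1, ?p + 1}. green i e}"
  have val: "max 0 (B_stage k (vtx i p) (vtx i' e)) * max 0 (B_stage k (vtx i' e) (vtx j q)) =
     of_bool (i = i' \<and> (?p = e - int k + 1 \<or> ?p = e - int k - 1) \<and> oblique i (e - int k) j ?q)"
    if "i' \<in> I" "green i' (e - int k)" for i' e
    using that i j by (auto simp: B_stage_vtx b_coord_green_in b_coord_green_out)
  have "(\<Sum>g\<in>green_set k. max 0 (B_stage k (vtx i p) g) * max 0 (B_stage k g (vtx j q))) =
     (\<Sum>g\<in>(\<lambda>e. vtx i (e + int k)) ` X. max 0 (B_stage k (vtx i p) g) * max 0 (B_stage k g (vtx j q)))"
  proof (rule sum.mono_neutral_right)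
    show "(\<lambda>e. vtx i (e + int k)) ` X \<subseteq> green_set k" using i by (auto simp: X_def green_set_def)
    show "\<forall>g\<in>green_set k - (\<lambda>e. vtx i (e + int k)) ` X. max 0 (B_stage k (vtx i p) g) * max 0 (B_stage k g (vtx j q)) = 0"
    proof
      fix g assume g: "g \<in> green_set k - (\<lambda>e. vtx i (e + int k)) ` X"
      then obtain i' e where e: "g = vtx i' e" "i' \<in> I" "green i' (e - int k)" by (auto elim: green_set_E)
      have "\<not> (i = i' \<and> (?p = e - int k + 1 \<or> ?p = e - int k - 1))"
      proof
        assume h: "i = i' \<and> (?p = e - int k + 1 \<or> ?p = e - int k - 1)"
        then have "e - int k \<in> X" using e by (auto simp: X_def)
        then have "g \<in> (\<lambda>e. vtx i (e + int k)) ` X" using e h by (intro image_eqI[of _ _ "e - int k"]) auto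
        then show False using g by simp
      qed
      then show "max 0 (B_stage k (vtx i p) g) * max 0 (B_stage k g (vtx j q)) = 0" unfolding e(1) val[OF e(2,3)] by auto
    qed
  qed simp
  also have "\<dots> = (\<Sum>e\<in>X. max 0 (B_stage k (vtx i p) (vtx i (e + int k))) * max 0 (B_stage k (vtx i (e + int k)) (vtx j q)))"
    by (subst sum.reindex) (auto simp: inj_on_def)
  also have "\<dots> = (\<Sum>e\<in>X. of_bool (oblique i e j ?q))"
  proof (intro sum.cong refl)
    fix e assume e: "e \<in> X"
    then have "?p = e + int k - int k + 1 \<or> ?p = e + int k - int k - 1" "green i (e + int k - int k)" by (auto simp: X_def)
    then show "max 0 (B_stage k (vtx i p) (vtx i (e + int k))) * max 0 (B_stage k (vtx i (e + int k)) (vtx j q)) = of_bool (oblique i e j ?q)"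
      using val[OF i, of "e + int k"] by auto
  qed
  also have "\<dots> = via i ?p j ?q"
    unfolding X_def via_def by (subst sum.inter_filter) auto
  finally show ?thesis .
qed

lemma b_coord_shift_green:
  assumes "green i p \<or> green j q"
  shows "- b_coord i p j q = b_coord i (p - 1) j (q - 1)"
proof (cases i j rule: arrow_cases)
  case same
  have "- 1 * (of_bool (vertical_arr (olen i) p q) - of_bool (vertical_arr (olen i) q p)) =
      (of_bool (vertical_arr (olen i) (p - 1) (q - 1)) - of_bool (vertical_arr (olen i) (q - 1) (p - 1)) :: int)"
    by (rule ver_shift) (use assms same in auto)
  then show ?thesis unfolding same[symmetric] b_coord_same by (simp only: mult_minus1)
next
  case out
  then show ?thesis using oblique_entry_shift_green[OF _ olen_arrow_cases[OF out(1)]] olen_pos[of i] Q_I[OF out(1)] assms by (simp add: b_coord_Q)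
next
  case into
  then show ?thesis using oblique_entry_shift_green[OF _ olen_arrow_cases[OF into(1)], of q p] olen_pos[of j] Q_I[OF into(1)] assms
      b_coord_skew[of i p j q] b_coord_skew[of i "p - 1" j "q - 1"] by (auto simp: b_coord_Q)
qed (simp add: b_coord_none)

lemma via_Q:
  assumes "(i, j) \<in> Q"
  shows "via i p j q = of_bool (green i (p - 1) \<and> q = p) + of_bool (green i (p + 1) \<and> q = p + 2)"
    "via j q i p = of_bool (green j (q - 1) \<and> p = q - 2) + of_bool (green j (q + 1) \<and> p = q)"
  using assms Q_asym[OF assms] by (auto simp: via_def oblique_def)

lemma via_none: "(i, j) \<notin> Q \<Longrightarrow> (j, i) \<notin> Q \<Longrightarrow> via i p j q = 0" by (simp add: via_def oblique_def)

lemma b_coord_shift_other: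
  assumes "\<not> green i p" "\<not> green j q"
  shows "b_coord i p j q + via i p j q - via j q i p = b_coord i (p - 1) j (q - 1)"
proof (cases i j rule: arrow_cases)
  case same
  then show ?thesis using ver_shift[of "olen i" p q 1] assms by (simp add: b_coord_same via_none)
next
  case out
  then show ?thesis using oblique_entry_shift_other[OF _ olen_arrow_cases[OF out(1)] assms] olen_pos[of i] Q_I[OF out(1)]
    by (simp add: b_coord_Q via_Q)
next
  case into
  have "b_coord j q i p + via j q i p - via i p j q = b_coord j (q - 1) i (p - 1)"
    using into oblique_entry_shift_other[OF _ olen_arrow_cases[OF into(1)] assms(2,1)] olen_pos[of j] Q_I[OF into(1)]
    by (simp add: b_coord_Q via_Q)
  then show ?thesis using b_coord_skew[of i p j q] b_coord_skew[of i "p - 1" j "q - 1"] by linarith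
qed (simp_all add: b_coord_none via_none)

text \<open>Mutation at the green vertices moves the pattern of red and green vertices down by one. Arrows at green vertices are
  reversed; all others are corrected by the paths counted by \<open>via\<close>. Both cases reduce to the arithmetic of two columns.\<close>

lemma mut_set_green_set: "mut_set (green_set k) (B_stage k) = B_stage (Suc k)"
proof (intro ext)
  fix v w
  show "mut_set (green_set k) (B_stage k) v w = B_stage (Suc k) v w"
  proof (cases "v \<in> V \<and> w \<in> V")
    case False
    have "max 0 (B_stage k v x) * max 0 (B_stage k x w) - max 0 (- B_stage k v x) * max 0 (- B_stage k x w) = 0" for x
      using False by (cases "v \<in> V") (simp_all add: B_stage_outside)
    then show ?thesis using False by (auto simp: mut_set_def B_stage_outside)
  next
    case True
    then obtain i p j q where v: "v = vtx i p" "i \<in> I" and w: "w = vtx j q" "j \<in> I" by (auto simp: V_iff)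
    let ?p = "p - int k" and ?q = "q - int k"
    have sh: "B_stage (Suc k) v w = b_coord i (?p - 1) j (?q - 1)" using v w by (simp add: B_stage_vtx diff_diff_eq add.commute)
    show ?thesis
    proof (cases "green i ?p \<or> green j ?q")
      case True
      then have "mut_set (green_set k) (B_stage k) v w = - b_coord i ?p j ?q" using v w by (auto simp: mut_set_def B_stage_vtx)
      then show ?thesis unfolding sh using b_coord_shift_green[OF True] by simp
    next
      case False
      have "(\<Sum>g\<in>green_set k. max 0 (B_stage k v g) * max 0 (B_stage k g w) - max 0 (- B_stage k v g) * max 0 (- B_stage k g w)) =
         via i ?p j ?q - via j ?q i ?p"
        unfolding sum_subtractf v(1) w(1) sum_via[OF v(2) w(2), symmetric] sum_via[OF w(2) v(2), symmetric]
        by (intro arg_cong2[of _ _ _ _ "(-)"] sum.cong refl)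
          (metis skewD[OF skew_B_stage] mult.commute minus_minus)
      then have "mut_set (green_set k) (B_stage k) v w = b_coord i ?p j ?q + via i ?p j ?q - via j ?q i ?p"
        using False v w by (simp add: mut_set_def B_stage_vtx)
      then show ?thesis unfolding sh using b_coord_shift_other[of i ?p j ?q] False by simp
    qed
  qed
qed

lemma green_list_props: "distinct (green_list K n Q l k) \<and> set (green_list K n Q l k) = green_set k" for K :: "'k::field itself"
  unfolding green_list_def greens_eq
  by (rule someI_ex) (use finite_distinct_list[OF finite_green_set[of k]] in blast)

lemma B_seq_B_stage: "B_seq K n C Q l k = B_stage k" for K :: "'k::field itself"
proof (induction k)
  case 0
  then show ?case by (simp add: B_c_B_stage)
next
  case (Suc k)
  then show ?case using green_list_props[of K k] fold_mutate[of "green_list K n Q l k" "B_stage k"] unlinked_green_set[of k]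
    by (simp add: mut_set_green_set)
qed

section \<open>The g- and c-vectors of a block\<close>

definition nbrs :: "nat \<Rightarrow> nat set" where "nbrs i = {j. (i, j) \<in> Q \<or> (j, i) \<in> Q}"

lemma nbrs_sym: "j \<in> nbrs i \<longleftrightarrow> i \<in> nbrs j" by (auto simp: nbrs_def)
lemma nbrs_I: "j \<in> nbrs i \<Longrightarrow> i \<in> I \<and> j \<in> I" using Q_I by (auto simp: nbrs_def)
lemma finite_nbrs [simp]: "finite (nbrs i)" by (rule finite_subset[OF _ finite_I]) (use nbrs_I in auto)
lemma sum_nbrs: "(\<Sum>j\<in>nbrs i. f j) = (\<Sum>j | (i, j) \<in> Q. f j) + (\<Sum>j | (j, i) \<in> Q. f j)"
proof -
  have "nbrs i = {j. (i, j) \<in> Q} \<union> {j. (j, i) \<in> Q}" by (auto simp: nbrs_def)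
  moreover have "finite {j. (i, j) \<in> Q}" "finite {j. (j, i) \<in> Q}" by (rule finite_subset[OF _ finite_I]; use Q_I in auto)+
  moreover have "{j. (i, j) \<in> Q} \<inter> {j. (j, i) \<in> Q} = {}" using Q_asym by auto
  ultimately show ?thesis by (simp add: sum.union_disjoint)
qed

text \<open>The vertices of a block of level \<open>L\<close> that are red at the seed \<open>k\<close> with \<open>L - k = s\<close>, and green at the seed
  \<open>k - 1\<close>. These are the vertices of the block that are mutated on the way back from the one to the other.\<close>

definition A :: "int \<Rightarrow> nat set" where "A s = {i \<in> I. red i (s - int (l i))}"

lemma A_nbrs: "i \<in> A s \<Longrightarrow> j \<in> nbrs i \<Longrightarrow> j \<notin> A s"
  using height[of i j] height[of j i] by (auto simp: A_def nbrs_def is_red_def)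
lemma A_self_nbrs: "i \<notin> nbrs i" by (auto simp: nbrs_def)
lemma A_neg: "s < 0 \<Longrightarrow> A s = {}" by (auto simp: A_def is_red_def)
lemma A_I: "i \<in> A s \<Longrightarrow> i \<in> I" by (simp add: A_def)
lemma finite_A [simp]: "finite (A s)" by (rule finite_subset[OF _ finite_I]) (use A_I in auto)

text \<open>The c- and g-vectors of a block after \<open>t\<close> steps that start at time \<open>s0\<close>, by the recursion of Fomin and Zelevinsky for positive
  c-vectors. The time in a block of level \<open>L\<close> at the \<open>k\<close>-th seed is \<open>L - k\<close>.\<close>

primrec c_vec :: "int \<Rightarrow> nat \<Rightarrow> nat \<Rightarrow> nat \<Rightarrow> int" where
  "c_vec s0 0 i = (\<lambda>a. of_bool (a = i))"
| "c_vec s0 (Suc t) i = (if i \<in> A (s0 + int t) then (\<lambda>a. - c_vec s0 t i a)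
     else (\<lambda>a. c_vec s0 t i a + (\<Sum>j\<in>nbrs i \<inter> A (s0 + int t). c_vec s0 t j a)))"

primrec g_vec :: "int \<Rightarrow> nat \<Rightarrow> nat \<Rightarrow> nat \<Rightarrow> int" where
  "g_vec s0 0 i = (\<lambda>a. of_bool (a = i))"
| "g_vec s0 (Suc t) i = (if i \<in> A (s0 + int t) then (\<lambda>a. - g_vec s0 t i a + (\<Sum>j\<in>nbrs i. g_vec s0 t j a)) else g_vec s0 t i)"

text \<open>The matrices of a step for the g- and for the c-vectors are inverse transposes of each other.\<close>

lemma g_vec_cv_dual:
  assumes "i \<in> I" "j \<in> I"
  shows "(\<Sum>a\<in>I. g_vec s0 t i a * c_vec s0 t j a) = of_bool (i = j)"
  using assms
proof (induction t arbitrary: i j)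
  case 0
  have "(\<Sum>a\<in>I. g_vec s0 0 i a * c_vec s0 0 j a) = (\<Sum>a\<in>I. if a = i then of_bool (i = j) else 0)"
    by (intro sum.cong) auto
  then show ?case using 0 by simp
next
  case (Suc t)
  let ?A = "A (s0 + int t)" and ?p = "\<lambda>i j. (\<Sum>a\<in>I. g_vec s0 t i a * c_vec s0 t j a)"
  have P: "?p i j = of_bool (i = j)" if "i \<in> I" "j \<in> I" for i j using Suc.IH[OF that] .
  have D: "(\<Sum>k\<in>K. ?p i k) = of_bool (i \<in> K)" if "K \<subseteq> I" "finite K" "i \<in> I" for K i
  proof -
    have "(\<Sum>k\<in>K. ?p i k) = (\<Sum>k\<in>K. if k = i then 1 else 0)" using P that by (intro sum.cong) auto
    then show ?thesis using that by simp
  qed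
  have D': "(\<Sum>k\<in>K. ?p k j) = of_bool (j \<in> K)" if "K \<subseteq> I" "finite K" "j \<in> I" for K j
  proof -
    have "(\<Sum>k\<in>K. ?p k j) = (\<Sum>k\<in>K. if k = j then 1 else 0)" using P that by (intro sum.cong) auto
    then show ?thesis using that by simp
  qed
  have nbI: "nbrs i \<subseteq> I" for i using nbrs_I by auto
  have c: "(\<Sum>a\<in>I. x a * c_vec s0 (Suc t) j a) = (if j \<in> ?A then - (\<Sum>a\<in>I. x a * c_vec s0 t j a)
     else (\<Sum>a\<in>I. x a * c_vec s0 t j a) + (\<Sum>k\<in>nbrs j \<inter> ?A. \<Sum>a\<in>I. x a * c_vec s0 t k a))" for x
    by (simp add: distrib_left sum.distrib sum_distrib_left sum_negf sum.swap[of _ _ I])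
  have g: "(\<Sum>a\<in>I. g_vec s0 (Suc t) i a * y a) = (if i \<in> ?A then - (\<Sum>a\<in>I. g_vec s0 t i a * y a)
     + (\<Sum>k\<in>nbrs i. \<Sum>a\<in>I. g_vec s0 t k a * y a) else (\<Sum>a\<in>I. g_vec s0 t i a * y a))" for y
    by (simp add: distrib_right sum.distrib sum_subtractf left_diff_distrib sum_distrib_right sum_negf sum.swap[of _ _ I])
  have fin: "finite (nbrs j \<inter> ?A)" "nbrs j \<inter> ?A \<subseteq> I" using nbI by auto
  show ?case
  proof (cases "j \<in> ?A")
    case True
    then have "(\<Sum>a\<in>I. g_vec s0 (Suc t) i a * c_vec s0 (Suc t) j a) = - (\<Sum>a\<in>I. g_vec s0 (Suc t) i a * c_vec s0 t j a)"
      unfolding c by simp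
    also have "\<dots> = of_bool (i = j)"
      unfolding g using P[OF Suc.prems] D'[OF nbI finite_nbrs Suc.prems(2), of i] True A_nbrs[of i "s0 + int t" j] by auto
    finally show ?thesis .
  next
    case False
    then have "(\<Sum>a\<in>I. g_vec s0 (Suc t) i a * c_vec s0 (Suc t) j a) =
       (\<Sum>a\<in>I. g_vec s0 (Suc t) i a * c_vec s0 t j a) + (\<Sum>k\<in>nbrs j \<inter> ?A. \<Sum>a\<in>I. g_vec s0 (Suc t) i a * c_vec s0 t k a)"
      unfolding c by simp
    also have "\<dots> = of_bool (i = j)"
    proof (cases "i \<in> ?A")
      case F: False
      then show ?thesis unfolding g using P[OF Suc.prems] D[OF fin(2,1) Suc.prems(1)] by simp
    next
      case T: True
      have "(\<Sum>k\<in>nbrs j \<inter> ?A. \<Sum>k'\<in>nbrs i. ?p k' k) = 0"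
      proof (rule sum.neutral, rule ballI)
        fix k assume k: "k \<in> nbrs j \<inter> ?A"
        then have "k \<in> I" "k \<notin> nbrs i" using fin A_nbrs[of i "s0 + int t" k] T by auto
        then show "(\<Sum>k'\<in>nbrs i. ?p k' k) = 0" using D'[OF nbI finite_nbrs] by simp
      qed
      then show ?thesis unfolding g using T P[OF Suc.prems] D[OF fin(2,1) Suc.prems(1)] D'[OF nbI finite_nbrs Suc.prems(2), of i] nbrs_sym[of i j] False
        by (auto simp: sum.distrib sum_negf sum_subtractf)
    qed
    finally show ?thesis .
  qed
qed

lemma c_vec_start: "s0 + int t \<le> 0 \<Longrightarrow> c_vec s0 t i = (\<lambda>a. of_bool (a = i))"
  by (induction t arbitrary: i) (simp_all add: A_neg)
lemma g_vec_start: "s0 + int t \<le> 0 \<Longrightarrow> g_vec s0 t i = (\<lambda>a. of_bool (a = i))"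
  by (induction t arbitrary: i) (simp_all add: A_neg)

lemma c_vec_from_zero: "s0 \<le> 0 \<Longrightarrow> c_vec s0 t i = c_vec 0 (nat (s0 + int t)) i"
proof (induction t arbitrary: i)
  case 0
  then show ?case by simp
next
  case (Suc t)
  show ?case
  proof (cases "s0 + int t < 0")
    case True
    then show ?thesis using c_vec_start[of s0 "Suc t"] by simp
  next
    case False
    then have e: "nat (s0 + int (Suc t)) = Suc (nat (s0 + int t))" "int (nat (s0 + int t)) = s0 + int t" by auto
    show ?thesis unfolding e(1) using Suc e(2) by simp
  qed
qed

lemma g_vec_from_zero: "s0 \<le> 0 \<Longrightarrow> g_vec s0 t i = g_vec 0 (nat (s0 + int t)) i"
proof (induction t arbitrary: i)
  case 0
  then show ?case by simp
next
  case (Suc t)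
  show ?case
  proof (cases "s0 + int t < 0")
    case True
    then show ?thesis using g_vec_start[of s0 "Suc t"] by simp
  next
    case False
    then have e: "nat (s0 + int (Suc t)) = Suc (nat (s0 + int t))" "int (nat (s0 + int t)) = s0 + int t" by auto
    show ?thesis unfolding e(1) using Suc e(2) by simp
  qed
qed

lemma g_vec_step: "g_vec 0 (nat (s + 1)) i = (if i \<in> A s then (\<lambda>a. - g_vec 0 (nat s) i a + (\<Sum>j\<in>nbrs i. g_vec 0 (nat s) j a)) else g_vec 0 (nat s) i)"
proof (cases "s < 0")
  case True
  then show ?thesis by (simp add: A_neg)
next
  case False
  then have "nat (s + 1) = Suc (nat s)" "int (nat s) = s" by auto
  then show ?thesis by simp
qed

text \<open>The simultaneous reflection on the root lattice at the vertices of \<open>A s\<close>.\<close>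

definition refl :: "int \<Rightarrow> (nat \<Rightarrow> int) \<Rightarrow> nat \<Rightarrow> int" where
  "refl s x a = (if a \<in> A s then - x a + (\<Sum>j\<in>nbrs a. x j) else x a)"

lemma refl_minus: "refl s (\<lambda>a. - x a) = (\<lambda>a. - refl s x a)" by (simp add: refl_def sum_negf fun_eq_iff)
lemma refl_add_sum: "refl s (\<lambda>a. x a + (\<Sum>j\<in>K. y j a)) = (\<lambda>a. refl s x a + (\<Sum>j\<in>K. refl s (y j) a))"
proof
  fix a
  show "refl s (\<lambda>a. x a + (\<Sum>j\<in>K. y j a)) a = refl s x a + (\<Sum>j\<in>K. refl s (y j) a)"
    by (simp add: refl_def sum.distrib sum_subtractf sum_negf sum.swap[of _ _ "nbrs a"])
qed

text \<open>A step applies to each c-vector the reflections at the c-vectors of the vertices in \<open>A\<close>. On the root lattice, the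
  c-vectors are the simple roots transformed by the successive simple reflections, and prolonging the sequence at its
  beginning applies the simultaneous reflection \<open>refl\<close> to all of them.\<close>

lemma c_vec_left: "i \<in> I \<Longrightarrow> c_vec s (Suc t) i = refl s (c_vec (s + 1) t i)"
proof (induction t arbitrary: i)
  case 0
  show ?case
  proof
    fix a
    have 1: "(\<Sum>j\<in>nbrs i \<inter> A s. of_bool (a = j)) = (of_bool (a \<in> nbrs i \<inter> A s) :: int)"
      by (simp add: of_bool_def)
    have 2: "(\<Sum>j\<in>nbrs a. of_bool (j = i)) = (of_bool (i \<in> nbrs a) :: int)"
      by (simp add: of_bool_def)
    show "c_vec s (Suc 0) i a = refl s (c_vec (s + 1) 0 i) a"
      using nbrs_sym[of i a] A_nbrs[of i s a] A_nbrs[of a s i] A_self_nbrs[of i] by (auto simp: refl_def 1 2)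
  qed
next
  case (Suc t)
  have e: "s + int (Suc t) = (s + 1) + int t" by simp
  have IH: "c_vec s (Suc t) j = refl s (c_vec (s + 1) t j)" if "j \<in> I" for j using Suc.IH[OF that] .
  show ?case
  proof (cases "i \<in> A (s + int (Suc t))")
    case True
    then have "c_vec s (Suc (Suc t)) i = (\<lambda>a. - c_vec s (Suc t) i a)" by (simp only: c_vec.simps(2)[of s "Suc t"] if_True)
    also have "\<dots> = refl s (\<lambda>a. - c_vec (s + 1) t i a)" unfolding IH[OF Suc.prems] refl_minus ..
    also have "(\<lambda>a. - c_vec (s + 1) t i a) = c_vec (s + 1) (Suc t) i" using True unfolding e by simp
    finally show ?thesis .
  next
    case False
    then have "c_vec s (Suc (Suc t)) i = (\<lambda>a. c_vec s (Suc t) i a + (\<Sum>j\<in>nbrs i \<inter> A (s + int (Suc t)). c_vec s (Suc t) j a))"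
      by (simp only: c_vec.simps(2)[of s "Suc t"] if_False)
    also have "\<dots> = (\<lambda>a. refl s (c_vec (s + 1) t i) a + (\<Sum>j\<in>nbrs i \<inter> A (s + int (Suc t)). refl s (c_vec (s + 1) t j) a))"
      using IH Suc.prems nbrs_I by (intro ext arg_cong2[of _ _ _ _ "(+)"] sum.cong) (auto simp del: c_vec.simps)
    also have "\<dots> = refl s (\<lambda>a. c_vec (s + 1) t i a + (\<Sum>j\<in>nbrs i \<inter> A (s + int (Suc t)). c_vec (s + 1) t j a))"
      unfolding refl_add_sum ..
    also have "(\<lambda>a. c_vec (s + 1) t i a + (\<Sum>j\<in>nbrs i \<inter> A (s + int (Suc t)). c_vec (s + 1) t j a)) = c_vec (s + 1) (Suc t) i"
      using False unfolding e by simp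
    finally show ?thesis .
  qed
qed

lemma euler_sym: "euler x y + euler y x = (\<Sum>v\<in>I. y v * (2 * x v - (\<Sum>j\<in>nbrs v. x j)))"
proof -
  have 1: "euler x y = (\<Sum>v\<in>I. y v * (x v - (\<Sum>u | (u, v) \<in> Q. x u)))"
    unfolding euler_def sum_into by (simp add: sum_distrib_left right_diff_distrib sum_subtractf mult.commute)
  have 2: "euler y x = (\<Sum>v\<in>I. y v * (x v - (\<Sum>w | (v, w) \<in> Q. x w)))"
    unfolding euler_def sum_out by (simp add: sum_distrib_left right_diff_distrib sum_subtractf)
  show ?thesis unfolding 1 2 sum_nbrs sum.distrib[symmetric] by (intro sum.cong) (auto simp: algebra_simps)
qed

lemma euler_supported_A:
  assumes "\<And>v. v \<in> I \<Longrightarrow> v \<notin> A s \<Longrightarrow> y v = 0" shows "euler y y = (\<Sum>v\<in>I. y v * y v)"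
proof -
  have "y u * y v = 0" if a: "(u, v) \<in> Q" for u v
    using A_nbrs[of u s v] assms[of u] assms[of v] Q_I[OF a] a by (auto simp: nbrs_def)
  then have "(\<Sum>(u, v)\<in>Q. y u * y v) = 0" by (intro sum.neutral) auto
  then show ?thesis by (simp add: euler_def)
qed

text \<open>No two vertices of \<open>A s\<close> are adjacent, so the reflections commute, and together they preserve the quadratic form.\<close>

lemma euler_refl: "euler (refl s x) (refl s x) = euler x x"
proof -
  define y where "y = (\<lambda>v. if v \<in> A s then 2 * x v - (\<Sum>j\<in>nbrs v. x j) else 0)"
  have r: "refl s x = (\<lambda>v. x v - y v)" by (auto simp: refl_def y_def fun_eq_iff)
  have "euler x y + euler y x = (\<Sum>v\<in>I. y v * y v)"
    unfolding euler_sym by (intro sum.cong) (auto simp: y_def)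
  moreover have "euler y y = (\<Sum>v\<in>I. y v * y v)" by (rule euler_supported_A[of s]) (simp add: y_def)
  ultimately show ?thesis unfolding r by (simp add: euler_diff_left euler_diff_right)
qed

lemma c_vec_root: "i \<in> I \<Longrightarrow> euler (c_vec s t i) (c_vec s t i) = 1"
proof (induction t arbitrary: s)
  case 0
  have "(\<Sum>(u, v)\<in>Q. of_bool (u = i) * of_bool (v = i)) = (0::int)" by (intro sum.neutral) auto
  moreover have "(\<Sum>v\<in>I. of_bool (v = i) * of_bool (v = i)) = (\<Sum>v\<in>I. if v = i then 1 else (0::int))" by (intro sum.cong) auto
  ultimately show ?case using 0 by (simp add: euler_def)
next
  case (Suc t)
  show ?case unfolding c_vec_left[OF Suc.prems] euler_refl by (rule Suc.IH[OF Suc.prems])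
qed

lemma c_vec_before: "t < l i \<or> t = 0 \<Longrightarrow> c_vec 0 t i = (\<lambda>a. of_bool (a = i))"
proof (induction t)
  case (Suc t)
  then have t: "Suc t < l i" by auto
  have "i \<notin> A (int t)" using t by (auto simp: A_def is_red_def)
  moreover have "nbrs i \<inter> A (int t) = {}" using t height by (fastforce simp: nbrs_def A_def is_red_def)
  ultimately show ?case using Suc t by simp
qed simp

text \<open>At the times at which the vertex \<open>i\<close> is reflected its c-vectors satisfy the mesh relations, and hence
  run through the dimension vectors of the orbit of \<open>P\<^sub>i\<close>.\<close>

lemma c_vec_beta:
  assumes "i \<in> I" "a < orbit_length i" "v \<in> I"
  shows "c_vec 0 (l i + 2 * a) i v = beta i a v"
  using assms
proof (induction "l i + 2 * a" arbitrary: i a v rule: less_induct)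
  case less
  have IH: "c_vec 0 (l j + 2 * b) j v = beta j b v" if "l j + 2 * b < l i + 2 * a" "j \<in> I" "b < orbit_length j" for j b
    using less(1)[OF that] less.prems(3) by blast
  show ?case
  proof (cases a)
    case 0
    show ?thesis
    proof (cases "l i")
      case l0: 0
      have "{j. (i, j) \<in> Q} = {}" using height[of i] l0 by fastforce
      then show ?thesis using pvec_rec_first[OF less.prems(3,1)] 0 l0 by simp
    next
      case (Suc t)
      have nbrs: "nbrs i \<inter> A (int t) = {j. (i, j) \<in> Q}"
      proof (intro equalityI subsetI)
        fix j assume "j \<in> nbrs i \<inter> A (int t)"
        then show "j \<in> {j. (i, j) \<in> Q}" using Suc height[of j i] by (auto simp: nbrs_def A_def is_red_def)
      next
        fix j assume "j \<in> {j. (i, j) \<in> Q}"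
        then have "(i, j) \<in> Q" by simp
        then show "j \<in> nbrs i \<inter> A (int t)" using Suc height[of i j] Q_I[of i j] olen_pos[of j] by (auto simp: nbrs_def A_def is_red_def)
      qed
      have "i \<notin> A (int t)" using Suc by (auto simp: A_def is_red_def)
      then have "c_vec 0 (Suc t) i v = c_vec 0 t i v + (\<Sum>j | (i, j) \<in> Q. c_vec 0 t j v)" using nbrs by simp
      also have "c_vec 0 t i v = of_bool (v = i)" using c_vec_before[of t i] Suc by simp
      also have "(\<Sum>j | (i, j) \<in> Q. c_vec 0 t j v) = (\<Sum>j | (i, j) \<in> Q. pvec j v)"
      proof (intro sum.cong refl)
        fix j assume "j \<in> {j. (i, j) \<in> Q}"
        then have j: "(i, j) \<in> Q" by simp
        then show "c_vec 0 t j v = pvec j v" using IH[of j 0] height[OF j] Suc 0 Q_I[OF j] orbit_length_pos[of j] by simp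
      qed
      finally show ?thesis using pvec_rec_first[OF less.prems(3,1)] 0 Suc by simp
    qed
  next
    case (Suc b)
    define t where "t = l i + 2 * b"
    have s: "l i + 2 * a = Suc (Suc t)" by (simp add: t_def Suc)
    have iA: "i \<in> A (int t)" using less.prems Suc by (auto simp: A_def is_red_def t_def olen_def)
    have niA: "i \<notin> A (int (Suc t))" by (auto simp: A_def is_red_def t_def)
    have nbrs: "nbrs i \<inter> A (int (Suc t)) = nbrs i"
    proof (intro equalityI subsetI)
      fix j assume j: "j \<in> nbrs i"
      then have jI: "j \<in> I" using nbrs_I by auto
      show "j \<in> nbrs i \<inter> A (int (Suc t))"
        using j jI height[of i j] height[of j i] orbit_length_arrow[of i j] orbit_length_arrow[of j i] less.prems(2) Suc
        by (auto simp: nbrs_def A_def is_red_def t_def olen_def)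
    qed auto
    have "c_vec 0 (Suc (Suc t)) i v = c_vec 0 (Suc t) i v + (\<Sum>j\<in>nbrs i. c_vec 0 (Suc t) j v)"
      using niA nbrs by (simp only: c_vec.simps(2)[of 0 "Suc t"] add_0 if_False)
    also have "c_vec 0 (Suc t) i v = - beta i b v"
      using iA IH[of i b] less.prems Suc by (simp add: t_def)
    also have "(\<Sum>j\<in>nbrs i. c_vec 0 (Suc t) j v) = (\<Sum>j | (i, j) \<in> Q. beta j a v) + (\<Sum>j | (j, i) \<in> Q. beta j b v)"
      unfolding sum_nbrs
    proof (intro arg_cong2[of _ _ _ _ "(+)"] sum.cong refl)
      fix j assume "j \<in> {j. (i, j) \<in> Q}"
      then have j: "(i, j) \<in> Q" by simp
      show "c_vec 0 (Suc t) j v = beta j a v"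
        using IH[of j a] height[OF j] Q_I[OF j] orbit_length_arrow[OF j] less.prems(2) Suc by (simp add: t_def)
    next
      fix j assume "j \<in> {j. (j, i) \<in> Q}"
      then have j: "(j, i) \<in> Q" by simp
      show "c_vec 0 (Suc t) j v = beta j b v"
        using IH[of j b] height[OF j] Q_I[OF j] orbit_length_arrow[OF j] less.prems(2) Suc by (simp add: t_def)
    qed
    finally show ?thesis unfolding s using beta_mesh[OF less.prems(1,3), of b] Suc by simp
  qed
qed

lemma A_E:
  assumes "i \<in> A s" obtains a where "a < orbit_length i" "s = int (l i + 2 * a)"
proof -
  have e: "even (s - int (l i))" "0 \<le> s - int (l i)" "s - int (l i) < 2 * int (orbit_length i)"
    using assms by (auto simp: A_def is_red_def olen_def)
  then obtain x where "s - int (l i) = 2 * x" by (elim evenE)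
  then show thesis using that[of "nat x"] e by auto
qed

lemma c_vec_zero_nonneg:
  assumes "i \<in> A s" shows "nonneg (c_vec 0 (nat s) i)"
proof -
  obtain a where a: "a < orbit_length i" "s = int (l i + 2 * a)" using A_E[OF assms] .
  then have "nat s = l i + 2 * a" by simp
  then show ?thesis using c_vec_beta[OF A_I[OF assms] a(1)] orbit_length_nonneg[OF a(1)] by (simp add: nonneg_def)
qed

primrec refls :: "nat \<Rightarrow> (nat \<Rightarrow> int) \<Rightarrow> nat \<Rightarrow> int" where
  "refls 0 x = x" | "refls (Suc t) x = refls t (refl (int t) x)"

lemma refl_cong: "(\<And>v. v \<in> I \<Longrightarrow> x v = y v) \<Longrightarrow> v \<in> I \<Longrightarrow> refl s x v = refl s y v"
  unfolding refl_def using nbrs_I by (auto intro!: sum.cong)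
lemma refls_cong: "(\<And>v. v \<in> I \<Longrightarrow> x v = y v) \<Longrightarrow> v \<in> I \<Longrightarrow> refls t x v = refls t y v"
proof (induction t arbitrary: x y v)
  case (Suc t)
  show ?case unfolding refls.simps by (rule Suc.IH[OF refl_cong[OF Suc.prems(1)] Suc.prems(2)])
qed simp

lemma c_vec_refls: "i \<in> I \<Longrightarrow> c_vec 0 (t + u) i = refls t (c_vec (int t) u i)"
proof (induction t arbitrary: u)
  case (Suc t)
  have "c_vec 0 (Suc t + u) i = refls t (c_vec (int t) (Suc u) i)" using Suc.IH[OF Suc.prems, of "Suc u"] by simp
  also have "c_vec (int t) (Suc u) i = refl (int t) (c_vec (int (Suc t)) u i)"
    using c_vec_left[OF Suc.prems, of "int t" u] by (simp add: add.commute)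
  finally show ?case by simp
qed simp

text \<open>Sign-coherence for an arbitrary starting time: if a c-vector \<open>\<gamma>\<close> were negative, then on the way back to
  the starting time \<open>0\<close>, where it is a positive root \<open>\<beta>\<^sub>i\<^sub>,\<^sub>a\<close>, it would change its sign at some simple reflection, so it
  would be the root of an earlier time; but these roots are distinct.\<close>

lemma c_vec_nonneg:
  assumes i: "i \<in> A (s0 + int t)" shows "nonneg (c_vec s0 t i)"
proof (cases "s0 \<le> 0")
  case True
  then show ?thesis using c_vec_zero_nonneg[OF i] unfolding c_vec_from_zero[OF True] by blast
next
  case False
  have iI: "i \<in> I" using A_I[OF i] .
  define S0 where "S0 = nat s0"
  have S0: "s0 = int S0" using False by (simp add: S0_def)
  define x where "x = (\<lambda>\<tau>. c_vec (int \<tau>) (S0 + t - \<tau>) i)"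
  have root: "nonneg (x \<tau>) \<or> nonneg (\<lambda>v. - x \<tau> v)" for \<tau> unfolding x_def by (rule root_sign[OF c_vec_root[OF iI]])
  have stepx: "x \<tau> = refl (int \<tau>) (x (Suc \<tau>))" if "\<tau> < S0" for \<tau>
  proof -
    have "S0 + t - \<tau> = Suc (S0 + t - Suc \<tau>)" using that by simp
    then show ?thesis using c_vec_left[OF iI, of "int \<tau>" "S0 + t - Suc \<tau>"] by (simp add: x_def add.commute)
  qed
  have x0: "nonneg (x 0)" using c_vec_zero_nonneg[OF i] S0 by (simp add: x_def nat_int_add)
  show ?thesis
  proof (rule ccontr)
    assume "\<not> nonneg (c_vec s0 t i)"
    then have neg: "\<not> nonneg (x S0)" using S0 by (simp add: x_def)
    \<comment> \<open>the reflection at which the sign changes\<close>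
    have "\<exists>\<tau><S0. nonneg (x \<tau>) \<and> \<not> nonneg (x (Suc \<tau>))"
    proof (rule ccontr)
      assume h: "\<not> ?thesis"
      have "nonneg (x \<tau>)" if "\<tau> \<le> S0" for \<tau> using that by (induction \<tau>) (use x0 h in auto)
      then show False using neg by simp
    qed
    then obtain \<tau> where tau: "\<tau> < S0" "nonneg (x \<tau>)" "\<not> nonneg (x (Suc \<tau>))" by blast
    define y where "y = (\<lambda>v. - x (Suc \<tau>) v)"
    have ynn: "y v \<ge> 0" if "v \<in> I" for v using root[of "Suc \<tau>"] tau(3) that by (auto simp: nonneg_def y_def)
    have yA: "y v = 0" if "v \<in> I" "v \<notin> A (int \<tau>)" for v
    proof -
      have "x \<tau> v = x (Suc \<tau>) v" using stepx[OF tau(1)] that by (simp add: refl_def)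
      then show ?thesis using ynn[OF that(1)] tau(2) that by (auto simp: nonneg_def y_def)
    qed
    have "euler y y = 1" unfolding y_def euler_minus_left euler_minus_right by (simp add: x_def c_vec_root[OF iI])
    then have q: "(\<Sum>v\<in>I. y v * y v) = 1" using euler_supported_A[of "int \<tau>" y, OF yA] by simp
    obtain b where b: "b \<in> I" "y b \<noteq> 0" using q by (metis (mono_tags, lifting) mult_zero_left sum.neutral zero_neq_one)
    have bA: "b \<in> A (int \<tau>)" using yA b by blast
    have split: "y b * y b + (\<Sum>v\<in>I - {b}. y v * y v) = 1" using q b by (simp add: sum.remove)
    have "y b \<ge> 1" using b(2) ynn[OF b(1)] by linarith
    then have "y b * y b \<ge> 1" using mult_mono[of 1 "y b" 1 "y b"] by simp
    moreover have rest: "(\<Sum>v\<in>I - {b}. y v * y v) \<ge> 0" by (intro sum_nonneg) simp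
    moreover note split
    ultimately have "y b * y b = 1" "(\<Sum>v\<in>I - {b}. y v * y v) = 0" by linarith+
    then have y1: "y b = 1" and y0: "\<And>v. v \<in> I \<Longrightarrow> v \<noteq> b \<Longrightarrow> y v = 0"
      using ynn[OF b(1)] by (auto simp: sum_nonneg_eq_0_iff zmult_eq_1_iff)
    have xb: "x (Suc \<tau>) v = - of_bool (v = b)" if "v \<in> I" for v
      using y1 y0[OF that] by (cases "v = b") (auto simp: y_def)
    have xt: "x \<tau> v = of_bool (v = b)" if v: "v \<in> I" for v
    proof -
      have "refl (int \<tau>) (x (Suc \<tau>)) v = refl (int \<tau>) (\<lambda>v. - of_bool (v = b)) v" using xb by (rule refl_cong) (use v in auto)
      also have "\<dots> = of_bool (v = b)"
      proof -
        have "(\<Sum>j\<in>nbrs v. - of_bool (j = b)) = (- of_bool (b \<in> nbrs v) :: int)" by (simp add: of_bool_def sum_negf)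
        then show ?thesis using bA A_nbrs[of v "int \<tau>" b] by (auto simp: refl_def)
      qed
      finally show ?thesis using stepx[OF tau(1)] by simp
    qed
    \<comment> \<open>from here on the two roots are moved by the same reflections\<close>
    have "c_vec 0 (S0 + t) i = refls \<tau> (x \<tau>)"
      using c_vec_refls[OF iI, of \<tau> "S0 + t - \<tau>"] tau(1) by (simp add: x_def)
    moreover have "c_vec 0 \<tau> b = refls \<tau> (c_vec (int \<tau>) 0 b)" using c_vec_refls[OF b(1), of \<tau> 0] by simp
    ultimately have eq: "c_vec 0 (S0 + t) i v = c_vec 0 \<tau> b v" if "v \<in> I" for v
      using refls_cong[of "x \<tau>" "c_vec (int \<tau>) 0 b" v \<tau>] xt that by simp
    obtain a where a: "a < orbit_length i" "s0 + int t = int (l i + 2 * a)" using A_E[OF i] .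
    obtain a' where a': "a' < orbit_length b" "int \<tau> = int (l b + 2 * a')" using A_E[OF bA] .
    have ta: "S0 + t = l i + 2 * a" "\<tau> = l b + 2 * a'" using a(2) a'(2) S0 by auto
    have "beta i a v = beta b a' v" if "v \<in> I" for v
      using eq[OF that] c_vec_beta[OF iI a(1) that] c_vec_beta[OF b(1) a'(1) that] unfolding ta by simp
    then have "i = b \<and> a = a'" using beta_distinct[OF iI b(1) a(1) a'(1)] by blast
    then show False using ta tau(1) by simp
  qed
qed

end

section \<open>The limit G-matrix\<close>

lemma sum_of_bool_eq:
  assumes "finite J" "x \<in> J" shows "(\<Sum>v\<in>J. of_bool (v = x) * f v) = (f x :: int)" "(\<Sum>v\<in>J. f v * of_bool (v = x)) = (f x :: int)"
proof -
  have "(\<Sum>v\<in>J. of_bool (v = x) * f v) = (\<Sum>v\<in>J. if v = x then f v else 0)" by (intro sum.cong) auto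
  then show "(\<Sum>v\<in>J. of_bool (v = x) * f v) = f x" using assms by simp
  then show "(\<Sum>v\<in>J. f v * of_bool (v = x)) = f x" by (simp add: mult.commute)
qed

text \<open>The matrix \<open>E\<close> by which mutation at \<open>S\<close> acts as a congruence.\<close>

definition cong_mat :: "'w set \<Rightarrow> ('w \<Rightarrow> 'w \<Rightarrow> int) \<Rightarrow> 'w \<Rightarrow> 'w \<Rightarrow> int" where
  "cong_mat S B v x = (if v \<in> S then - of_bool (v = x) + max 0 (B v x) else of_bool (v = x))"

lemma sum_cong_mat:
  assumes J: "finite J" "S \<subseteq> J" and x: "x \<in> J"
  shows "(\<Sum>v\<in>J. cong_mat S B v x * f v) = (if x \<in> S then - f x else f x) + (\<Sum>g\<in>S. max 0 (B g x) * f g)"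
proof -
  have "(\<Sum>v\<in>J. cong_mat S B v x * f v) =
     (\<Sum>v\<in>J. of_bool (v = x) * ((if x \<in> S then - f x else f x)) + (if v \<in> S then max 0 (B v x) * f v else 0))"
    by (intro sum.cong) (auto simp: cong_mat_def algebra_simps)
  also have "\<dots> = (if x \<in> S then - f x else f x) + (\<Sum>v\<in>J. if v \<in> S then max 0 (B v x) * f v else 0)"
    unfolding sum.distrib sum_of_bool_eq(1)[OF J(1) x, of "\<lambda>v. (if x \<in> S then - f x else f x)"] ..
  also have "(\<Sum>v\<in>J. if v \<in> S then max 0 (B v x) * f v else 0) = (\<Sum>g\<in>S. max 0 (B g x) * f g)"
    using J by (simp add: sum.inter_restrict[symmetric] Int_absorb1)
  finally show ?thesis .
qed

lemma max_product_identity: "max 0 (- a) * b + a * max 0 b = max 0 a * max 0 b - max 0 (- a) * max 0 (- b)" for a b :: int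
  by (auto simp: max_def)

text \<open>Row and column operations at the vertices of \<open>S\<close> do not interfere, as \<open>B\<close> vanishes on \<open>S \<times> S\<close>. Outside
  \<open>S\<close> the correction terms combine by \<open>max_product_identity\<close>.\<close>

lemma mut_set_congruence:
  assumes J: "finite J" "S \<subseteq> J" and x: "x \<in> J" and z: "z \<in> J" and sk: "skew B" and un: "unlinked S B"
  shows "(\<Sum>v\<in>J. \<Sum>w\<in>J. cong_mat S B v x * B v w * cong_mat S B w z) = mut_set S B x z"
proof -
  have un: "B g h = 0" if "g \<in> S" "h \<in> S" for g h using un that by (auto simp: unlinked_def)
  define R where "R = (\<lambda>w. (if x \<in> S then - B x w else B x w) + (\<Sum>g\<in>S. max 0 (B g x) * B g w))"
  have "(\<Sum>v\<in>J. \<Sum>w\<in>J. cong_mat S B v x * B v w * cong_mat S B w z) = (\<Sum>w\<in>J. cong_mat S B w z * (\<Sum>v\<in>J. cong_mat S B v x * B v w))"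
    by (subst sum.swap) (simp add: sum_distrib_left mult.commute)
  also have "\<dots> = (\<Sum>w\<in>J. cong_mat S B w z * R w)"
    unfolding sum_cong_mat[OF J x, of B "\<lambda>v. B v _"] R_def ..
  also have "\<dots> = (if z \<in> S then - R z else R z) + (\<Sum>h\<in>S. max 0 (B h z) * R h)"
    by (rule sum_cong_mat[OF J z])
  also have "(\<Sum>h\<in>S. max 0 (B h z) * R h) = (\<Sum>h\<in>S. max 0 (B h z) * (if x \<in> S then 0 else B x h))"
    using un by (intro sum.cong refl) (auto simp: R_def)
  also have "(if z \<in> S then - R z else R z) + \<dots> = mut_set S B x z"
  proof (cases "x \<in> S \<or> z \<in> S")
    case True
    have a: "(\<Sum>g\<in>S. max 0 (B g x) * B g z) = 0" using True un by (intro sum.neutral) auto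
    have b: "(\<Sum>h\<in>S. max 0 (B h z) * (if x \<in> S then 0 else B x h)) = 0" using True un by (intro sum.neutral) auto
    show ?thesis unfolding b R_def a using True un[of x z] by (auto simp: mut_set_def)
  next
    case False
    have "(\<Sum>g\<in>S. max 0 (B g x) * B g z) + (\<Sum>h\<in>S. max 0 (B h z) * B x h) =
       (\<Sum>k\<in>S. max 0 (B x k) * max 0 (B k z) - max 0 (- B x k) * max 0 (- B k z))"
      unfolding sum.distrib[symmetric]
    proof (intro sum.cong refl)
      fix g
      show "max 0 (B g x) * B g z + max 0 (B g z) * B x g = max 0 (B x g) * max 0 (B g z) - max 0 (- B x g) * max 0 (- B g z)"
        using max_product_identity[of "B x g" "B g z"] skewD[OF sk, of g x] by (simp add: mult.commute)
    qed
    then show ?thesis using False by (simp add: R_def mut_set_def)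
  qed
  finally show ?thesis .
qed

context dynkin_quiver begin

text \<open>The blocks \<open>I(m)\<close> are the sets of vertices of level \<open>-m\<close>. From the seed with the number of the level on, no
  vertex of the block is green.\<close>

definition level :: "vertex \<Rightarrow> int" where "level v = depth v + int (l (fst v))"
definition block_vtx :: "nat \<Rightarrow> int \<Rightarrow> vertex" where "block_vtx i L = vtx i (L - int (l i))"

lemma level_block_vtx [simp]: "level (block_vtx i L) = L" by (simp add: level_def block_vtx_def)
lemma fst_block_vtx [simp]: "fst (block_vtx i L) = i" by (simp add: block_vtx_def)
lemma block_vtx_V [simp]: "block_vtx i L \<in> V \<longleftrightarrow> i \<in> I" by (simp add: block_vtx_def)
lemma block_vtx_inj [simp]: "block_vtx i L = block_vtx j M \<longleftrightarrow> i = j \<and> L = M" by (auto simp: block_vtx_def)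
lemma V_block_vtx: "v \<in> V \<Longrightarrow> block_vtx (fst v) (level v) = v" by (auto simp: V_iff block_vtx_def level_def)
lemma fst_V: "v \<in> V \<Longrightarrow> fst v \<in> I" by (auto simp: V_iff)
lemma V_eqI: "v \<in> V \<Longrightarrow> w \<in> V \<Longrightarrow> v = w \<longleftrightarrow> fst v = fst w \<and> level v = level w" using V_block_vtx by metis

lemma green_set_V: "green_set k \<subseteq> V" by (auto simp: green_set_def)

text \<open>A vertex is green at stage \<open>k\<close> iff it is red at stage \<open>k + 1\<close>, when the pattern has moved down by one.\<close>

lemma green_set_A: "v \<in> green_set k \<longleftrightarrow> v \<in> V \<and> fst v \<in> A (level v - int k - 1)"
proof (cases "v \<in> V")
  case True
  then obtain i p where v: "v = vtx i p" "i \<in> I" by (auto simp: V_iff)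
  have "green i (p - int k) \<longleftrightarrow> red i (p - int k - 1)"
    unfolding is_green_def is_red_def by presburger
  then show ?thesis using v by (simp add: A_def level_def algebra_simps)
qed (use green_set_V in auto)

lemma green_arrows_out:
  assumes "g \<in> green_set k"
  shows "max 0 (B_stage k g w) = of_bool (w \<in> V \<and> level w = level g \<and> fst w \<in> nbrs (fst g))"
proof (cases "w \<in> V")
  case True
  obtain i e where g: "g = vtx i e" "i \<in> I" "green i (e - int k)" using assms by (auto elim: green_set_E)
  obtain j q where w: "w = vtx j q" "j \<in> I" using True by (auto simp: V_iff)
  have "oblique i (e - int k) j (q - int k) \<longleftrightarrow> q + int (l j) = e + int (l i) \<and> j \<in> nbrs i"
    using height[of i j] height[of j i] by (auto simp: oblique_def nbrs_def)
  then show ?thesis using g w b_coord_green_out[OF g(3)] by (simp add: B_stage_vtx level_def)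
qed (simp add: B_stage_outside)

lemma B_stage_Suc_green: "g \<in> green_set k \<Longrightarrow> B_stage (Suc k) w g = B_stage k g w"
  using skewD[OF skew_B_stage, of k w g] by (simp add: mut_set_green_set[symmetric] mut_set_def)

lemma sum_link:
  assumes T: "finite T" "\<And>j. j \<in> nbrs (fst g) \<Longrightarrow> block_vtx j (level g) \<in> T"
  shows "(\<Sum>w\<in>T. of_bool (w \<in> V \<and> level w = level g \<and> fst w \<in> nbrs (fst g)) * f w) = (\<Sum>j\<in>nbrs (fst g). f (block_vtx j (level g)) :: int)"
proof -
  let ?X = "(\<lambda>j. block_vtx j (level g)) ` nbrs (fst g)"
  have "w \<in> ?X" if "w \<in> V" "level w = level g" "fst w \<in> nbrs (fst g)" for w
    using that V_block_vtx[OF that(1)] by (intro image_eqI[of _ _ "fst w"]) auto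
  then have "(\<Sum>w\<in>T. of_bool (w \<in> V \<and> level w = level g \<and> fst w \<in> nbrs (fst g)) * f w) =
     (\<Sum>w\<in>?X. of_bool (w \<in> V \<and> level w = level g \<and> fst w \<in> nbrs (fst g)) * f w)"
    using T by (intro sum.mono_neutral_right) auto
  also have "\<dots> = (\<Sum>w\<in>?X. f w)" using nbrs_I by (intro sum.cong) auto
  finally show ?thesis by (simp add: sum.reindex inj_on_def)
qed

lemma mutate_back: "mut_set (green_set k) (B_stage (Suc k)) = B_stage k"
  using mut_set_involutive[OF unlinked_green_set[of k]] by (simp add: mut_set_green_set)

text \<open>Walking back from the \<open>k\<close>-th seed, the mutable part of the extended matrix at the \<open>r\<close>-th seed is known; the
  coefficient rows are the c-vectors of each block. Their positivity selects the monomial of the exchange relation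
  which is free of coefficients, so the degrees of the cluster variables of a block only involve that block.\<close>

lemma return_path_degrees:
  fixes K :: "'k::field itself" and B :: "vertex + vertex \<Rightarrow> vertex + vertex \<Rightarrow> int"
  assumes F: "finite F" "F \<subseteq> V" "\<And>j. j \<in> I \<Longrightarrow> block_vtx j L \<in> F" and i: "i \<in> I"
  shows "r \<le> k \<Longrightarrow> (\<And>v w. B (Inl v) (Inl w) = - B_stage r v w) \<Longrightarrow>
    (\<And>v y. v \<in> V \<Longrightarrow> y \<in> V \<Longrightarrow> B (Inr y) (Inl v) = (if level y = level v then c_vec (level v - int k) (k - r) (fst v) (fst y) else 0)) \<Longrightarrow>
    (\<And>i. i \<in> I \<Longrightarrow> D (Inl (block_vtx i L)) = (\<lambda>u. if u \<in> V \<and> level u = L then g_vec (L - int k) (k - r) i (fst u) else 0)) \<Longrightarrow>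
    grade_fold (Inl ` F \<union> Inr ` F) (map Inl (return_path K n Q l r)) B D (Inl (block_vtx i L)) =
      (\<lambda>u. if u \<in> V \<and> level u = L then g_vec (L - int k) k i (fst u) else 0)"
proof (induction r arbitrary: B D)
  case 0
  have k: "k - 0 = k" by simp
  show ?case using 0(4)[OF i] unfolding k by simp
next
  case (Suc r)
  note B = Suc.prems(2) and CC = Suc.prems(3) and DD = Suc.prems(4)
  have kr: "k - r = Suc (k - Suc r)" "int (k - Suc r) = int k - int r - 1" using Suc.prems(1) by auto
  let ?J = "Inl ` F \<union> Inr ` F"
  define gl :: "(vertex + vertex) list" where "gl = map Inl (green_list K n Q l r)"
  have gl: "distinct gl" "set gl = Inl ` green_set r"
    using green_list_props[of K r] by (auto simp: gl_def distinct_map)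
  have un: "unlinked (set gl) B"
    unfolding gl unlinked_def using B B_stage_Suc_green[of _ r] unlinked_green_set[of r] by (auto simp: unlinked_def)
  define B' where "B' = fold mutate_matrix gl B"
  define D' where "D' = grade_fold ?J gl B D"
  have B': "B' = mut_set (Inl ` green_set r) B" unfolding B'_def using fold_mutate[OF gl(1) un] gl by simp
  have grA: "g \<in> green_set r \<longleftrightarrow> fst g \<in> A (level g - int k + int (k - Suc r))" if "g \<in> V" for g
    using that unfolding green_set_A kr(2) by (simp add: algebra_simps)
  \<comment> \<open>the mutations take place at vertices with positive c-vectors\<close>
  have c_nonneg: "B (Inr y) (Inl g) \<ge> 0" if "g \<in> green_set r" "y \<in> V" for g y
  proof -
    have g: "g \<in> V" using that green_set_V by auto
    show ?thesis using CC[OF g that(2)] c_vec_nonneg[of "fst g" "level g - int k" "k - Suc r"] grA[OF g] that fst_V[OF that(2)]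
      by (auto simp: nonneg_def)
  qed
  have out: "max 0 (- B (Inl w) (Inl g)) = of_bool (w \<in> V \<and> level w = level g \<and> fst w \<in> nbrs (fst g))" if "g \<in> green_set r" for g w
    using green_arrows_out[OF that, of w] B_stage_Suc_green[OF that, of w] by (simp add: B)
  have in': "max 0 (B (Inl g) (Inl w)) = of_bool (w \<in> V \<and> level w = level g \<and> fst w \<in> nbrs (fst g))" if "g \<in> green_set r" for g w
    using out[OF that, of w] skewD[OF skew_B_stage, of "Suc r" g w] by (simp add: B)
  have 1: "B' (Inl v) (Inl w) = - B_stage r v w" for v w
  proof -
    have "B' (Inl v) (Inl w) = mut_set (green_set r) (\<lambda>a b. - B_stage (Suc r) a b) v w"
      unfolding B' by (auto simp: mut_set_def B sum.reindex)
    also have "\<dots> = - mut_set (green_set r) (B_stage (Suc r)) v w"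
      using fun_cong[OF fun_cong[OF mut_set_uminus[of "green_set r" "B_stage (Suc r)"], of v], of w] .
    finally show ?thesis unfolding mutate_back .
  qed
  have 2: "B' (Inr y) (Inl v) = (if level y = level v then c_vec (level v - int k) (k - r) (fst v) (fst y) else 0)"
    if v: "v \<in> V" and y: "y \<in> V" for v y
  proof (cases "v \<in> green_set r")
    case True
    then show ?thesis using CC[OF v y] grA[OF v] unfolding B' kr(1) by (auto simp: mut_set_def)
  next
    case False
    let ?C = "\<lambda>g. B (Inr y) (Inl g)"
    have "B' (Inr y) (Inl v) = ?C v + (\<Sum>g\<in>green_set r. max 0 (?C g) * max 0 (B (Inl g) (Inl v)) - max 0 (- ?C g) * max 0 (- B (Inl g) (Inl v)))"
      unfolding B' using False by (auto simp: mut_set_def sum.reindex)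
    also have "(\<Sum>g\<in>green_set r. max 0 (?C g) * max 0 (B (Inl g) (Inl v)) - max 0 (- ?C g) * max 0 (- B (Inl g) (Inl v))) =
       (\<Sum>g\<in>green_set r. if level g = level v \<and> fst g \<in> nbrs (fst v) then ?C g else 0)"
      using c_nonneg[OF _ y] v nbrs_sym by (intro sum.cong refl) (auto simp: in')
    also have "\<dots> = (\<Sum>g | g \<in> green_set r \<and> level g = level v \<and> fst g \<in> nbrs (fst v). ?C g)"
      by (subst sum.inter_filter[symmetric]) auto
    also have "{g. g \<in> green_set r \<and> level g = level v \<and> fst g \<in> nbrs (fst v)} =
       (\<lambda>j. block_vtx j (level v)) ` (nbrs (fst v) \<inter> A (level v - int k + int (k - Suc r)))" (is "?X = ?Y")
    proof (intro equalityI subsetI)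
      fix g assume g: "g \<in> ?X"
      then have "g \<in> V" using green_set_V by auto
      then show "g \<in> ?Y" using g grA V_block_vtx[of g] by (intro image_eqI[of _ _ "fst g"]) auto
    next
      fix g assume "g \<in> ?Y"
      then obtain j where j: "g = block_vtx j (level v)" "j \<in> nbrs (fst v)" "j \<in> A (level v - int k + int (k - Suc r))" by blast
      then show "g \<in> ?X" using grA[of g] nbrs_I by auto
    qed
    also have "(\<Sum>g\<in>?Y. ?C g) = (\<Sum>j\<in>nbrs (fst v) \<inter> A (level v - int k + int (k - Suc r)). ?C (block_vtx j (level v)))"
      by (subst sum.reindex) (auto simp: inj_on_def)
    also have "\<dots> = (\<Sum>j\<in>nbrs (fst v) \<inter> A (level v - int k + int (k - Suc r)).
       if level y = level v then c_vec (level v - int k) (k - Suc r) j (fst y) else 0)"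
    proof (intro sum.cong refl)
      fix j assume "j \<in> nbrs (fst v) \<inter> A (level v - int k + int (k - Suc r))"
      then have "block_vtx j (level v) \<in> V" using nbrs_I by auto
      then show "?C (block_vtx j (level v)) = (if level y = level v then c_vec (level v - int k) (k - Suc r) j (fst y) else 0)"
        using CC[OF _ y] by simp
    qed
    finally show ?thesis unfolding kr(1) using CC[OF v y] False grA[OF v] by auto
  qed
  have 3: "D' (Inl (block_vtx i L)) = (\<lambda>u. if u \<in> V \<and> level u = L then g_vec (L - int k) (k - r) i (fst u) else 0)" if i: "i \<in> I" for i
  proof (cases "block_vtx i L \<in> green_set r")
    case False
    then have "D' (Inl (block_vtx i L)) = D (Inl (block_vtx i L))"
      unfolding D'_def grade_fold_unlinked[OF gl(1) un] using gl by auto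
    then show ?thesis using DD[OF i] False grA[of "block_vtx i L"] i unfolding kr(1) by (simp cong: if_cong)
  next
    case True
    let ?g = "block_vtx i L"
    have "D' (Inl ?g) u = (if u \<in> V \<and> level u = L then g_vec (L - int k) (k - r) i (fst u) else 0)" for u
    proof -
      have "D' (Inl ?g) u = - D (Inl ?g) u + (\<Sum>w\<in>?J. max 0 (- B w (Inl ?g)) * D w u)"
        unfolding D'_def grade_fold_unlinked[OF gl(1) un] using gl True by auto
      also have "(\<Sum>w\<in>?J. max 0 (- B w (Inl ?g)) * D w u) =
         (\<Sum>w\<in>F. max 0 (- B (Inl w) (Inl ?g)) * D (Inl w) u) + (\<Sum>y\<in>F. max 0 (- B (Inr y) (Inl ?g)) * D (Inr y) u)"
        by (subst sum.union_disjoint) (use F in \<open>auto simp: sum.reindex\<close>)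
      also have "(\<Sum>y\<in>F. max 0 (- B (Inr y) (Inl ?g)) * D (Inr y) u) = 0"
      proof (rule sum.neutral, rule ballI)
        fix y assume "y \<in> F"
        then have "B (Inr y) (Inl ?g) \<ge> 0" using F(2) by (intro c_nonneg[OF True]) blast
        then show "max 0 (- B (Inr y) (Inl ?g)) * D (Inr y) u = 0" by simp
      qed
      also have "(\<Sum>w\<in>F. max 0 (- B (Inl w) (Inl ?g)) * D (Inl w) u) = (\<Sum>j\<in>nbrs (fst ?g). D (Inl (block_vtx j (level ?g))) u)"
        unfolding out[OF True] by (rule sum_link) (use F nbrs_I in auto)
      also have "\<dots> = (\<Sum>j\<in>nbrs i. if u \<in> V \<and> level u = L then g_vec (L - int k) (k - Suc r) j (fst u) else 0)"
        using DD nbrs_I by (intro sum.cong) auto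
      finally show ?thesis using DD[OF i] True grA[of "block_vtx i L"] i unfolding kr(1)
        by (cases "u \<in> V \<and> level u = L") auto
    qed
    then show ?thesis by blast
  qed
  have r: "r \<le> k" using Suc.prems(1) by simp
  have "grade_fold ?J (map Inl (return_path K n Q l (Suc r))) B D = grade_fold ?J (map Inl (return_path K n Q l r)) B' D'"
    by (simp add: grade_fold_append B'_def D'_def gl_def)
  then show ?case by (simp only: Suc.IH[OF r 1 2 3])
qed

lemma set_return_path: "set (return_path K n Q l k) = (\<Union>r<k. green_set r)" for K :: "'k::field itself"
  by (induction k) (use green_list_props[of K] in \<open>auto simp: less_Suc_eq\<close>)

lemma G_matrix_eq:
  fixes K :: "'k::field itself"
  assumes v: "v \<in> V"
  shows "G_matrix K n C Q l k u v = (if u \<in> V \<and> level u = level v then g_vec (level v - int k) k (fst v) (fst u) else 0)"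
proof -
  let ?B = "\<lambda>a b. - B_stage k a b" and ?g = "\<lambda>u. if u \<in> V \<and> level u = level v then g_vec (level v - int k) k (fst v) (fst u) else 0"
  define F0 where "F0 = (\<Union>r<k. green_set r) \<union> (\<lambda>j. block_vtx j (level v)) ` I"
  have "g_vector V ?B (return_path K n Q l k) v = ?g"
  proof (rule g_vector_eq)
    show "skew ?B" unfolding skew_def by (intro allI) (subst skewD[OF skew_B_stage], simp)
    show "finite F0" "F0 \<subseteq> V" using green_set_V by (auto simp: F0_def finite_I)
    fix F assume F: "finite F" "F0 \<subseteq> F" "F \<subseteq> V"
    have bF: "block_vtx j (level v) \<in> F" if "j \<in> I" for j using F(2) that by (auto simp: F0_def)
    have vF: "v \<in> F" using bF[OF fst_V[OF v]] V_block_vtx[OF v] by simp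
    have out: "\<forall>u. u \<notin> F \<longrightarrow> ?g u = 0"
    proof (intro allI impI)
      fix u assume "u \<notin> F"
      then have "\<not> (u \<in> V \<and> level u = level v)" using bF[OF fst_V, of u] V_block_vtx[of u] by auto
      then show "?g u = 0" by (rule if_not_P)
    qed
    have "grade_fold (Inl ` F \<union> Inr ` F) (map Inl (return_path K n Q l k)) (principal_extension ?B)
         (case_sum (\<lambda>i u. of_bool (u = i)) (\<lambda>j u. if u \<in> F then - ?B u j else 0)) (Inl (block_vtx (fst v) (level v))) = ?g"
    proof (rule return_path_degrees[OF F(1,3) bF fst_V[OF v] order_refl])
      fix w y assume "w \<in> V" "y \<in> V"
      then show "principal_extension ?B (Inr y) (Inl w) =
         (if level y = level w then c_vec (level w - int k) (k - k) (fst w) (fst y) else 0)"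
        using V_eqI[of y w] by auto
    next
      fix i assume i: "i \<in> I"
      have "(of_bool (u = block_vtx i (level v)) :: int) = (if u \<in> V \<and> level u = level v then of_bool (fst u = i) else 0)" for u
        using V_eqI[of u "block_vtx i (level v)"] i by (cases "u \<in> V") auto
      then show "case_sum (\<lambda>i u. of_bool (u = i)) (\<lambda>j u. if u \<in> F then - ?B u j else 0) (Inl (block_vtx i (level v))) =
          (\<lambda>u. if u \<in> V \<and> level u = level v then g_vec (level v - int k) (k - k) i (fst u) else 0)"
        by (simp add: fun_eq_iff)
    qed simp_all
    then show "set (return_path K n Q l k) \<subseteq> F \<and> v \<in> F \<and> (\<forall>u. u \<notin> F \<longrightarrow> ?g u = 0) \<and>
       grade_fold (Inl ` F \<union> Inr ` F) (map Inl (return_path K n Q l k)) (principal_extension ?B)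
         (case_sum (\<lambda>i u. of_bool (u = i)) (\<lambda>j u. if u \<in> F then - ?B u j else 0)) (Inl v) = ?g"
      using vF out F(2) unfolding V_block_vtx[OF v] set_return_path by (auto simp: F0_def)
  qed
  then show ?thesis unfolding G_matrix_def B_seq_B_stage V_def[symmetric] by simp
qed

text \<open>The degree in direction \<open>y\<close> of the cluster variable at \<open>v\<close>, for the walk from a late seed to the \<open>k\<close>-th one.\<close>

definition G_stage :: "nat \<Rightarrow> vertex \<Rightarrow> vertex \<Rightarrow> int" where
  "G_stage k v y = (if y \<in> V \<and> level y = level v then g_vec 0 (nat (level v - int k)) (fst v) (fst y) else 0)"

lemma G_infinity_eq:
  fixes K :: "'k::field itself"
  assumes v: "v \<in> V" shows "G_infinity K n C Q l u v = G_stage 0 v u"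
proof -
  have "\<forall>\<^sub>F k in sequentially. G_matrix K n C Q l k u v = G_stage 0 v u"
    unfolding eventually_sequentially
  proof (intro exI[of _ "nat (level v)"] allI impI)
    fix k assume "nat (level v) \<le> k"
    then show "G_matrix K n C Q l k u v = G_stage 0 v u"
      unfolding G_matrix_eq[OF v] G_stage_def using g_vec_from_zero[of "level v - int k" k "fst v"] by simp
  qed
  then have "(\<lambda>k. G_matrix K n C Q l k u v) \<longlonglongrightarrow> G_stage 0 v u" by (rule tendsto_eventually)
  then show ?thesis unfolding G_infinity_def by (rule limI)
qed

lemma G_stage_late: "level v \<le> int k \<Longrightarrow> v \<in> V \<Longrightarrow> x \<in> V \<Longrightarrow> G_stage k v x = of_bool (v = x)"
  using V_eqI[of v x] by (auto simp: G_stage_def)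

text \<open>Finite unions of blocks, on which all sums take place.\<close>

definition blocks :: "int set \<Rightarrow> vertex set" where "blocks Ls = {v \<in> V. level v \<in> Ls}"

lemma finite_blocks [simp]: assumes "finite Ls" shows "finite (blocks Ls)"
proof -
  have "blocks Ls \<subseteq> (\<Union>L\<in>Ls. (\<lambda>i. block_vtx i L) ` I)"
  proof
    fix v assume "v \<in> blocks Ls"
    then show "v \<in> (\<Union>L\<in>Ls. (\<lambda>i. block_vtx i L) ` I)" using V_block_vtx[of v] fst_V[of v]
      by (intro UN_I[of "level v"] image_eqI[of _ _ "fst v"]) (auto simp: blocks_def)
  qed
  then show ?thesis by (rule finite_subset) (use assms finite_I in auto)
qed

text \<open>The recursion for the g-vectors of a block is multiplication by the matrix of the congruence, as the oblique arrows out of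
  a green vertex lead to its neighbours in the block.\<close>

lemma G_stage_step:
  assumes v: "v \<in> blocks Ls" and Ls: "finite Ls"
  shows "G_stage k v x = (\<Sum>w\<in>blocks Ls. cong_mat (green_set k) (B_stage k) v w * G_stage (Suc k) w x)"
proof -
  have vV: "v \<in> V" "level v \<in> Ls" using v by (auto simp: blocks_def)
  have g: "g_vec 0 (nat (level v - int k)) (fst v) = (if v \<in> green_set k then (\<lambda>a. - g_vec 0 (nat (level v - int (Suc k))) (fst v) a +
      (\<Sum>j\<in>nbrs (fst v). g_vec 0 (nat (level v - int (Suc k))) j a)) else g_vec 0 (nat (level v - int (Suc k))) (fst v))"
    using g_vec_step[of "level v - int k - 1" "fst v"] vV(1) by (simp add: green_set_A algebra_simps)
  show ?thesis
  proof (cases "v \<in> green_set k")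
    case True
    have "(\<Sum>w\<in>blocks Ls. cong_mat (green_set k) (B_stage k) v w * G_stage (Suc k) w x) =
       (\<Sum>w\<in>blocks Ls. of_bool (w = v) * - G_stage (Suc k) w x + of_bool (w \<in> V \<and> level w = level v \<and> fst w \<in> nbrs (fst v)) * G_stage (Suc k) w x)"
      using True by (intro sum.cong refl) (auto simp: cong_mat_def green_arrows_out)
    also have "\<dots> = - G_stage (Suc k) v x + (\<Sum>j\<in>nbrs (fst v). G_stage (Suc k) (block_vtx j (level v)) x)"
      unfolding sum.distrib sum_of_bool_eq(1)[OF finite_blocks[OF Ls] v]
      by (intro arg_cong2[of _ _ _ _ "(+)"] refl sum_link) (use finite_blocks[OF Ls] vV nbrs_I in \<open>auto simp: blocks_def\<close>)
    also have "\<dots> = G_stage k v x"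
      using True g by (cases "x \<in> V \<and> level x = level v") (auto simp: G_stage_def)
    finally show ?thesis by simp
  next
    case False
    then have "(\<Sum>w\<in>blocks Ls. cong_mat (green_set k) (B_stage k) v w * G_stage (Suc k) w x) = (\<Sum>w\<in>blocks Ls. of_bool (w = v) * G_stage (Suc k) w x)"
      by (intro sum.cong refl) (auto simp: cong_mat_def)
    also have "\<dots> = G_stage (Suc k) v x" by (rule sum_of_bool_eq(1)[OF finite_blocks[OF Ls] v])
    also have "\<dots> = G_stage k v x" using False g by (simp add: G_stage_def)
    finally show ?thesis by simp
  qed
qed

text \<open>The factors \<open>E\<close> from the two G-matrices turn \<open>B\<^sup>(\<^sup>k\<^sup>)\<close> into \<open>B\<^sup>(\<^sup>k\<^sup>+\<^sup>1\<^sup>)\<close>.\<close>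

lemma stage_invariance:
  assumes Ls: "finite Ls" "level ` green_set k \<subseteq> Ls"
  shows "(\<Sum>v\<in>blocks Ls. \<Sum>w\<in>blocks Ls. G_stage k v x * B_stage k v w * G_stage k w z) =
    (\<Sum>v\<in>blocks Ls. \<Sum>w\<in>blocks Ls. G_stage (Suc k) v x * B_stage (Suc k) v w * G_stage (Suc k) w z)"
proof -
  let ?J = "blocks Ls" and ?E = "cong_mat (green_set k) (B_stage k)" and ?g = "G_stage (Suc k)"
  have grJ: "green_set k \<subseteq> ?J" using Ls(2) green_set_V by (auto simp: blocks_def)
  have "(\<Sum>v\<in>?J. \<Sum>w\<in>?J. G_stage k v x * B_stage k v w * G_stage k w z) =
     (\<Sum>v\<in>?J. \<Sum>w\<in>?J. (\<Sum>v'\<in>?J. ?E v v' * ?g v' x) * B_stage k v w * (\<Sum>w'\<in>?J. ?E w w' * ?g w' z))"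
    using G_stage_step[OF _ Ls(1)] by (intro sum.cong refl) simp
  also have "\<dots> = (\<Sum>v\<in>?J. \<Sum>w\<in>?J. \<Sum>v'\<in>?J. \<Sum>w'\<in>?J. ?g v' x * (?E v v' * B_stage k v w * ?E w w') * ?g w' z)"
    by (intro sum.cong refl) (simp add: sum_distrib_left sum_distrib_right mult_ac)
  also have "\<dots> = (\<Sum>v\<in>?J. \<Sum>v'\<in>?J. \<Sum>w\<in>?J. \<Sum>w'\<in>?J. ?g v' x * (?E v v' * B_stage k v w * ?E w w') * ?g w' z)"
    by (rule sum.cong[OF refl], rule sum.swap)
  also have "\<dots> = (\<Sum>v'\<in>?J. \<Sum>v\<in>?J. \<Sum>w\<in>?J. \<Sum>w'\<in>?J. ?g v' x * (?E v v' * B_stage k v w * ?E w w') * ?g w' z)"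
    by (rule sum.swap)
  also have "\<dots> = (\<Sum>v'\<in>?J. \<Sum>v\<in>?J. \<Sum>w'\<in>?J. \<Sum>w\<in>?J. ?g v' x * (?E v v' * B_stage k v w * ?E w w') * ?g w' z)"
    by (rule sum.cong[OF refl], rule sum.cong[OF refl], rule sum.swap)
  also have "\<dots> = (\<Sum>v'\<in>?J. \<Sum>w'\<in>?J. \<Sum>v\<in>?J. \<Sum>w\<in>?J. ?g v' x * (?E v v' * B_stage k v w * ?E w w') * ?g w' z)"
    by (rule sum.cong[OF refl], rule sum.swap)
  also have "\<dots> = (\<Sum>v'\<in>?J. \<Sum>w'\<in>?J. ?g v' x * (\<Sum>v\<in>?J. \<Sum>w\<in>?J. ?E v v' * B_stage k v w * ?E w w') * ?g w' z)"
    by (intro sum.cong refl) (simp add: sum_distrib_left sum_distrib_right)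
  also have "\<dots> = (\<Sum>v'\<in>?J. \<Sum>w'\<in>?J. ?g v' x * B_stage (Suc k) v' w' * ?g w' z)"
    using mut_set_congruence[OF finite_blocks[OF Ls(1)] grJ _ _ skew_B_stage unlinked_green_set] by (intro sum.cong refl) (simp add: mut_set_green_set)
  finally show ?thesis .
qed

definition B_e :: "vertex \<Rightarrow> vertex \<Rightarrow> int" where
  "B_e v w = of_bool ((v, w) \<in> Gamma_e n C l) - of_bool ((w, v) \<in> Gamma_e n C l)"

text \<open>Above the red and green vertices $\Gamma_c$ agrees with $\Gamma_e$.\<close>

lemma B_stage_late:
  assumes "x \<in> V" "z \<in> V" "depth x < int k" "depth z < int k" shows "B_stage k x z = B_e x z"
proof -
  have *: "arr i p j q \<longleftrightarrow> i = j \<and> q = p - 1 \<or> (i, j) \<in> Q \<and> q = p + 1 \<or> (j, i) \<in> Q \<and> q = p"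
    if "p < 0" "q < 0" "i \<in> I" "j \<in> I" for i p j q
  proof (cases i j rule: arrow_cases)
    case same
    then show ?thesis using that Q_asym[of i i] by (auto simp: vertical_arr_def is_red_def)
  next
    case out
    then show ?thesis using that olen_pos[of i] Q_asym[of i j] by (auto simp: arr_fw forward_arr_def is_green_def)
  next
    case into
    then show ?thesis using that olen_pos[of i] Q_asym[of j i] by (auto simp: arr_bw backward_arr_def is_green_def)
  qed (simp add: arr_none)
  obtain i p j q where e: "x = vtx i p" "i \<in> I" "z = vtx j q" "j \<in> I" using assms by (auto simp: V_iff)
  then have "p - int k < 0" "q - int k < 0" using assms by auto
  then show ?thesis using e by (simp add: B_stage_vtx b_coord_def * B_e_def Gamma_e_vtx)
qed

text \<open>The set of levels is enlarged so that it contains all green vertices up to the stage \<open>N\<close>, at which the blocks of \<open>x\<close> and \<open>z\<close>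
  lie above all coloured vertices.\<close>

lemma G_B_G_transpose:
  assumes x: "x \<in> V" "level x \<in> Ls" and z: "z \<in> V" "level z \<in> Ls" and Ls: "finite Ls"
  shows "(\<Sum>v\<in>blocks Ls. \<Sum>w\<in>blocks Ls. G_stage 0 v x * B_stage 0 v w * G_stage 0 w z) = B_e x z"
proof -
  \<comment> \<open>the bound on depths makes \<open>B\<^sup>(\<^sup>N\<^sup>)\<close> agree with \<open>B\<^sub>e\<close>, the bound on levels makes the G-matrix trivial\<close>
  define N where "N = nat (max (max (level x) (level z)) (max (depth x) (depth z))) + 1"
  define Ms where "Ms = Ls \<union> (\<Union>k<N. level ` green_set k)"
  have Ms: "finite Ms" "Ls \<subseteq> Ms" using Ls by (auto simp: Ms_def)
  have xz: "x \<in> blocks Ms" "z \<in> blocks Ms" using x z Ms(2) by (auto simp: blocks_def)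
  let ?T = "\<lambda>J k. \<Sum>v\<in>J. \<Sum>w\<in>J. G_stage k v x * B_stage k v w * G_stage k w z"
  have sub: "blocks Ls \<subseteq> blocks Ms" using Ms by (auto simp: blocks_def)
  have in': "(\<Sum>w\<in>blocks Ls. G_stage 0 v x * B_stage 0 v w * G_stage 0 w z) = (\<Sum>w\<in>blocks Ms. G_stage 0 v x * B_stage 0 v w * G_stage 0 w z)" for v
    by (rule sum.mono_neutral_left) (use finite_blocks[OF Ms(1)] sub z in \<open>auto simp: blocks_def G_stage_def\<close>)
  have "?T (blocks Ls) 0 = ?T (blocks Ms) 0"
    unfolding in' by (rule sum.mono_neutral_left) (use finite_blocks[OF Ms(1)] sub x in \<open>auto simp: blocks_def G_stage_def\<close>)
  also have "k \<le> N \<Longrightarrow> ?T (blocks Ms) 0 = ?T (blocks Ms) k" for k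
  proof (induction k)
    case (Suc k)
    then have "level ` green_set k \<subseteq> (\<Union>k<N. level ` green_set k)" by (intro UN_upper) simp
    then have "level ` green_set k \<subseteq> Ms" unfolding Ms_def by blast
    then show ?case using Suc stage_invariance[OF Ms(1), of k x z] by simp
  qed simp
  then have "?T (blocks Ms) 0 = ?T (blocks Ms) N" by simp
  also have "\<dots> = (\<Sum>v\<in>blocks Ms. \<Sum>w\<in>blocks Ms. of_bool (v = x) * B_stage N v w * of_bool (w = z))"
  proof (intro sum.cong refl)
    fix v w assume vw: "v \<in> blocks Ms" "w \<in> blocks Ms"
    have "G_stage N v x = of_bool (v = x)"
    proof (cases "level v = level x")
      case True
      then show ?thesis using vw x by (intro G_stage_late) (auto simp: blocks_def N_def)
    qed (auto simp: G_stage_def)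
    moreover have "G_stage N w z = of_bool (w = z)"
    proof (cases "level w = level z")
      case True
      then show ?thesis using vw z by (intro G_stage_late) (auto simp: blocks_def N_def)
    qed (auto simp: G_stage_def)
    ultimately show "G_stage N v x * B_stage N v w * G_stage N w z = of_bool (v = x) * B_stage N v w * of_bool (w = z)" by simp
  qed
  also have "\<dots> = B_stage N x z"
    unfolding sum_of_bool_eq(2)[OF finite_blocks[OF Ms(1)] xz(2)] by (rule sum_of_bool_eq(1)[OF finite_blocks[OF Ms(1)] xz(1)])
  also have "\<dots> = B_e x z" using x z by (intro B_stage_late) (auto simp: N_def)
  finally show ?thesis .
qed

text \<open>The inverse transpose of the limit G-matrix.\<close>

definition C_limit :: "vertex \<Rightarrow> vertex \<Rightarrow> int" where
  "C_limit v y = (if level y = level v then c_vec 0 (nat (level v)) (fst v) (fst y) else 0)"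

lemma sum_block:
  assumes "finite Ls" "L \<in> Ls"
  shows "(\<Sum>z\<in>blocks Ls. if level z = L then f z else 0) = (\<Sum>a\<in>I. f (block_vtx a L) :: int)"
proof -
  have "{z \<in> blocks Ls. level z = L} = (\<lambda>a. block_vtx a L) ` I"
  proof (intro equalityI subsetI)
    fix z assume "z \<in> {z \<in> blocks Ls. level z = L}"
    then show "z \<in> (\<lambda>a. block_vtx a L) ` I" using V_block_vtx[of z] fst_V[of z] by (intro image_eqI[of _ _ "fst z"]) (auto simp: blocks_def)
  qed (use assms in \<open>auto simp: blocks_def\<close>)
  then show ?thesis using assms by (simp add: sum.inter_filter[symmetric] sum.reindex inj_on_def)
qed

lemma G_stage_cs_dual:
  assumes Ls: "finite Ls" "level v \<in> Ls" and v: "v \<in> V" and w: "w \<in> V"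
  shows "(\<Sum>z\<in>blocks Ls. G_stage 0 w z * C_limit v z) = of_bool (w = v)"
proof -
  have "(\<Sum>z\<in>blocks Ls. G_stage 0 w z * C_limit v z) =
     (\<Sum>z\<in>blocks Ls. if level z = level v then (if level w = level v then g_vec 0 (nat (level v)) (fst w) (fst z) * c_vec 0 (nat (level v)) (fst v) (fst z) else 0) else 0)"
    by (intro sum.cong refl) (auto simp: G_stage_def C_limit_def blocks_def)
  also have "\<dots> = (if level w = level v then of_bool (fst w = fst v) else 0)"
    unfolding sum_block[OF Ls] using g_vec_cv_dual[OF fst_V[OF w] fst_V[OF v], of 0 "nat (level v)"] by simp
  finally show ?thesis using V_eqI[OF w v] by auto
qed

section \<open>The matrix $\Lambda_e$\<close>

text \<open>The coefficient matrices of the inverse quantum Cartan matrix, in terms of the adjacency matrix of the diagram.\<close>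

fun cartan_coeff :: "nat \<Rightarrow> nat \<Rightarrow> nat \<Rightarrow> int" where
  "cartan_coeff 0 i j = 0"
| "cartan_coeff (Suc 0) i j = of_bool (i = j)"
| "cartan_coeff (Suc (Suc m)) i j = (\<Sum>k\<in>nbrs i. cartan_coeff (Suc m) k j) - cartan_coeff m i j"

text \<open>The coefficients are polynomials in the adjacency matrix, so they commute with it.\<close>

lemma cartan_coeff_right: "cartan_coeff (Suc (Suc m)) i j = (\<Sum>k\<in>nbrs j. cartan_coeff (Suc m) i k) - cartan_coeff m i j"
proof (induction m arbitrary: i j rule: less_induct)
  case (less m)
  have d: "(\<Sum>k\<in>nbrs i. of_bool (k = j)) = (of_bool (j \<in> nbrs i) :: int)" "(\<Sum>k\<in>nbrs i. of_bool (j = k)) = (of_bool (j \<in> nbrs i) :: int)" for i j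
    by (simp_all add: of_bool_def)
  consider "m = 0" | "m = 1" | r where "m = Suc (Suc r)" by (metis One_nat_def not0_implies_Suc)
  then show ?case
  proof cases
    case 1
    then show ?thesis using nbrs_sym[of i j] by (simp add: d)
  next
    case 2
    have "(\<Sum>k\<in>nbrs i. of_bool (j \<in> nbrs k)) = (\<Sum>k\<in>nbrs i \<inter> nbrs j. 1 :: int)"
      using nbrs_sym by (simp add: of_bool_def sum.inter_restrict[symmetric])
    moreover have "(\<Sum>k\<in>nbrs j. of_bool (k \<in> nbrs i)) = (\<Sum>k\<in>nbrs j \<inter> nbrs i. 1 :: int)"
      by (simp add: of_bool_def sum.inter_restrict[symmetric])
    ultimately show ?thesis using 2 by (simp add: d Int_commute)
  next
    case (3 r)
    have "cartan_coeff (Suc (Suc m)) i j = (\<Sum>k\<in>nbrs i. cartan_coeff (Suc m) k j) - cartan_coeff m i j" by simp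
    also have "(\<Sum>k\<in>nbrs i. cartan_coeff (Suc m) k j) = (\<Sum>k\<in>nbrs i. (\<Sum>h\<in>nbrs j. cartan_coeff m k h) - cartan_coeff (Suc r) k j)"
      using less.IH[of "Suc r"] 3 by simp
    also have "cartan_coeff m i j = (\<Sum>h\<in>nbrs j. cartan_coeff (Suc r) i h) - cartan_coeff r i j" using less.IH[of r] 3 by simp
    also have "(\<Sum>k\<in>nbrs i. (\<Sum>h\<in>nbrs j. cartan_coeff m k h) - cartan_coeff (Suc r) k j) - ((\<Sum>h\<in>nbrs j. cartan_coeff (Suc r) i h) - cartan_coeff r i j) =
       (\<Sum>h\<in>nbrs j. (\<Sum>k\<in>nbrs i. cartan_coeff m k h) - cartan_coeff (Suc r) i h) - ((\<Sum>k\<in>nbrs i. cartan_coeff (Suc r) k j) - cartan_coeff r i j)"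
      by (simp add: sum_subtractf sum.swap[of _ "nbrs i" "nbrs j"])
    also have "\<dots> = (\<Sum>h\<in>nbrs j. cartan_coeff (Suc m) i h) - cartan_coeff m i j" using 3 by simp
    finally show ?thesis .
  qed
qed

lemma cartan_coeff_sym: "cartan_coeff m i j = cartan_coeff m j i"
proof (induction m arbitrary: i j rule: less_induct)
  case (less m)
  consider "m = 0" | "m = Suc 0" | r where "m = Suc (Suc r)" by (metis not0_implies_Suc)
  then show ?case
  proof cases
    case (3 r)
    have "cartan_coeff (Suc (Suc r)) i j = (\<Sum>k\<in>nbrs i. cartan_coeff (Suc r) j k) - cartan_coeff r j i"
      using less.IH[of "Suc r"] less.IH[of r] 3 by simp
    then show ?thesis using cartan_coeff_right[of r j i] 3 by simp
  qed auto
qed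

lemma quantum_cartan_value:
  "i \<in> I \<Longrightarrow> k \<in> I \<Longrightarrow> quantum_cartan C i k = (if i = k then fls_X + fls_X_inv else if k \<in> nbrs i then - 1 else 0)"
  using C_value[of i k] Q_asym[of i k] by (auto simp: quantum_cartan_def nbrs_def)

lemma sum_quantum_cartan:
  assumes i: "i \<in> I"
  shows "(\<Sum>k\<in>I. quantum_cartan C i k * f k) = (fls_X + fls_X_inv) * f i - (\<Sum>k\<in>nbrs i. f k)"
    "(\<Sum>k\<in>I. f k * quantum_cartan C k i) = (fls_X + fls_X_inv) * f i - (\<Sum>k\<in>nbrs i. f k)"
proof -
  have e: "quantum_cartan C i k = (if k = i then fls_X + fls_X_inv else 0) - (if k \<in> nbrs i then 1 else 0)"
    "quantum_cartan C k i = (if k = i then fls_X + fls_X_inv else 0) - (if k \<in> nbrs i then 1 else 0)" if "k \<in> I" for k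
    using quantum_cartan_value[OF i that] quantum_cartan_value[OF that i] A_self_nbrs[of i] nbrs_sym[of i k] by auto
  have I: "I \<inter> nbrs i = nbrs i" using nbrs_I by auto
  have s: "(\<Sum>k\<in>I. ((if k = i then a else 0) - (if k \<in> nbrs i then 1 else 0)) * f k) = a * f i - (\<Sum>k\<in>nbrs i. f k)" for a
  proof -
    have "(\<Sum>k\<in>I. ((if k = i then a else 0) - (if k \<in> nbrs i then 1 else 0)) * f k) =
       (\<Sum>k\<in>I. (if k = i then a * f k else 0) - (if k \<in> nbrs i then f k else 0))"
      using A_self_nbrs[of i] by (intro sum.cong) auto
    then show ?thesis using i finite_I by (simp add: sum_subtractf sum.inter_restrict[symmetric] I)
  qed
  show "(\<Sum>k\<in>I. quantum_cartan C i k * f k) = (fls_X + fls_X_inv) * f i - (\<Sum>k\<in>nbrs i. f k)"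
    unfolding s[symmetric] using e by (intro sum.cong) auto
  show "(\<Sum>k\<in>I. f k * quantum_cartan C k i) = (fls_X + fls_X_inv) * f i - (\<Sum>k\<in>nbrs i. f k)"
    unfolding s[symmetric] using e by (intro sum.cong) (auto simp: mult.commute)
qed

text \<open>The recursion is the equation \<open>C(z) X = 1\<close> coefficient by coefficient; a two-sided inverse is unique.\<close>

lemma quantum_cartan_inverse_nth:
  assumes "i \<in> I" "j \<in> I"
  shows "fls_nth (quantum_cartan_inverse n C i j) m = cartan_coeff (nat m) i j"
proof -
  define Y where "Y = (\<lambda>i j. if i \<in> I \<and> j \<in> I then Abs_fls (\<lambda>m. cartan_coeff (nat m) i j) else 0)"
  have Y: "fls_nth (Y i j) m = cartan_coeff (nat m) i j" if "i \<in> I" "j \<in> I" for i j m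
    using that nth_Abs_fls_lower_bound[of 0 "\<lambda>m. cartan_coeff (nat m) i j" m] by (simp add: Y_def)
  have rec: "cartan_coeff (nat (m - 1)) i j + cartan_coeff (nat (m + 1)) i j - (\<Sum>k\<in>nbrs i. cartan_coeff (nat m) k j) = of_bool (m = 0 \<and> i = j)" for i j m
  proof -
    consider "m < 0" | "m = 0" | r where "m = int (Suc r)" by (metis int_cases neg_int_cases not0_implies_Suc of_nat_0 not_le negative_zless zero_less_Suc)
    then show ?thesis
    proof cases
      case (3 r)
      then have "nat (m - 1) = r" "nat m = Suc r" "nat (m + 1) = Suc (Suc r)" by auto
      then show ?thesis using 3 by simp
    qed simp_all
  qed
  have id1: "(\<Sum>k\<in>I. quantum_cartan C i k * Y k j) = of_bool (i = j)" if "i \<in> I" "j \<in> I" for i j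
  proof (rule fls_eqI)
    fix m
    have "(\<Sum>k\<in>nbrs i. fls_nth (Y k j) m) = (\<Sum>k\<in>nbrs i. cartan_coeff (nat m) k j)" using Y nbrs_I that by (intro sum.cong) auto
    then show "fls_nth (\<Sum>k\<in>I. quantum_cartan C i k * Y k j) m = fls_nth (of_bool (i = j)) m"
      unfolding sum_quantum_cartan[OF that(1)] using rec[of m i j]
      by (simp add: distrib_right fls_X_times_conv_shift fls_X_inv_times_conv_shift fls_nth_sum Y that)
  qed
  have id2: "(\<Sum>k\<in>I. Y i k * quantum_cartan C k j) = of_bool (i = j)" if "i \<in> I" "j \<in> I" for i j
  proof (rule fls_eqI)
    fix m
    have "(\<Sum>k\<in>nbrs j. fls_nth (Y i k) m) = (\<Sum>k\<in>nbrs j. cartan_coeff (nat m) k i)" using Y nbrs_I that cartan_coeff_sym by (intro sum.cong) auto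
    then show "fls_nth (\<Sum>k\<in>I. Y i k * quantum_cartan C k j) m = fls_nth (of_bool (i = j)) m"
      unfolding sum_quantum_cartan[OF that(2)] using rec[of m j i] cartan_coeff_sym[of _ i j]
      by (simp add: distrib_right fls_X_times_conv_shift fls_X_inv_times_conv_shift fls_nth_sum Y that)
  qed
  have "quantum_cartan_inverse n C = Y"
    unfolding quantum_cartan_inverse_def I_def[symmetric]
  proof (rule the_equality)
    show "(\<forall>i j. i \<notin> I \<or> j \<notin> I \<longrightarrow> Y i j = 0) \<and> (\<forall>i\<in>I. \<forall>j\<in>I. (\<Sum>k\<in>I. quantum_cartan C i k * Y k j) = of_bool (i = j) \<and>
           (\<Sum>k\<in>I. Y i k * quantum_cartan C k j) = of_bool (i = j))"
      using id1 id2 by (auto simp: Y_def)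
  next
    fix X assume X: "(\<forall>i j. i \<notin> I \<or> j \<notin> I \<longrightarrow> X i j = 0) \<and> (\<forall>i\<in>I. \<forall>j\<in>I. (\<Sum>k\<in>I. quantum_cartan C i k * X k j) = of_bool (i = j) \<and>
           (\<Sum>k\<in>I. X i k * quantum_cartan C k j) = of_bool (i = j))"
    show "X = Y"
    proof (intro ext)
      fix i j
      show "X i j = Y i j"
      proof (cases "i \<in> I \<and> j \<in> I")
        case True
        have "X i j = (\<Sum>k\<in>I. X i k * (\<Sum>h\<in>I. quantum_cartan C k h * Y h j))"
        proof -
          have "(\<Sum>k\<in>I. X i k * (\<Sum>h\<in>I. quantum_cartan C k h * Y h j)) = (\<Sum>k\<in>I. if k = j then X i k else 0)"
            using id1 True by (intro sum.cong) auto
          then show ?thesis using True finite_I by simp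
        qed
        also have "\<dots> = (\<Sum>k\<in>I. \<Sum>h\<in>I. X i k * quantum_cartan C k h * Y h j)"
          by (simp add: sum_distrib_left mult.assoc)
        also have "\<dots> = (\<Sum>h\<in>I. \<Sum>k\<in>I. X i k * quantum_cartan C k h * Y h j)" by (rule sum.swap)
        also have "\<dots> = (\<Sum>h\<in>I. (\<Sum>k\<in>I. X i k * quantum_cartan C k h) * Y h j)"
          by (simp add: sum_distrib_right)
        also have "\<dots> = (\<Sum>h\<in>I. if h = i then Y h j else 0)"
          using X True by (intro sum.cong) auto
        finally show ?thesis using True finite_I by simp
      next
        case False
        then have "X i j = 0" using X by blast
        then show ?thesis using False by (auto simp: Y_def)
      qed
    qed
  qed
  then show ?thesis using Y[OF assms] by simp
qed

text \<open>For \<open>m \<ge> -1\<close> the two sums differ by their first term; the other case follows as \<open>\<F>\<^sub>i\<^sub>j\<close> is odd.\<close>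

lemma F_odd_step:
  assumes ij: "i \<in> I" "j \<in> I"
  shows "F_odd n C i j (m + 2) = F_odd n C i j m - cartan_coeff (nat \<bar>m + 1\<bar>) i j"
proof -
  let ?f = "\<lambda>m k. cartan_coeff (nat (m - 2 * k + 1)) i j"
  have N: "F_nonneg n C i j m = - (\<Sum>k | 1 \<le> k \<and> 2 * k - 1 \<le> m. ?f m k)" for m
    unfolding F_nonneg_def quantum_cartan_inverse_nth[OF ij] ..
  have small: "F_nonneg n C i j m = 0" if "m \<le> 1" for m
    unfolding N using that by (auto intro!: sum.neutral)
  have step: "F_nonneg n C i j (m + 2) = F_nonneg n C i j m - cartan_coeff (nat (m + 1)) i j" if "m \<ge> - 1" for m
  proof -
    define K where "K = {k. 1 \<le> k \<and> 2 * k - 1 \<le> m}"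
    have K': "{k. 1 \<le> k \<and> 2 * k - 1 \<le> m + 2} = insert 1 ((\<lambda>k. k + 1) ` K)"
    proof (intro equalityI subsetI)
      fix k assume "k \<in> {k. 1 \<le> k \<and> 2 * k - 1 \<le> m + 2}"
      then show "k \<in> insert 1 ((\<lambda>k. k + 1) ` K)"
        by (cases "k = 1") (auto simp: K_def intro!: image_eqI[of _ _ "k - 1"])
    qed (use that in \<open>auto simp: K_def\<close>)
    have fin: "finite ((\<lambda>k. k + 1) ` K)" unfolding K_def by (rule finite_imageI, rule finite_subset[of _ "{1..\<bar>m\<bar> + 1}"]) auto
    have n1: "1 \<notin> (\<lambda>k. k + 1) ` K" by (auto simp: K_def)
    have "(\<Sum>k\<in>(\<lambda>k. k + 1) ` K. ?f (m + 2) k) = (\<Sum>k\<in>K. ?f m k)"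
      by (subst sum.reindex) (auto simp: inj_on_def intro!: sum.cong arg_cong[where f = "\<lambda>m. cartan_coeff (nat m) i j"])
    then have "(\<Sum>k | 1 \<le> k \<and> 2 * k - 1 \<le> m + 2. ?f (m + 2) k) = cartan_coeff (nat (m + 1)) i j + (\<Sum>k\<in>K. ?f m k)"
      unfolding K' sum.insert[OF fin n1] by (simp add: add.commute)
    then show ?thesis unfolding N K_def[symmetric] by simp
  qed
  have F: "F_odd n C i j m = F_nonneg n C i j m - F_nonneg n C i j (- m)" for m
    using small[of m] small[of "- m"] by (auto simp: F_odd_def)
  show ?thesis
  proof (cases "m \<ge> - 1")
    case True
    then show ?thesis unfolding F using step[OF True] small[of "- (m + 2)"] small[of "- m"] by simp
  next
    case False
    then have "F_nonneg n C i j (- m - 2 + 2) = F_nonneg n C i j (- m - 2) - cartan_coeff (nat (- m - 2 + 1)) i j" by (intro step) simp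
    moreover have "nat \<bar>m + 1\<bar> = nat (- m - 2 + 1)" "- (m + 2) = - m - 2" "- m - 2 + 2 = - m" using False by auto
    ultimately show ?thesis unfolding F using small[of m] small[of "m + 2"] False by simp
  qed
qed

lemma F_odd_minus: "i \<in> I \<Longrightarrow> j \<in> I \<Longrightarrow> F_odd n C i j (- m) = - F_odd n C j i m"
proof -
  assume ij: "i \<in> I" "j \<in> I"
  have "F_nonneg n C i j m = F_nonneg n C j i m" for m
    unfolding F_nonneg_def quantum_cartan_inverse_nth[OF ij] quantum_cartan_inverse_nth[OF ij(2,1)] by (simp add: cartan_coeff_sym)
  moreover have "F_nonneg n C i j 0 = 0" by (simp add: F_nonneg_def)
  ultimately show ?thesis by (auto simp: F_odd_def)
qed

lemma F_odd_mesh: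
  assumes ij: "i \<in> I" "j \<in> I"
  shows "F_odd n C i j (m + 2) - F_odd n C i j (m - 2) + (\<Sum>k\<in>nbrs i. F_odd n C k j (m - 1) - F_odd n C k j (m + 1)) =
    (if i = j \<and> m = 0 then - 2 else 0)"
proof -
  have 1: "F_odd n C i j (m + 2) - F_odd n C i j (m - 2) = - cartan_coeff (nat \<bar>m + 1\<bar>) i j - cartan_coeff (nat \<bar>m - 1\<bar>) i j"
    using F_odd_step[OF ij, of m] F_odd_step[OF ij, of "m - 2"] by simp
  have 2: "(\<Sum>k\<in>nbrs i. F_odd n C k j (m - 1) - F_odd n C k j (m + 1)) = (\<Sum>k\<in>nbrs i. cartan_coeff (nat \<bar>m\<bar>) k j)"
  proof (intro sum.cong refl)
    fix k assume "k \<in> nbrs i"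
    then have "k \<in> I" using nbrs_I by auto
    then show "F_odd n C k j (m - 1) - F_odd n C k j (m + 1) = cartan_coeff (nat \<bar>m\<bar>) k j"
      using F_odd_step[OF _ ij(2), of k "m - 1"] by (simp add: algebra_simps)
  qed
  show ?thesis
  proof (cases "m = 0")
    case True
    then show ?thesis unfolding 1 2 by simp
  next
    case False
    then obtain r where r: "nat \<bar>m\<bar> = Suc r" by (metis abs_le_zero_iff nat_eq_iff2 not0_implies_Suc of_nat_0 zero_less_abs_iff nat_0_iff)
    have "nat \<bar>m + 1\<bar> = Suc (Suc r) \<and> nat \<bar>m - 1\<bar> = r \<or> nat \<bar>m + 1\<bar> = r \<and> nat \<bar>m - 1\<bar> = Suc (Suc r)"
      using r by linarith
    then show ?thesis
    proof (elim disjE conjE)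
      assume h: "nat \<bar>m + 1\<bar> = Suc (Suc r)" "nat \<bar>m - 1\<bar> = r"
      show ?thesis unfolding 1 2 r h using False by simp
    next
      assume h: "nat \<bar>m + 1\<bar> = r" "nat \<bar>m - 1\<bar> = Suc (Suc r)"
      show ?thesis unfolding 1 2 r h using False by simp
    qed
  qed
qed

lemma Lambda_e_skew: "v \<in> V \<Longrightarrow> w \<in> V \<Longrightarrow> Lambda_e n C v w = - Lambda_e n C w v"
  using F_odd_minus[of "fst v" "fst w" "snd v - snd w"] fst_V by (auto simp: Lambda_e_def split: prod.splits)

lemma sum_Gamma_e_in:
  assumes T: "finite T" "\<And>x. (x, vtx i p) \<in> Gamma_e n C l \<Longrightarrow> x \<in> T" and i: "i \<in> I"
  shows "(\<Sum>x\<in>T. of_bool ((x, vtx i p) \<in> Gamma_e n C l) * f x) =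
    f (i, snd (vtx i p) - 2) + (\<Sum>k\<in>nbrs i. f (k, snd (vtx i p) + 1) :: int)"
proof -
  let ?r = "snd (vtx i p)"
  have V: "(k, ?r + 1) = (if (k, i) \<in> Q then vtx k (p - 1) else vtx k p)" if "k \<in> nbrs i" for k
    using that height[of k i] height[of i k] by (auto simp: vtx_def nbrs_def)
  have e: "{x. (x, vtx i p) \<in> Gamma_e n C l} = insert (i, ?r - 2) ((\<lambda>k. (k, ?r + 1)) ` nbrs i)" (is "?X = ?Y")
  proof (intro equalityI subsetI)
    fix x assume "x \<in> ?X"
    then have x: "(x, vtx i p) \<in> Gamma_e n C l" by simp
    obtain j q where j: "x = vtx j q" "j \<in> I" using Gamma_e_E[OF x] by blast
    then consider "j = i" "q = p + 1" | "(j, i) \<in> Q" "q = p - 1" | "(i, j) \<in> Q" "q = p"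
      using x unfolding j(1) Gamma_e_vtx by force
    then show "x \<in> ?Y"
    proof cases
      case 1 then show ?thesis using j by (simp add: vtx_def)
    next
      case 2
      then have n: "j \<in> nbrs i" by (simp add: nbrs_def)
      then have "x = (j, ?r + 1)" using V[OF n] j 2 by simp
      then show ?thesis using n by blast
    next
      case 3
      then have n: "j \<in> nbrs i" by (simp add: nbrs_def)
      then have "x = (j, ?r + 1)" using V[OF n] j 3 Q_asym[of i j] by auto
      then show ?thesis using n by blast
    qed
  next
    fix x assume "x \<in> ?Y"
    then consider "x = vtx i (p + 1)" | k where "k \<in> nbrs i" "x = (k, ?r + 1)" by (auto simp: vtx_def)
    then show "x \<in> ?X"
    proof cases
      case 1 then show ?thesis using i by (simp add: Gamma_e_vtx)
    next
      case (2 k)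
      then show ?thesis unfolding 2(2) V[OF 2(1)] using nbrs_I[OF 2(1)] by (auto simp: Gamma_e_vtx nbrs_def)
    qed
  qed
  have "(\<Sum>x\<in>T. of_bool ((x, vtx i p) \<in> Gamma_e n C l) * f x) = (\<Sum>x\<in>?Y. of_bool ((x, vtx i p) \<in> Gamma_e n C l) * f x)"
    using T e by (intro sum.mono_neutral_right) auto
  also have "\<dots> = (\<Sum>x\<in>?Y. f x)" using e by (intro sum.cong) auto
  also have "\<dots> = f (i, ?r - 2) + (\<Sum>x\<in>(\<lambda>k. (k, ?r + 1)) ` nbrs i. f x)" by (subst sum.insert) auto
  finally show ?thesis by (simp add: sum.reindex inj_on_def)
qed

lemma sum_Gamma_e_out:
  assumes T: "finite T" "\<And>x. (vtx i p, x) \<in> Gamma_e n C l \<Longrightarrow> x \<in> T" and i: "i \<in> I"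
  shows "(\<Sum>x\<in>T. of_bool ((vtx i p, x) \<in> Gamma_e n C l) * f x) =
    f (i, snd (vtx i p) + 2) + (\<Sum>k\<in>nbrs i. f (k, snd (vtx i p) - 1) :: int)"
proof -
  let ?r = "snd (vtx i p)"
  have V: "(k, ?r - 1) = (if (i, k) \<in> Q then vtx k (p + 1) else vtx k p)" if "k \<in> nbrs i" for k
    using that height[of k i] height[of i k] by (auto simp: vtx_def nbrs_def)
  have e: "{x. (vtx i p, x) \<in> Gamma_e n C l} = insert (i, ?r + 2) ((\<lambda>k. (k, ?r - 1)) ` nbrs i)" (is "?X = ?Y")
  proof (intro equalityI subsetI)
    fix x assume "x \<in> ?X"
    then have x: "(vtx i p, x) \<in> Gamma_e n C l" by simp
    obtain j q where j: "x = vtx j q" "j \<in> I" using Gamma_e_E[OF x] by blast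
    then consider "j = i" "q = p - 1" | "(i, j) \<in> Q" "q = p + 1" | "(j, i) \<in> Q" "q = p"
      using x unfolding j(1) Gamma_e_vtx by force
    then show "x \<in> ?Y"
    proof cases
      case 1 then show ?thesis using j by (simp add: vtx_def)
    next
      case 2
      then have n: "j \<in> nbrs i" by (simp add: nbrs_def)
      then have "x = (j, ?r - 1)" using V[OF n] j 2 by simp
      then show ?thesis using n by blast
    next
      case 3
      then have n: "j \<in> nbrs i" by (simp add: nbrs_def)
      then have "x = (j, ?r - 1)" using V[OF n] j 3 Q_asym[of j i] by auto
      then show ?thesis using n by blast
    qed
  next
    fix x assume "x \<in> ?Y"
    then consider "x = vtx i (p - 1)" | k where "k \<in> nbrs i" "x = (k, ?r - 1)" by (auto simp: vtx_def)
    then show "x \<in> ?X"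
    proof cases
      case 1 then show ?thesis using i by (simp add: Gamma_e_vtx)
    next
      case (2 k)
      then show ?thesis unfolding 2(2) V[OF 2(1)] using nbrs_I[OF 2(1)] by (auto simp: Gamma_e_vtx nbrs_def)
    qed
  qed
  have "(\<Sum>x\<in>T. of_bool ((vtx i p, x) \<in> Gamma_e n C l) * f x) = (\<Sum>x\<in>?Y. of_bool ((vtx i p, x) \<in> Gamma_e n C l) * f x)"
    using T e by (intro sum.mono_neutral_right) auto
  also have "\<dots> = (\<Sum>x\<in>?Y. f x)" using e by (intro sum.cong) auto
  also have "\<dots> = f (i, ?r + 2) + (\<Sum>x\<in>(\<lambda>k. (k, ?r - 1)) ` nbrs i. f x)" by (subst sum.insert) auto
  finally show ?thesis by (simp add: sum.reindex inj_on_def)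
qed

text \<open>The arrows at \<open>z = (i, r)\<close> come from \<open>(i, r - 2)\<close> and \<open>(k, r + 1)\<close> and go to \<open>(i, r + 2)\<close> and \<open>(k, r - 1)\<close>, for \<open>k\<close> adjacent
  to \<open>i\<close>; the sum over them is the left hand side of \<open>F_odd_mesh\<close>.\<close>

lemma B_e_Lambda_e:
  assumes z: "z \<in> V" and y: "y \<in> V" and T: "finite T" "\<And>x. (x, z) \<in> Gamma_e n C l \<or> (z, x) \<in> Gamma_e n C l \<Longrightarrow> x \<in> T"
  shows "(\<Sum>x\<in>T. B_e x z * Lambda_e n C x y) = (if z = y then - 2 else 0)"
proof -
  obtain i p where zi: "z = vtx i p" "i \<in> I" using z by (auto simp: V_iff)
  define r where "r = snd z"
  obtain j s where y': "y = (j, s)" "j \<in> I" using fst_V[OF y] by (cases y) auto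
  have zr: "z = (i, r)" using zi by (simp add: r_def vtx_def)
  have "(\<Sum>x\<in>T. B_e x z * Lambda_e n C x y) =
     (\<Sum>x\<in>T. of_bool ((x, z) \<in> Gamma_e n C l) * Lambda_e n C x y) - (\<Sum>x\<in>T. of_bool ((z, x) \<in> Gamma_e n C l) * Lambda_e n C x y)"
    by (simp add: B_e_def left_diff_distrib sum_subtractf)
  also have "\<dots> = F_odd n C i j ((s - r) + 2) - F_odd n C i j ((s - r) - 2) + (\<Sum>k\<in>nbrs i. F_odd n C k j ((s - r) - 1) - F_odd n C k j ((s - r) + 1))"
    using sum_Gamma_e_in[OF T(1) _ zi(2), of p "\<lambda>x. Lambda_e n C x y"] sum_Gamma_e_out[OF T(1) _ zi(2), of p "\<lambda>x. Lambda_e n C x y"] T(2)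
    unfolding zi(1)[symmetric] r_def[symmetric] by (simp add: Lambda_e_def y' sum_subtractf algebra_simps)
  also have "\<dots> = (if i = j \<and> s - r = 0 then - 2 else 0)" by (rule F_odd_mesh[OF zi(2) y'(2)])
  finally show ?thesis using zr y' by auto
qed

section \<open>Compatibility\<close>

lemma mat_prod_eq:
  assumes "finite T" "T \<subseteq> J" "\<And>w. w \<in> J \<Longrightarrow> w \<notin> T \<Longrightarrow> M u w * N w v = 0"
  shows "mat_prod J M N u v = (\<Sum>w\<in>T. M u w * N w v)"
  unfolding mat_prod_def using assms by (intro sum.mono_neutral_left) auto

text \<open>Arrows join depths that differ by at most \<open>2\<close>.\<close>

lemma finite_neighbours: "finite {w \<in> V. B_stage 0 v w \<noteq> 0}"
proof (cases "v \<in> V")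
  case True
  then obtain i p where v: "v = vtx i p" "i \<in> I" by (auto simp: V_iff)
  have near: "\<bar>q' - p'\<bar> \<le> 2" if "arr i p' j q'" for i p' j q'
    using that by (cases i j rule: arrow_cases) (auto simp: arr_none arr_fw arr_bw vertical_arr_def forward_arr_def backward_arr_def dest!: olen_arrow_cases)
  have "{w \<in> V. B_stage 0 v w \<noteq> 0} \<subseteq> (\<Union>j\<in>I. vtx j ` {p - 2..p + 2})"
  proof
    fix w assume w: "w \<in> {w \<in> V. B_stage 0 v w \<noteq> 0}"
    then obtain j q where j: "w = vtx j q" "j \<in> I" by (auto simp: V_iff)
    then have "arr i p j q \<or> arr j q i p" using w v by (auto simp: B_stage_vtx b_coord_def)
    then have "\<bar>q - p\<bar> \<le> 2" using near[of i p j q] near[of j q i p] by auto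
    then show "w \<in> (\<Union>j\<in>I. vtx j ` {p - 2..p + 2})"
      unfolding j(1) using j(2) by (intro UN_I[of j] image_eqI[of _ _ q]) auto
  qed
  then show ?thesis by (rule finite_subset) (use finite_I in auto)
qed (simp add: B_stage_outside)

lemma Lambda_c_eq:
  fixes K :: "'k::field itself"
  assumes Ls: "finite Ls" "level w \<in> Ls" "level v \<in> Ls" and w: "w \<in> V" and v: "v \<in> V"
  shows "Lambda_c K n C Q l w v = (\<Sum>x\<in>blocks Ls. \<Sum>y\<in>blocks Ls. G_stage 0 w x * Lambda_e n C x y * G_stage 0 v y)"
proof -
  let ?G = "G_infinity K n C Q l"
  have J: "blocks Ls \<subseteq> V" by (auto simp: blocks_def)
  have "mat_prod V (mat_transp ?G) (mat_prod V (Lambda_e n C) ?G) w v =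
     (\<Sum>x\<in>blocks Ls. mat_transp ?G w x * mat_prod V (Lambda_e n C) ?G x v)"
    by (rule mat_prod_eq[OF finite_blocks[OF Ls(1)] J]) (use Ls w in \<open>auto simp: mat_transp_def G_infinity_eq G_stage_def blocks_def\<close>)
  also have "\<dots> = (\<Sum>x\<in>blocks Ls. G_stage 0 w x * (\<Sum>y\<in>blocks Ls. Lambda_e n C x y * G_stage 0 v y))"
  proof (intro sum.cong refl)
    fix x
    have "mat_prod V (Lambda_e n C) ?G x v = (\<Sum>y\<in>blocks Ls. Lambda_e n C x y * ?G y v)"
      by (rule mat_prod_eq[OF finite_blocks[OF Ls(1)] J]) (use Ls v in \<open>auto simp: G_infinity_eq G_stage_def blocks_def\<close>)
    then show "mat_transp ?G w x * mat_prod V (Lambda_e n C) ?G x v = G_stage 0 w x * (\<Sum>y\<in>blocks Ls. Lambda_e n C x y * G_stage 0 v y)"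
      using w v by (simp add: mat_transp_def G_infinity_eq)
  qed
  finally show ?thesis unfolding Lambda_c_def Let_def V_def[symmetric] by (simp add: sum_distrib_left mult.assoc)
qed

lemma Lambda_c_skew:
  fixes K :: "'k::field itself"
  assumes w: "w \<in> V" and v: "v \<in> V"
  shows "Lambda_c K n C Q l w v = - Lambda_c K n C Q l v w"
proof -
  let ?J = "blocks {level w, level v}"
  have "(\<Sum>x\<in>?J. \<Sum>y\<in>?J. G_stage 0 w x * Lambda_e n C x y * G_stage 0 v y) = (\<Sum>x\<in>?J. \<Sum>y\<in>?J. - (G_stage 0 v y * Lambda_e n C y x * G_stage 0 w x))"
  proof (intro sum.cong refl)
    fix x y assume "x \<in> ?J" "y \<in> ?J"
    then show "G_stage 0 w x * Lambda_e n C x y * G_stage 0 v y = - (G_stage 0 v y * Lambda_e n C y x * G_stage 0 w x)"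
      using Lambda_e_skew[of x y] by (simp add: blocks_def)
  qed
  also have "\<dots> = - (\<Sum>y\<in>?J. \<Sum>x\<in>?J. G_stage 0 v y * Lambda_e n C y x * G_stage 0 w x)"
    by (subst sum.swap) (simp add: sum_negf)
  finally show ?thesis
    using Lambda_c_eq[of "{level w, level v}" w v K] Lambda_c_eq[of "{level w, level v}" v w K] w v by simp
qed

text \<open>The relation \<open>G B\<^sub>c G\<^sup>T = B\<^sub>e\<close> multiplied by the inverse transpose of \<open>G\<close>.\<close>

lemma G_B_eq:
  assumes x: "x \<in> V" and u: "u \<in> V" and Ls: "finite Ls" "level x \<in> Ls" "level u \<in> Ls"
  shows "(\<Sum>w\<in>blocks Ls. G_stage 0 w x * B_stage 0 w u) = (\<Sum>z\<in>blocks Ls. B_e x z * C_limit u z)"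
proof -
  let ?J = "blocks Ls"
  have "(\<Sum>z\<in>?J. B_e x z * C_limit u z) = (\<Sum>z\<in>?J. (\<Sum>w\<in>?J. \<Sum>w'\<in>?J. G_stage 0 w x * B_stage 0 w w' * G_stage 0 w' z) * C_limit u z)"
    using G_B_G_transpose[OF x Ls(2) _ _ Ls(1)] by (intro sum.cong refl) (simp add: blocks_def)
  also have "\<dots> = (\<Sum>z\<in>?J. \<Sum>w\<in>?J. \<Sum>w'\<in>?J. G_stage 0 w x * B_stage 0 w w' * (G_stage 0 w' z * C_limit u z))"
    by (simp add: sum_distrib_right mult.assoc)
  also have "\<dots> = (\<Sum>w\<in>?J. \<Sum>z\<in>?J. \<Sum>w'\<in>?J. G_stage 0 w x * B_stage 0 w w' * (G_stage 0 w' z * C_limit u z))"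
    by (rule sum.swap)
  also have "\<dots> = (\<Sum>w\<in>?J. \<Sum>w'\<in>?J. \<Sum>z\<in>?J. G_stage 0 w x * B_stage 0 w w' * (G_stage 0 w' z * C_limit u z))"
    by (rule sum.cong[OF refl], rule sum.swap)
  also have "\<dots> = (\<Sum>w\<in>?J. \<Sum>w'\<in>?J. G_stage 0 w x * B_stage 0 w w' * (\<Sum>z\<in>?J. G_stage 0 w' z * C_limit u z))"
    by (simp add: sum_distrib_left)
  also have "\<dots> = (\<Sum>w\<in>?J. \<Sum>w'\<in>?J. G_stage 0 w x * B_stage 0 w w' * of_bool (w' = u))"
    using G_stage_cs_dual[OF Ls(1,3) u] by (intro sum.cong refl) (simp add: blocks_def)
  also have "\<dots> = (\<Sum>w\<in>?J. G_stage 0 w x * B_stage 0 w u)"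
  proof -
    have "u \<in> ?J" using u Ls by (simp add: blocks_def)
    then show ?thesis by (simp only: sum_of_bool_eq(2)[OF finite_blocks[OF Ls(1)]])
  qed
  finally show ?thesis ..
qed

text \<open>The factor \<open>B\<^sub>c\<close> is moved past \<open>G\<close> by \<open>G_B_eq\<close>, then \<open>B_e_Lambda_e\<close> applies, and the two remaining matrices are dual to each
  other. The level set \<open>Ls\<close> is finite and contains the supports of all sums.\<close>

lemma B_c_Lambda_c:
  fixes K :: "'k::field itself"
  assumes u: "u \<in> V" and v: "v \<in> V"
  shows "mat_prod V (mat_transp (B_stage 0)) (Lambda_c K n C Q l) u v = (if u = v then - 2 else 0)"
proof -
  define near where "near = {x. \<exists>z. z \<in> V \<and> level z = level u \<and> ((x, z) \<in> Gamma_e n C l \<or> (z, x) \<in> Gamma_e n C l)}"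
  have levs: "level ` near \<subseteq> {level u - 1..level u + 1}"
  proof
    fix L assume "L \<in> level ` near"
    then obtain x z where xz: "L = level x" "level z = level u" "(x, z) \<in> Gamma_e n C l \<or> (z, x) \<in> Gamma_e n C l"
      by (auto simp: near_def)
    then obtain i p j q where e: "x = vtx i p" "z = vtx j q" "i \<in> I" "j \<in> I" by (meson Gamma_e_E)
    then have "\<bar>level x - level z\<bar> \<le> 1"
      using xz(3) unfolding e(1,2) Gamma_e_vtx level_def using height[of i j] height[of j i] by auto
    then show "L \<in> {level u - 1..level u + 1}" using xz by auto
  qed
  define Ls where "Ls = {level u - 1..level u + 1} \<union> {level v} \<union> level ` {w \<in> V. B_stage 0 u w \<noteq> 0}"
  have Ls: "finite Ls" "level u \<in> Ls" "level v \<in> Ls" using finite_neighbours by (auto simp: Ls_def)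
  have J: "blocks Ls \<subseteq> V" by (auto simp: blocks_def)
  let ?J = "blocks Ls" and ?L = "Lambda_e n C"
  have b: "B_stage 0 u w = 0" if "w \<in> V" "w \<notin> ?J" for w
    using that by (auto simp: blocks_def Ls_def)
  have "mat_prod V (mat_transp (B_stage 0)) (Lambda_c K n C Q l) u v = (\<Sum>w\<in>?J. mat_transp (B_stage 0) u w * Lambda_c K n C Q l w v)"
    by (rule mat_prod_eq[OF finite_blocks[OF Ls(1)] J]) (use b skewD[OF skew_B_stage, of 0 _ u] in \<open>auto simp: mat_transp_def\<close>)
  also have "\<dots> = (\<Sum>w\<in>?J. B_stage 0 w u * (\<Sum>x\<in>?J. \<Sum>y\<in>?J. G_stage 0 w x * ?L x y * G_stage 0 v y))"
    using Lambda_c_eq[OF Ls(1) _ Ls(3) _ v, of _ K] by (intro sum.cong refl) (auto simp: mat_transp_def blocks_def)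
  also have "\<dots> = (\<Sum>w\<in>?J. \<Sum>x\<in>?J. \<Sum>y\<in>?J. (G_stage 0 w x * B_stage 0 w u) * (?L x y * G_stage 0 v y))"
    by (simp add: sum_distrib_left mult_ac)
  also have "\<dots> = (\<Sum>x\<in>?J. \<Sum>w\<in>?J. \<Sum>y\<in>?J. (G_stage 0 w x * B_stage 0 w u) * (?L x y * G_stage 0 v y))" by (rule sum.swap)
  also have "\<dots> = (\<Sum>x\<in>?J. \<Sum>y\<in>?J. \<Sum>w\<in>?J. (G_stage 0 w x * B_stage 0 w u) * (?L x y * G_stage 0 v y))"
    by (rule sum.cong[OF refl], rule sum.swap)
  also have "\<dots> = (\<Sum>x\<in>?J. \<Sum>y\<in>?J. (\<Sum>z\<in>?J. B_e x z * C_limit u z) * (?L x y * G_stage 0 v y))"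
    using G_B_eq[OF _ u Ls(1) _ Ls(2)] by (intro sum.cong refl) (simp add: blocks_def sum_distrib_right[symmetric])
  also have "\<dots> = (\<Sum>x\<in>?J. \<Sum>y\<in>?J. \<Sum>z\<in>?J. C_limit u z * G_stage 0 v y * (B_e x z * ?L x y))"
    by (simp add: sum_distrib_right sum_distrib_left mult_ac)
  also have "\<dots> = (\<Sum>y\<in>?J. \<Sum>x\<in>?J. \<Sum>z\<in>?J. C_limit u z * G_stage 0 v y * (B_e x z * ?L x y))" by (rule sum.swap)
  also have "\<dots> = (\<Sum>y\<in>?J. \<Sum>z\<in>?J. \<Sum>x\<in>?J. C_limit u z * G_stage 0 v y * (B_e x z * ?L x y))"
    by (rule sum.cong[OF refl], rule sum.swap)
  also have "\<dots> = (\<Sum>y\<in>?J. \<Sum>z\<in>?J. C_limit u z * G_stage 0 v y * (\<Sum>x\<in>?J. B_e x z * ?L x y))" by (simp add: sum_distrib_left)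
  also have "\<dots> = (\<Sum>y\<in>?J. \<Sum>z\<in>?J. (- 2 * (C_limit u z * G_stage 0 v y)) * of_bool (z = y))"
  proof (intro sum.cong refl)
    fix y z assume yz: "y \<in> ?J" "z \<in> ?J"
    show "C_limit u z * G_stage 0 v y * (\<Sum>x\<in>?J. B_e x z * ?L x y) = (- 2 * (C_limit u z * G_stage 0 v y)) * of_bool (z = y)"
    proof (cases "level z = level u")
      case True
      have adj: "x \<in> ?J" if "(x, z) \<in> Gamma_e n C l \<or> (z, x) \<in> Gamma_e n C l" for x
      proof -
        have "x \<in> near" using that True yz unfolding near_def blocks_def by blast
        then have "level x \<in> Ls" using levs by (auto simp: Ls_def)
        moreover have "x \<in> V" using that by (auto simp: Gamma_e_def V_def)
        ultimately show ?thesis by (simp add: blocks_def)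
      qed
      have "z \<in> V" "y \<in> V" using yz J by auto
      from B_e_Lambda_e[OF this finite_blocks[OF Ls(1)] adj] show ?thesis by simp
    qed (simp add: C_limit_def)
  qed
  also have "\<dots> = - 2 * (\<Sum>y\<in>?J. G_stage 0 v y * C_limit u y)"
  proof -
    have "(\<Sum>z\<in>?J. (- 2 * (C_limit u z * G_stage 0 v y)) * of_bool (z = y)) = - 2 * (C_limit u y * G_stage 0 v y)" if "y \<in> ?J" for y
      by (rule sum_of_bool_eq(2)[OF finite_blocks[OF Ls(1)] that])
    then show ?thesis by (simp add: sum_distrib_left mult_ac)
  qed
  also have "\<dots> = (if u = v then - 2 else 0)" using G_stage_cs_dual[OF Ls(1,2) u v] by auto
  finally show ?thesis .
qed

lemma compatible: "compatible_pair V (Lambda_c K n C Q l) (B_c K n C Q l)" for K :: "'k::field itself"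
  unfolding compatible_pair_def B_c_B_stage
proof (intro conjI ballI exI[of _ "\<lambda>_. - 2"])
  fix u assume "u \<in> V"
  show "finite {v \<in> V. B_stage 0 u v \<noteq> 0}" by (rule finite_neighbours)
  have "{v \<in> V. B_stage 0 v u \<noteq> 0} = {v \<in> V. B_stage 0 u v \<noteq> 0}" using skewD[OF skew_B_stage, of 0 _ u] by auto
  then show "finite {v \<in> V. B_stage 0 v u \<noteq> 0}" using finite_neighbours by simp
next
  fix u v assume "u \<in> V" "v \<in> V"
  then show "Lambda_c K n C Q l u v = - Lambda_c K n C Q l v u" by (rule Lambda_c_skew)
next
  fix u v assume "u \<in> V" "v \<in> V"
  then show "mat_prod V (mat_transp (B_stage 0)) (Lambda_c K n C Q l) u v = (if u = v then - 2 else 0)" by (rule B_c_Lambda_c)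
qed simp

end

theorem proposition4p6:
  fixes n :: nat
    and C :: "nat \<Rightarrow> nat \<Rightarrow> int"
    and c :: "(nat \<Rightarrow> int) \<Rightarrow> (nat \<Rightarrow> int)"
    and Q :: "nat rel"
    and l :: "nat \<Rightarrow> nat"
    and K :: "'k::field itself"
  assumes "simply_laced_cartan n C"
    and "coxeter_element n C c"
    and "coxeter_quiver n C c Q"
    and "height_function n Q l"
  shows "compatible_pair (V_set n l) (Lambda_c K n C Q l) (B_c K n C Q l)"
proof -
  interpret dynkin_quiver n C Q l
    using assms by unfold_locales (auto simp: coxeter_quiver_def height_function_def)
  show ?thesis using compatible[of K] by (simp only: V_def)
qed

end
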